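(* Each of the following two decision problems is in NP. Input: a finite relational structure $\mathbb{A}$ with finite signature and a set $B\subseteq A$ that is guaranteed to be a subuniverse of the polymorphism algebra $\mathbf{A}=\mathrm{Pol}\,\mathbb{A}$. Questions: (1) Is $B$ an absorbing subuniverse of $\mathbf{A}$? (2) Is $B$ a Jónsson absorbing subuniverse of $\mathbf{A}$?
   Context: The relations of $\mathbb{A}$ are given in the input by lists of their tuples. The condition that $B$ is a subuniverse of $\mathrm{Pol}\,\mathbb{A}$ is a promise on the input (it need not be verified); membership in NP means that there is a polynomial-time verifier that, on inputs satisfying the promise, accepts some polynomial-size certificate if and only if the answer is yes. $\mathrm{Pol}\,\mathbb{A}$ denotes the algebra with universe $A$ whose operations are all polymorphisms of $\mathbb{A}$ (finitary operations on $A$ preserving all relations of $\mathbb{A}$); its term operations are exactly the polymorphisms of $\mathbb{A}$. A subuniverse $B$ of an algebra $\mathbf{A}$ is absorbing if $\mathbf{A}$ has an idempotent term operation $t$ (i.e. $t(x,\dots,x)\approx x$) of some arity such that $t(a_1,\dots,a_n)\in B$ whenever all but at most one of the $a_i\in A$ belong to $B$. A subuniverse $B$ of $\mathbf{A}$ is Jónsson absorbing if $\mathbf{A}$ has a sequence of ternary terms $d_0,d_1,\dots,d_n$ such that (i) $d_i(B,A,B)\subseteq B$ for all $i\le n$; (ii) $d_i(x,y,y)\approx d_{i+1}(x,x,y)$ for all $i<n$; (iii) $d_0(x,y,z)\approx x$ and $d_n(x,y,z)\approx z$. *)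

theory Defs
  imports Complex_Main "HOL-Computational_Algebra.Polynomial"
begin

section \<open>Algebras, term operations, absorption\<close>

text \<open>An operation of arity \<open>n\<close> is a function on lists, of which only the values on lists of
  length \<open>n\<close> over the universe matter.\<close>

record 'a algebra =
  universe :: "'a set"
  basic_ops :: "(nat \<times> ('a list \<Rightarrow> 'a)) set"

definition args :: "'a set \<Rightarrow> nat \<Rightarrow> 'a list set" where
  "args A n = {xs. length xs = n \<and> set xs \<subseteq> A}"

definition subuniverse :: "'a algebra \<Rightarrow> 'a set \<Rightarrow> bool" where
  "subuniverse \<A> B \<longleftrightarrow> B \<subseteq> universe \<A> \<and>
     (\<forall>(n, f) \<in> basic_ops \<A>. \<forall>xs \<in> args B n. f xs \<in> B)"

inductive_set term_ops :: "'a algebra \<Rightarrow> nat \<Rightarrow> ('a list \<Rightarrow> 'a) set"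
  for \<A> :: "'a algebra" and k :: nat where
  var: "i < k \<Longrightarrow> (\<lambda>xs. xs ! i) \<in> term_ops \<A> k"
| app: "(n, f) \<in> basic_ops \<A> \<Longrightarrow> length gs = n \<Longrightarrow> (\<And>g. g \<in> set gs \<Longrightarrow> g \<in> term_ops \<A> k)
        \<Longrightarrow> (\<lambda>xs. f (map (\<lambda>g. g xs) gs)) \<in> term_ops \<A> k"

definition absorbing :: "'a algebra \<Rightarrow> 'a set \<Rightarrow> bool" where
  "absorbing \<A> B \<longleftrightarrow> subuniverse \<A> B \<and>
     (\<exists>n > 0. \<exists>t \<in> term_ops \<A> n.
        (\<forall>x \<in> universe \<A>. t (replicate n x) = x) \<and>
        (\<forall>xs \<in> args (universe \<A>) n. card {i. i < n \<and> xs ! i \<notin> B} \<le> 1 \<longrightarrow> t xs \<in> B))"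

definition jonsson_absorbing :: "'a algebra \<Rightarrow> 'a set \<Rightarrow> bool" where
  "jonsson_absorbing \<A> B \<longleftrightarrow> subuniverse \<A> B \<and>
     (\<exists>(n::nat) d. (\<forall>i \<le> n. d i \<in> term_ops \<A> 3) \<and>
        (\<forall>i \<le> n. \<forall>b \<in> B. \<forall>a \<in> universe \<A>. \<forall>c \<in> B. d i [b, a, c] \<in> B) \<and>
        (\<forall>i < n. \<forall>x \<in> universe \<A>. \<forall>y \<in> universe \<A>. d i [x, y, y] = d (Suc i) [x, x, y]) \<and>
        (\<forall>x \<in> universe \<A>. \<forall>y \<in> universe \<A>. \<forall>z \<in> universe \<A>.
            d 0 [x, y, z] = x \<and> d n [x, y, z] = z))"


section \<open>Relational structures and polymorphisms\<close>

text \<open>The signature is finite: the \<open>i\<close>-th list entry holds the arity and the interpretation of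
  the \<open>i\<close>-th relation symbol.\<close>

record 'a rel_structure =
  domain :: "'a set"
  relations :: "(nat \<times> 'a list set) list"

definition finite_structure :: "'a rel_structure \<Rightarrow> bool" where
  "finite_structure S \<longleftrightarrow> finite (domain S) \<and>
     (\<forall>(r, R) \<in> set (relations S). R \<subseteq> args (domain S) r)"

text \<open>\<open>f\<close> is applied to \<open>n\<close> tuples of \<open>R\<close> coordinatewise.\<close>

definition preserves :: "nat \<Rightarrow> ('a list \<Rightarrow> 'a) \<Rightarrow> nat \<Rightarrow> 'a list set \<Rightarrow> bool" where
  "preserves n f r R \<longleftrightarrow>
     (\<forall>ts. length ts = n \<and> set ts \<subseteq> R \<longrightarrow> map (\<lambda>j. f (map (\<lambda>t. t ! j) ts)) [0..<r] \<in> R)"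

definition polymorphism :: "'a rel_structure \<Rightarrow> nat \<Rightarrow> ('a list \<Rightarrow> 'a) \<Rightarrow> bool" where
  "polymorphism S n f \<longleftrightarrow> n > 0 \<and> (\<forall>xs \<in> args (domain S) n. f xs \<in> domain S) \<and>
     (\<forall>(r, R) \<in> set (relations S). preserves n f r R)"

definition Pol :: "'a rel_structure \<Rightarrow> 'a algebra" where
  "Pol S = \<lparr>universe = domain S, basic_ops = {(n, f). polymorphism S n f}\<rparr>"


section \<open>Deterministic multi-tape Turing machines\<close>

datatype move = Left | Stay | Right

text \<open>States and tape symbols are initial segments of the naturals. State 0 is initial,
  1 accepts and 2 rejects; symbol 0 is the blank, and 1 and 2 stand for the input bits.\<close>

record tm =
  n_tapes :: nat
  n_syms :: nat
  n_states :: nat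
  trans :: "nat \<Rightarrow> nat list \<Rightarrow> nat \<times> (nat \<times> move) list"

text \<open>Only the finite part of the transition function constrained here is ever used.\<close>

definition wf_tm :: "tm \<Rightarrow> bool" where
  "wf_tm M \<longleftrightarrow> n_tapes M \<ge> 2 \<and> n_syms M \<ge> 3 \<and> n_states M \<ge> 3 \<and>
     (\<forall>q < n_states M. \<forall>ss \<in> args {..<n_syms M} (n_tapes M). 
        fst (trans M q ss) < n_states M \<and>
        length (snd (trans M q ss)) = n_tapes M \<and>
        fst ` set (snd (trans M q ss)) \<subseteq> {..<n_syms M})"

text \<open>A tape is a head position together with the contents of a two-way infinite tape.\<close>

type_synonym tape = "int \<times> (int \<Rightarrow> nat)"
type_synonym config = "nat \<times> tape list"

fun act :: "nat \<times> move \<Rightarrow> tape \<Rightarrow> tape" where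
  "act (s, m) (h, c) = (case m of Left \<Rightarrow> h - 1 | Stay \<Rightarrow> h | Right \<Rightarrow> h + 1, c(h := s))"

fun step :: "tm \<Rightarrow> config \<Rightarrow> config" where
  "step M (q, ts) =
     (if q \<in> {1, 2} then (q, ts)
      else let (q', as) = trans M q (map (\<lambda>(h, c). c h) ts) in (q', map2 act as ts))"

definition load :: "bool list \<Rightarrow> tape" where
  "load w = (0, \<lambda>i. if 0 \<le> i \<and> i < int (length w) then (if w ! nat i then 2 else 1) else 0)"

text \<open>The input \<open>x\<close> is on the first tape, the certificate \<open>u\<close> on the second.\<close>

definition state_after :: "tm \<Rightarrow> bool list \<Rightarrow> bool list \<Rightarrow> nat \<Rightarrow> nat" where
  "state_after M x u t =
     fst ((step M ^^ t) (0, load x # load u # replicate (n_tapes M - 2) (load [])))"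

definition accepts :: "tm \<Rightarrow> bool list \<Rightarrow> bool list \<Rightarrow> bool" where
  "accepts M x u \<longleftrightarrow> (\<exists>t. state_after M x u t = 1)"

definition poly_time :: "tm \<Rightarrow> bool" where
  "poly_time M \<longleftrightarrow>
     (\<exists>p :: nat poly. \<forall>x u. state_after M x u (poly p (length x + length u)) \<in> {1, 2})"

text \<open>Membership in NP of the problem asking \<open>Q i\<close> for inputs \<open>i\<close> promised to lie in \<open>I\<close> and
  presented as words \<open>enc i\<close>. Nothing but the time bound is required of the verifier on words
  that do not present an element of \<open>I\<close>.\<close>

definition promise_NP :: "('i \<Rightarrow> bool list) \<Rightarrow> 'i set \<Rightarrow> ('i \<Rightarrow> bool) \<Rightarrow> bool" where
  "promise_NP enc I Q \<longleftrightarrow>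
     (\<exists>M. \<exists>p :: nat poly. wf_tm M \<and> poly_time M \<and>
        (\<forall>i \<in> I. Q i \<longleftrightarrow> (\<exists>u. length u \<le> poly p (length (enc i)) \<and> accepts M (enc i) u)))"


section \<open>The inputs and their presentation as words\<close>

text \<open>Elements of the universe are named by natural numbers. The universe, each relation and the
  subset are given by arbitrary lists of their members.\<close>

record input =
  in_universe :: "nat list"
  in_relations :: "(nat \<times> nat list list) list"
  in_subset :: "nat list"

definition input_structure :: "input \<Rightarrow> nat rel_structure" where
  "input_structure x = \<lparr>domain = set (in_universe x),
     relations = map (\<lambda>(r, ts). (r, set ts)) (in_relations x)\<rparr>"

definition promised :: "input set" where
  "promised = {x. finite_structure (input_structure x) \<and>
                  subuniverse (Pol (input_structure x)) (set (in_subset x))}"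

text \<open>Binary digits, least significant first; zero has none.\<close>

fun bin :: "nat \<Rightarrow> bool list" where
  "bin n = (if n = 0 then [] else odd n # bin (n div 2))"

declare bin.simps [simp del]

text \<open>Self-delimiting: every entry is announced by \<open>True\<close>, and \<open>False\<close> ends the list.\<close>

definition enc_list :: "('a \<Rightarrow> bool list) \<Rightarrow> 'a list \<Rightarrow> bool list" where
  "enc_list e xs = concat (map (\<lambda>x. True # e x) xs) @ [False]"

definition enc_nat :: "nat \<Rightarrow> bool list" where
  "enc_nat n = enc_list (\<lambda>b. [b]) (bin n)"

definition enc_input :: "input \<Rightarrow> bool list" where
  "enc_input x =
     enc_list enc_nat (in_universe x) @
     enc_list (\<lambda>(r, ts). enc_nat r @ enc_list (enc_list enc_nat) ts) (in_relations x) @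
     enc_list enc_nat (in_subset x)"

end

theory Submission
  imports Defs "HOL-Library.FuncSet"
begin

text \<open>Both questions are equivalent to one condition with short certificates. If \<open>t\<close> witnesses absorption,
  substituting two variables for consecutive blocks of arguments of \<open>t\<close> gives a chain of Jonsson absorption operations. Such a chain yields,
  for every two tuples \<open>x\<close>, \<open>y\<close> of the universe or of a relation \<open>R\<close>, a path from \<open>x\<close> to \<open>y\<close> inside \<open>R\<close> whose
  edges are the pairs \<open>(d x x y, d x y y)\<close>, where \<open>d\<close> is an idempotent ternary polymorphism with \<open>d(B, A, B) \<subseteq> B\<close>. Since
  different pairs \<open>x\<close>, \<open>y\<close> may use different operations, and each edge needs only one, the tables of polynomially many
  operations certify the existence of all these paths.

  Conversely, the paths give an absorbing operation: the polymorphisms of a large arity that satisfy the absorption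
  identities are the solutions of a constraint system, and the paths make the constraints linked. A linked system is
  reduced to smaller domains by iterating its own constraints until a solution remains.

  The certificates are verified by a nondeterministic program with a fixed number of two-way read-only heads on the word
  formed by the input and the tables. Such programs are closed under bounded existential quantification and transitive
  closure. They have polynomially many configurations, so the sequence of choices along a
  shortest accepting run can be appended to the certificate and read by a deterministic machine.\<close>

section \<open>Linked constraint systems and absorption\<close>

text \<open>A chain that serves all pairs at once is a path among ternary operations, of which there
  are exponentially many; this is why the certified condition is local. The price is paid in the
  converse. It works because the reduction always connects two values of one variable at a time, so
  the operations along different paths need not fit together.

  The arity of the absorbing operation never enters a certificate, so it may be huge. Its value is
  dictated by propagation: if the absorption constraints forced a contradiction, a derivation of it
  with the fewest uses of these constraints would use fewer than
  \<open>2 ^ Suc (card (Pow U \<times> Pow U))\<close> of them. At that arity so few constraints,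
  each with at most one entry outside \<open>B\<close>, are met by a projection.

  On the machine side the obstacle is that programs have no complement. Every check is therefore
  phrased positively: universal statements become scans of a list, and disequality of numbers gets a
  test of its own. The table part of the word comes from an adversary, so soundness may use only
  what these scans establish about it.\<close>

lemma funpow_in: "f ` X \<subseteq> X \<Longrightarrow> x \<in> X \<Longrightarrow> (f ^^ n) x \<in> X"
  by (induction n) auto

lemma idempotent_power:
  assumes "finite X" "f ` X \<subseteq> X"
  shows "\<exists>k>0. \<forall>x\<in>X. (f ^^ k) ((f ^^ k) x) = (f ^^ k) x"
proof -
  let ?g = "\<lambda>n. restrict (f ^^ n) X"
  have "range ?g \<subseteq> (X \<rightarrow>\<^sub>E X)"
    using assms(2) by (auto intro: funpow_in)
  moreover have "finite (X \<rightarrow>\<^sub>E X)" using assms(1) by (intro finite_PiE) auto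
  ultimately have "finite (range ?g)" by (rule finite_subset)
  hence "\<not> inj ?g" using infinite_UNIV_nat finite_imageD by blast
  then obtain n m where nm: "n < m" "?g n = ?g m"
    unfolding inj_on_def by (metis linorder_neqE_nat)
  define p where "p = m - n"
  have p: "p > 0" "m = n + p" using nm by (auto simp: p_def)
  have e: "(f ^^ (n + p)) x = (f ^^ n) x" if "x \<in> X" for x
    using fun_cong[OF nm(2), of x] that p by simp
  have e2: "(f ^^ (n + p + j)) x = (f ^^ (n + j)) x" if "x \<in> X" for x j
    using e[OF that] by (metis add.commute comp_apply funpow_add)
  have e3: "(f ^^ (n + j + i * p)) x = (f ^^ (n + j)) x" if "x \<in> X" for x j i
  proof (induction i)
    case (Suc i)
    have "(f ^^ (n + j + Suc i * p)) x = (f ^^ (n + p + (j + i * p))) x" by (simp add: algebra_simps)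
    also have "\<dots> = (f ^^ (n + (j + i * p))) x" using e2[OF that] .
    finally show ?case using Suc by (simp add: algebra_simps)
  qed simp
  \<comment> \<open>A multiple of the period that is at least \<open>n\<close>: both
    \<open>k\<close> and \<open>k + k\<close> lie in the periodic part and differ by whole
    periods.\<close>
  define k where "k = p * Suc n"
  obtain i where i: "p = Suc i" using p by (cases p) auto
  define j where "j = Suc (i * Suc n)"
  have j: "k = n + j" by (simp add: k_def j_def i)
  have "(f ^^ k) ((f ^^ k) x) = (f ^^ k) x" if "x \<in> X" for x
  proof -
    have "(f ^^ k) ((f ^^ k) x) = (f ^^ (k + k)) x" by (simp add: funpow_add)
    also have "k + k = n + j + Suc n * p" using j by (simp add: k_def algebra_simps)
    also have "(f ^^ (n + j + Suc n * p)) x = (f ^^ (n + j)) x" using e3[OF that] .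
    finally show ?thesis using j by simp
  qed
  moreover have "k > 0" using p by (simp add: k_def)
  ultimately show ?thesis by blast
qed

lemma idempotent_power_mult:
  assumes "\<And>x. x \<in> X \<Longrightarrow> (f ^^ k) ((f ^^ k) x) = (f ^^ k) x" "f ` X \<subseteq> X" "m > 0" "x \<in> X"
  shows "(f ^^ (m * k)) x = (f ^^ k) x"
  using \<open>m > 0\<close>
proof (induction m)
  case (Suc m)
  show ?case
  proof (cases "m = 0")
    case False
    have "(f ^^ (Suc m * k)) x = (f ^^ k) ((f ^^ (m * k)) x)" by (simp add: funpow_add)
    with Suc False assms show ?thesis by simp
  qed simp
qed simp

text \<open>Multiples of an exponent with idempotent power give the same power, so a product of the
  individual exponents serves the whole family.\<close>

lemma common_idempotent_power:
  assumes "finite I" "\<And>i. i \<in> I \<Longrightarrow> finite (X i) \<and> f i ` X i \<subseteq> X i"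
  shows "\<exists>k>0. \<forall>i\<in>I. \<forall>x\<in>X i. (f i ^^ k) ((f i ^^ k) x) = (f i ^^ k) x"
  using assms
proof (induction I rule: finite_induct)
  case empty
  show ?case by (rule exI[of _ 1]) simp
next
  case (insert i I)
  then obtain k where k: "k > 0" "\<And>i x. i \<in> I \<Longrightarrow> x \<in> X i \<Longrightarrow> (f i ^^ k) ((f i ^^ k) x) = (f i ^^ k) x"
    by (meson insertCI)
  obtain l where l: "l > 0" "\<And>x. x \<in> X i \<Longrightarrow> (f i ^^ l) ((f i ^^ l) x) = (f i ^^ l) x"
    using idempotent_power[of "X i" "f i"] insert.prems by blast
  have "(f j ^^ (l * k)) ((f j ^^ (l * k)) x) = (f j ^^ (l * k)) x" if j: "j \<in> insert i I" "x \<in> X j" for j x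
  proof (cases "j \<in> I")
    case True
    have c: "f j ` X j \<subseteq> X j" using insert.prems j by blast
    have "(f j ^^ (l * k)) y = (f j ^^ k) y" if "y \<in> X j" for y
      using idempotent_power_mult[where X="X j" and f="f j" and k=k and m=l and x=y] k(2)[OF True] c l(1) that by blast
    thus ?thesis using k(2)[OF True j(2)] funpow_in[OF c j(2)] j(2) by simp
  next
    case False
    hence ji: "j = i" using j by blast
    have c: "f j ` X j \<subseteq> X j" using insert.prems j by blast
    have "(f j ^^ (k * l)) y = (f j ^^ l) y" if "y \<in> X j" for y
      using idempotent_power_mult[where X="X j" and f="f j" and k=l and m=k and x=y] l(2) ji c k(1) that by blast
    thus ?thesis using l(2)[of x] funpow_in[OF c j(2)] j(2) ji by (simp add: mult.commute)
  qed
  thus ?case using k(1) l(1) by (intro exI[of _ "l * k"]) simp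
qed

lemma rtrancl_image:
  assumes "\<And>x y. (x, y) \<in> r \<Longrightarrow> (f x, f y) \<in> s" "(x, y) \<in> r\<^sup>*"
  shows "(f x, f y) \<in> s\<^sup>*"
  using assms(2) by (induction rule: rtrancl_induct) (auto intro: rtrancl_into_rtrancl assms(1))

lemma relpow_choice:
  assumes "\<And>x. x \<in> X \<Longrightarrow> f x \<in> X \<and> (x, f x) \<in> H" "x \<in> X"
  shows "(x, (f ^^ n) x) \<in> H ^^ n \<and> (f ^^ n) x \<in> X"
proof (induction n)
  case (Suc n)
  thus ?case using assms(1)[of "(f ^^ n) x"] by (auto intro: relpow_Suc_I)
qed (use assms in simp)

lemma relpow_choice_conv:
  assumes "\<And>x. x \<in> X \<Longrightarrow> f x \<in> X \<and> (f x, x) \<in> H" "x \<in> X"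
  shows "((f ^^ n) x, x) \<in> H ^^ n \<and> (f ^^ n) x \<in> X"
proof (induction n)
  case (Suc n)
  have "(f ((f ^^ n) x), x) \<in> H ^^ Suc n"
    using Suc assms(1)[of "(f ^^ n) x"] by (blast intro: relpow_Suc_I2)
  thus ?case using Suc assms(1)[of "(f ^^ n) x"] by simp
qed (use assms in simp)

lemma relpow_mult_loop:
  assumes "(b, b) \<in> H ^^ k" shows "(b, b) \<in> H ^^ (k * m)"
proof (induction m)
  case (Suc m)
  have "(b, b) \<in> H ^^ (k * m) O H ^^ k" using Suc assms by blast
  thus ?case by (simp add: relpow_add[symmetric] add.commute)
qed simp

section \<open>Binary constraint systems and their linked reductions\<close>

text \<open>The system is given by a set \<open>S\<close> of solutions, with \<open>A\<close> and
  \<open>R\<close> its unary and binary projections. Hence every pair in a constraint extends to a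
  member of \<open>S\<close>, whereas an assignment that meets all binary constraints may lie
  outside \<open>S\<close>.\<close>

locale csp =
  fixes V :: "'v set" and S :: "('v \<Rightarrow> 'b) set"
  assumes finV: "finite V"
    and finA: "\<And>v. v \<in> V \<Longrightarrow> finite ((\<lambda>s. s v) ` S)"
    and S_ne: "S \<noteq> {}"
begin

definition A :: "'v \<Rightarrow> 'b set" where "A v = (\<lambda>s. s v) ` S"

definition R :: "'v \<Rightarrow> 'v \<Rightarrow> ('b \<times> 'b) set" where "R u v = (\<lambda>s. (s u, s v)) ` S"

definition arc_consistent :: "('v \<Rightarrow> 'b set) \<Rightarrow> bool" where
  "arc_consistent X \<longleftrightarrow> (\<forall>u\<in>V. X u \<noteq> {} \<and> X u \<subseteq> A u \<and> (\<forall>v\<in>V. \<forall>x\<in>X u. \<exists>y\<in>X v. (x, y) \<in> R u v))"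

text \<open>The operations are indexed by the variable because the passage to a retract composes
  them with maps that differ from variable to variable. Only the middle argument may leave
  \<open>X\<close>; this asymmetry is what absorption means here.\<close>

definition absorbs :: "('v \<Rightarrow> 'b set) \<Rightarrow> ('v \<Rightarrow> 'b \<Rightarrow> 'b \<Rightarrow> 'b \<Rightarrow> 'b) \<Rightarrow> bool" where
  "absorbs X d \<longleftrightarrow>
     (\<forall>v\<in>V. \<forall>x\<in>X v. \<forall>y\<in>A v. \<forall>z\<in>X v. d v x y z \<in> X v) \<and>
     (\<forall>u\<in>V. \<forall>v\<in>V. \<forall>x\<in>X u. \<forall>x'\<in>X v. \<forall>y y'. \<forall>z\<in>X u. \<forall>z'\<in>X v.
        (x, x') \<in> R u v \<and> (y, y') \<in> R u v \<and> (z, z') \<in> R u v \<longrightarrow> (d u x y z, d v x' y' z') \<in> R u v)"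

definition links :: "('v \<Rightarrow> 'b set) \<Rightarrow> 'v \<Rightarrow> 'b \<Rightarrow> 'b \<Rightarrow> ('b \<times> 'b) set" where
  "links X v x y = {(d v x x y, d v x y y) | d. absorbs X d}"

definition linked :: "('v \<Rightarrow> 'b set) \<Rightarrow> bool" where
  "linked X \<longleftrightarrow> arc_consistent X \<and> (\<forall>v\<in>V. \<forall>x\<in>X v. \<forall>y\<in>X v. (x, y) \<in> (links X v x y)\<^sup>*)"

definition endo :: "('v \<Rightarrow> 'b set) \<Rightarrow> ('v \<Rightarrow> 'b \<Rightarrow> 'b) \<Rightarrow> bool" where
  "endo X M \<longleftrightarrow> (\<forall>v\<in>V. M v ` X v \<subseteq> X v) \<and>
     (\<forall>u\<in>V. \<forall>v\<in>V. \<forall>x\<in>X u. \<forall>y\<in>X v. (x, y) \<in> R u v \<longrightarrow> (M u x, M v y) \<in> R u v)"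

abbreviation total :: "('v \<Rightarrow> 'b set) \<Rightarrow> nat" where "total X \<equiv> \<Sum>v\<in>V. card (X v)"

lemma absorbs_closed:
  "absorbs X d \<Longrightarrow> v \<in> V \<Longrightarrow> x \<in> X v \<Longrightarrow> y \<in> A v \<Longrightarrow> z \<in> X v \<Longrightarrow> d v x y z \<in> X v"
  by (simp add: absorbs_def)

lemma absorbs_R:
  "absorbs X d \<Longrightarrow> u \<in> V \<Longrightarrow> v \<in> V \<Longrightarrow> x \<in> X u \<Longrightarrow> x' \<in> X v \<Longrightarrow> z \<in> X u \<Longrightarrow> z' \<in> X v \<Longrightarrow>
   (x, x') \<in> R u v \<Longrightarrow> (y, y') \<in> R u v \<Longrightarrow> (z, z') \<in> R u v \<Longrightarrow> (d u x y z, d v x' y' z') \<in> R u v"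
  by (simp add: absorbs_def)

lemma R_sym: "(x, y) \<in> R u v \<Longrightarrow> (y, x) \<in> R v u" by (auto simp: R_def)
lemma R_A: "(x, y) \<in> R u v \<Longrightarrow> x \<in> A u \<and> y \<in> A v" by (auto simp: R_def A_def)

lemma finX: "arc_consistent X \<Longrightarrow> v \<in> V \<Longrightarrow> finite (X v)"
  using finA[of v] unfolding arc_consistent_def A_def by (blast intro: finite_subset)

lemma total_less:
  assumes "arc_consistent X" "\<And>v. v \<in> V \<Longrightarrow> X' v \<subseteq> X v" "v0 \<in> V" "X' v0 \<noteq> X v0"
  shows "total X' < total X"
proof (rule sum_strict_mono_ex1)
  show "\<forall>v\<in>V. card (X' v) \<le> card (X v)"
    using assms(2) finX[OF assms(1)] by (simp add: card_mono)
  show "\<exists>v\<in>V. card (X' v) < card (X v)"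
    using assms(2)[OF assms(3)] assms(3,4) finX[OF assms(1)]
    by (intro bexI[of _ v0] psubset_card_mono) (simp_all add: psubset_eq)
qed (rule finV)

lemma endo_funpow: "endo X M \<Longrightarrow> endo X (\<lambda>v. M v ^^ k)"
proof (induction k)
  case (Suc k)
  thus ?case unfolding endo_def by (auto simp: image_subset_iff)
qed (auto simp: endo_def)

text \<open>An idempotent power \<open>E\<close> of \<open>M\<close> retracts the system onto its
  image. Composing the absorbing operations with \<open>E\<close> maps a path of links to a path of
  links, and \<open>E\<close> fixes the two ends when they lie in the image. The image is proper at
  \<open>v0\<close> because otherwise \<open>E\<close>, and with it the inner factor
  \<open>M\<close>, would be injective there.\<close>

lemma shrink_endo:
  assumes X: "linked X" and M: "endo X M" and v0: "v0 \<in> V" "\<not> inj_on (M v0) (X v0)"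
  shows "\<exists>X'. linked X' \<and> (\<forall>v\<in>V. X' v \<subseteq> X v) \<and> total X' < total X"
proof -
  have ac: "arc_consistent X" using X by (simp add: linked_def)
  have "finite (X v) \<and> M v ` X v \<subseteq> X v" if "v \<in> V" for v
    using finX[OF ac that] M that by (simp add: endo_def)
  from common_idempotent_power[where X=X and f=M, OF finV this]
  obtain k where k: "k > 0" "\<forall>v\<in>V. \<forall>x\<in>X v. (M v ^^ k) ((M v ^^ k) x) = (M v ^^ k) x" by auto
  define E where "E v = M v ^^ k" for v
  define X' where "X' v = E v ` X v" for v
  have E: "endo X E" using endo_funpow[OF M, of k] by (simp add: E_def[abs_def])
  have EX: "E v x \<in> X v" if "v \<in> V" "x \<in> X v" for v x using E that by (auto simp: endo_def)
  have ER: "(E u x, E v y) \<in> R u v" if "u \<in> V" "v \<in> V" "x \<in> X u" "y \<in> X v" "(x, y) \<in> R u v" for u v x y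
    using E that by (simp add: endo_def)
  have Eid: "E v x = x" if "v \<in> V" "x \<in> X' v" for v x using that k by (auto simp: X'_def E_def)
  have sub: "X' v \<subseteq> X v" if "v \<in> V" for v using EX that by (auto simp: X'_def)
  have ac': "arc_consistent X'"
    unfolding arc_consistent_def
  proof (intro ballI conjI)
    fix u assume u: "u \<in> V"
    show "X' u \<noteq> {}" using ac u by (auto simp: X'_def arc_consistent_def)
    show "X' u \<subseteq> A u" using ac u sub[OF u] unfolding arc_consistent_def by blast
    fix v x assume v: "v \<in> V" and x: "x \<in> X' u"
    hence xX: "x \<in> X u" using sub[OF u] by blast
    then obtain y where y: "y \<in> X v" "(x, y) \<in> R u v" using ac u v unfolding arc_consistent_def by blast
    hence "(E u x, E v y) \<in> R u v" using ER[OF u v xX] by blast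
    thus "\<exists>y\<in>X' v. (x, y) \<in> R u v" using Eid[OF u x] \<open>y \<in> X v\<close> by (auto simp: X'_def)
  qed
  have abs': "absorbs X' (\<lambda>v x y z. E v (d v x y z))" if d: "absorbs X d" for d
    unfolding absorbs_def
  proof (intro conjI ballI allI impI)
    fix v x y z assume v: "v \<in> V" and "x \<in> X' v" "y \<in> A v" "z \<in> X' v"
    hence "d v x y z \<in> X v" using absorbs_closed[OF d v] sub[OF v] by blast
    thus "E v (d v x y z) \<in> X' v" by (simp add: X'_def)
  next
    fix u v x x' y y' z z'
    assume u: "u \<in> V" and v: "v \<in> V" and h: "x \<in> X' u" "x' \<in> X' v" "z \<in> X' u" "z' \<in> X' v"
      and r: "(x, x') \<in> R u v \<and> (y, y') \<in> R u v \<and> (z, z') \<in> R u v"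
    have h': "x \<in> X u" "x' \<in> X v" "z \<in> X u" "z' \<in> X v" using h sub[OF u] sub[OF v] by blast+
    have "(d u x y z, d v x' y' z') \<in> R u v" using absorbs_R[OF d u v h'] r by blast
    moreover have "y \<in> A u" "y' \<in> A v" using r R_A by blast+
    hence "d u x y z \<in> X u" "d v x' y' z' \<in> X v"
      using absorbs_closed[OF d u h'(1) _ h'(3)] absorbs_closed[OF d v h'(2) _ h'(4)] by blast+
    ultimately show "(E u (d u x y z), E v (d v x' y' z')) \<in> R u v" using ER[OF u v] by blast
  qed
  have "(x, y) \<in> (links X' v x y)\<^sup>*" if v: "v \<in> V" and x: "x \<in> X' v" and y: "y \<in> X' v" for v x y
  proof -
    have "(x, y) \<in> (links X v x y)\<^sup>*" using X v x y sub[OF v] unfolding linked_def by blast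
    moreover have "(E v a, E v b) \<in> links X' v x y" if "(a, b) \<in> links X v x y" for a b
    proof -
      obtain d where d: "absorbs X d" "a = d v x x y" "b = d v x y y" using \<open>(a, b) \<in> links X v x y\<close> by (auto simp: links_def)
      show ?thesis unfolding links_def using abs'[OF d(1)] d(2,3)
        by (intro CollectI exI[of _ "\<lambda>v x y z. E v (d v x y z)"]) simp
    qed
    ultimately have "(E v x, E v y) \<in> (links X' v x y)\<^sup>*" by (rule rtrancl_image[rotated])
    thus ?thesis using Eid v x y by simp
  qed
  hence "linked X'" using ac' by (simp add: linked_def)
  moreover have "X' v0 \<noteq> X v0"
  proof
    assume eq: "X' v0 = X v0"
    have "card (E v0 ` X v0) = card (X v0)" using eq by (simp add: X'_def)
    hence "inj_on (E v0) (X v0)" using finX[OF ac v0(1)] by (simp add: eq_card_imp_inj_on)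
    moreover have "E v0 = (M v0 ^^ (k - 1)) \<circ> M v0" unfolding E_def using k(1)
      by (metis Suc_diff_1 funpow_Suc_right)
    ultimately have "inj_on (M v0) (X v0)" by (metis inj_on_imageI2)
    thus False using v0 by blast
  qed
  ultimately show ?thesis using total_less[OF ac, of X' v0] sub v0(1) by blast
qed

section \<open>Walks along constraints and cycles of constraints\<close>

text \<open>Used with two domains: the reduced \<open>X\<close>, and the full \<open>A\<close>, for
  which walks are relaxed. The empty walk is \<open>Id_on\<close> and not \<open>Id\<close>, so that
  a walk never leaves its domains.\<close>

primrec walk :: "('v \<Rightarrow> 'b set) \<Rightarrow> 'v \<Rightarrow> 'v list \<Rightarrow> ('b \<times> 'b) set" where
  "walk X v [] = Id_on (X v)"
| "walk X v (w # ws) = (R v w \<inter> X v \<times> X w) O walk X w ws"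

lemma walk_sub: "walk X v p \<subseteq> X v \<times> X (last (v # p))"
proof (induction p arbitrary: v)
  case (Cons w p)
  show ?case using Cons[of w] by fastforce
qed auto

lemma walk_append: "walk X v (p @ q) = walk X v p O walk X (last (v # p)) q"
proof (induction p arbitrary: v)
  case Nil
  show ?case using walk_sub[of X v q] by auto
next
  case (Cons w p)
  show ?case using Cons[of w] by (auto simp: O_assoc)
qed

lemma walk_mono: "(\<And>u. u \<in> set (v # p) \<Longrightarrow> X u \<subseteq> Y u) \<Longrightarrow> walk X v p \<subseteq> walk Y v p"
proof (induction p arbitrary: v)
  case (Cons w p)
  have "walk X w p \<subseteq> walk Y w p" using Cons by simp
  moreover have "X v \<subseteq> Y v" "X w \<subseteq> Y w" using Cons by auto
  ultimately show ?case by auto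
qed auto

text \<open>The middle walk may be relaxed, yet the result is a walk in \<open>X\<close>. This turns
  connections of the relaxed system into connections of the reduced one.\<close>

lemma absorbs_walk:
  assumes d: "absorbs X d" and X: "arc_consistent X"
  shows "set (v # p) \<subseteq> V \<Longrightarrow> (x, x') \<in> walk X v p \<Longrightarrow> (y, y') \<in> walk A v p \<Longrightarrow> (z, z') \<in> walk X v p \<Longrightarrow>
    (d v x y z, d (last (v # p)) x' y' z') \<in> walk X v p"
proof (induction p arbitrary: v x y z)
  case Nil
  thus ?case using absorbs_closed[OF d, of v x y z] by auto
next
  case (Cons w p)
  obtain x1 y1 z1 where 1: "(x, x1) \<in> R v w" "x \<in> X v" "x1 \<in> X w" "(x1, x') \<in> walk X w p"
     "(y, y1) \<in> R v w" "(y1, y') \<in> walk A w p"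
     "(z, z1) \<in> R v w" "z \<in> X v" "z1 \<in> X w" "(z1, z') \<in> walk X w p"
    using Cons.prems(2,3,4) by (simp only: walk.simps) blast
  have vw: "v \<in> V" "w \<in> V" using Cons.prems by auto
  have "(d w x1 y1 z1, d (last (w # p)) x' y' z') \<in> walk X w p"
    using Cons.IH[of w x1 y1 z1] Cons.prems(1) 1 by simp
  moreover have "(d v x y z, d w x1 y1 z1) \<in> R v w"
    using absorbs_R[OF d vw, of x x1 z z1 y y1] 1 by blast
  moreover have "y \<in> A v" "y1 \<in> A w" using 1(5) R_A by blast+
  hence "d v x y z \<in> X v" "d w x1 y1 z1 \<in> X w"
    using absorbs_closed[OF d vw(1), of x y z] absorbs_closed[OF d vw(2), of x1 y1 z1] 1 by blast+
  ultimately have "(d v x y z, d (last (w # p)) x' y' z') \<in> walk X v (w # p)"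
    by (simp only: walk.simps) blast
  thus ?case by simp
qed

lemma walk_forward:
  assumes X: "arc_consistent X"
  shows "set (v # p) \<subseteq> V \<Longrightarrow> x \<in> X v \<Longrightarrow> \<exists>y. (x, y) \<in> walk X v p"
proof (induction p arbitrary: v x)
  case (Cons w p)
  then obtain y where "y \<in> X w" "(x, y) \<in> R v w" using X unfolding arc_consistent_def by force
  moreover have "\<exists>z. (y, z) \<in> walk X w p" using Cons.IH[of w y] Cons.prems \<open>y \<in> X w\<close> by simp
  then obtain z where "(y, z) \<in> walk X w p" by blast
  ultimately show ?case using Cons.prems by auto
qed auto

lemma walk_backward:
  assumes X: "arc_consistent X"
  shows "set (v # p) \<subseteq> V \<Longrightarrow> y \<in> X (last (v # p)) \<Longrightarrow> \<exists>x. (x, y) \<in> walk X v p"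
proof (induction p arbitrary: v)
  case (Cons w p)
  then obtain z where z: "(z, y) \<in> walk X w p" by (auto split: if_splits)
  hence "z \<in> X w" using walk_sub by blast
  then obtain x where "x \<in> X v" "(z, x) \<in> R w v"
    using X Cons.prems unfolding arc_consistent_def by force
  hence "(x, z) \<in> R v w \<inter> X v \<times> X w" using \<open>z \<in> X w\<close> R_sym by blast
  thus ?case using z by auto
qed auto

lemma walk_solution: "s \<in> S \<Longrightarrow> (s v, s (last (v # p))) \<in> walk A v p"
proof (induction p arbitrary: v)
  case (Cons w p)
  have "(s v, s w) \<in> R v w \<inter> A v \<times> A w" using Cons by (auto simp: R_def A_def)
  thus ?case using Cons by auto
qed (auto simp: A_def)

lemma absorbs_walk_pow:
  assumes d: "absorbs X d" and X: "arc_consistent X" and p: "set (v # p) \<subseteq> V" "last (v # p) = v"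
  shows "(x, x') \<in> walk X v p ^^ n \<Longrightarrow> (y, y') \<in> walk A v p ^^ n \<Longrightarrow> (z, z') \<in> walk X v p ^^ n \<Longrightarrow>
    (d v x y z, d v x' y' z') \<in> walk X v p ^^ n"
proof (induction n arbitrary: x' y' z')
  case (Suc n)
  then obtain x1 y1 z1 where 1: "(x, x1) \<in> walk X v p ^^ n" "(x1, x') \<in> walk X v p"
    "(y, y1) \<in> walk A v p ^^ n" "(y1, y') \<in> walk A v p" "(z, z1) \<in> walk X v p ^^ n" "(z1, z') \<in> walk X v p"
    by auto
  have "(d v x1 y1 z1, d v x' y' z') \<in> walk X v p"
    using absorbs_walk[OF d X p(1) 1(2) 1(4) 1(6)] p(2) by simp
  thus ?case using Suc.IH[OF 1(1) 1(3) 1(5)] by auto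
qed auto

text \<open>Relaxed edges can be traversed backwards at the cost of further rounds of the cycle,
  because each edge comes from a solution that can be followed all the way round.
  \<open>Rch u x\<close> says that \<open>x\<close> is reached at \<open>u\<close> after some full
  rounds and an initial part of another.\<close>

lemma relax_reversible:
  assumes p: "set (v # p) \<subseteq> V" "last (v # p) = v" and b: "b \<in> A v"
    and q: "set (u # q) \<subseteq> set (v # p)" "last (u # q) = v" "u = v" and yb: "(y, b) \<in> walk A u q"
  shows "\<exists>n. \<forall>m\<ge>n. (b, y) \<in> walk A v p ^^ m"
proof -
  let ?K = "walk A v p"
  define Rch where "Rch u x \<longleftrightarrow> (\<exists>n p1 p2. p = p1 @ p2 \<and> last (v # p1) = u \<and> (b, x) \<in> ?K ^^ n O walk A v p1)" for u x
  have step: "Rch u' y" if h: "Rch u x" "(y, x) \<in> R u' u" "u' \<in> set (v # p)" for u u' x y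
  proof -
    obtain n p1 p2 where 1: "p = p1 @ p2" "last (v # p1) = u" "(b, x) \<in> ?K ^^ n O walk A v p1"
      using h(1) unfolding Rch_def by blast
    \<comment> \<open>A solution through the edge: following it completes the current round, and
      following it once more from \<open>v\<close> stops at \<open>u'\<close> in the value
      \<open>y\<close>.\<close>
    obtain s where s: "s \<in> S" "s u' = y" "s u = x" using h(2) by (auto simp: R_def)
    have l: "last (u # p2) = v" using p(2) 1 by (cases p2) auto
    have "(x, s v) \<in> walk A u p2" using walk_solution[OF s(1), of u p2] s l by simp
    hence "(b, s v) \<in> ?K ^^ n O walk A v p1 O walk A u p2" using 1(3) by blast
    also have "walk A v p1 O walk A u p2 = ?K" using 1 by (simp only: walk_append)
    finally have 2: "(b, s v) \<in> ?K ^^ Suc n" by simp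
    obtain p1' p2' where 3: "p = p1' @ p2'" "last (v # p1') = u'"
    proof (cases "u' = v")
      case True
      thus ?thesis using that[of "[]" p] by simp
    next
      case False
      hence "u' \<in> set p" using h(3) by simp
      then obtain as bs where "p = as @ u' # bs" by (meson split_list)
      thus ?thesis using that[of "as @ [u']" bs] by simp
    qed
    have "(s v, y) \<in> walk A v p1'" using walk_solution[OF s(1), of v p1'] s 3 by simp
    with 2 3 show ?thesis unfolding Rch_def by blast
  qed
  have path: "Rch u y" if "(y, x) \<in> walk A u ws" "set (u # ws) \<subseteq> set (v # p)" "Rch (last (u # ws)) x" for u y x ws
    using that
  proof (induction ws arbitrary: u y)
    case (Cons w ws)
    then obtain z where z: "(y, z) \<in> R u w" "(z, x) \<in> walk A w ws" by auto
    have "Rch w z" using Cons.IH[OF z(2)] Cons.prems by auto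
    from step[OF this z(1)] show ?case using Cons.prems by auto
  qed auto
  have "(b, b) \<in> ?K ^^ 0 O walk A v []" using b by auto
  hence "Rch v b" unfolding Rch_def by (metis append_Nil last_ConsL)
  hence "Rch v y" using path[OF yb q(1)] q(2,3) by simp
  then obtain n p1 p2 where 1: "p = p1 @ p2" "last (v # p1) = v" "(b, y) \<in> ?K ^^ n O walk A v p1"
    unfolding Rch_def by blast
  have "y \<in> A v" using yb walk_sub[of A u q] q(3) by auto
  then obtain s where s: "s \<in> S" "s v = y" by (auto simp: A_def)
  have l: "last (v # p2) = v" using p(2) 1 by (cases p2) auto
  have "(y, y) \<in> walk A v p2" using walk_solution[OF s(1), of v p2] s l by simp
  hence "(b, y) \<in> ?K ^^ n O walk A v p1 O walk A v p2" using 1(3) by blast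
  also have "walk A v p1 O walk A v p2 = ?K" using 1 by (simp only: walk_append)
  finally have 2: "(b, y) \<in> ?K ^^ Suc n" by simp
  \<comment> \<open>A solution through \<open>y\<close> gives a loop at \<open>y\<close>, so every
    larger number of rounds is possible too.\<close>
  have "(y, y) \<in> ?K" using walk_solution[OF s(1), of v p] s p(2) by simp
  hence "(y, y) \<in> ?K ^^ m" for m by (induction m) auto
  hence "(b, y) \<in> ?K ^^ (Suc n + m)" for m using 2 unfolding relpow_add by blast
  hence "\<forall>m\<ge>Suc n. (b, y) \<in> ?K ^^ m" by (metis le_add_diff_inverse)
  thus ?thesis by blast
qed

lemma walk_replicate:
  assumes "last (v # p) = v" "D \<subseteq> X v"
  shows "walk X v (concat (replicate n p)) = Id_on (X v) O walk X v p ^^ n \<and> last (v # concat (replicate n p)) = v"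
proof (induction n)
  case (Suc n)
  have "walk X v (concat (replicate (Suc n) p)) = walk X v (concat (replicate n p) @ p)"
    by (metis concat.simps(2) concat_append append_Nil2 concat.simps(1) replicate_Suc replicate_append_same)
  also have "\<dots> = (Id_on (X v) O walk X v p ^^ n) O walk X v p" using Suc by (simp only: walk_append)
  finally have "walk X v (concat (replicate (Suc n) p)) = Id_on (X v) O walk X v p ^^ Suc n" by (simp add: O_assoc)
  moreover have "last (v # concat (replicate (Suc n) p)) = v" using Suc assms(1)
    by (metis append_Nil2 concat.simps(2) last.simps last_append replicate_Suc)
  ultimately show ?case by blast
qed auto

text \<open>One half of the condition that defines Prague instances. For \<open>a\<close> in
  \<open>D\<close> with predecessor \<open>a'\<close> along \<open>p\<close>, going forward from
  \<open>a\<close> leads to a point \<open>b\<close> on a loop, going backward from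
  \<open>a'\<close> to a point \<open>c\<close> on a loop. The relaxed system leads from
  \<open>b\<close> back to \<open>c\<close>. With the loops as outer arguments and this return as
  middle argument, every link between \<open>b\<close> and \<open>c\<close> is a walk in
  \<open>X\<close>. As \<open>D\<close> is closed under rounds, it contains \<open>c\<close>, hence
  \<open>a'\<close>, hence \<open>a\<close> lies in \<open>D'\<close>.\<close>

lemma prague:
  assumes X: "linked X" and v: "v \<in> V" and p: "set p \<subseteq> V" "last (v # p) = v" and q: "set q \<subseteq> V" "last (v # q) = v"
    and D: "D \<subseteq> X v" "D' = walk X v p `` D" "D = walk X v q `` D'"
  shows "D \<subseteq> D'"
proof
  fix a assume a: "a \<in> D"
  have ac: "arc_consistent X" using X by (simp add: linked_def)
  define r where "r = p @ q"
  have r: "set (v # r) \<subseteq> V" "last (v # r) = v" using p q v by (simp_all add: r_def) (auto split: if_splits)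
  let ?H = "walk X v r" and ?K = "walk A v r"
  have H: "?H = walk X v p O walk X v q" using p(2) by (simp only: r_def walk_append)
  have DH: "?H `` D = D" unfolding H relcomp_Image D(2)[symmetric] D(3)[symmetric] ..
  have DHn: "(?H ^^ n) `` D = D" for n
    by (induction n) (simp_all add: relcomp_Image DH)
  have sub: "?H \<subseteq> X v \<times> X v" using walk_sub[of X v r] r(2) by simp
  have "\<forall>x\<in>X v. \<exists>y. y \<in> X v \<and> (x, y) \<in> ?H" 
  proof
    fix x assume "x \<in> X v"
    then obtain y where "(x, y) \<in> ?H" using walk_forward[OF ac r(1)] by blast
    thus "\<exists>y. y \<in> X v \<and> (x, y) \<in> ?H" using sub by blast
  qed
  then obtain f where f: "\<forall>x\<in>X v. f x \<in> X v \<and> (x, f x) \<in> ?H" by (rule bchoice[THEN exE])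
  have "\<forall>y\<in>X v. \<exists>x. x \<in> X v \<and> (x, y) \<in> ?H" 
  proof
    fix y assume "y \<in> X v"
    then obtain x where "(x, y) \<in> ?H" using walk_backward[OF ac r(1), of y] r(2) by metis
    thus "\<exists>x. x \<in> X v \<and> (x, y) \<in> ?H" using sub by blast
  qed
  then obtain g where g: "\<forall>x\<in>X v. g x \<in> X v \<and> (g x, x) \<in> ?H" by (rule bchoice[THEN exE])
  have "finite (X v) \<and> (if i then f else g) ` X v \<subseteq> X v" for i
    using finX[OF ac v] f g by auto
  with common_idempotent_power[of "UNIV :: bool set" "\<lambda>_. X v" "\<lambda>i. if i then f else g"]
  obtain k where k: "k > 0"
    "\<forall>i\<in>UNIV. \<forall>x\<in>X v. ((if i then f else g) ^^ k) (((if i then f else g) ^^ k) x) = ((if i then f else g) ^^ k) x"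
    by auto
  have kf: "(f ^^ k) ((f ^^ k) x) = (f ^^ k) x" and kg: "(g ^^ k) ((g ^^ k) x) = (g ^^ k) x" if "x \<in> X v" for x
    using k(2)[rule_format, OF UNIV_I that, of True] k(2)[rule_format, OF UNIV_I that, of False] by simp_all
  have aX: "a \<in> X v" using a D by blast
  obtain a' where a': "(a', a) \<in> walk X v p" using walk_backward[OF ac, of v p a] aX p v by auto
  hence a'X: "a' \<in> X v" using walk_sub by blast
  \<comment> \<open>Iterating the chosen successor \<open>k\<close> times ends in a fixed point of
    \<open>f ^^ k\<close>, which is a loop of \<open>k\<close> rounds; likewise for \<open>c\<close>
    with predecessors.\<close>
  define b where "b = (f ^^ k) a"
  define c where "c = (g ^^ k) a'"
  have b: "(a, b) \<in> ?H ^^ k" "b \<in> X v" using relpow_choice[of "X v" f ?H a k] f aX by (auto simp: b_def)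
  have bb: "(b, b) \<in> ?H ^^ k" using relpow_choice[of "X v" f ?H b k] f b(2) kf[OF aX] by (auto simp: b_def)
  have c: "(c, a') \<in> ?H ^^ k" "c \<in> X v" using relpow_choice_conv[of "X v" g ?H a' k] g a'X by (auto simp: c_def)
  have cc: "(c, c) \<in> ?H ^^ k" using relpow_choice_conv[of "X v" g ?H c k] g c(2) kg[OF a'X] by (auto simp: c_def)
  have bD: "b \<in> D" using b(1) a DHn[of k] by blast
  have XA: "X u \<subseteq> A u" if "u \<in> V" for u using ac that by (auto simp: arc_consistent_def)
  let ?w = "concat (replicate k r) @ p @ concat (replicate k r)"
  have wr: "walk X v (concat (replicate k r)) = Id_on (X v) O ?H ^^ k" "last (v # concat (replicate k r)) = v"
    using walk_replicate[OF r(2), of D X k] D(1) by blast+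
  have "(c, b) \<in> walk X v ?w"
  proof -
    have "walk X v ?w = walk X v (concat (replicate k r)) O walk X v p O walk X v (concat (replicate k r))"
      using wr(2) p(2) by (simp only: walk_append)
    thus ?thesis using wr(1) c a' b aX a'X by (auto intro!: relcompI)
  qed
  moreover have wset: "set (v # ?w) \<subseteq> set (v # r)" by (auto simp: r_def)
  ultimately have cb: "(c, b) \<in> walk A v ?w" using walk_mono[of v ?w X A] XA r(1) by blast
  have "last (v # ?w) = v" using wr(2) p(2) by (auto split: if_splits)
  then obtain n where n: "\<And>m. m \<ge> n \<Longrightarrow> (b, c) \<in> ?K ^^ m"
    using relax_reversible[OF r _ wset _ _ cb] XA v b(2) by blast
  \<comment> \<open>A number of rounds that is a multiple of both loop lengths and at least
    \<open>n\<close>.\<close>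
  have "(b, c) \<in> ?K ^^ (k * n)" using n[of "k * n"] k(1) by simp
  hence "links X v b c \<subseteq> ?H ^^ (k * n)"
    using absorbs_walk_pow[OF _ ac r relpow_mult_loop[OF bb] _ relpow_mult_loop[OF cc]]
    by (auto simp: links_def)
  moreover have "(b, c) \<in> (links X v b c)\<^sup>*" using X v b(2) c(2) by (auto simp: linked_def)
  ultimately have "(b, c) \<in> (?H ^^ (k * n))\<^sup>*" by (meson rtrancl_mono subsetD)
  hence "c \<in> D" using bD
  proof (induction rule: rtrancl_induct)
    case (step y z)
    thus ?case using DHn[of "k * n"] by blast
  qed
  hence "a' \<in> D" using c(1) DHn[of k] by blast
  thus "a \<in> D'" using a' D(2) by blast
qed


section \<open>Reduction to a proper absorbing subset\<close>

text \<open>A reachable state from which the fewest states are reachable lies in a terminal strong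
  component.\<close>

lemma terminal_state:
  fixes T :: "'s rel"
  assumes "finite (T\<^sup>* `` {z})"
  shows "\<exists>z0. (z, z0) \<in> T\<^sup>* \<and> (\<forall>y. (z0, y) \<in> T\<^sup>* \<longrightarrow> (y, z0) \<in> T\<^sup>*)"
proof -
  define f where "f y = card (T\<^sup>* `` {y})" for y
  obtain z0 where z0: "(z, z0) \<in> T\<^sup>*" "\<And>y. (z, y) \<in> T\<^sup>* \<Longrightarrow> f z0 \<le> f y"
    using ex_has_least_nat[of "\<lambda>y. (z, y) \<in> T\<^sup>*" z f] by auto
  have "(y, z0) \<in> T\<^sup>*" if y: "(z0, y) \<in> T\<^sup>*" for y
  proof -
    have sub: "T\<^sup>* `` {y} \<subseteq> T\<^sup>* `` {z0}" using y by (auto intro: rtrancl_trans)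
    have "finite (T\<^sup>* `` {z0})" using z0(1) by (intro finite_subset[OF _ assms]) (auto intro: rtrancl_trans)
    moreover have "card (T\<^sup>* `` {z0}) \<le> card (T\<^sup>* `` {y})" using z0(2)[OF rtrancl_trans[OF z0(1) y]] by (simp add: f_def)
    ultimately have "T\<^sup>* `` {y} = T\<^sup>* `` {z0}" using sub by (metis card_subset_eq card_mono le_antisym)
    thus ?thesis by blast
  qed
  thus ?thesis using z0(1) by blast
qed

text \<open>Proper nonempty closed sets are propagated along the constraints until a terminal strong
  component is reached. By \<open>prague\<close> in both directions, that component contains at most
  one set per variable. Taking these sets, and the old domain at the other variables, is arc
  consistent because no proper set leads out of the component, and closedness keeps the operations
  absorbing.\<close>

lemma shrink_closed:
  assumes X: "linked X" and v0: "v0 \<in> V" and Ob: "Ob \<subseteq> X v0" "Ob \<noteq> {}" "Ob \<noteq> X v0"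
    and cl: "\<And>d x y z. absorbs X d \<Longrightarrow> x \<in> Ob \<Longrightarrow> y \<in> A v0 \<Longrightarrow> z \<in> Ob \<Longrightarrow> d v0 x y z \<in> Ob"
  shows "\<exists>X'. linked X' \<and> (\<forall>v\<in>V. X' v \<subseteq> X v) \<and> total X' < total X"
proof -
  have ac: "arc_consistent X" using X by (simp add: linked_def)
  define C where "C v D \<longleftrightarrow> D \<subseteq> X v \<and> D \<noteq> {} \<and> D \<noteq> X v \<and>
    (\<forall>d x y z. absorbs X d \<longrightarrow> x \<in> D \<longrightarrow> y \<in> A v \<longrightarrow> z \<in> D \<longrightarrow> d v x y z \<in> D)" for v D
  define plus where "plus v D w = (R v w \<inter> X v \<times> X w) `` D" for v D w
  \<comment> \<open>Propagation steps that produce the whole domain carry no restriction and are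
    left out; only this makes the component closed under all remaining steps.\<close>
  define T where "T = {((v, D), (w, D')). v \<in> V \<and> w \<in> V \<and> C v D \<and> D' = plus v D w \<and> D' \<noteq> X w}"
  have C_plus: "C w (plus v D w)" if h: "v \<in> V" "w \<in> V" "C v D" "plus v D w \<noteq> X w" for v w D
  proof -
    have DX: "D \<subseteq> X v" "D \<noteq> {}" using h by (auto simp: C_def)
    then obtain x where "x \<in> D" by blast
    then obtain y where "y \<in> X w" "(x, y) \<in> R v w" using ac h DX unfolding arc_consistent_def by blast
    hence ne: "plus v D w \<noteq> {}" using \<open>x \<in> D\<close> DX unfolding plus_def by blast
    have "d w x' y' z' \<in> plus v D w" if d: "absorbs X d" "x' \<in> plus v D w" "y' \<in> A w" "z' \<in> plus v D w" for d x' y' z'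
    proof -
      obtain x z where xz: "x \<in> D" "z \<in> D" "(x, x') \<in> R v w" "(z, z') \<in> R v w" "x' \<in> X w" "z' \<in> X w"
        using d unfolding plus_def by blast
      obtain s where "s \<in> S" "y' = s w" using d by (auto simp: A_def)
      hence y: "(s v, y') \<in> R v w" by (auto simp: R_def)
      have "(d v x (s v) z, d w x' y' z') \<in> R v w"
        using absorbs_R[OF d(1) h(1,2), of x x' z z' "s v" y'] xz y DX by blast
      moreover have "d v x (s v) z \<in> D" using h(3) d(1) xz R_A[OF y] unfolding C_def by blast
      moreover have "d w x' y' z' \<in> X w" using absorbs_closed[OF d(1) h(2)] xz d(3) by blast
      ultimately show ?thesis using DX unfolding plus_def by blast
    qed
    thus ?thesis using ne h(4) unfolding C_def by (auto simp: plus_def)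
  qed
  have CO: "C v0 Ob" using Ob cl by (auto simp: C_def)
  have reach_C: "fst z \<in> V \<and> C (fst z) (snd z)" if "((v0, Ob), z) \<in> T\<^sup>*" for z
    using that
  proof (induction rule: rtrancl_induct)
    case (step y z)
    obtain w E w' where yz: "y = (w, E)" "z = (w', plus w E w')" "w \<in> V" "w' \<in> V" "C w E" "plus w E w' \<noteq> X w'"
      using step.hyps(2) by (auto simp: T_def)
    show ?case using C_plus[OF yz(3,4,5,6)] yz by simp
  qed (use v0 CO in simp)
  have "T\<^sup>* `` {(v0, Ob)} \<subseteq> Sigma V (\<lambda>v. Pow (X v))"
  proof
    fix z assume "z \<in> T\<^sup>* `` {(v0, Ob)}"
    hence "fst z \<in> V \<and> C (fst z) (snd z)" using reach_C by blast
    thus "z \<in> Sigma V (\<lambda>v. Pow (X v))" by (cases z) (auto simp: C_def)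
  qed
  moreover have "finite (Sigma V (\<lambda>v. Pow (X v)))" using finV finX[OF ac] by auto
  ultimately have "finite (T\<^sup>* `` {(v0, Ob)})" by (rule finite_subset)
  from terminal_state[OF this] obtain z0 where z0: "((v0, Ob), z0) \<in> T\<^sup>*" "\<And>y. (z0, y) \<in> T\<^sup>* \<Longrightarrow> (y, z0) \<in> T\<^sup>*"
    by blast
  define Z where "Z = T\<^sup>* `` {z0}"
  have ZC: "v \<in> V \<and> C v D" if "(v, D) \<in> Z" for v D
    using reach_C[of "(v, D)"] rtrancl_trans[OF z0(1)] that by (auto simp: Z_def)
  have path: "\<exists>p. set p \<subseteq> V \<and> last (v # p) = fst z \<and> snd z = walk X v p `` D"
    if "((v, D), z) \<in> T\<^sup>*" "D \<subseteq> X v" for v D z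
    using that(1)
  proof (induction rule: rtrancl_induct)
    case base
    have "Id_on (X v) `` D = D" using that(2) by blast
    thus ?case by (intro exI[of _ "[]"]) simp
  next
    case (step y z)
    obtain w E w' E' where yz: "y = (w, E)" "z = (w', E')" by fastforce
    obtain p where p: "set p \<subseteq> V" "last (v # p) = w" "E = walk X v p `` D" using step.IH yz by auto
    have T: "w' \<in> V" "E' = plus w E w'" using step.hyps(2) yz by (auto simp: T_def)
    have "walk X v (p @ [w']) = walk X v p O (R w w' \<inter> X w \<times> X w')"
      using p(2) by (auto simp add: walk_append simp del: last.simps)
    hence "E' = walk X v (p @ [w']) `` D" using T p(3) by (simp only: plus_def relcomp_Image)
    thus ?case using p T yz by (intro exI[of _ "p @ [w']"]) auto
  qed
  have uniq: "D = D'" if h: "(v, D) \<in> Z" "(v, D') \<in> Z" for v D D'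
  proof -
    have r: "((v, D), (v, D')) \<in> T\<^sup>*" "((v, D'), (v, D)) \<in> T\<^sup>*"
      using h z0(2) rtrancl_trans by (auto simp: Z_def intro: rtrancl_trans)
    have sub: "D \<subseteq> X v" "D' \<subseteq> X v" and v: "v \<in> V" using ZC[OF h(1)] ZC[OF h(2)] by (auto simp: C_def)
    obtain p where p: "set p \<subseteq> V" "last (v # p) = v" "D' = walk X v p `` D" using path[OF r(1) sub(1)] by auto
    obtain q where q: "set q \<subseteq> V" "last (v # q) = v" "D = walk X v q `` D'" using path[OF r(2) sub(2)] by auto
    show ?thesis using prague[OF X v p(1,2) q(1,2) sub(1) p(3) q(3)] prague[OF X v q(1,2) p(1,2) sub(2) q(3) p(3)] by blast
  qed
  define X' where "X' v = (if \<exists>D. (v, D) \<in> Z then SOME D. (v, D) \<in> Z else X v)" for v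
  have X'Z: "X' v = D" if "(v, D) \<in> Z" for v D
    using that uniq someI[of "\<lambda>D. (v, D) \<in> Z" D] unfolding X'_def by auto
  have X'cases: "(v, X' v) \<in> Z \<or> X' v = X v" for v
  proof (cases "\<exists>D. (v, D) \<in> Z")
    case True
    then obtain D where "(v, D) \<in> Z" by blast
    thus ?thesis using X'Z by simp
  qed (simp add: X'_def)
  have sub: "X' v \<subseteq> X v" "X' v \<noteq> {}" if "v \<in> V" for v
    using X'cases[of v] ZC[of v "X' v"] ac that unfolding C_def arc_consistent_def by blast+
  have ac': "arc_consistent X'"
    unfolding arc_consistent_def
  proof (intro ballI conjI)
    fix u assume u: "u \<in> V"
    show "X' u \<noteq> {}" using sub u by blast
    show "X' u \<subseteq> A u" using ac u sub(1)[OF u] unfolding arc_consistent_def by blast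
    fix v x assume v: "v \<in> V" and x: "x \<in> X' u"
    have xX: "x \<in> X u" using x sub(1)[OF u] by blast
    show "\<exists>y\<in>X' v. (x, y) \<in> R u v"
    proof (cases "(v, X' v) \<in> Z")
      case False
      hence "X' v = X v" using X'cases by blast
      thus ?thesis using ac u v xX unfolding arc_consistent_def by auto
    next
      case True
      \<comment> \<open>What \<open>X' v\<close> propagates to \<open>u\<close> is either the whole
        domain or again a set of the terminal component, and then it is \<open>X' u\<close> by
        uniqueness.\<close>
      have "x \<in> plus v (X' v) u"
      proof (cases "plus v (X' v) u = X u")
        case False
        have "((v, X' v), (u, plus v (X' v) u)) \<in> T" using False ZC[OF True] u by (auto simp: T_def)
        hence "(u, plus v (X' v) u) \<in> Z" using True unfolding Z_def by (auto intro: rtrancl_into_rtrancl)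
        thus ?thesis using X'Z x by blast
      qed (use xX in simp)
      thus ?thesis unfolding plus_def using R_sym by blast
    qed
  qed
  have abs': "absorbs X' d" if d: "absorbs X d" for d
    unfolding absorbs_def
  proof (intro conjI ballI allI impI)
    fix v x y z assume v: "v \<in> V" and h: "x \<in> X' v" "y \<in> A v" "z \<in> X' v"
    show "d v x y z \<in> X' v"
    proof (cases "(v, X' v) \<in> Z")
      case True
      thus ?thesis using ZC[OF True] h d unfolding C_def by blast
    next
      case False
      thus ?thesis using X'cases[of v] absorbs_closed[OF d v, of x y z] h by auto
    qed
  next
    fix u v x x' y y' z z'
    assume u: "u \<in> V" and v: "v \<in> V" and h: "x \<in> X' u" "x' \<in> X' v" "z \<in> X' u" "z' \<in> X' v"
      and r: "(x, x') \<in> R u v \<and> (y, y') \<in> R u v \<and> (z, z') \<in> R u v"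
    have h': "x \<in> X u" "x' \<in> X v" "z \<in> X u" "z' \<in> X v" using h sub[OF u] sub[OF v] by blast+
    show "(d u x y z, d v x' y' z') \<in> R u v" using absorbs_R[OF d u v h'] r by blast
  qed
  have "(x, y) \<in> (links X' v x y)\<^sup>*" if "v \<in> V" "x \<in> X' v" "y \<in> X' v" for v x y
  proof -
    have "(x, y) \<in> (links X v x y)\<^sup>*" using X that sub[OF that(1)] unfolding linked_def by blast
    moreover have "links X v x y \<subseteq> links X' v x y" using abs' unfolding links_def by blast
    ultimately show ?thesis using rtrancl_mono by blast
  qed
  hence "linked X'" using ac' by (simp add: linked_def)
  moreover have "z0 \<in> Z" by (simp add: Z_def)
  hence z0Z: "(fst z0, snd z0) \<in> Z" by simp
  have "X' (fst z0) \<noteq> X (fst z0)" "fst z0 \<in> V" using X'Z[OF z0Z] ZC[OF z0Z] by (auto simp: C_def)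
  hence "total X' < total X" using total_less[OF ac sub(1)] by blast
  ultimately show ?thesis using sub(1) by blast
qed

end

section \<open>Systems that admit no further reduction\<close>

context csp
begin

definition hom :: "('v \<Rightarrow> 'b set) \<Rightarrow> ('v \<Rightarrow> 'b \<Rightarrow> 'b) \<Rightarrow> bool" where
  "hom X N \<longleftrightarrow> (\<forall>v\<in>V. N v ` X v \<subseteq> A v) \<and>
     (\<forall>u\<in>V. \<forall>v\<in>V. \<forall>x\<in>X u. \<forall>y\<in>X v. (x, y) \<in> R u v \<longrightarrow> (N u x, N v y) \<in> R u v)"

lemma endo_hom: "arc_consistent X \<Longrightarrow> endo X M \<Longrightarrow> hom X M"
  unfolding endo_def hom_def arc_consistent_def by blast

lemma hom_const: "s \<in> S \<Longrightarrow> hom X (\<lambda>v _. s v)"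
  by (auto simp: hom_def A_def R_def)

lemma endo_absorbs:
  assumes d: "absorbs X d" and M: "endo X M" "endo X M'" and N: "hom X N"
  shows "endo X (\<lambda>v x. d v (M v x) (N v x) (M' v x))"
  unfolding endo_def
proof (intro conjI ballI impI)
  fix v assume v: "v \<in> V"
  show "(\<lambda>x. d v (M v x) (N v x) (M' v x)) ` X v \<subseteq> X v"
    using M N v absorbs_closed[OF d v] by (auto simp: endo_def hom_def image_subset_iff)
next
  fix u v x y assume u: "u \<in> V" and v: "v \<in> V" and h: "x \<in> X u" "y \<in> X v" "(x, y) \<in> R u v"
  show "(d u (M u x) (N u x) (M' u x), d v (M v y) (N v y) (M' v y)) \<in> R u v"
    using M N u v h by (intro absorbs_R[OF d u v]) (simp_all add: endo_def hom_def image_subset_iff)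
qed

text \<open>In a system that cannot be shrunk all endomorphisms are injective and no closed set is
  proper. These two facts force every domain to be a single point, and an arc consistent system of
  points is a solution.\<close>

theorem linked_solution:
  "linked X \<Longrightarrow> \<exists>s. (\<forall>v\<in>V. s v \<in> X v) \<and> (\<forall>u\<in>V. \<forall>v\<in>V. (s u, s v) \<in> R u v)"
proof (induction "total X" arbitrary: X rule: less_induct)
  case less
  note X = less.prems
  have ac: "arc_consistent X" using X by (simp add: linked_def)
  show ?case
  proof (cases "\<exists>X'. linked X' \<and> (\<forall>v\<in>V. X' v \<subseteq> X v) \<and> total X' < total X")
    case True
    then obtain X' where X': "linked X'" "\<forall>v\<in>V. X' v \<subseteq> X v" "total X' < total X" by blast
    show ?thesis using less.hyps[OF X'(3,1)] X'(2) by blast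
  next
    case False
    have inj: "inj_on (M v) (X v)" if "endo X M" "v \<in> V" for M v
      using shrink_endo[OF X that] False by blast
    have full: "Ob = X v" if "v \<in> V" "Ob \<subseteq> X v" "Ob \<noteq> {}"
      "\<And>d x y z. absorbs X d \<Longrightarrow> x \<in> Ob \<Longrightarrow> y \<in> A v \<Longrightarrow> z \<in> Ob \<Longrightarrow> d v x y z \<in> Ob" for v Ob
    proof (rule ccontr)
      assume "Ob \<noteq> X v"
      have "\<exists>X'. linked X' \<and> (\<forall>v\<in>V. X' v \<subseteq> X v) \<and> total X' < total X"
      proof (rule shrink_closed[of X v Ob])
        show "d v x y z \<in> Ob" if "absorbs X d" "x \<in> Ob" "y \<in> A v" "z \<in> Ob" for d x y z
          using that by (rule \<open>\<And>d x y z. absorbs X d \<Longrightarrow> x \<in> Ob \<Longrightarrow> y \<in> A v \<Longrightarrow> z \<in> Ob \<Longrightarrow> d v x y z \<in> Ob\<close>)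
      qed fact+
      thus False using False by simp
    qed
    \<comment> \<open>The orbit of \<open>x\<close> under endomorphisms is closed: the middle
      argument may be any value of a solution, because the constant maps given by a solution are
      homomorphisms into \<open>A\<close>. So the orbit is the whole domain.\<close>
    have trans: "\<exists>M. endo X M \<and> M v x = y" if v: "v \<in> V" and x: "x \<in> X v" and y: "y \<in> X v" for v x y
    proof -
      define Ob where "Ob = {M v x | M. endo X M}"
      have "endo X (\<lambda>v x. x)" by (simp add: endo_def)
      hence a: "x \<in> Ob" unfolding Ob_def by (intro CollectI exI[of _ "\<lambda>v x. x"]) simp
      have b: "Ob \<subseteq> X v" using v x by (auto simp: Ob_def endo_def)
      have c: "d v x' y' z' \<in> Ob" if d: "absorbs X d" "x' \<in> Ob" "y' \<in> A v" "z' \<in> Ob" for d x' y' z'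
      proof -
        obtain M M' s where M: "endo X M" "endo X M'" "x' = M v x" "z' = M' v x" "s \<in> S" "y' = s v"
          using d by (auto simp: Ob_def A_def)
        show ?thesis unfolding Ob_def
          using endo_absorbs[OF d(1) M(1,2) hom_const[OF M(5)]] M
          by (intro CollectI exI[of _ "\<lambda>u w. d u (M u w) (s u) (M' u w)"]) simp
      qed
      have "Ob = X v"
      proof (rule full[OF v b])
        show "Ob \<noteq> {}" using a by blast
      qed (rule c)
      hence "y \<in> Ob" using y by simp
      thus ?thesis by (auto simp: Ob_def)
    qed
    have single: "x = y" if v: "v \<in> V" and x: "x \<in> X v" and y: "y \<in> X v" for v x y
    proof (rule ccontr)
      assume ne: "x \<noteq> y"
      obtain M where M: "endo X M" "M v x = y" using trans[OF v x y] by blast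
      \<comment> \<open>A composite of maps sending \<open>c\<close> to
        \<open>d v x' c (M v x')\<close>. With \<open>c\<close> fixed it is an endomorphism as a
        function of \<open>x'\<close>, written \<open>F\<close>, and thus injective. With
        \<open>x' = x\<close> the innermost \<open>d\<close> sends \<open>x\<close> and
        \<open>y\<close> to the two ends of one of their links, since
        \<open>M v x = y\<close>.\<close>
      define W where "W ds x' c = foldr (\<lambda>d c. d v x' c (M v x')) ds c" for ds :: "('v \<Rightarrow> 'b \<Rightarrow> 'b \<Rightarrow> 'b \<Rightarrow> 'b) list" and x' c
      let ?ok = "\<lambda>ds. \<forall>d\<in>set ds. absorbs X d"
      define F where "F ds s u w = foldr (\<lambda>d c. d u w c (M u w)) ds (s u)" for ds :: "('v \<Rightarrow> 'b \<Rightarrow> 'b \<Rightarrow> 'b \<Rightarrow> 'b) list" and s u w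
      have id_endo: "endo X (\<lambda>v x. x)" by (simp add: endo_def)
      have F: "hom X (F ds s) \<and> (ds \<noteq> [] \<longrightarrow> endo X (F ds s))" if "?ok ds" "s \<in> S" for ds s
        using that(1)
      proof (induction ds)
        case Nil
        show ?case using hom_const[OF that(2)] by (simp add: F_def[abs_def])
      next
        case (Cons d ds)
        have "endo X (\<lambda>u w. d u w (F ds s u w) (M u w))"
          using endo_absorbs[of X d "\<lambda>v x. x" M "F ds s"] id_endo M(1) Cons by simp
        thus ?case using endo_hom[OF ac, of "F (d # ds) s"] by (simp add: F_def[abs_def])
      qed
      have WX: "W ds x' c \<in> X v" if "?ok ds" "x' \<in> X v" "c \<in> X v" for ds x' c
        using that(1)
      proof (induction ds)
        case (Cons d ds)
        have "c \<in> X v \<Longrightarrow> c \<in> A v" for c using ac v unfolding arc_consistent_def by blast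
        moreover have "M v x' \<in> X v" using M(1) v \<open>x' \<in> X v\<close> by (auto simp: endo_def)
        moreover have "W ds x' c \<in> X v" using Cons by simp
        ultimately have "d v x' (W ds x' c) (M v x') \<in> X v"
          using absorbs_closed[of X d v x' "W ds x' c" "M v x'"] v Cons.prems \<open>x' \<in> X v\<close> by simp
        thus ?case by (simp add: W_def)
      qed (use that in \<open>simp add: W_def\<close>)
      have W_append: "W (ds @ es) x' c = W ds x' (W es x' c)" for ds es x' c by (simp add: W_def)
      have W_pow: "(W ds x' ^^ k) c = W (concat (replicate k ds)) x' c" for ds x' k c
        by (induction k) (simp_all add: W_append, simp add: W_def)
      \<comment> \<open>For idempotent powers \<open>U x'\<close>, the map sending \<open>x'\<close>
        to \<open>U x' z\<close> is a bijection, so each \<open>z\<close> is fixed by exactly one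
        \<open>U x'\<close>, whose index is \<open>g z\<close>. The map \<open>g\<close> is onto and
        therefore injective. All values of \<open>U x\<close> have the same image \<open>x\<close>
        under \<open>g\<close>, so \<open>U x\<close> is constant.\<close>
      have const: "\<exists>k>0. \<forall>c\<in>X v. \<forall>c'\<in>X v. (W ds x ^^ k) c = (W ds x ^^ k) c'" if ds: "?ok ds" "ds \<noteq> []" for ds
      proof -
        have "finite (X v) \<and> W ds x' ` X v \<subseteq> X v" if "x' \<in> X v" for x'
          using finX[OF ac v] WX[OF ds(1) that] by blast
        from common_idempotent_power[where I="X v" and X="\<lambda>_. X v" and f="W ds", OF finX[OF ac v] this]
        obtain k where k: "k > 0" "\<forall>x'\<in>X v. \<forall>c\<in>X v. (W ds x' ^^ k) ((W ds x' ^^ k) c) = (W ds x' ^^ k) c" by auto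
        define U where "U x' = W ds x' ^^ k" for x'
        have UX: "U x' c \<in> X v" if "x' \<in> X v" "c \<in> X v" for x' c
          using WX[of "concat (replicate k ds)"] ds that by (auto simp: U_def W_pow)
        have Uinj: "inj_on (\<lambda>x'. U x' c) (X v)" if c: "c \<in> X v" for c
        proof -
          obtain s where s: "s \<in> S" "s v = c" using c ac v unfolding arc_consistent_def A_def by blast
          have "endo X (F (concat (replicate k ds)) s)" using F[of "concat (replicate k ds)" s] ds s k(1) by auto
          from inj[OF this v] show ?thesis using s by (simp add: U_def W_pow W_def F_def[abs_def])
        qed
        have ex: "\<exists>!x'. x' \<in> X v \<and> U x' z = z" if z: "z \<in> X v" for z
        proof -
          have "(\<lambda>x'. U x' z) ` X v = X v"
            using Uinj[OF z] UX z finX[OF ac v] by (intro endo_inj_surj) auto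
          then obtain x' where "x' \<in> X v" "U x' z = z" using z by (metis imageE)
          thus ?thesis using Uinj[OF z] unfolding inj_on_def by metis
        qed
        define g where "g z = (THE x'. x' \<in> X v \<and> U x' z = z)" for z
        have g: "g z = x'" if "x' \<in> X v" "z \<in> X v" "U x' z = z" for x' z
          unfolding g_def using ex[OF that(2)] that by (intro the1_equality) auto
        have gU: "g (U x' c) = x'" if "x' \<in> X v" "c \<in> X v" for x' c
          using k(2) UX[OF that] that by (intro g) (auto simp: U_def)
        have gX: "g ` X v = X v"
        proof
          show "g ` X v \<subseteq> X v"
          proof
            fix w assume "w \<in> g ` X v"
            then obtain z where z: "z \<in> X v" "w = g z" by blast
            from ex[OF z(1)] obtain x' where "x' \<in> X v" "U x' z = z" by blast
            thus "w \<in> X v" using g z by simp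
          qed
          show "X v \<subseteq> g ` X v" using gU UX x by (metis image_eqI subsetI)
        qed
        hence "inj_on g (X v)" using finX[OF ac v] by (simp add: eq_card_imp_inj_on)
        hence "U x c = U x c'" if "c \<in> X v" "c' \<in> X v" for c c'
          using gU[OF x] UX[OF x] that unfolding inj_on_def by metis
        thus ?thesis using k(1) unfolding U_def by blast
      qed
      \<comment> \<open>If every further operation merged \<open>x\<close> and \<open>y\<close>,
        then \<open>W ds x\<close> would be constant along the path of links that joins
        them.\<close>
      have ext: "\<exists>d. absorbs X d \<and> W (ds @ [d]) x x \<noteq> W (ds @ [d]) x y" if ds: "W ds x x \<noteq> W ds x y" for ds
      proof (rule ccontr)
        assume no: "\<not> ?thesis"
        have "(x, y) \<in> (links X v x y)\<^sup>*" using X v x y unfolding linked_def by blast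
        hence "W ds x x = W ds x y"
        proof (induction rule: rtrancl_induct)
          case (step a b)
          then obtain d where d: "absorbs X d" "a = d v x x y" "b = d v x y y" by (auto simp: links_def)
          have "W (ds @ [d]) x x = W (ds @ [d]) x y" using no d(1) by blast
          hence "W ds x a = W ds x b" using d M(2) by (simp add: W_def)
          thus ?case using step.IH by simp
        qed simp
        thus False using ds by blast
      qed
      \<comment> \<open>An endless sequence that always separates \<open>x\<close> from
        \<open>y\<close>. Only finitely many maps exist, so two prefixes act alike, and the
        operations \<open>es\<close> between them may be inserted any number of times. By
        \<open>const\<close> some number of repetitions is a constant map, which contradicts
        separation.\<close>
      define sq where "sq = rec_nat [] (\<lambda>_ ds. ds @ [SOME d. absorbs X d \<and> W (ds @ [d]) x x \<noteq> W (ds @ [d]) x y])"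
      have sq_Suc: "sq (Suc n) = sq n @ [SOME d. absorbs X d \<and> W (sq n @ [d]) x x \<noteq> W (sq n @ [d]) x y]" for n
        by (simp add: sq_def)
      have sq: "?ok (sq n) \<and> W (sq n) x x \<noteq> W (sq n) x y" for n
      proof (induction n)
        case 0
        show ?case using ne by (simp add: sq_def W_def)
      next
        case (Suc n)
        from someI_ex[OF ext[of "sq n"]] Suc show ?case unfolding sq_Suc by auto
      qed
      have sq_prefix: "\<exists>es. sq (n + m) = sq n @ es \<and> length es = m" for n m
        by (induction m) (auto simp: sq_Suc)
      let ?g = "\<lambda>n. restrict (W (sq n) x) (X v)"
      have "range ?g \<subseteq> (X v \<rightarrow>\<^sub>E X v)" using WX sq x by auto
      moreover have "finite (X v \<rightarrow>\<^sub>E X v)" using finX[OF ac v] by (intro finite_PiE) auto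
      ultimately have "finite (range ?g)" by (rule finite_subset)
      hence "\<not> inj ?g" using infinite_UNIV_nat finite_imageD by blast
      then obtain i j where ij: "i < j" "?g i = ?g j" unfolding inj_on_def by (metis linorder_neqE_nat)
      obtain es where "sq (i + (j - i)) = sq i @ es" "length es = j - i" using sq_prefix by blast
      hence es: "sq j = sq i @ es" "es \<noteq> []" using ij(1) by auto
      have eq: "W (sq i) x c = W (sq i) x (W es x c)" if "c \<in> X v" for c
        using fun_cong[OF ij(2), of c] that es by (simp add: W_append)
      have okes: "?ok es" using sq[of j] es by auto
      have eqk: "W (sq i) x c = W (sq i) x ((W es x ^^ k) c)" if "c \<in> X v" for c k
      proof (induction k)
        case (Suc k)
        have "(W es x ^^ k) c \<in> X v" using WX[OF okes x] that by (intro funpow_in) auto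
        thus ?case using Suc eq by simp
      qed simp
      obtain k where "\<forall>c\<in>X v. \<forall>c'\<in>X v. (W es x ^^ k) c = (W es x ^^ k) c'" using const[OF okes es(2)] by blast
      hence "W (sq i) x x = W (sq i) x y" using eqk[OF x, of k] eqk[OF y, of k] x y by metis
      thus False using sq by blast
    qed
    have "\<forall>v\<in>V. \<exists>x. x \<in> X v" using ac unfolding arc_consistent_def by blast
    then obtain s where s: "\<forall>v\<in>V. s v \<in> X v" by (rule bchoice[THEN exE])
    have "(s u, s v) \<in> R u v" if uv: "u \<in> V" "v \<in> V" for u v
    proof -
      obtain y where "y \<in> X v" "(s u, y) \<in> R u v" using ac uv s unfolding arc_consistent_def by blast
      thus ?thesis using single[OF uv(2)] s uv by metis
    qed
    thus ?thesis using s by blast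
  qed
qed

lemma R_closed:
  assumes "\<And>s1 s2 s3. s1 \<in> S \<Longrightarrow> s2 \<in> S \<Longrightarrow> s3 \<in> S \<Longrightarrow> \<exists>s\<in>S. \<forall>v\<in>V. s v = d (s1 v) (s2 v) (s3 v)"
    and "u \<in> V" "v \<in> V" "(x, x') \<in> R u v" "(y, y') \<in> R u v" "(z, z') \<in> R u v"
  shows "(d x y z, d x' y' z') \<in> R u v"
proof -
  obtain s1 s2 s3 where s: "s1 \<in> S" "s2 \<in> S" "s3 \<in> S" "x = s1 u" "x' = s1 v" "y = s2 u" "y' = s2 v" "z = s3 u" "z' = s3 v"
    using assms(4-6) by (auto simp: R_def)
  from assms(1)[OF s(1-3)] obtain t where t: "t \<in> S" "\<forall>v\<in>V. t v = d (s1 v) (s2 v) (s3 v)" by blast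
  have "(d x y z, d x' y' z') = (t u, t v)" using t(2) s(4-9) assms(2,3) by simp
  thus ?thesis unfolding R_def using t(1) by (rule image_eqI)
qed

end

section \<open>Absorption constraints and the size of minimal derivations\<close>

text \<open>The variables in \<open>L\<close> carry an additional demand \<open>s w \<in> P\<close>.
  Members of \<open>S\<close> need not meet all demands at once; \<open>small\<close> guarantees it
  only for fewer demands than the bound that comes out of \<open>derivable_bound\<close>.\<close>

locale absorbing_csp = csp V S for V :: "'v set" and S :: "('v \<Rightarrow> 'b) set" +
  fixes L :: "'v set" and P :: "'b set" and Ops :: "('b \<Rightarrow> 'b \<Rightarrow> 'b \<Rightarrow> 'b) set" and U :: "'b set"
  assumes L: "L \<subseteq> V"
    and ops: "\<And>d s1 s2 s3. d \<in> Ops \<Longrightarrow> s1 \<in> S \<Longrightarrow> s2 \<in> S \<Longrightarrow> s3 \<in> S \<Longrightarrow>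
        \<exists>s\<in>S. \<forall>v\<in>V. s v = d (s1 v) (s2 v) (s3 v)"
    and ops_P: "\<And>d w x y z. d \<in> Ops \<Longrightarrow> w \<in> L \<Longrightarrow> x \<in> A w \<inter> P \<Longrightarrow> y \<in> A w \<Longrightarrow> z \<in> A w \<inter> P \<Longrightarrow> d x y z \<in> P"
    and chain: "\<And>v x y. v \<in> V \<Longrightarrow> x \<in> A v \<Longrightarrow> y \<in> A v \<Longrightarrow> (x, y) \<in> {(d x x y, d x y y) | d. d \<in> Ops}\<^sup>*"
    and U: "finite U" "\<And>v. v \<in> V \<Longrightarrow> A v \<subseteq> U"
    and small: "\<And>W. W \<subseteq> L \<Longrightarrow> finite W \<Longrightarrow> card W < 2 ^ Suc (card (Pow U \<times> Pow U)) \<Longrightarrow> \<exists>s\<in>S. \<forall>w\<in>W. s w \<in> P"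
begin

text \<open>The number counts how often a constraint \<open>s w \<in> P\<close> is used.\<close>

inductive derivable :: "nat \<Rightarrow> 'v \<Rightarrow> 'b set \<Rightarrow> bool" where
  all: "v \<in> V \<Longrightarrow> derivable 0 v (A v)"
| leaf: "w \<in> L \<Longrightarrow> derivable 1 w (A w \<inter> P)"
| edge: "derivable c u F \<Longrightarrow> v \<in> V \<Longrightarrow> derivable c v (R u v `` F)"
| inter: "derivable c v F \<Longrightarrow> derivable c' v F' \<Longrightarrow> derivable (c + c') v (F \<inter> F')"

lemma derivable_sub: "derivable c v F \<Longrightarrow> v \<in> V \<and> F \<subseteq> A v"
proof (induction rule: derivable.induct)
  case (leaf w)
  thus ?case using L by blast
next
  case (edge c u F v)
  thus ?case using R_A by blast
qed auto

lemma ops_A: "d \<in> Ops \<Longrightarrow> v \<in> V \<Longrightarrow> x \<in> A v \<Longrightarrow> y \<in> A v \<Longrightarrow> z \<in> A v \<Longrightarrow> d x y z \<in> A v"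
proof -
  assume h: "d \<in> Ops" "v \<in> V" "x \<in> A v" "y \<in> A v" "z \<in> A v"
  then obtain s1 s2 s3 where s: "s1 \<in> S" "s2 \<in> S" "s3 \<in> S" "x = s1 v" "y = s2 v" "z = s3 v" by (auto simp: A_def)
  from ops[OF h(1) s(1-3)] obtain t where t: "t \<in> S" "\<forall>v\<in>V. t v = d (s1 v) (s2 v) (s3 v)" by blast
  have "d x y z = t v" using t(2) s(4-6) h(2) by simp
  thus ?thesis unfolding A_def using t(1) by (rule image_eqI)
qed

lemma ops_R:
  assumes "d \<in> Ops" "u \<in> V" "v \<in> V" "(x, x') \<in> R u v" "(y, y') \<in> R u v" "(z, z') \<in> R u v"
  shows "(d x y z, d x' y' z') \<in> R u v"
  by (rule R_closed[where d = d, OF ops[OF assms(1)] assms(2-6)])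

lemma derivable_absorbs:
  "derivable c v F \<Longrightarrow> d \<in> Ops \<Longrightarrow> x \<in> F \<Longrightarrow> y \<in> A v \<Longrightarrow> z \<in> F \<Longrightarrow> d x y z \<in> F"
proof (induction arbitrary: x y z rule: derivable.induct)
  case (all v)
  show ?case using ops_A[OF all.prems(1) all.hyps all.prems(2-4)] .
next
  case (leaf w)
  have "w \<in> V" using L leaf.hyps by blast
  moreover have "x \<in> A w" "z \<in> A w" using leaf.prems by simp_all
  ultimately show ?case using ops_A[of d w x y z] ops_P[OF leaf.prems(1) leaf.hyps leaf.prems(2-4)] leaf.prems by simp
next
  case (edge c u F v)
  obtain x0 z0 where xz: "x0 \<in> F" "(x0, x) \<in> R u v" "z0 \<in> F" "(z0, z) \<in> R u v" using edge.prems by blast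
  obtain s where "s \<in> S" "y = s v" using edge.prems by (auto simp: A_def)
  hence y: "(s u, y) \<in> R u v" by (auto simp: R_def)
  have "u \<in> V" using derivable_sub edge by blast
  hence "(d x0 (s u) z0, d x y z) \<in> R u v" using ops_R[OF edge.prems(1) _ edge.hyps(2) xz(2) y xz(4)] by blast
  moreover have "d x0 (s u) z0 \<in> F" using edge.IH edge.prems(1) xz R_A[OF y] by blast
  ultimately show ?case by blast
next
  case (inter c v F c' F')
  show ?case using inter.IH(1)[OF inter.prems(1) _ inter.prems(3)] inter.IH(2)[OF inter.prems(1) _ inter.prems(3)] inter.prems
    by simp
qed

text \<open>The variables at the leaves of the derivation form \<open>W\<close>, which is why
  counting leaves with multiplicity bounds the number of demands involved.\<close>

lemma derivable_satisfied:
  "derivable c v F \<Longrightarrow> \<exists>W\<subseteq>L. finite W \<and> card W \<le> c \<and> (\<forall>s\<in>S. (\<forall>w\<in>W. s w \<in> P) \<longrightarrow> s v \<in> F)"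
proof (induction rule: derivable.induct)
  case (all v)
  show ?case by (intro exI[of _ "{}"]) (auto simp: A_def)
next
  case (leaf w)
  thus ?case by (intro exI[of _ "{w}"]) (auto simp: A_def)
next
  case (edge c u F v)
  then obtain W where W: "W \<subseteq> L" "finite W" "card W \<le> c" "\<forall>s\<in>S. (\<forall>w\<in>W. s w \<in> P) \<longrightarrow> s u \<in> F" by blast
  have "s v \<in> R u v `` F" if "s \<in> S" "s u \<in> F" for s
    using that by (intro ImageI[of "s u"]) (auto simp: R_def)
  thus ?case using W by (intro exI[of _ W]) simp
next
  case (inter c v F c' F')
  then obtain W W' where W: "W \<subseteq> L" "finite W" "card W \<le> c" "\<forall>s\<in>S. (\<forall>w\<in>W. s w \<in> P) \<longrightarrow> s v \<in> F"
    and W': "W' \<subseteq> L" "finite W'" "card W' \<le> c'" "\<forall>s\<in>S. (\<forall>w\<in>W'. s w \<in> P) \<longrightarrow> s v \<in> F'" by blast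
  have "card (W \<union> W') \<le> c + c'" using card_Un_le[of W W'] W(3) W'(3) by linarith
  thus ?case using W(1,2,4) W'(1,2,4) by (intro exI[of _ "W \<union> W'"]) simp
qed

text \<open>Absorption between relations: \<open>H\<close> absorbs \<open>K\<close>, which in the
  applications relaxes \<open>H\<close> at one place.\<close>

definition compatible :: "('b \<times> 'b) set \<Rightarrow> ('b \<times> 'b) set \<Rightarrow> bool" where
  "compatible H K \<longleftrightarrow> (\<forall>d\<in>Ops. \<forall>x x' y y' z z'. (x, x') \<in> H \<longrightarrow> (y, y') \<in> K \<longrightarrow> (z, z') \<in> H \<longrightarrow> (d x y z, d x' y' z') \<in> H)"

lemma compatibleD:
  "compatible H K \<Longrightarrow> d \<in> Ops \<Longrightarrow> (x, x') \<in> H \<Longrightarrow> (y, y') \<in> K \<Longrightarrow> (z, z') \<in> H \<Longrightarrow> (d x y z, d x' y' z') \<in> H"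
  unfolding compatible_def by blast

lemma compatible_comp:
  assumes "compatible H K" "compatible H' K'" shows "compatible (H O H') (K O K')"
  unfolding compatible_def
proof (intro ballI allI impI)
  fix d x x' y y' z z'
  assume d: "d \<in> Ops" "(x, x') \<in> H O H'" "(y, y') \<in> K O K'" "(z, z') \<in> H O H'"
  obtain x1 y1 z1 where 1: "(x, x1) \<in> H" "(x1, x') \<in> H'" "(y, y1) \<in> K" "(y1, y') \<in> K'" "(z, z1) \<in> H" "(z1, z') \<in> H'"
    using d by blast
  show "(d x y z, d x' y' z') \<in> H O H'"
    using compatibleD[OF assms(1) d(1) 1(1,3,5)] compatibleD[OF assms(2) d(1) 1(2,4,6)] by blast
qed

lemma compatible_pow: "compatible H H \<Longrightarrow> compatible (H ^^ n) (H ^^ n)"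
proof (induction n)
  case 0
  show ?case by (simp add: compatible_def)
next
  case (Suc n)
  thus ?case using compatible_comp[of "H ^^ n" "H ^^ n" H H] by simp
qed

text \<open>\<open>weak_segment F G F' G'\<close>: a relation \<open>H\<close> leads from a lower to a higher node of a derivation; \<open>F\<close> is the set derived below,
  \<open>G\<close> the set of values compatible with everything derived elsewhere. In a \<open>segment\<close>, dropping one of the side
  branches on the way relaxes \<open>H\<close> to a relation \<open>K\<close> that connects \<open>F\<close> and \<open>G'\<close>.\<close>

definition weak_segment :: "'b set \<Rightarrow> 'b set \<Rightarrow> 'b set \<Rightarrow> 'b set \<Rightarrow> bool" where
  "weak_segment F G F' G' \<longleftrightarrow> (\<exists>H. F' = H `` F \<and> G = H\<inverse> `` G' \<and> compatible H H)"

definition segment :: "'b set \<Rightarrow> 'b set \<Rightarrow> 'b set \<Rightarrow> 'b set \<Rightarrow> bool" where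
  "segment F G F' G' \<longleftrightarrow> (\<exists>H K. F' = H `` F \<and> G = H\<inverse> `` G' \<and> compatible H H \<and> compatible H K \<and>
     (\<exists>f\<in>F. \<exists>g\<in>G'. (f, g) \<in> K))"

lemma weak_segment_segment:
  assumes "weak_segment F G F1 G1" "segment F1 G1 F2 G2"
  shows "segment F G F2 G2"
proof -
  obtain H where H: "F1 = H `` F" "G = H\<inverse> `` G1" "compatible H H" using assms(1) by (auto simp: weak_segment_def)
  obtain H' K f g where H': "F2 = H' `` F1" "G1 = H'\<inverse> `` G2" "compatible H' H'" "compatible H' K"
    "f \<in> F1" "g \<in> G2" "(f, g) \<in> K" using assms(2) unfolding segment_def by blast
  have "F2 = (H O H') `` F" "G = (H O H')\<inverse> `` G2" using H H' by (simp_all add: relcomp_Image converse_relcomp)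
  moreover have "\<exists>f\<in>F. \<exists>g\<in>G2. (f, g) \<in> H O K" using H(1) H'(5-7) by blast
  ultimately show ?thesis unfolding segment_def
    using compatible_comp[OF H(3) H'(3)] compatible_comp[OF H(3) H'(4)]
    by (intro exI[of _ "H O H'"] exI[of _ "H O K"] conjI)
qed

text \<open>If a segment returned to its starting state, \<open>F\<close> and \<open>G\<close> would
  both be invariant, so there are a loop at some \<open>f0\<close> in \<open>F\<close> and a loop at
  some \<open>g0\<close> in \<open>G\<close>, with a relaxed connection from \<open>f0\<close> to
  \<open>g0\<close>. Absorption turns the chain from \<open>f0\<close> to \<open>g0\<close> into
  steps of a power of \<open>H\<close>, and \<open>F\<close>, being closed under \<open>H\<close>,
  would contain \<open>g0\<close>.\<close>

lemma segment_irrefl: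
  assumes v: "v \<in> V" and FG: "F \<subseteq> A v" "G \<subseteq> A v" "F \<inter> G = {}"
  shows "\<not> segment F G F G"
proof
  assume "segment F G F G"
  then obtain H K f g where H: "F = H `` F" "G = H\<inverse> `` G" "compatible H H" "compatible H K" "f \<in> F" "g \<in> G" "(f, g) \<in> K"
    unfolding segment_def by blast
  have "\<forall>x\<in>F. \<exists>y. y \<in> F \<and> (y, x) \<in> H" using H(1) by blast
  then obtain p where p: "\<forall>x\<in>F. p x \<in> F \<and> (p x, x) \<in> H" by (rule bchoice[THEN exE])
  have "\<forall>x\<in>G. \<exists>y. y \<in> G \<and> (x, y) \<in> H" using H(2) by blast
  then obtain q where q: "\<forall>x\<in>G. q x \<in> G \<and> (x, q x) \<in> H" by (rule bchoice[THEN exE])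
  have fin: "finite F" "finite G" using FG U finite_subset v by (meson order.trans)+
  have "finite (if i then F else G) \<and> (if i then p else q) ` (if i then F else G) \<subseteq> (if i then F else G)" for i
    using fin p q by auto
  with common_idempotent_power[of "UNIV :: bool set" "\<lambda>i. if i then F else G" "\<lambda>i. if i then p else q"]
  obtain k where k: "k > 0" "\<forall>i\<in>UNIV. \<forall>x\<in>(if i then F else G).
    ((if i then p else q) ^^ k) (((if i then p else q) ^^ k) x) = ((if i then p else q) ^^ k) x" by auto
  have kp: "(p ^^ k) ((p ^^ k) x) = (p ^^ k) x" if "x \<in> F" for x
    using k(2)[rule_format, of True x] that by simp
  have kq: "(q ^^ k) ((q ^^ k) x) = (q ^^ k) x" if "x \<in> G" for x
    using k(2)[rule_format, of False x] that by simp
  have pF: "((p ^^ n) x, x) \<in> H ^^ n \<and> (p ^^ n) x \<in> F" if "x \<in> F" for n x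
    using relpow_choice_conv[of F p H x n] p that by blast
  have qG: "(x, (q ^^ n) x) \<in> H ^^ n \<and> (q ^^ n) x \<in> G" if "x \<in> G" for n x
    using relpow_choice[of G q H x n] q that by blast
  define f1 where "f1 = (p ^^ (k - 1)) f"
  define f0 where "f0 = (p ^^ k) f1"
  define g0 where "g0 = (q ^^ k) g"
  have f1: "(f1, f) \<in> H ^^ (k - 1)" "f1 \<in> F" using pF[OF H(5)] by (auto simp: f1_def)
  have f0: "(f0, f1) \<in> H ^^ k" "f0 \<in> F" "(f0, f0) \<in> H ^^ k"
    using pF[OF f1(2), of k] pF[of f0 k] kp[OF f1(2)] by (auto simp: f0_def)
  have g0: "(g, g0) \<in> H ^^ k" "g0 \<in> G" "(g0, g0) \<in> H ^^ k"
    using qG[OF H(6), of k] qG[of g0 k] kq[OF H(6)] by (auto simp: g0_def)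
  \<comment> \<open>A path of length \<open>3 * k\<close> with the single relaxed step
    \<open>K\<close> from \<open>f\<close> to \<open>g\<close>. Starting \<open>k - 1\<close> steps
    before \<open>f\<close> makes the length a multiple of the loop length.\<close>
  define Q where "Q = H ^^ k O H ^^ (k - 1) O K O H ^^ k"
  have "H ^^ (k * 3) = H ^^ (k + ((k - 1) + (1 + k)))" using k(1) by (intro arg_cong[where f="\<lambda>n. H ^^ n"]) simp
  also have "\<dots> = H ^^ k O H ^^ (k - 1) O H O H ^^ k" by (simp only: relpow_add relpow_1 O_assoc)
  finally have pw: "H ^^ (k * 3) = H ^^ k O H ^^ (k - 1) O H O H ^^ k" .
  have comp: "compatible (H ^^ (k * 3)) Q" unfolding pw Q_def
    by (intro compatible_comp compatible_pow H(3,4))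
  have "(f0, g0) \<in> Q" unfolding Q_def using f0(1) f1(1) H(7) g0(1) by blast
  moreover have "(f0, f0) \<in> H ^^ (k * 3)" "(g0, g0) \<in> H ^^ (k * 3)" by (rule relpow_mult_loop[OF f0(3)], rule relpow_mult_loop[OF g0(3)])
  ultimately have "{(d f0 f0 g0, d f0 g0 g0) | d. d \<in> Ops} \<subseteq> H ^^ (k * 3)" using compatibleD[OF comp] by blast
  moreover have "(f0, g0) \<in> {(d f0 f0 g0, d f0 g0 g0) | d. d \<in> Ops}\<^sup>*" using chain[OF v] f0(2) g0(2) FG by blast
  ultimately have "(f0, g0) \<in> (H ^^ (k * 3))\<^sup>*" by (meson rtrancl_mono subsetD)
  moreover have "(H ^^ n) `` F = F" for n by (induction n) (simp_all add: relcomp_Image H(1)[symmetric])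
  ultimately have "g0 \<in> F" using f0(2) by (induction rule: rtrancl_induct) blast+
  thus False using g0(2) FG(3) by blast
qed

abbreviation "states \<equiv> Pow U \<times> Pow U"

text \<open>The derivation is assumed to have the fewest leaves among those whose set misses
  \<open>G\<close>. \<open>Q\<close> records the states met at intersections between the current
  node and the root; by \<open>segment_irrefl\<close> they never repeat, so there are at most
  \<open>card states\<close> of them. Descending into the branch with more leaves loses at most a
  factor of two at each recorded intersection.\<close>

lemma derivable_bound:
  "derivable c v F \<Longrightarrow> G \<subseteq> A v \<Longrightarrow> F \<inter> G = {} \<Longrightarrow> (\<And>c' F'. c' < c \<Longrightarrow> derivable c' v F' \<Longrightarrow> F' \<inter> G \<noteq> {}) \<Longrightarrow>
   Q \<subseteq> states \<Longrightarrow> (\<And>F' G'. (F', G') \<in> Q \<Longrightarrow> segment F G F' G') \<Longrightarrow> c < 2 ^ (Suc (card states) - card Q)"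
proof (induction arbitrary: G Q rule: derivable.induct)
  case (all v)
  show ?case by simp
next
  case (leaf w)
  have Q: "card Q \<le> card states" using leaf.prems(4) U(1) by (intro card_mono) auto
  have "(1 :: nat) \<le> 2 ^ (card states - card Q)" by simp
  hence "1 < 2 * (2 :: nat) ^ (card states - card Q)" by linarith
  thus ?case by (simp only: Suc_diff_le[OF Q] power_Suc)
next
  case (edge c u F v)
  have u: "u \<in> V" using derivable_sub edge.hyps by blast
  have "compatible (R u v) (R u v)"
    unfolding compatible_def by (intro ballI allI impI) (rule ops_R[OF _ u edge.hyps(2)])
  hence ws: "weak_segment F ((R u v)\<inverse> `` G) (R u v `` F) G" unfolding weak_segment_def by blast
  show ?case
  proof (rule edge.IH)
    show "(R u v)\<inverse> `` G \<subseteq> A u" using R_A by blast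
    show "F \<inter> (R u v)\<inverse> `` G = {}" using edge.prems(2) by blast
    show "F' \<inter> (R u v)\<inverse> `` G \<noteq> {}" if "c' < c" "derivable c' u F'" for c' F'
      using edge.prems(3)[OF that(1) derivable.edge[OF that(2) edge.hyps(2)]] by blast
    show "Q \<subseteq> states" by fact
    show "segment F ((R u v)\<inverse> `` G) F' G'" if "(F', G') \<in> Q" for F' G'
      using weak_segment_segment[OF ws edge.prems(5)[OF that]] .
  qed
next
  case (inter c1 v F1 c2 F2)
  have step: "c1 + c2 < 2 ^ (Suc (card states) - card Q)"
    if D: "derivable c1 v F1" "derivable c2 v F2" and le: "c2 \<le> c1" and dis: "(F1 \<inter> F2) \<inter> G = {}"
      and min: "\<And>c' F'. c' < c1 + c2 \<Longrightarrow> derivable c' v F' \<Longrightarrow> F' \<inter> G \<noteq> {}"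
      and seg: "\<And>F' G'. (F', G') \<in> Q \<Longrightarrow> segment (F1 \<inter> F2) G F' G'"
      and IH: "\<And>G Q. G \<subseteq> A v \<Longrightarrow> F1 \<inter> G = {} \<Longrightarrow> (\<And>c' F'. c' < c1 \<Longrightarrow> derivable c' v F' \<Longrightarrow> F' \<inter> G \<noteq> {}) \<Longrightarrow>
         Q \<subseteq> states \<Longrightarrow> (\<And>F' G'. (F', G') \<in> Q \<Longrightarrow> segment F1 G F' G') \<Longrightarrow> c1 < 2 ^ (Suc (card states) - card Q)"
    for c1 c2 F1 F2
  proof -
    have F1: "v \<in> V" "F1 \<subseteq> A v" and F2: "F2 \<subseteq> A v" using derivable_sub D by blast+
    have "compatible (Id_on F2) (Id_on Y)" if Y: "Y \<subseteq> A v" for Y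
      unfolding compatible_def
    proof (intro ballI allI impI)
      fix d x x' y y' z z'
      assume h: "d \<in> Ops" "(x, x') \<in> Id_on F2" "(y, y') \<in> Id_on Y" "(z, z') \<in> Id_on F2"
      hence eq: "x' = x" "y' = y" "z' = z" "x \<in> F2" "y \<in> A v" "z \<in> F2" using Y by auto
      thus "(d x y z, d x' y' z') \<in> Id_on F2" using derivable_absorbs[OF D(2) h(1) eq(4-6)] by (simp add: Id_on_iff)
    qed
    hence c: "compatible (Id_on F2) (Id_on F2)" "compatible (Id_on F2) (Id_on (A v))" using F2 by simp_all
    have ws: "weak_segment F1 (G \<inter> F2) (F1 \<inter> F2) G" unfolding weak_segment_def
      using c(1) by (intro exI[of _ "Id_on F2"] conjI) (blast, blast, assumption)
    have min1: "F' \<inter> (G \<inter> F2) \<noteq> {}" if h: "c' < c1" "derivable c' v F'" for c' F'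
    proof -
      have "(F' \<inter> F2) \<inter> G \<noteq> {}"
        by (rule min[OF _ derivable.inter[OF h(2) D(2)]]) (use h(1) in simp)
      thus ?thesis by (simp add: Int_ac)
    qed
    have seg1: "segment F1 (G \<inter> F2) F' G'" if "(F', G') \<in> Q" for F' G'
      using weak_segment_segment[OF ws seg[OF that]] .
    have G1: "G \<inter> F2 \<subseteq> A v" "F1 \<inter> (G \<inter> F2) = {}" using F2 dis by blast+
    show ?thesis
    proof (cases "c2 = 0")
      \<comment> \<open>A branch without leaves adds nothing to the count, and dropping it saves
        nothing, so minimality gives no relaxed connection and no state is recorded.\<close>
      case True
      have "c1 < 2 ^ (Suc (card states) - card Q)"
        by (rule IH[OF G1]) (rule min1, assumption+, rule inter.prems(4), rule seg1)
      thus ?thesis using True by simp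
    next
      case False
      hence "F1 \<inter> G \<noteq> {}" by (intro min[OF _ D(1)]) simp
      \<comment> \<open>Dropping \<open>F2\<close> saves leaves, so by minimality \<open>F1\<close>
        alone still meets \<open>G\<close>. Relaxing the restriction to \<open>F2\<close> to the
        identity on \<open>A v\<close> is the connection that a segment asks for.\<close>
      hence "\<exists>f\<in>F1. \<exists>g\<in>G. (f, g) \<in> Id_on (A v)" using F1(2) by blast
      hence sg: "segment F1 (G \<inter> F2) (F1 \<inter> F2) G" unfolding segment_def using c
        by (intro exI[of _ "Id_on F2"] exI[of _ "Id_on (A v)"] conjI) (blast, blast, assumption+)
      have st: "(F1 \<inter> F2, G) \<in> states" using F1 F2 inter.prems(1) U(2)[OF F1(1)] by blast
      have fin: "finite states" using U(1) by simp
      have "F1 \<inter> F2 \<subseteq> A v" using F1(2) by blast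
      hence notin: "(F1 \<inter> F2, G) \<notin> Q"
        using seg[of "F1 \<inter> F2" G] segment_irrefl[OF F1(1) _ inter.prems(1) dis] by blast
      have "finite Q" using fin inter.prems(4) finite_subset by blast
      hence card: "card (insert (F1 \<inter> F2, G) Q) = Suc (card Q)" using notin by simp
      have "insert (F1 \<inter> F2, G) Q \<subseteq> states" using st inter.prems(4) by blast
      hence "Suc (card Q) \<le> card states" using card fin by (metis card_mono)
      have "c1 < 2 ^ (Suc (card states) - card (insert (F1 \<inter> F2, G) Q))"
      proof (rule IH[OF G1])
        show "F' \<inter> (G \<inter> F2) \<noteq> {}" if "c' < c1" "derivable c' v F'" for c' F' using that by (rule min1)
        show "insert (F1 \<inter> F2, G) Q \<subseteq> states" by fact
        show "segment F1 (G \<inter> F2) F' G'" if "(F', G') \<in> insert (F1 \<inter> F2, G) Q" for F' G'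
          using that sg seg1[of F' G'] by auto
      qed
      hence "c1 < 2 ^ (card states - card Q)" using card by simp
      hence "c1 + c2 < 2 * 2 ^ (card states - card Q)" using le by linarith
      thus ?thesis using \<open>Suc (card Q) \<le> card states\<close> by (simp add: Suc_diff_le)
    qed
  qed
  show ?case
  proof (cases "c2 \<le> c1")
    case True
    show ?thesis
    proof (rule step[OF inter.hyps True])
      show "F' \<inter> G \<noteq> {}" if "c' < c1 + c2" "derivable c' v F'" for c' F' using that by (rule inter.prems(3))
      show "segment (F1 \<inter> F2) G F' G'" if "(F', G') \<in> Q" for F' G' using that by (rule inter.prems(5))
    qed (fact inter.prems inter.IH(1))+
  next
    case False
    have "c2 + c1 < 2 ^ (Suc (card states) - card Q)"
    proof (rule step[OF inter.hyps(2,1)])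
      show "c1 \<le> c2" using False by simp
      show "F2 \<inter> F1 \<inter> G = {}" using inter.prems(2) by (simp add: Int_commute)
      show "F' \<inter> G \<noteq> {}" if "c' < c2 + c1" "derivable c' v F'" for c' F'
        using inter.prems(3)[of c' F'] that by (simp add: add.commute)
      show "segment (F2 \<inter> F1) G F' G'" if "(F', G') \<in> Q" for F' G'
        using inter.prems(5)[OF that] by (simp add: Int_commute)
    qed (fact inter.IH(2))
    thus ?thesis by (simp add: add.commute)
  qed
qed

text \<open>A derivation of the empty set with the fewest leaves is minimal for
  \<open>G = A v\<close>. Its leaves are then so few that \<open>small\<close> provides a solution
  meeting them all, whose value would lie in the empty set.\<close>

lemma derivable_nonempty: "\<not> derivable c v {}"
proof
  assume "derivable c v {}"
  define c0 where "c0 = (LEAST c. \<exists>v. derivable c v {})"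
  have "\<exists>v. derivable c0 v {}" unfolding c0_def
    by (rule LeastI[of "\<lambda>c. \<exists>v. derivable c v {}" c], rule exI, fact)
  then obtain v where v: "derivable c0 v {}" by blast
  have min: "\<not> derivable c' u {}" if "c' < c0" for c' u 
    using not_less_Least[of c' "\<lambda>c. \<exists>v. derivable c v {}"] that unfolding c0_def by blast
  have "c0 < 2 ^ (Suc (card states) - card ({} :: ('b set \<times> 'b set) set))"
  proof (rule derivable_bound[OF v])
    show "A v \<subseteq> A v" "{} \<inter> A v = {}" "{} \<subseteq> states" by simp_all
    show "F' \<inter> A v \<noteq> {}" if "c' < c0" "derivable c' v F'" for c' F'
    proof -
      have "F' \<noteq> {}" using min[OF that(1), of v] that(2) by blast
      thus ?thesis using derivable_sub[OF that(2)] by blast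
    qed
  qed simp
  hence c0: "c0 < 2 ^ Suc (card states)" by simp
  from derivable_satisfied[OF v]
  obtain W where W: "W \<subseteq> L" "finite W" "card W \<le> c0" "\<forall>s\<in>S. (\<forall>w\<in>W. s w \<in> P) \<longrightarrow> s v \<in> {}" by blast
  from small[OF W(1,2) le_less_trans[OF W(3) c0]] W(4) show False by blast
qed

text \<open>The least derivable sets are nonempty, inside \<open>P\<close> on \<open>L\<close>, and
  arc consistent because propagating one of them derives another set. They are linked by the given
  chains, so \<open>linked_solution\<close> applies.\<close>

theorem absorbing_solution:
  "\<exists>s. (\<forall>u\<in>V. \<forall>v\<in>V. (s u, s v) \<in> R u v) \<and> (\<forall>w\<in>L. s w \<in> P)"
proof -
  define X where "X v = \<Inter> {F. \<exists>c. derivable c v F}" for v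
  have X: "\<exists>c. derivable c v (X v)" if v: "v \<in> V" for v
  proof -
    have inter: "\<exists>c. derivable c v (\<Inter> \<F>)" if "finite \<F>" "\<F> \<noteq> {}" "\<F> \<subseteq> {F. \<exists>c. derivable c v F}" for \<F>
      using that
    proof (induction rule: finite_ne_induct)
      case (insert F \<F>)
      then obtain c c' where "derivable c v F" "derivable c' v (\<Inter> \<F>)" by auto
      from derivable.inter[OF this] show ?case by auto
    qed auto
    have "{F. \<exists>c. derivable c v F} \<subseteq> Pow (A v)" using derivable_sub by blast
    hence "finite {F. \<exists>c. derivable c v F}" using U v by (meson finite_Pow_iff finite_subset)
    moreover have "{F. \<exists>c. derivable c v F} \<noteq> {}" using derivable.all[OF v] by blast
    ultimately show ?thesis unfolding X_def by (rule inter) simp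
  qed
  have XF: "X v \<subseteq> F" if "derivable c v F" for c v F using that unfolding X_def by blast
  have XA: "X v \<subseteq> A v" if "v \<in> V" for v using XF[OF derivable.all[OF that]] .
  have ac: "arc_consistent X"
    unfolding arc_consistent_def
  proof (intro ballI conjI)
    fix u assume u: "u \<in> V"
    obtain c where "derivable c u (X u)" using X[OF u] by blast
    thus "X u \<noteq> {}" using derivable_nonempty[of c u] by metis
    show "X u \<subseteq> A u" using XA[OF u] .
    fix v x assume v: "v \<in> V" and x: "x \<in> X u"
    obtain c where "derivable c v (X v)" using X[OF v] by blast
    from XF[OF derivable.edge[OF this u]] x have "x \<in> R v u `` X v" by blast
    thus "\<exists>y\<in>X v. (x, y) \<in> R u v" using R_sym by blast
  qed
  have abs: "absorbs X (\<lambda>v. d)" if d: "d \<in> Ops" for d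
    unfolding absorbs_def
  proof (intro conjI ballI allI impI)
    fix v x y z assume v: "v \<in> V" "x \<in> X v" "y \<in> A v" "z \<in> X v"
    obtain c where "derivable c v (X v)" using X[OF v(1)] by blast
    from derivable_absorbs[OF this d v(2-4)] show "d x y z \<in> X v" .
  next
    fix u v x x' y y' z z' assume "u \<in> V" "v \<in> V" "(x, x') \<in> R u v \<and> (y, y') \<in> R u v \<and> (z, z') \<in> R u v"
    thus "(d x y z, d x' y' z') \<in> R u v" by (intro ops_R[OF d]) simp_all
  qed
  have "(x, y) \<in> (links X v x y)\<^sup>*" if "v \<in> V" "x \<in> X v" "y \<in> X v" for v x y
  proof -
    have "(x, y) \<in> {(d x x y, d x y y) | d. d \<in> Ops}\<^sup>*"
      using that XA[OF that(1)] by (intro chain[OF that(1)]) auto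
    moreover have "{(d x x y, d x y y) | d. d \<in> Ops} \<subseteq> links X v x y"
    proof
      fix p assume "p \<in> {(d x x y, d x y y) | d. d \<in> Ops}"
      then obtain d where d: "d \<in> Ops" "p = (d x x y, d x y y)" by blast
      show "p \<in> links X v x y" unfolding links_def d(2)
        using abs[OF d(1)] by (intro CollectI exI[of _ "\<lambda>v. d"] conjI) simp_all
    qed
    ultimately show ?thesis by (meson rtrancl_mono subsetD)
  qed
  hence "linked X" using ac by (simp add: linked_def)
  from linked_solution[OF this] obtain s where s: "\<forall>v\<in>V. s v \<in> X v" "\<forall>u\<in>V. \<forall>v\<in>V. (s u, s v) \<in> R u v" by blast
  have "s w \<in> P" if "w \<in> L" for w using s(1) XF[OF derivable.leaf[OF that]] that L by blast
  thus ?thesis using s(2) by blast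
qed

end

section \<open>Local Jonsson absorption\<close>

lemma term_ops_minor:
  fixes \<A> :: "'a algebra"
  assumes "t \<in> term_ops \<A> n" "\<And>j. j < n \<Longrightarrow> \<pi> j < m"
  shows "(\<lambda>xs. t (map (\<lambda>j. xs ! \<pi> j) [0..<n])) \<in> term_ops \<A> m"
  using assms(1)
proof (induction rule: term_ops.induct)
  case (var i)
  have "(\<lambda>xs :: 'a list. map (\<lambda>j. xs ! \<pi> j) [0..<n] ! i) = (\<lambda>xs. xs ! \<pi> i)" using var by auto
  thus ?case using term_ops.var[OF assms(2)[OF var], of \<A>] by (simp only:)
next
  case (app k f gs)
  let ?gs = "map (\<lambda>g xs. g (map (\<lambda>j. xs ! \<pi> j) [0..<n])) gs"
  have "(\<lambda>xs. f (map (\<lambda>g. g xs) ?gs)) \<in> term_ops \<A> m"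
    using app by (intro term_ops.app[of k]) auto
  thus ?case by (simp add: comp_def)
qed

theorem absorbing_imp_jonsson:
  assumes "absorbing \<A> B"
  shows "jonsson_absorbing \<A> B"
proof -
  obtain n t where t: "subuniverse \<A> B" "n > 0" "t \<in> term_ops \<A> n"
    and idem: "\<forall>x\<in>universe \<A>. t (replicate n x) = x"
    and abs: "\<forall>xs\<in>args (universe \<A>) n. card {i. i < n \<and> xs ! i \<notin> B} \<le> 1 \<longrightarrow> t xs \<in> B"
    using assms unfolding absorbing_def by blast
  have B: "B \<subseteq> universe \<A>" using t(1) by (simp add: subuniverse_def)
  \<comment> \<open>In \<open>d i\<close> the first \<open>n - i\<close> arguments are
    \<open>x\<close>, the next one is \<open>y\<close> and the others are \<open>z\<close>, so at
    most one argument lies outside \<open>B\<close>. The chain ends at \<open>Suc n\<close> because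
    \<open>d n\<close> still has \<open>y\<close> as its first argument.\<close>
  define p :: "nat \<Rightarrow> nat \<Rightarrow> nat" where "p i j = (if j + i < n then 0 else if j + i = n then 1 else 2)" for i j
  define d where "d i = (\<lambda>xs. t (map (\<lambda>j. xs ! p i j) [0..<n]))" for i
  have 1: "d i \<in> term_ops \<A> 3" for i unfolding d_def by (intro term_ops_minor[OF t(3)]) (simp add: p_def)
  have 2: "d i [b, a, c] \<in> B" if "b \<in> B" "a \<in> universe \<A>" "c \<in> B" for i a b c
    unfolding d_def
  proof (rule abs[rule_format])
    show "map (\<lambda>j. [b, a, c] ! p i j) [0..<n] \<in> args (universe \<A>) n" using that B by (auto simp: args_def p_def)
    have "{j. j < n \<and> map (\<lambda>j. [b, a, c] ! p i j) [0..<n] ! j \<notin> B} \<subseteq> {n - i}"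
      using that by (auto simp: p_def split: if_splits)
    from card_mono[OF _ this] show "card {j. j < n \<and> map (\<lambda>j. [b, a, c] ! p i j) [0..<n] ! j \<notin> B} \<le> 1" by simp
  qed
  have 3: "d i [x, y, y] = d (Suc i) [x, x, y]" for i x y
    unfolding d_def by (intro arg_cong[where f = t] map_cong) (auto simp: p_def)
  have 4: "d 0 [x, y, z] = x" if "x \<in> universe \<A>" for x y z
  proof -
    have "map (\<lambda>j. [x, y, z] ! p 0 j) [0..<n] = replicate n x" by (intro nth_equalityI) (auto simp: p_def)
    thus ?thesis using idem that by (simp add: d_def)
  qed
  have 5: "d (Suc n) [x, y, z] = z" if "z \<in> universe \<A>" for x y z
  proof -
    have "map (\<lambda>j. [x, y, z] ! p (Suc n) j) [0..<n] = replicate n z" by (intro nth_equalityI) (auto simp: p_def)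
    thus ?thesis using idem that by (simp add: d_def)
  qed
  show ?thesis unfolding jonsson_absorbing_def
    by (intro conjI exI[of _ "Suc n"] exI[of _ d] allI ballI impI t(1) 1 2 3 4 5)
qed

section \<open>Polymorphisms acting on tuples, and paths inside relations\<close>

definition columnwise :: "nat \<Rightarrow> ('a list \<Rightarrow> 'a) \<Rightarrow> 'a list list \<Rightarrow> 'a list" where
  "columnwise r f ts = map (\<lambda>j. f (map (\<lambda>t. t ! j) ts)) [0..<r]"

lemma preserves_columnwise:
  "preserves n f r R \<longleftrightarrow> (\<forall>ts. length ts = n \<and> set ts \<subseteq> R \<longrightarrow> columnwise r f ts \<in> R)"
  by (simp add: preserves_def columnwise_def)

lemma length_columnwise [simp]: "length (columnwise r f ts) = r" by (simp add: columnwise_def)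

lemma nth_columnwise [simp]: "j < r \<Longrightarrow> columnwise r f ts ! j = f (map (\<lambda>t. t ! j) ts)"
  by (simp add: columnwise_def)

text \<open>The domain as a relation of arity one, so that elements and tuples are treated
  alike.\<close>

definition unary :: "'a rel_structure \<Rightarrow> nat \<times> 'a list set" where
  "unary S = (1, (\<lambda>a. [a]) ` domain S)"

abbreviation all_relations :: "'a rel_structure \<Rightarrow> (nat \<times> 'a list set) list" where
  "all_relations S \<equiv> unary S # relations S"

definition idempotent_pol :: "'a rel_structure \<Rightarrow> nat \<Rightarrow> ('a list \<Rightarrow> 'a) \<Rightarrow> bool" where
  "idempotent_pol S n f \<longleftrightarrow> polymorphism S n f \<and> (\<forall>x\<in>domain S. f (replicate n x) = x)"

definition lift3 :: "('a list \<Rightarrow> 'a) \<Rightarrow> 'a list \<Rightarrow> 'a list \<Rightarrow> 'a list \<Rightarrow> 'a list" where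
  "lift3 d x y z = columnwise (length x) d [x, y, z]"

definition jonsson_ops :: "'a rel_structure \<Rightarrow> 'a set \<Rightarrow> ('a list \<Rightarrow> 'a) set" where
  "jonsson_ops S B = {d. idempotent_pol S 3 d \<and> (\<forall>b\<in>B. \<forall>a\<in>domain S. \<forall>c\<in>B. d [b, a, c] \<in> B)}"

text \<open>The local form of J\'onsson absorption: the chain of ternary operations may depend on the two tuples. It has
  certificates of polynomial size because it is a path inside the relation \<open>R\<close>.\<close>

definition locally_absorbing :: "'a rel_structure \<Rightarrow> 'a set \<Rightarrow> bool" where
  "locally_absorbing S B \<longleftrightarrow> (\<forall>(r, R) \<in> set (all_relations S). \<forall>x\<in>R. \<forall>y\<in>R.
     (x, y) \<in> {(lift3 d x x y, lift3 d x y y) | d. d \<in> jonsson_ops S B}\<^sup>*)"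

lemma polymorphism_preserves:
  assumes "polymorphism S n f" "(r, R) \<in> set (all_relations S)" "length ts = n" "set ts \<subseteq> R"
  shows "columnwise r f ts \<in> R"
proof (cases "(r, R) \<in> set (relations S)")
  case True
  thus ?thesis using assms unfolding polymorphism_def preserves_columnwise by blast
next
  case False
  hence rR: "r = 1" "R = (\<lambda>a. [a]) ` domain S" using assms(2) by (auto simp: unary_def)
  have "t ! 0 \<in> domain S" if "t \<in> set ts" for t using that assms(4) rR(2) by auto
  hence "map (\<lambda>t. t ! 0) ts \<in> args (domain S) n" using assms(3) by (auto simp: args_def)
  hence "f (map (\<lambda>t. t ! 0) ts) \<in> domain S" using assms(1) by (simp add: polymorphism_def)
  thus ?thesis using rR by (simp add: columnwise_def)
qed

lemma all_relations_args:
  assumes "finite_structure S" "(r, R) \<in> set (all_relations S)" shows "R \<subseteq> args (domain S) r"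
proof (cases "(r, R) \<in> set (relations S)")
  case True
  thus ?thesis using assms(1) unfolding finite_structure_def by blast
next
  case False
  thus ?thesis using assms(2) by (auto simp: unary_def args_def)
qed

lemma columnwise_comp:
  "columnwise r (\<lambda>xs. f (map (\<lambda>g. g xs) gs)) ts = columnwise r f (map (\<lambda>g. columnwise r g ts) gs)"
  by (intro nth_equalityI) (auto simp: comp_def cong: map_cong)

lemma polymorphism_comp:
  assumes "polymorphism S m f" "length gs = m" "\<And>g. g \<in> set gs \<Longrightarrow> polymorphism S n g" "n > 0"
  shows "polymorphism S n (\<lambda>xs. f (map (\<lambda>g. g xs) gs))"
  unfolding polymorphism_def preserves_columnwise
proof (intro conjI ballI, goal_cases)
  case (2 xs)
  have "g xs \<in> domain S" if "g \<in> set gs" for g using assms(3)[OF that] 2 by (simp add: polymorphism_def)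
  hence "map (\<lambda>g. g xs) gs \<in> args (domain S) m" using assms(2) by (auto simp: args_def)
  thus ?case using assms(1) by (simp add: polymorphism_def)
next
  case (3 rR)
  obtain r R where rR: "rR = (r, R)" by (cases rR)
  have "columnwise r (\<lambda>xs. f (map (\<lambda>g. g xs) gs)) ts \<in> R" if "length ts = n" "set ts \<subseteq> R" for ts
    unfolding columnwise_comp
  proof (rule polymorphism_preserves[OF assms(1)])
    show "(r, R) \<in> set (all_relations S)" using 3 rR by simp
    have "columnwise r g ts \<in> R" if "g \<in> set gs" for g
      using 3 rR \<open>length ts = n\<close> \<open>set ts \<subseteq> R\<close> by (intro polymorphism_preserves[OF assms(3)[OF that]]) simp_all
    thus "set (map (\<lambda>g. columnwise r g ts) gs) \<subseteq> R" by auto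
  qed (simp add: assms(2))
  thus ?case using rR by simp
qed (rule assms(4))

lemma idempotent_pol_proj:
  assumes "finite_structure S" "i < n"
  shows "idempotent_pol S n (\<lambda>xs. xs ! i)"
  unfolding idempotent_pol_def polymorphism_def preserves_columnwise
proof (intro conjI ballI, goal_cases)
  case (2 xs)
  thus ?case using assms by (auto simp: args_def)
next
  case (3 rR)
  obtain r R where rR: "rR = (r, R)" by (cases rR)
  have "columnwise r (\<lambda>xs. xs ! i) ts \<in> R" if ts: "length ts = n" "set ts \<subseteq> R" for ts
  proof -
    have i: "ts ! i \<in> R" using ts assms by auto
    hence "length (ts ! i) = r" using all_relations_args[OF assms(1), of r R] 3 rR by (auto simp: args_def)
    hence "columnwise r (\<lambda>xs. xs ! i) ts = ts ! i" using ts assms by (intro nth_equalityI) auto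
    thus ?thesis using i by simp
  qed
  thus ?case using rR by simp
qed (use assms in auto)

lemma term_ops_Pol:
  assumes "finite_structure S" "n > 0" "t \<in> term_ops (Pol S) n"
  shows "polymorphism S n t"
  using assms(3)
proof (induction rule: term_ops.induct)
  case (var i)
  thus ?case using idempotent_pol_proj[OF assms(1)] by (simp add: idempotent_pol_def)
next
  case (app m f gs)
  thus ?case using assms(2) by (intro polymorphism_comp) (auto simp: Pol_def)
qed

text \<open>Composing with the projections rebuilds the argument list up to length \<open>n\<close>;
  on longer or shorter lists the term operation may differ from \<open>f\<close>, hence the
  restriction.\<close>

lemma Pol_term_ops:
  assumes "polymorphism S n f"
  shows "\<exists>t\<in>term_ops (Pol S) n. \<forall>xs. length xs = n \<longrightarrow> t xs = f xs"
proof -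
  let ?gs = "map (\<lambda>i xs. xs ! i) [0..<n]"
  have "(\<lambda>xs. f (map (\<lambda>g. g xs) ?gs)) \<in> term_ops (Pol S) n"
    using assms by (intro term_ops.app[of n]) (auto simp: Pol_def intro: term_ops.var)
  moreover have "\<forall>xs. length xs = n \<longrightarrow> f (map (\<lambda>g. g xs) ?gs) = f xs"
    by (intro allI impI arg_cong[where f = f] nth_equalityI) auto
  ultimately show ?thesis by (intro bexI)
qed

lemma lift3_nth [simp]: "j < length x \<Longrightarrow> lift3 d x y z ! j = d [x ! j, y ! j, z ! j]"
  by (simp add: lift3_def)

lemma length_lift3 [simp]: "length (lift3 d x y z) = length x" by (simp add: lift3_def)

theorem jonsson_imp_locally_absorbing:
  assumes fin: "finite_structure S" and J: "jonsson_absorbing (Pol S) B"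
  shows "locally_absorbing S B"
proof -
  have univ: "universe (Pol S) = domain S" by (simp add: Pol_def)
  obtain n d where d': "\<forall>i\<le>n. d i \<in> term_ops (Pol S) 3"
    "\<forall>i\<le>n. \<forall>b\<in>B. \<forall>a\<in>domain S. \<forall>c\<in>B. d i [b, a, c] \<in> B"
    "\<forall>i<n. \<forall>x\<in>domain S. \<forall>y\<in>domain S. d i [x, y, y] = d (Suc i) [x, x, y]"
    "\<forall>x\<in>domain S. \<forall>y\<in>domain S. \<forall>z\<in>domain S. d 0 [x, y, z] = x \<and> d n [x, y, z] = z"
    using J unfolding jonsson_absorbing_def univ by iprover
  note d = d'(1)[rule_format] d'(2)[rule_format] d'(3)[rule_format] d'(4)[rule_format]
  \<comment> \<open>Idempotence is not among the conditions on a Jonsson chain; it follows along the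
    chain by putting \<open>y = x\<close> in the gluing identity.\<close>
  have idem: "d i [x, x, x] = x" if "i \<le> n" "x \<in> domain S" for i x
    using that(1)
  proof (induction i)
    case (Suc i)
    thus ?case using d(3)[of i x x] that(2) by simp
  qed (use d(4) that in simp)
  have dJ: "d i \<in> jonsson_ops S B" if "i \<le> n" for i
    using term_ops_Pol[OF fin _ d(1)[OF that]] idem[OF that] d(2)[OF that]
    by (auto simp: jonsson_ops_def idempotent_pol_def numeral_3_eq_3)
  have "(x, y) \<in> {(lift3 d x x y, lift3 d x y y) | d. d \<in> jonsson_ops S B}\<^sup>*" (is "_ \<in> ?E\<^sup>*")
    if rR: "(r, R) \<in> set (all_relations S)" and x: "x \<in> R" and y: "y \<in> R" for r R x y
  proof -
    have "x \<in> args (domain S) r" "y \<in> args (domain S) r" using all_relations_args[OF fin rR] x y by blast+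
    hence len: "length x = r" "length y = r" and dom: "\<And>j. j < r \<Longrightarrow> x ! j \<in> domain S \<and> y ! j \<in> domain S"
      by (auto simp: args_def)
    have e: "(lift3 (d i) x x y, lift3 (d i) x y y) \<in> ?E" if "i \<le> n" for i using dJ[OF that] by blast
    have step: "lift3 (d i) x y y = lift3 (d (Suc i)) x x y" if "i < n" for i
      using d(3)[OF that] dom len by (intro nth_equalityI) auto
    have path: "(x, lift3 (d i) x x y) \<in> ?E\<^sup>*" if "i \<le> n" for i
      using that
    proof (induction i)
      case 0
      have "lift3 (d 0) x x y = x" using d(4) dom len by (intro nth_equalityI) auto
      thus ?case by simp
    next
      case (Suc i)
      hence "(x, lift3 (d i) x x y) \<in> ?E\<^sup>*" by simp
      also have "(lift3 (d i) x x y, lift3 (d (Suc i)) x x y) \<in> ?E" using e[of i] step[of i] Suc.prems by simp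
      finally show ?case .
    qed
    have "lift3 (d n) x y y = y" using d(4) dom len by (intro nth_equalityI) auto
    thus ?thesis using path[of n] e[of n] by (simp add: rtrancl_into_rtrancl)
  qed
  thus ?thesis unfolding locally_absorbing_def by blast
qed

text \<open>A variable is a choice of \<open>n\<close> tuples from one relation, and a polymorphism
  assigns to it the result of its columnwise application. The assignment found by
  \<open>absorbing_solution\<close> agrees with some idempotent polymorphism only on each pair of
  variables, but this is enough to read off one operation that is itself an idempotent polymorphism
  and absorbs.\<close>

theorem locally_absorbing_imp_absorbing:
  fixes S :: "'a rel_structure"
  assumes fin: "finite_structure S" and sub: "subuniverse (Pol S) B" and loc: "locally_absorbing S B"
  shows "absorbing (Pol S) B"
proof -
  let ?rels = "all_relations S"
  define D where "D = domain S"
  define un where "un = unary S"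
  define U where "U = \<Union> (snd ` set ?rels)"
  define n where "n = (2 :: nat) ^ Suc (card (Pow U \<times> Pow U))"
  define V :: "((nat \<times> 'a list set) \<times> 'a list list) set"
    where "V = {(rR, ts). rR \<in> set ?rels \<and> length ts = n \<and> set ts \<subseteq> snd rR}"
  define sol :: "('a list \<Rightarrow> 'a) \<Rightarrow> (nat \<times> 'a list set) \<times> 'a list list \<Rightarrow> 'a list"
    where "sol f v = columnwise (fst (fst v)) f (snd v)" for f v
  define Sol where "Sol = {sol f | f. idempotent_pol S n f}"
  \<comment> \<open>The variable at which a polymorphism \<open>f\<close> has the value
    \<open>[f w]\<close>; the operation is recovered from these variables.\<close>
  define word :: "'a list \<Rightarrow> (nat \<times> 'a list set) \<times> 'a list list" where "word w = (un, map (\<lambda>a. [a]) w)" for w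
  define L where "L = word ` {w \<in> args D n. card {i. i < n \<and> w ! i \<notin> B} \<le> 1}"
  have un: "fst un = 1" "snd un = (\<lambda>a. [a]) ` D" "un \<in> set ?rels" by (simp_all add: un_def unary_def D_def)
  have n0: "n > 0" by (simp add: n_def)
  have BD: "B \<subseteq> D" using sub by (simp add: subuniverse_def Pol_def D_def)
  have finD: "finite D" using fin by (simp add: finite_structure_def D_def)
  have rel_args: "R \<subseteq> args D r" if "(r, R) \<in> set ?rels" for r R
    using all_relations_args[OF fin that] by (simp add: D_def)
  have finR: "finite R" if "(r, R) \<in> set ?rels" for r R
    using rel_args[OF that] finite_lists_length_eq[OF finD, of r] by (auto simp: args_def conj_commute intro: finite_subset)
  have finR': "finite (snd rR)" if "rR \<in> set ?rels" for rR using finR[of "fst rR" "snd rR"] that by simp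
  have solR: "sol f (rR, ts) \<in> snd rR" if "idempotent_pol S n f" "(rR, ts) \<in> V" for f rR ts
    using that polymorphism_preserves[of S n f "fst rR" "snd rR" ts] by (simp add: sol_def V_def idempotent_pol_def)
  have word_V: "word w \<in> V" if "w \<in> args D n" for w
    using that un by (auto simp: word_def V_def args_def)
  have sol_word: "sol f (word w) = [f w]" for f w
    by (simp add: sol_def word_def un columnwise_def comp_def)
  have LV: "L \<subseteq> V" using word_V by (auto simp: L_def)
  interpret csp V Sol
  proof
    have "V \<subseteq> (SIGMA rR:set ?rels. {ts. set ts \<subseteq> snd rR \<and> length ts = n})" by (auto simp: V_def)
    moreover have "finite \<dots>" by (intro finite_SigmaI finite_lists_length_eq finR') simp_all
    ultimately show "finite V" by (rule finite_subset)
    show "Sol \<noteq> {}" using idempotent_pol_proj[OF fin n0] by (auto simp: Sol_def)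
  next
    fix v assume v: "v \<in> V"
    have "(\<lambda>s. s v) ` Sol \<subseteq> snd (fst v)" using solR[of _ "fst v" "snd v"] v by (auto simp: Sol_def)
    moreover have "finite (snd (fst v))" using v finR[of "fst (fst v)" "snd (fst v)"] by (auto simp: V_def)
    ultimately show "finite ((\<lambda>s. s v) ` Sol)" by (rule finite_subset)
  qed
  have AR: "A v \<subseteq> snd (fst v)" if "v \<in> V" for v
  proof
    fix x assume "x \<in> A v"
    then obtain s where "s \<in> Sol" "x = s v" unfolding A_def by blast
    then obtain f where "idempotent_pol S n f" "x = sol f v" unfolding Sol_def by blast
    thus "x \<in> snd (fst v)" using solR[of f "fst v" "snd v"] that by simp
  qed
  have AL: "\<exists>a\<in>D. x = [a]" if "v \<in> L" "x \<in> A v" for v x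
  proof -
    have "v \<in> V" "fst v = un" using that(1) LV by (auto simp: L_def word_def)
    thus ?thesis using AR[of v] that(2) un(2) by auto
  qed
  interpret absorbing_csp V Sol L "(\<lambda>b. [b]) ` B" "lift3 ` jonsson_ops S B" U
  proof
    show "L \<subseteq> V" by (rule LV)
  next
    fix d s1 s2 s3 assume "d \<in> lift3 ` jonsson_ops S B" and s: "s1 \<in> Sol" "s2 \<in> Sol" "s3 \<in> Sol"
    then obtain d' where d': "d = lift3 d'" "idempotent_pol S 3 d'" by (auto simp: jonsson_ops_def)
    obtain f1 f2 f3 where f: "s1 = sol f1" "idempotent_pol S n f1" "s2 = sol f2" "idempotent_pol S n f2"
      "s3 = sol f3" "idempotent_pol S n f3" using s by (auto simp: Sol_def)
    let ?f = "\<lambda>xs. d' (map (\<lambda>g. g xs) [f1, f2, f3])"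
    have "polymorphism S n ?f"
      using f d' n0 by (intro polymorphism_comp[where m = 3]) (auto simp: idempotent_pol_def)
    hence "idempotent_pol S n ?f" using f d' by (simp add: idempotent_pol_def numeral_3_eq_3)
    moreover have "sol ?f v = d (s1 v) (s2 v) (s3 v)" for v
      by (simp add: sol_def f d' lift3_def columnwise_comp[of _ d' "[f1, f2, f3]", simplified])
    ultimately show "\<exists>s\<in>Sol. \<forall>v\<in>V. s v = d (s1 v) (s2 v) (s3 v)" unfolding Sol_def by blast
  next
    show "finite U" unfolding U_def by (intro finite_UN_I finR') simp_all
  next
    fix W assume W: "W \<subseteq> L" "finite W" "card W < 2 ^ Suc (card (Pow U \<times> Pow U))"
    define bad where "bad v = {i. i < n \<and> hd (snd v ! i) \<notin> B}" for v :: "(nat \<times> 'a list set) \<times> 'a list list"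
    have bad: "card (bad v) \<le> 1 \<and> (\<exists>w\<in>args D n. v = word w)" if vW: "v \<in> W" for v
    proof -
      obtain w where w: "w \<in> args D n" "card {i. i < n \<and> w ! i \<notin> B} \<le> 1" "v = word w"
        using vW W(1) unfolding L_def by blast
      have "bad v = {i. i < n \<and> w ! i \<notin> B}" using w by (auto simp: bad_def word_def args_def)
      thus ?thesis using w by auto
    qed
    \<comment> \<open>Each demanded word has at most one entry outside \<open>B\<close>, so fewer
      than \<open>n\<close> words leave some position where all entries are in \<open>B\<close>. The
      projection to it is the common solution.\<close>
    have "card (\<Union> (bad ` W)) \<le> (\<Sum>v\<in>W. card (bad v))" by (rule card_UN_le[OF W(2)])
    also have "\<dots> \<le> (\<Sum>v\<in>W. 1)" using bad by (intro sum_mono) blast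
    finally have "card (\<Union> (bad ` W)) < card {..<n}" using W(3) by (simp add: n_def)
    hence "\<not> {..<n} \<subseteq> \<Union> (bad ` W)" 
      using card_mono[of "\<Union> (bad ` W)" "{..<n}"] W(2) by (auto simp: bad_def)
    then obtain i where i: "i < n" "\<And>v. v \<in> W \<Longrightarrow> i \<notin> bad v" by blast
    have "sol (\<lambda>xs. xs ! i) v \<in> (\<lambda>b. [b]) ` B" if v: "v \<in> W" for v
    proof -
      obtain w where w: "w \<in> args D n" "v = word w" using bad[OF v] by blast
      have "w ! i \<in> B" using i(2)[OF v] i(1) w by (auto simp: bad_def word_def args_def)
      thus ?thesis using w by (simp add: sol_word)
    qed
    thus "\<exists>s\<in>Sol. \<forall>w\<in>W. s w \<in> (\<lambda>b. [b]) ` B" unfolding Sol_def using idempotent_pol_proj[OF fin i(1)] by blast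
  next
    fix v assume v: "v \<in> V"
    have "snd (fst v) \<subseteq> U" using v by (auto simp: U_def V_def)
    thus "A v \<subseteq> U" using AR[OF v] by blast
    fix x y assume "x \<in> A v" "y \<in> A v"
    hence xy: "x \<in> snd (fst v)" "y \<in> snd (fst v)" using AR[OF v] by blast+
    have "(fst (fst v), snd (fst v)) \<in> set ?rels" using v by (auto simp: V_def)
    hence "(x, y) \<in> {(lift3 d x x y, lift3 d x y y) | d. d \<in> jonsson_ops S B}\<^sup>*"
      using loc xy unfolding locally_absorbing_def by blast
    also have "{(lift3 d x x y, lift3 d x y y) | d. d \<in> jonsson_ops S B} =
      {(d x x y, d x y y) | d. d \<in> lift3 ` jonsson_ops S B}" by blast
    finally show "(x, y) \<in> {(d x x y, d x y y) | d. d \<in> lift3 ` jonsson_ops S B}\<^sup>*" .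
  next
    fix d w x y z assume d: "d \<in> lift3 ` jonsson_ops S B" and w: "w \<in> L" and
      x: "x \<in> A w \<inter> (\<lambda>b. [b]) ` B" and y: "y \<in> A w" and z: "z \<in> A w \<inter> (\<lambda>b. [b]) ` B"
    obtain d' where d': "d = lift3 d'" "\<And>b a c. b \<in> B \<Longrightarrow> a \<in> D \<Longrightarrow> c \<in> B \<Longrightarrow> d' [b, a, c] \<in> B"
      using d by (auto simp: jonsson_ops_def D_def)
    obtain a where "a \<in> D" "y = [a]" using AL[OF w y] by blast
    moreover obtain b c where "b \<in> B" "c \<in> B" "x = [b]" "z = [c]" using x z by blast
    ultimately show "d x y z \<in> (\<lambda>b. [b]) ` B" using d'(2) by (simp add: d'(1) lift3_def columnwise_def)
  qed
  obtain s where s: "\<And>u v. u \<in> V \<Longrightarrow> v \<in> V \<Longrightarrow> (s u, s v) \<in> R u v" "\<And>w. w \<in> L \<Longrightarrow> s w \<in> (\<lambda>b. [b]) ` B"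
    using absorbing_solution by blast
  define f where "f w = hd (s (word w))" for w
  have s2: "\<exists>g. idempotent_pol S n g \<and> s u = sol g u \<and> s v = sol g v" if uv: "u \<in> V" "v \<in> V" for u v
  proof -
    obtain t where "t \<in> Sol" "s u = t u" "s v = t v" using s(1)[OF uv] unfolding R_def by blast
    thus ?thesis unfolding Sol_def by auto
  qed
  \<comment> \<open>Comparing the variable \<open>(rR, ts)\<close> with the word of one column at a
    time shows that \<open>s\<close> is \<open>f\<close> applied columnwise. A different
    polymorphism may be the witness for each column.\<close>
  have s_col: "s (rR, ts) = columnwise (fst rR) f ts" if v: "(rR, ts) \<in> V" for rR ts
  proof (intro nth_equalityI)
    show len: "length (s (rR, ts)) = length (columnwise (fst rR) f ts)" using s2[OF v v] by (auto simp: sol_def)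
    fix j assume "j < length (s (rR, ts))"
    hence j: "j < fst rR" using len by simp
    have "t ! j \<in> D" if "t \<in> set ts" for t
    proof -
      have "t \<in> args D (fst rR)" using v that rel_args[of "fst rR" "snd rR"] by (auto simp: V_def)
      thus ?thesis using j by (auto simp: args_def)
    qed
    hence w: "map (\<lambda>t. t ! j) ts \<in> args D n" using v by (auto simp: args_def V_def)
    obtain g where g: "s (word (map (\<lambda>t. t ! j) ts)) = sol g (word (map (\<lambda>t. t ! j) ts))" "s (rR, ts) = sol g (rR, ts)"
      using s2[OF word_V[OF w] v] by blast
    show "s (rR, ts) ! j = columnwise (fst rR) f ts ! j"
      using g j by (simp add: f_def sol_word) (simp add: sol_def)
  qed
  have f_word: "s (word w) = [f w]" "f w \<in> D" if w: "w \<in> args D n" for w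
  proof -
    obtain g where "idempotent_pol S n g" "s (word w) = sol g (word w)" using s2[OF word_V[OF w] word_V[OF w]] by blast
    thus "s (word w) = [f w]" "f w \<in> D" using w by (auto simp: f_def sol_word idempotent_pol_def polymorphism_def D_def)
  qed
  have pol: "polymorphism S n f"
    unfolding polymorphism_def preserves_columnwise
  proof (intro conjI ballI, goal_cases)
    case (2 xs)
    thus ?case using f_word(2)[of xs] by (simp add: D_def)
  next
    case (3 rR)
    obtain r R where rR: "rR = (r, R)" by (cases rR)
    have "columnwise r f ts \<in> R" if "length ts = n" "set ts \<subseteq> R" for ts
    proof -
      have v: "((r, R), ts) \<in> V" using 3 rR that by (simp add: V_def)
      obtain g where "idempotent_pol S n g" "s ((r, R), ts) = sol g ((r, R), ts)" using s2[OF v v] by blast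
      thus ?thesis using solR[of g "(r, R)" ts] v s_col[OF v] by simp
    qed
    thus ?case using rR by simp
  qed (rule n0)
  have f_idem: "f (replicate n x) = x" if "x \<in> D" for x
  proof -
    have w: "word (replicate n x) \<in> V" using that by (intro word_V) (auto simp: args_def)
    obtain g where "idempotent_pol S n g" "s (word (replicate n x)) = sol g (word (replicate n x))" using s2[OF w w] by blast
    thus ?thesis using that by (simp add: f_def sol_word idempotent_pol_def D_def)
  qed
  have f_abs: "f w \<in> B" if w: "w \<in> args D n" "card {i. i < n \<and> w ! i \<notin> B} \<le> 1" for w
  proof -
    have "word w \<in> L" using w by (auto simp: L_def)
    from s(2)[OF this] show ?thesis using f_word(1)[OF w(1)] by auto
  qed
  obtain t where t: "t \<in> term_ops (Pol S) n" "\<And>xs. length xs = n \<Longrightarrow> t xs = f xs" using Pol_term_ops[OF pol] by blast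
  have univ: "universe (Pol S) = D" by (simp add: Pol_def D_def)
  show ?thesis unfolding absorbing_def univ
    using sub n0 t(1) f_idem f_abs t(2)
    by (intro conjI exI[of _ n] bexI[of _ t]) (auto simp: args_def)
qed

section \<open>Programs with finitely many read-only heads\<close>

text \<open>The tape symbol at position \<open>p\<close> of the presentation of \<open>bs\<close> with end markers: 3 on the left, the blank 0 on the right.\<close>

definition symbol :: "bool list \<Rightarrow> nat \<Rightarrow> nat" where
  "symbol bs p = (if p = 0 then 3 else if p \<le> length bs then (if bs ! (p - 1) then 2 else 1) else 0)"

section \<open>Semantics of nondeterministic multihead programs\<close>

type_synonym heads = "nat \<Rightarrow> nat"

datatype action = Skip | Read nat nat | GoL nat | GoR nat

datatype prog = Act action | Seq prog prog | Alt prog prog | Star prog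

fun exec :: "bool list \<Rightarrow> action \<Rightarrow> heads \<Rightarrow> heads option" where
  "exec bs Skip e = Some e"
| "exec bs (Read h a) e = (if symbol bs (e h) = a then Some e else None)"
| "exec bs (GoL h) e = (if symbol bs (e h) \<noteq> 3 then Some (e(h := e h - 1)) else None)"
| "exec bs (GoR h) e = (if symbol bs (e h) \<noteq> 0 then Some (e(h := e h + 1)) else None)"

primrec sem :: "bool list \<Rightarrow> prog \<Rightarrow> (heads \<times> heads) set" where
  "sem bs (Act a) = {(e, e'). exec bs a e = Some e'}"
| "sem bs (Seq p q) = sem bs p O sem bs q"
| "sem bs (Alt p q) = sem bs p \<union> sem bs q"
| "sem bs (Star p) = (sem bs p)\<^sup>*"

text \<open>A control state is the list of programs still to be run. There are at most two
  successors, so one certificate bit selects among them, and each step performs a single action,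
  which a Turing machine can do in one step.\<close>

fun succs :: "prog list \<Rightarrow> (action \<times> prog list) list" where
  "succs [] = []"
| "succs (Act a # k) = [(a, k)]"
| "succs (Seq p q # k) = [(Skip, p # q # k)]"
| "succs (Alt p q # k) = [(Skip, p # k), (Skip, q # k)]"
| "succs (Star p # k) = [(Skip, k), (Skip, p # Star p # k)]"

definition small_step :: "bool list \<Rightarrow> ((prog list \<times> heads) \<times> (prog list \<times> heads)) set" where
  "small_step bs = {((k, e), (k', e')). \<exists>a. (a, k') \<in> set (succs k) \<and> exec bs a e = Some e'}"

lemma small_stepI: "(a, k') \<in> set (succs k) \<Longrightarrow> exec bs a e = Some e' \<Longrightarrow> ((k, e), (k', e')) \<in> small_step bs"
  by (auto simp: small_step_def)

lemma sem_small_step: "(e, e') \<in> sem bs p \<Longrightarrow> ((p # k, e), (k, e')) \<in> (small_step bs)\<^sup>*"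
proof (induction p arbitrary: e e' k)
  case (Act a)
  thus ?case by (auto intro!: r_into_rtrancl small_stepI)
next
  case (Seq p q)
  then obtain e1 where 1: "(e, e1) \<in> sem bs p" "(e1, e') \<in> sem bs q" by auto
  have "((Seq p q # k, e), (p # q # k, e)) \<in> small_step bs" by (rule small_stepI) auto
  also have "((p # q # k, e), (q # k, e1)) \<in> (small_step bs)\<^sup>*" using Seq.IH(1) 1 by blast
  also have "((q # k, e1), (k, e')) \<in> (small_step bs)\<^sup>*" using Seq.IH(2) 1 by blast
  finally show ?case .
next
  case (Alt p q)
  have a: "((Alt p q # k, e), (p # k, e)) \<in> small_step bs" "((Alt p q # k, e), (q # k, e)) \<in> small_step bs"
    by (rule small_stepI[of Skip]; simp)+
  from Alt.prems consider "(e, e') \<in> sem bs p" | "(e, e') \<in> sem bs q" by auto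
  thus ?case
  proof cases
    case 1
    from converse_rtrancl_into_rtrancl[OF a(1) Alt.IH(1)[OF this]] show ?thesis .
  next
    case 2
    from converse_rtrancl_into_rtrancl[OF a(2) Alt.IH(2)[OF this]] show ?thesis .
  qed
next
  case (Star p)
  have "(e, e') \<in> (sem bs p)\<^sup>*" using Star.prems by simp
  thus ?case
  proof (induction rule: converse_rtrancl_induct)
    case base
    show ?case by (intro r_into_rtrancl small_stepI[of Skip]) auto
  next
    case (step y z)
    have "((Star p # k, y), (p # Star p # k, y)) \<in> small_step bs" by (rule small_stepI[of Skip]) auto
    also have "((p # Star p # k, y), (Star p # k, z)) \<in> (small_step bs)\<^sup>*" using Star.IH step.hyps by blast
    also note step.IH
    finally show ?case .
  qed
qed

primrec sem_list :: "bool list \<Rightarrow> prog list \<Rightarrow> (heads \<times> heads) set" where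
  "sem_list bs [] = Id"
| "sem_list bs (p # k) = sem bs p O sem_list bs k"

text \<open>Gives the other half of the equivalence by induction backwards from the empty
  continuation.\<close>

lemma small_step_sem_list:
  assumes "((k, e), (k', e')) \<in> small_step bs" "(e', e'') \<in> sem_list bs k'"
  shows "(e, e'') \<in> sem_list bs k"
proof (cases k)
  case Nil
  thus ?thesis using assms by (simp add: small_step_def)
next
  case (Cons p k0)
  show ?thesis
  proof (cases p)
    case (Star q)
    from assms Cons Star consider "k' = k0" "e' = e" | "k' = q # Star q # k0" "e' = e" by (auto simp: small_step_def)
    thus ?thesis
    proof cases
      case 1
      thus ?thesis using assms(2) Cons Star by auto
    next
      case 2
      then obtain y z where "(e, y) \<in> sem bs q" "(y, z) \<in> (sem bs q)\<^sup>*" "(z, e'') \<in> sem_list bs k0"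
        using assms(2) by auto
      thus ?thesis using Cons Star by (auto intro: converse_rtrancl_into_rtrancl)
    qed
  qed (use assms Cons in \<open>auto simp: small_step_def\<close>)
qed

lemma sem_iff_small_step: "(e, e') \<in> sem bs p \<longleftrightarrow> (([p], e), ([], e')) \<in> (small_step bs)\<^sup>*"
proof
  assume "(([p], e), ([], e')) \<in> (small_step bs)\<^sup>*"
  hence "(snd ([p], e), e') \<in> sem_list bs (fst ([p], e))"
    by (induction rule: converse_rtrancl_induct) (auto dest: small_step_sem_list)
  thus "(e, e') \<in> sem bs p" by simp
qed (rule sem_small_step)

text \<open>The control states that can arise while \<open>p\<close> runs in front of
  \<open>k\<close>, except \<open>k\<close> itself. The set is finite because a starred program
  returns to a continuation that is already present.\<close>

primrec continuations :: "prog \<Rightarrow> prog list \<Rightarrow> prog list set" where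
  "continuations (Act a) k = {Act a # k}"
| "continuations (Seq p q) k = insert (Seq p q # k) (continuations p (q # k) \<union> continuations q k)"
| "continuations (Alt p q) k = insert (Alt p q # k) (continuations p k \<union> continuations q k)"
| "continuations (Star p) k = insert (Star p # k) (continuations p (Star p # k))"

fun head_bound :: "action \<Rightarrow> nat" where
  "head_bound Skip = 0"
| "head_bound (Read h a) = Suc h"
| "head_bound (GoL h) = Suc h"
| "head_bound (GoR h) = Suc h"

primrec n_heads :: "prog \<Rightarrow> nat" where
  "n_heads (Act a) = head_bound a"
| "n_heads (Seq p q) = max (n_heads p) (n_heads q)"
| "n_heads (Alt p q) = max (n_heads p) (n_heads q)"
| "n_heads (Star p) = n_heads p"

lemma finite_continuations [simp]: "finite (continuations p k)"
  by (induction p arbitrary: k) auto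

lemma start_continuations: "p # k \<in> continuations p k" by (cases p) auto

lemma continuations_succs:
  "x \<in> continuations p k \<Longrightarrow> (a, x') \<in> set (succs x) \<Longrightarrow>
   (x' = k \<or> x' \<in> continuations p k) \<and> head_bound a \<le> n_heads p"
proof (induction p arbitrary: k)
  case (Seq p q)
  consider "x = Seq p q # k" | "x \<in> continuations p (q # k)" | "x \<in> continuations q k" using Seq.prems by auto
  thus ?case
  proof cases
    case 1
    thus ?thesis using Seq.prems start_continuations by auto
  next
    case 2
    from Seq.IH(1)[OF this Seq.prems(2)] show ?thesis using start_continuations by auto
  next
    case 3
    from Seq.IH(2)[OF this Seq.prems(2)] show ?thesis by auto
  qed
next
  case (Alt p q)
  consider "x = Alt p q # k" | "x \<in> continuations p k" | "x \<in> continuations q k" using Alt.prems by auto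
  thus ?case
  proof cases
    case 1
    thus ?thesis using Alt.prems start_continuations by auto
  next
    case 2
    from Alt.IH(1)[OF this Alt.prems(2)] show ?thesis by auto
  next
    case 3
    from Alt.IH(2)[OF this Alt.prems(2)] show ?thesis by auto
  qed
next
  case (Star p)
  consider "x = Star p # k" | "x \<in> continuations p (Star p # k)" using Star.prems by auto
  thus ?case
  proof cases
    case 1
    thus ?thesis using Star.prems start_continuations by auto
  next
    case 2
    from Star.IH[OF this Star.prems(2)] show ?thesis by auto
  qed
qed auto

lemma length_succs: "length (succs k) \<le> 2" "k \<noteq> [] \<Longrightarrow> succs k \<noteq> []"
  by (cases k rule: succs.cases; simp)+

section \<open>Acceptance of words and compilation to a Turing machine\<close>

definition final_heads :: "bool list \<Rightarrow> heads" where "final_heads bs = (\<lambda>_. Suc (length bs))"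

text \<open>The heads start on the right end marker because that is where the machine's head tapes
  stand once the word has been written on them.\<close>

definition accepts_word :: "prog \<Rightarrow> bool list \<Rightarrow> bool" where
  "accepts_word p bs \<longleftrightarrow> (\<exists>e. (final_heads bs, e) \<in> sem bs p)"

text \<open>The machine for a program \<open>p\<^sub>0\<close>. Tape 0 holds the input \<open>x\<close>, tape 1 the certificate, and every head of the program
  has a tape of its own. States 3 to 5 write the left marker, \<open>x\<close> and a word \<open>w\<close> guessed by the certificate on all head
  tapes. The other states are the control states of the program, and one bit of the certificate is consumed by every step
  to select the successor. Hence the machine stops at the latest when the certificate is used up.\<close>

locale compiled =
  fixes p0 :: prog
begin

definition nh :: nat where "nh = n_heads p0"
definition Q :: "prog list set" where "Q = insert [] (continuations p0 [])"
definition idx :: "prog list \<Rightarrow> nat" where "idx = (SOME f. bij_betw f Q {0..<card Q})"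
text \<open>Finishing the program is the accepting state 1. The offset keeps the control states
  apart from the start, the two verdicts and the three set-up states.\<close>

definition code :: "prog list \<Rightarrow> nat" where "code k = (if k = [] then 1 else 6 + idx k)"
definition decode :: "nat \<Rightarrow> prog list" where "decode q = inv_into Q idx (q - 6)"

text \<open>Every cell is rewritten with the symbol just scanned, so the head tapes are read-only;
  the first two tapes belong to the input and the certificate.\<close>

definition moves :: "(nat \<Rightarrow> move) \<Rightarrow> nat list \<Rightarrow> (nat \<times> move) list" where
  "moves mv ss = map (\<lambda>h. (ss ! (h + 2), mv h)) [0..<nh]"

definition halt :: "nat list \<Rightarrow> nat \<times> (nat \<times> move) list" where
  "halt ss = (2, (ss ! 0, Stay) # (ss ! 1, Stay) # moves (\<lambda>_. Stay) ss)"

definition go :: "nat \<Rightarrow> (nat \<Rightarrow> move) \<Rightarrow> nat list \<Rightarrow> nat \<times> (nat \<times> move) list" where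
  "go q mv ss = (q, (ss ! 0, Stay) # (ss ! 1, Right) # moves mv ss)"

fun perform :: "action \<Rightarrow> prog list \<Rightarrow> nat list \<Rightarrow> nat \<times> (nat \<times> move) list" where
  "perform Skip k ss = go (code k) (\<lambda>_. Stay) ss"
| "perform (Read h a) k ss = (if ss ! (h + 2) = a then go (code k) (\<lambda>_. Stay) ss else halt ss)"
| "perform (GoL h) k ss = (if ss ! (h + 2) \<noteq> 3 then go (code k) (\<lambda>h'. if h' = h then Left else Stay) ss else halt ss)"
| "perform (GoR h) k ss = (if ss ! (h + 2) \<noteq> 0 then go (code k) (\<lambda>h'. if h' = h then Right else Stay) ss else halt ss)"

definition pick :: "nat \<Rightarrow> prog list \<Rightarrow> action \<times> prog list" where
  "pick c k = (if c = 2 \<and> length (succs k) = 2 then succs k ! 1 else succs k ! 0)"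

text \<open>In state 4 a certificate bit \<open>True\<close> announces another guessed letter, which
  state 5 copies to all head tapes, and \<open>False\<close> starts the program. All other
  situations, in particular an exhausted certificate, lead to rejection.\<close>

definition delta :: "nat \<Rightarrow> nat list \<Rightarrow> nat \<times> (nat \<times> move) list" where
  "delta q ss =
    (if q = 0 then (3, (ss ! 0, Stay) # (ss ! 1, Stay) # map (\<lambda>_. (3, Right)) [0..<nh])
     else if q = 3 then
       (if ss ! 0 \<in> {1, 2} then (3, (ss ! 0, Right) # (ss ! 1, Stay) # map (\<lambda>_. (ss ! 0, Right)) [0..<nh])
        else (4, (ss ! 0, Stay) # (ss ! 1, Stay) # moves (\<lambda>_. Stay) ss))
     else if q = 4 then
       (if ss ! 1 = 2 then go 5 (\<lambda>_. Stay) ss else if ss ! 1 = 1 then go (code [p0]) (\<lambda>_. Stay) ss else halt ss)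
     else if q = 5 then
       (if ss ! 1 \<in> {1, 2} then (4, (ss ! 0, Stay) # (ss ! 1, Right) # map (\<lambda>_. (ss ! 1, Right)) [0..<nh]) else halt ss)
     else if q < 6 \<or> ss ! 1 \<notin> {1, 2} \<or> succs (decode q) = [] then halt ss
     else (let (a, k) = pick (ss ! 1) (decode q) in perform a k ss))"

definition M :: tm where
  "M = \<lparr>n_tapes = nh + 2, n_syms = 4, n_states = 6 + card Q, trans = delta\<rparr>"

lemma finite_Q: "finite Q" by (simp add: Q_def)

lemma idx: "bij_betw idx Q {0..<card Q}"
  unfolding idx_def using ex_bij_betw_finite_nat[OF finite_Q] by (rule someI_ex)

lemma code_less: "k \<in> Q \<Longrightarrow> code k < 6 + card Q"
  using bij_betwE[OF idx] by (auto simp: code_def)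

lemma decode_Q: "6 \<le> q \<Longrightarrow> q < 6 + card Q \<Longrightarrow> decode q \<in> Q"
  unfolding decode_def using idx by (intro inv_into_into) (auto simp: bij_betw_def)

lemma decode_code: "k \<in> Q \<Longrightarrow> k \<noteq> [] \<Longrightarrow> decode (code k) = k"
  unfolding decode_def code_def using idx by (simp add: bij_betw_def)

lemma code_ge: "k \<noteq> [] \<Longrightarrow> code k \<ge> 6" by (simp add: code_def)

lemma succs_Q:
  assumes "k \<in> Q" "(a, k') \<in> set (succs k)" shows "k' \<in> Q" "head_bound a \<le> nh"
proof -
  have "k \<in> continuations p0 []" using assms by (auto simp: Q_def)
  from continuations_succs[OF this assms(2)] show "k' \<in> Q" "head_bound a \<le> nh" by (auto simp: Q_def nh_def)
qed

lemma pick_succs: "succs k \<noteq> [] \<Longrightarrow> pick c k \<in> set (succs k)"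
  by (auto simp: pick_def)

lemma start_Q: "[p0] \<in> Q" using start_continuations by (simp add: Q_def)

definition valid_out :: "nat \<times> (nat \<times> move) list \<Rightarrow> bool" where
  "valid_out r \<longleftrightarrow> fst r < 6 + card Q \<and> length (snd r) = nh + 2 \<and> fst ` set (snd r) \<subseteq> {..<4}"

lemma wf_M: "wf_tm M"
proof -
  have "valid_out (delta q ss)" if q: "q < 6 + card Q" and ss: "ss \<in> args {..<4} (nh + 2)" for q ss
  proof -
    have s: "ss ! i < 4" if "i < nh + 2" for i
    proof -
      have "ss ! i \<in> set ss" using ss that by (auto simp: args_def)
      thus ?thesis using ss by (auto simp: args_def)
    qed
    have s01: "ss ! 0 < 4" "ss ! 1 < 4" using s[of 0] s[of 1] by simp_all
    hence s1: "ss ! Suc 0 < 4" by simp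
    have mv: "valid_out (r, (ss ! 0, m0) # (ss ! 1, m1) # moves mv ss)" if "r < 6 + card Q" for r mv m0 m1
      using that s01 s1 s by (auto simp: valid_out_def moves_def)
    have ap: "valid_out (r, (ss ! 0, m0) # (ss ! 1, m1) # map (\<lambda>_. (a, Right)) [0..<nh])" if "r < 6 + card Q" "a < 4" for r a m0 m1
      using that s01 s1 by (auto simp: valid_out_def)
    have h: "valid_out (halt ss)" unfolding halt_def by (rule mv) simp
    have g: "valid_out (go r mv ss)" if "r < 6 + card Q" for r mv unfolding go_def using that by (rule mv)
    have pf: "valid_out (perform a k ss)" if "k \<in> Q" for a k
      using g[OF code_less[OF that]] h by (cases a) auto
    show ?thesis
    proof (cases "q < 6")
      case True
      hence "q \<in> {0, 1, 2, 3, 4, 5}" by auto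
      thus ?thesis using ap mv h g code_less[OF start_Q] s01 by (elim insertE) (simp_all add: delta_def)
    next
      case False
      show ?thesis
      proof (cases "ss ! 1 \<notin> {1, 2} \<or> succs (decode q) = []")
        case True
        thus ?thesis unfolding delta_def using False h by simp
      next
        case ok: False
        obtain a k where ak: "pick (ss ! 1) (decode q) = (a, k)" by fastforce
        have "decode q \<in> Q" using decode_Q False q by simp
        moreover have "(a, k) \<in> set (succs (decode q))" using pick_succs[of "decode q" "ss ! 1"] ak ok by simp
        ultimately have "k \<in> Q" by (rule succs_Q)
        thus ?thesis unfolding delta_def using pf[of k a] ak False ok by simp
      qed
    qed
  qed
  thus ?thesis by (auto simp: wf_tm_def M_def valid_out_def)
qed

section \<open>The configurations that occur and the effect of one step\<close>

definition ztape :: "bool list \<Rightarrow> int \<Rightarrow> nat" where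
  "ztape bs i = (if i < 0 then 0 else symbol bs (nat i))"

definition config :: "bool list \<Rightarrow> bool list \<Rightarrow> nat \<Rightarrow> nat \<Rightarrow> nat \<Rightarrow> bool list \<Rightarrow> heads \<Rightarrow> config" where
  "config x u q i j bs e =
     (q, (int i, snd (load x)) # (int j, snd (load u)) # map (\<lambda>h. (int (e h), ztape bs)) [0..<nh])"

abbreviation init :: "bool list \<Rightarrow> bool list \<Rightarrow> config" where
  "init x u \<equiv> (0, load x # load u # replicate (n_tapes M - 2) (load []))"

definition cell :: "bool list \<Rightarrow> nat \<Rightarrow> nat" where
  "cell u j = (if j < length u then (if u ! j then 2 else 1) else 0)"

definition reads :: "bool list \<Rightarrow> bool list \<Rightarrow> nat \<Rightarrow> nat \<Rightarrow> bool list \<Rightarrow> heads \<Rightarrow> nat list" where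
  "reads x u i j bs e = cell x i # cell u j # map (\<lambda>h. symbol bs (e h)) [0..<nh]"

lemma reads_simps [simp]:
  "reads x u i j bs e ! 0 = cell x i" "reads x u i j bs e ! Suc 0 = cell u j"
  "h < nh \<Longrightarrow> reads x u i j bs e ! Suc (Suc h) = symbol bs (e h)"
  by (simp_all add: reads_def)

lemma load_cell: "snd (load u) (int j) = cell u j" by (auto simp: load_def cell_def)

lemma load_upd: "(snd (load u))(int j := cell u j) = snd (load u)"
  by (rule fun_upd_idem) (rule load_cell)

lemma ztape_nat: "ztape bs (int p) = symbol bs p" by (simp add: ztape_def)

lemma ztape_upd: "(ztape bs)(int p := symbol bs p) = ztape bs"
  by (rule fun_upd_idem) (rule ztape_nat)

lemma map2_map: "map2 f (map g xs) (map h xs) = map (\<lambda>x. f (g x) (h x)) xs"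
  by (induction xs) auto

lemma step_M:
  assumes "q \<noteq> 1" "q \<noteq> 2" "delta q (reads x u i j bs e) = (q', as)"
  shows "step M (config x u q i j bs e) =
    (q', map2 act as ((int i, snd (load x)) # (int j, snd (load u)) # map (\<lambda>h. (int (e h), ztape bs)) [0..<nh]))"
proof -
  have "trans M = delta" by (simp add: M_def)
  thus ?thesis unfolding config_def
    using assms(1,2) assms(3)[unfolded reads_def] by (simp add: load_cell ztape_nat comp_def)
qed

lemma ztape_append: "(ztape bs)(int (Suc (length bs)) := if b then 2 else 1) = ztape (bs @ [b])"
proof
  fix i
  show "((ztape bs)(int (Suc (length bs)) := if b then 2 else 1)) i = ztape (bs @ [b]) i"
  proof (cases "i < 0")
    case False
    then obtain p where p: "i = int p" by (metis nat_0_le not_less)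
    show ?thesis
    proof (cases "p = Suc (length bs)")
      case True
      thus ?thesis unfolding p ztape_nat by (simp add: symbol_def)
    next
      case False
      hence "symbol bs p = symbol (bs @ [b]) p" by (cases p) (auto simp: symbol_def nth_append)
      thus ?thesis using False unfolding p by (simp add: ztape_nat del: of_nat_Suc)
    qed
  qed (simp add: ztape_def)
qed

lemma step_init: "step M (init x u) = config x u 3 0 0 [] (\<lambda>_. 1)"
proof -
  have z: "(\<lambda>i. 0)(0 := 3) = ztape []" by (rule ext) (auto simp: ztape_def symbol_def)
  have r: "replicate (n_tapes M - 2) (load []) = map (\<lambda>_. (0, \<lambda>i. 0)) [0..<nh]"
    by (auto simp add: M_def map_replicate_const load_def fun_eq_iff)
  have t: "trans M = delta" by (simp add: M_def)
  have "init x u = (0, (0, snd (load x)) # (0, snd (load u)) # map (\<lambda>_. (0, \<lambda>i. 0)) [0..<nh])"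
    unfolding r by (simp add: load_def)
  also have "step M \<dots> = config x u 3 0 0 [] (\<lambda>_. 1)"
    by (simp add: t delta_def map2_map z config_def)
  finally show ?thesis .
qed

lemma step_go:
  assumes "q \<noteq> 1" "q \<noteq> 2" "delta q (reads x u i j bs e) = go q' mv (reads x u i j bs e)"
    and e': "\<And>h. h < nh \<Longrightarrow> (case mv h of Left \<Rightarrow> int (e h) - 1 | Stay \<Rightarrow> int (e h) | Right \<Rightarrow> int (e h) + 1) = int (e' h)"
  shows "step M (config x u q i j bs e) = config x u q' i (Suc j) bs e'"
  unfolding step_M[OF assms(1,2) assms(3)[unfolded go_def]] unfolding config_def
  using e' by (simp add: moves_def map2_map load_upd ztape_upd)

lemma step_halt:
  assumes "q \<noteq> 1" "q \<noteq> 2" "delta q (reads x u i j bs e) = halt (reads x u i j bs e)"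
  shows "fst (step M (config x u q i j bs e)) = 2"
  unfolding step_M[OF assms(1,2) assms(3)[unfolded halt_def]] by simp

lemma step_copy:
  assumes "i < length x"
  shows "step M (config x u 3 i 0 (take i x) (\<lambda>_. Suc i)) = config x u 3 (Suc i) 0 (take (Suc i) x) (\<lambda>_. Suc (Suc i))"
proof -
  let ?r = "reads x u i 0 (take i x) (\<lambda>_. Suc i)"
  have c: "cell x i = (if x ! i then 2 else 1)" using assms by (simp add: cell_def)
  have d: "delta 3 ?r = (3, (cell x i, Right) # (cell u 0, Stay) # map (\<lambda>_. (cell x i, Right)) [0..<nh])"
    by (simp add: delta_def c)
  have "(ztape (take i x))(int (Suc i) := cell x i) = ztape (take (Suc i) x)"
    using ztape_append[of "take i x" "x ! i"] assms unfolding c by (simp add: take_Suc_conv_app_nth)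
  moreover have n: "(3 :: nat) \<noteq> 1" "(3 :: nat) \<noteq> 2" by simp_all
  ultimately show ?thesis unfolding step_M[OF n d] unfolding config_def
    using load_upd[of u 0] load_upd[of x i] by (simp add: map2_map)
qed

lemma step_copied:
  "step M (config x u 3 (length x) 0 bs e) = config x u 4 (length x) 0 bs e"
proof -
  let ?r = "reads x u (length x) 0 bs e"
  have d: "delta 3 ?r = (4, (cell x (length x), Stay) # (cell u 0, Stay) # moves (\<lambda>_. Stay) ?r)"
    by (simp add: delta_def cell_def)
  have n: "(3 :: nat) \<noteq> 1" "(3 :: nat) \<noteq> 2" by simp_all
  show ?thesis unfolding step_M[OF n d] unfolding config_def
    using load_upd[of u 0] by (simp add: map2_map load_upd moves_def ztape_upd)
qed

lemma step_guess:
  assumes "j < length u"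
  shows "step M (config x u 5 i j bs (\<lambda>_. Suc (length bs))) =
    config x u 4 i (Suc j) (bs @ [u ! j]) (\<lambda>_. Suc (length (bs @ [u ! j])))"
proof -
  let ?r = "reads x u i j bs (\<lambda>_. Suc (length bs))"
  have c: "cell u j = (if u ! j then 2 else 1)" using assms by (simp add: cell_def)
  have d: "delta 5 ?r = (4, (cell x i, Stay) # (cell u j, Right) # map (\<lambda>_. (cell u j, Right)) [0..<nh])"
    by (simp add: delta_def c)
  have "(ztape bs)(int (Suc (length bs)) := cell u j) = ztape (bs @ [u ! j])"
    using ztape_append[of bs "u ! j"] unfolding c .
  moreover have n: "(5 :: nat) \<noteq> 1" "(5 :: nat) \<noteq> 2" by simp_all
  ultimately show ?thesis unfolding step_M[OF n d] unfolding config_def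
    by (simp add: map2_map load_upd)
qed

lemma cell_end: "cell u j \<in> {1, 2} \<longleftrightarrow> j < length u" by (auto simp: cell_def)

lemma step_run:
  assumes k: "k \<in> Q" "k \<noteq> []" and j: "j < length u" and ak: "pick (cell u j) k = (a, k')"
  shows "case exec bs a e of
      Some e' \<Rightarrow> step M (config x u (code k) i j bs e) = config x u (code k') i (Suc j) bs e'
    | None \<Rightarrow> fst (step M (config x u (code k) i j bs e)) = 2"
proof -
  let ?r = "reads x u i j bs e"
  have sk: "succs k \<noteq> []" using length_succs(2)[OF k(2)] .
  have q: "code k \<ge> 6" "code k \<noteq> 1" "code k \<noteq> 2" using code_ge[OF k(2)] by auto
  have "cell u j \<in> {1, 2}" using j cell_end by blast
  hence d: "delta (code k) ?r = perform a k' ?r"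
    using q sk by (simp add: delta_def decode_code[OF k] ak)
  have "(a, k') \<in> set (succs k)" using pick_succs[OF sk, of "cell u j"] ak by simp
  hence hb: "head_bound a \<le> nh" using succs_Q[OF k(1)] by blast
  show ?thesis
  proof (cases a)
    case Skip
    show ?thesis using d Skip by (auto intro!: step_go[OF q(2,3)])
  next
    case (Read h s)
    thus ?thesis using d hb by (auto intro!: step_go[OF q(2,3)] step_halt[OF q(2,3)])
  next
    case (GoL h)
    have "symbol bs (e h) \<noteq> 3 \<Longrightarrow> e h > 0" by (cases "e h = 0") (simp_all add: symbol_def)
    thus ?thesis using d hb GoL by (auto intro!: step_go[OF q(2,3)] step_halt[OF q(2,3)] simp: of_nat_diff)
  next
    case (GoR h)
    thus ?thesis using d hb by (auto intro!: step_go[OF q(2,3)] step_halt[OF q(2,3)])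
  qed
qed

end

context compiled
begin

lemma step_choose:
  assumes "j < length u"
  shows "step M (config x u 4 i j bs e) = config x u (if u ! j then 5 else code [p0]) i (Suc j) bs e"
proof -
  have n: "(4 :: nat) \<noteq> 1" "(4 :: nat) \<noteq> 2" by simp_all
  have "delta 4 (reads x u i j bs e) = go (if u ! j then 5 else code [p0]) (\<lambda>_. Stay) (reads x u i j bs e)"
    using assms by (simp add: delta_def cell_def)
  thus ?thesis by (rule step_go[OF n]) simp
qed

lemma step_exhausted:
  assumes "q \<ge> 4" "length u \<le> j"
  shows "fst (step M (config x u q i j bs e)) = 2"
proof (rule step_halt)
  have "cell u j = 0" using assms(2) by (simp add: cell_def)
  thus "delta q (reads x u i j bs e) = halt (reads x u i j bs e)" using assms(1) by (simp add: delta_def)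
qed (use assms(1) in simp_all)

lemma step_halted: "fst c \<in> {1, 2} \<Longrightarrow> step M c = c"
  by (cases c) simp

abbreviation reached :: "bool list \<Rightarrow> prog list \<Rightarrow> heads \<Rightarrow> bool" where
  "reached bs k e \<equiv> (([p0], final_heads bs), (k, e)) \<in> (small_step bs)\<^sup>*"

text \<open>The first \<open>length x + 2\<close> steps set up the tapes, and every later one
  consumes a certificate bit. The bound on \<open>t\<close> by the position \<open>j\<close> is
  therefore an invariant, and it is the source of the time bound.\<close>

definition running :: "bool list \<Rightarrow> bool list \<Rightarrow> nat \<Rightarrow> config \<Rightarrow> bool" where
  "running x u t c \<longleftrightarrow> (t = 0 \<and> c = init x u) \<or>
     (\<exists>i\<le>length x. t = Suc i \<and> c = config x u 3 i 0 (take i x) (\<lambda>_. Suc i)) \<or>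
     (\<exists>w j. j \<le> length u \<and> t \<le> length x + 2 + j \<and>
        (c = config x u 4 (length x) j (x @ w) (final_heads (x @ w)) \<or>
         c = config x u 5 (length x) j (x @ w) (final_heads (x @ w)))) \<or>
     (\<exists>w j k e. j \<le> length u \<and> t \<le> length x + 2 + j \<and> k \<in> Q \<and> k \<noteq> [] \<and>
        c = config x u (code k) (length x) j (x @ w) e \<and> reached (x @ w) k e)"

lemma running_copy: "i \<le> length x \<Longrightarrow> running x u (Suc i) (config x u 3 i 0 (take i x) (\<lambda>_. Suc i))"
  unfolding running_def by blast

lemma running_guess:
  "j \<le> length u \<Longrightarrow> t \<le> length x + 2 + j \<Longrightarrow> q \<in> {4, 5} \<Longrightarrow>
   running x u t (config x u q (length x) j (x @ w) (final_heads (x @ w)))"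
  unfolding running_def by blast

lemma running_run:
  "j \<le> length u \<Longrightarrow> t \<le> length x + 2 + j \<Longrightarrow> k \<in> Q \<Longrightarrow> k \<noteq> [] \<Longrightarrow> reached (x @ w) k e \<Longrightarrow>
   running x u t (config x u (code k) (length x) j (x @ w) e)"
  unfolding running_def by blast

definition halted :: "bool list \<Rightarrow> config \<Rightarrow> bool" where
  "halted x c \<longleftrightarrow> fst c = 2 \<or> (fst c = 1 \<and> (\<exists>w e. reached (x @ w) [] e))"

lemma config_state [simp]: "fst (config x u q i j bs e) = q" by (simp add: config_def)

lemma running_halted_step:
  assumes "running x u t c \<or> halted x c"
  shows "running x u (Suc t) (step M c) \<or> halted x (step M c)"
proof (cases "halted x c")
  case True
  thus ?thesis using step_halted[of c] by (auto simp: halted_def)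
next
  case False
  with assms consider
      (init) "t = 0" "c = init x u"
    | (copy) i where "i \<le> length x" "t = Suc i" "c = config x u 3 i 0 (take i x) (\<lambda>_. Suc i)"
    | (choose) w j where "j \<le> length u" "t \<le> length x + 2 + j" "c = config x u 4 (length x) j (x @ w) (final_heads (x @ w))"
    | (guess) w j where "j \<le> length u" "t \<le> length x + 2 + j" "c = config x u 5 (length x) j (x @ w) (final_heads (x @ w))"
    | (run) w j k e where "j \<le> length u" "t \<le> length x + 2 + j" "k \<in> Q" "k \<noteq> []"
        "c = config x u (code k) (length x) j (x @ w) e" "reached (x @ w) k e"
    unfolding running_def by blast
  thus ?thesis
  proof cases
    case init
    have "step M c = config x u 3 0 0 (take 0 x) (\<lambda>_. Suc 0)" unfolding init(2) step_init by simp
    thus ?thesis using running_copy[of 0 x u] init(1) by simp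
  next
    case copy
    show ?thesis
    proof (cases "i < length x")
      case True
      from step_copy[OF this, of u] copy True show ?thesis using running_copy[of "Suc i" x u] by simp
    next
      case False
      hence i: "i = length x" using copy by simp
      have "step M c = config x u 4 (length x) 0 (x @ []) (final_heads (x @ []))"
        using step_copied[of x u] copy i by (simp add: final_heads_def)
      thus ?thesis using running_guess[of 0 u "Suc t" x 4 "[]"] copy i by simp
    qed
  next
    case choose
    show ?thesis
    proof (cases "j < length u")
      case True
      show ?thesis
      proof (cases "u ! j")
        case True
        hence "step M c = config x u 5 (length x) (Suc j) (x @ w) (final_heads (x @ w))"
          using step_choose[OF \<open>j < length u\<close>] choose by simp
        thus ?thesis using running_guess[of "Suc j" u "Suc t" x 5 w] choose \<open>j < length u\<close> by simp
      next
        case False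
        hence "step M c = config x u (code [p0]) (length x) (Suc j) (x @ w) (final_heads (x @ w))"
          using step_choose[OF \<open>j < length u\<close>] choose by simp
        thus ?thesis using running_run[of "Suc j" u "Suc t" x "[p0]" w] choose \<open>j < length u\<close> start_Q by simp
      qed
    next
      case False
      thus ?thesis using step_exhausted[of 4 u j] choose by (auto simp: halted_def)
    qed
  next
    case guess
    show ?thesis
    proof (cases "j < length u")
      case True
      have "step M c = config x u 4 (length x) (Suc j) (x @ (w @ [u ! j])) (final_heads (x @ (w @ [u ! j])))"
        using step_guess[OF True, of x "length x" "x @ w"] guess by (simp add: final_heads_def)
      thus ?thesis using running_guess[of "Suc j" u "Suc t" x 4 "w @ [u ! j]"] guess True by simp
    next
      case False
      thus ?thesis using step_exhausted[of 5 u j] guess by (auto simp: halted_def)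
    qed
  next
    case run
    show ?thesis
    proof (cases "j < length u")
      case True
      obtain a k' where ak: "pick (cell u j) k = (a, k')" by fastforce
      have sk: "(a, k') \<in> set (succs k)" using pick_succs[OF length_succs(2)[OF run(4)], of "cell u j"] ak by simp
      note s = step_run[OF run(3,4) True ak, where bs="x @ w" and e=e and x=x and i="length x"]
      show ?thesis
      proof (cases "exec (x @ w) a e")
        case None
        thus ?thesis using s run(5) by (simp add: halted_def)
      next
        case (Some e')
        hence c: "step M c = config x u (code k') (length x) (Suc j) (x @ w) e'" using s run(5) by simp
        have r: "reached (x @ w) k' e'" using run(6) small_stepI[OF sk Some] by (rule rtrancl_into_rtrancl)
        show ?thesis
        proof (cases "k' = []")
          case True
          thus ?thesis using c r by (auto simp: halted_def code_def)
        next
          case False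
          thus ?thesis using running_run[of "Suc j" u "Suc t" x k' w e'] c r run \<open>j < length u\<close> succs_Q(1)[OF run(3) sk] by simp
        qed
      qed
    next
      case False
      thus ?thesis using step_exhausted[of "code k" u j] code_ge[OF run(4)] run by (auto simp: halted_def)
    qed
  qed
qed

lemma running_or_halted:
  "running x u t ((step M ^^ t) (init x u)) \<or> halted x ((step M ^^ t) (init x u))"
proof (induction t)
  case 0
  show ?case by (simp add: running_def)
next
  case (Suc t)
  thus ?case using running_halted_step by simp
qed

text \<open>A machine still running satisfies \<open>t \<le> length x + 2 + length u\<close>; one
  step more and it has halted.\<close>

lemma poly_time_M: "poly_time M"
proof -
  have "state_after M x u (poly [:3, 1:] (length x + length u)) \<in> {1, 2}" for x u
  proof -
    let ?t = "length x + length u + 3"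
    have "\<not> running x u ?t c" for c by (auto simp: running_def)
    hence "halted x ((step M ^^ ?t) (init x u))" using running_or_halted[of x u ?t] by blast
    hence "state_after M x u ?t \<in> {1, 2}" by (auto simp: halted_def state_after_def)
    moreover have "poly [:3, 1:] (length x + length u) = ?t" by simp
    ultimately show ?thesis by (simp only:)
  qed
  thus ?thesis unfolding poly_time_def by blast
qed

lemma accepts_imp_word:
  assumes "accepts M x u"
  shows "\<exists>w. accepts_word p0 (x @ w)"
proof -
  obtain t where t: "fst ((step M ^^ t) (init x u)) = 1" using assms by (auto simp: accepts_def state_after_def)
  have "\<not> running x u t ((step M ^^ t) (init x u))"
  proof
    assume "running x u t ((step M ^^ t) (init x u))"
    moreover have "code k \<noteq> Suc 0" if "k \<noteq> []" for k using that by (simp add: code_def)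
    ultimately show False using t unfolding running_def by auto
  qed
  hence "halted x ((step M ^^ t) (init x u))" using running_or_halted by blast
  thus ?thesis using t by (auto simp: halted_def accepts_word_def sem_iff_small_step)
qed

section \<open>Certificates that steer the machine through a given run\<close>

definition leads :: "bool list \<Rightarrow> bool list \<Rightarrow> config \<Rightarrow> bool" where
  "leads x u c \<longleftrightarrow> (\<exists>t. (step M ^^ t) (init x u) = c)"

lemma leads_step: "leads x u c \<Longrightarrow> step M c = c' \<Longrightarrow> leads x u c'"
  unfolding leads_def by (metis funpow.simps(2) o_apply)

lemma leads_copied: "leads x u (config x u 4 (length x) 0 x (final_heads x))"
proof -
  have "leads x u (config x u 3 i 0 (take i x) (\<lambda>_. Suc i))" if "i \<le> length x" for i
    using that
  proof (induction i)
    case 0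
    have "leads x u (init x u)" unfolding leads_def by (rule exI[of _ 0]) simp
    from leads_step[OF this step_init] show ?case by simp
  next
    case (Suc i)
    thus ?case using leads_step[OF _ step_copy[of i x u]] by simp
  qed
  from leads_step[OF this[of "length x"] ] show ?thesis using step_copied[of x u] by (simp add: final_heads_def)
qed

text \<open>\<open>v\<close> is \<open>w\<close> with an announcing \<open>True\<close> in front of
  each letter.\<close>

lemma leads_guessed:
  "length v = 2 * length w \<Longrightarrow> (\<And>i. i < length w \<Longrightarrow> v ! (2 * i) \<and> v ! (2 * i + 1) = w ! i) \<Longrightarrow>
   leads x (v @ u) (config x (v @ u) 4 (length x) (length v) (x @ w) (final_heads (x @ w)))"
proof -
  assume v: "length v = 2 * length w" "\<And>i. i < length w \<Longrightarrow> v ! (2 * i) \<and> v ! (2 * i + 1) = w ! i"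
  have "leads x (v @ u) (config x (v @ u) 4 (length x) (2 * i) (x @ take i w) (final_heads (x @ take i w)))"
    if "i \<le> length w" for i
    using that
  proof (induction i)
    case 0
    show ?case using leads_copied by simp
  next
    case (Suc i)
    have j: "2 * i < length (v @ u)" "Suc (2 * i) < length (v @ u)" using Suc.prems v(1) by simp_all
    have b: "(v @ u) ! (2 * i)" "(v @ u) ! Suc (2 * i) = w ! i" using v(2)[of i] Suc.prems v(1) by (simp_all add: nth_append)
    have "leads x (v @ u) (config x (v @ u) 5 (length x) (Suc (2 * i)) (x @ take i w) (final_heads (x @ take i w)))"
      using leads_step[OF Suc.IH step_choose[OF j(1)]] Suc.prems b(1) by simp
    from leads_step[OF this[unfolded final_heads_def] step_guess[OF j(2)]] b(2)
    show ?case using Suc.prems by (simp add: final_heads_def take_Suc_conv_app_nth)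
  qed
  from this[of "length w"] show ?thesis using v(1) by simp
qed

text \<open>The rest \<open>u\<close> of the certificate is left arbitrary, so that the choice bit
  of the next step can be appended in the induction.\<close>

lemma leads_run:
  assumes v: "length v = 2 * length w" "\<And>i. i < length w \<Longrightarrow> v ! (2 * i) \<and> v ! (2 * i + 1) = w ! i"
  shows "(([p0], final_heads (x @ w)), (k, e)) \<in> small_step (x @ w) ^^ n \<Longrightarrow>
    k \<in> Q \<and> (\<exists>c. length c = n \<and> (\<forall>u. leads x (v @ False # c @ u)
       (config x (v @ False # c @ u) (code k) (length x) (length v + 1 + n) (x @ w) e)))"
proof (induction n arbitrary: k e)
  case 0
  hence ke: "k = [p0]" "e = final_heads (x @ w)" by auto
  have "leads x (v @ False # u) (config x (v @ False # u) (code [p0]) (length x) (Suc (length v)) (x @ w) (final_heads (x @ w)))" for u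
  proof -
    have "length v < length (v @ False # u)" by simp
    from leads_step[OF leads_guessed[OF v, of x "False # u"] step_choose[OF this]] show ?thesis by (simp add: nth_append)
  qed
  thus ?case using ke start_Q by simp
next
  case (Suc n)
  then obtain k1 e1 where 1: "(([p0], final_heads (x @ w)), (k1, e1)) \<in> small_step (x @ w) ^^ n"
    "((k1, e1), (k, e)) \<in> small_step (x @ w)" by auto
  obtain c where c: "k1 \<in> Q" "length c = n" "\<And>u. leads x (v @ False # c @ u)
       (config x (v @ False # c @ u) (code k1) (length x) (length v + 1 + n) (x @ w) e1)" using Suc.IH[OF 1(1)] by blast
  obtain a where a: "(a, k) \<in> set (succs k1)" "exec (x @ w) a e1 = Some e" using 1(2) by (auto simp: small_step_def)
  have k1: "k1 \<noteq> []" using a by auto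
  \<comment> \<open>The bit \<open>False\<close> selects the first successor; the bit is
    \<open>True\<close> exactly if the run takes another one.\<close>
  define b where "b = ((a, k) \<noteq> succs k1 ! 0)"
  have pk: "pick (if b then 2 else 1) k1 = (a, k)"
  proof (cases b)
    case True
    obtain i where i: "i < length (succs k1)" "succs k1 ! i = (a, k)" using a(1) by (auto simp: in_set_conv_nth)
    hence "i \<noteq> 0" using True by (cases i) (auto simp: b_def)
    hence "i = 1" "length (succs k1) = 2" using i(1) length_succs(1)[of k1] by auto
    thus ?thesis using True i by (simp add: pick_def)
  next
    case False
    thus ?thesis by (simp add: pick_def b_def)
  qed
  have "leads x (v @ False # (c @ [b]) @ u)
    (config x (v @ False # (c @ [b]) @ u) (code k) (length x) (length v + 1 + Suc n) (x @ w) e)" for u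
  proof -
    let ?u = "v @ False # c @ b # u"
    have j: "length v + 1 + n < length ?u" using c(2) by simp
    have "?u ! (length v + 1 + n) = b" using c(2) by (simp add: nth_append)
    hence "cell ?u (length v + 1 + n) = (if b then 2 else 1)" using j by (simp add: cell_def)
    from step_run[OF c(1) k1 j, where a=a and k'=k and bs="x @ w" and e=e1 and x=x and i="length x"] this pk a(2)
    have "step M (config x ?u (code k1) (length x) (length v + 1 + n) (x @ w) e1) =
      config x ?u (code k) (length x) (Suc (length v + 1 + n)) (x @ w) e" by simp
    from leads_step[OF c(3)[of "b # u"] this] show ?thesis by simp
  qed
  thus ?case using succs_Q(1)[OF c(1) a(1)] c(2) by (intro conjI exI[of _ "c @ [b]"]) auto
qed

text \<open>A shortest run uses at most as many steps as the configuration graph has edges, and the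
  square bounds the edges by pairs of configurations.\<close>

lemma small_step_bounded:
  assumes "reached bs k e"
  shows "\<exists>n \<le> (card Q * (length bs + 2) ^ nh) ^ 2. (([p0], final_heads bs), (k, e)) \<in> small_step bs ^^ n"
proof -
  \<comment> \<open>Heads from \<open>nh\<close> on never move. Pinning them to their initial
    position leaves finitely many configurations although \<open>heads\<close> assigns positions to
    infinitely many heads.\<close>
  define C where "C = {(k, e). k \<in> Q \<and> (\<forall>h. e h \<le> Suc (length bs)) \<and> (\<forall>h\<ge>nh. e h = Suc (length bs))}"
  define T where "T = {xs. set xs \<subseteq> {..Suc (length bs)} \<and> length xs = nh}"
  have inj: "inj_on (\<lambda>(k, e). (k, map e [0..<nh])) C"
  proof (rule inj_onI, clarsimp simp: C_def)
    fix e e' :: heads assume h: "\<forall>h\<ge>nh. e h = Suc (length bs)" "\<forall>h\<ge>nh. e' h = Suc (length bs)"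
      "\<forall>h\<in>{0..<nh}. e h = e' h"
    show "e = e'"
    proof
      fix h show "e h = e' h" using h by (cases "h < nh") auto
    qed
  qed
  have fT: "finite T" "card T = (length bs + 2) ^ nh"
    using finite_lists_length_eq[of "{..Suc (length bs)}" nh] card_lists_length_eq[of "{..Suc (length bs)}" nh]
    by (simp_all add: T_def)
  have sub: "(\<lambda>(k, e). (k, map e [0..<nh])) ` C \<subseteq> Q \<times> T" by (auto simp: C_def T_def)
  have fC: "finite C" using inj sub finite_subset[OF sub] finite_Q fT by (auto intro: finite_imageD)
  have cC: "card C \<le> card Q * (length bs + 2) ^ nh"
    using card_image[OF inj] card_mono[OF _ sub] finite_Q fT by (simp add: card_cartesian_product)
  define r where "r = small_step bs \<inter> C \<times> C"
  have start: "([p0], final_heads bs) \<in> C" using start_Q by (simp add: C_def final_heads_def)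
  have closed: "c' \<in> C" if cc: "(c, c') \<in> small_step bs" "c \<in> C" for c c'
  proof -
    obtain k e k' e' a where c: "c = (k, e)" "c' = (k', e')" "(a, k') \<in> set (succs k)" "exec bs a e = Some e'"
      using cc(1) unfolding small_step_def by blast
    have ke: "k \<in> Q" "\<forall>h. e h \<le> Suc (length bs)" "\<forall>h\<ge>nh. e h = Suc (length bs)" using cc(2) c by (auto simp: C_def)
    have hb: "head_bound a \<le> nh" and "k' \<in> Q" using succs_Q[OF ke(1) c(3)] by auto
    moreover have "(\<forall>h. e' h \<le> Suc (length bs)) \<and> (\<forall>h\<ge>nh. e' h = Suc (length bs))"
    proof (cases a)
      case Skip thus ?thesis using c(4) ke by simp
    next
      case (Read h s) thus ?thesis using c(4) ke by (simp split: if_splits)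
    next
      case (GoL h) thus ?thesis using c(4) ke hb by (auto split: if_splits simp: le_diff_conv le_SucI)
    next
      case (GoR h)
      hence "symbol bs (e h) \<noteq> 0" "e' = e(h := e h + 1)" using c(4) by (auto split: if_splits)
      moreover from this have "e h \<le> length bs" by (cases "e h \<le> length bs") (auto simp: symbol_def)
      ultimately show ?thesis using ke hb GoR by auto
    qed
    ultimately show ?thesis using c by (simp add: C_def)
  qed
  have "(([p0], final_heads bs), c) \<in> r\<^sup>* \<and> c \<in> C" if "(([p0], final_heads bs), c) \<in> (small_step bs)\<^sup>*" for c
    using that
  proof (induction rule: rtrancl_induct)
    case (step y z)
    thus ?case using closed[OF step.hyps(2)] by (auto simp: r_def intro: rtrancl_into_rtrancl)
  qed (use start in simp)
  hence "(([p0], final_heads bs), (k, e)) \<in> r\<^sup>*" using assms by blast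
  moreover have "finite r" using fC by (auto simp: r_def)
  ultimately obtain n where n: "n \<le> card r" "(([p0], final_heads bs), (k, e)) \<in> r ^^ n"
    by (auto simp: rtrancl_finite_eq_relpow)
  have "card r \<le> card (C \<times> C)" using fC by (intro card_mono) (auto simp: r_def)
  also have "\<dots> \<le> (card Q * (length bs + 2) ^ nh) ^ 2"
    using cC by (simp add: card_cartesian_product power2_eq_square mult_mono)
  finally have "n \<le> (card Q * (length bs + 2) ^ nh) ^ 2" using n(1) by simp
  moreover have "(([p0], final_heads bs), (k, e)) \<in> small_step bs ^^ n"
  proof -
    have "r ^^ m \<subseteq> small_step bs ^^ m" for m by (induction m) (auto simp: r_def)
    thus ?thesis using n(2) by blast
  qed
  ultimately show ?thesis by blast
qed

lemma word_imp_accepts: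
  assumes "accepts_word p0 (x @ w)"
  shows "\<exists>u. length u \<le> 2 * length w + 1 + (card Q * (length x + length w + 2) ^ nh) ^ 2 \<and> accepts M x u"
proof -
  obtain e where "reached (x @ w) [] e" using assms by (auto simp: accepts_word_def sem_iff_small_step)
  from small_step_bounded[OF this] obtain n where
    n: "n \<le> (card Q * (length x + length w + 2) ^ nh) ^ 2" "(([p0], final_heads (x @ w)), ([], e)) \<in> small_step (x @ w) ^^ n" by auto
  define v where "v = concat (map (\<lambda>b. [True, b]) w)"
  have v: "length v = 2 * length w" "i < length w \<Longrightarrow> v ! (2 * i) \<and> v ! (2 * i + 1) = w ! i" for i
  proof -
    show "length v = 2 * length w" unfolding v_def by (induction w) auto
    show "i < length w \<Longrightarrow> v ! (2 * i) \<and> v ! (2 * i + 1) = w ! i" unfolding v_def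
    proof (induction w arbitrary: i)
      case (Cons b w)
      thus ?case by (cases i) auto
    qed simp
  qed
  obtain c where c: "length c = n" "\<And>u. leads x (v @ False # c @ u)
       (config x (v @ False # c @ u) (code []) (length x) (length v + 1 + n) (x @ w) e)"
    using leads_run[OF v n(2)] by blast
  from c(2)[of "[]"] obtain t where
    "(step M ^^ t) (init x (v @ False # c)) = config x (v @ False # c) (code []) (length x) (length v + 1 + n) (x @ w) e"
    unfolding leads_def by auto
  hence "fst ((step M ^^ t) (init x (v @ False # c))) = 1" by (simp add: code_def)
  hence "accepts M x (v @ False # c)" unfolding accepts_def state_after_def by blast
  thus ?thesis using n(1) c(1) v(1) by (intro exI[of _ "v @ False # c"]) simp
qed

end

theorem promise_NP_prog:
  fixes p :: prog and r :: "nat poly"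
  assumes sound: "\<And>i w. i \<in> I \<Longrightarrow> accepts_word p (enc i @ w) \<Longrightarrow> P i"
    and complete: "\<And>i. i \<in> I \<Longrightarrow> P i \<Longrightarrow> \<exists>w. length w \<le> poly r (length (enc i)) \<and> accepts_word p (enc i @ w)"
  shows "promise_NP enc I P"
proof -
  interpret compiled p .
  \<comment> \<open>The summands pay for the announced word, the bit that starts the program, and
    the choice bits of a shortest run. The number of heads \<open>nh\<close> is fixed with the
    program, so this is a polynomial.\<close>
  define b :: "nat poly" where "b = 2 * r + 1 + ([:card Q:] * ([:2, 1:] + r) ^ nh) ^ 2"
  have "P i \<longleftrightarrow> (\<exists>u. length u \<le> poly b (length (enc i)) \<and> accepts M (enc i) u)" if i: "i \<in> I" for i
  proof
    assume "P i"
    then obtain w where w: "length w \<le> poly r (length (enc i))" "accepts_word p (enc i @ w)" using complete[OF i] by blast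
    obtain u where u: "length u \<le> 2 * length w + 1 + (card Q * (length (enc i) + length w + 2) ^ nh) ^ 2" "accepts M (enc i) u"
      using word_imp_accepts[OF w(2)] by blast
    have h: "(length (enc i) + length w + 2) ^ nh \<le> (2 + length (enc i) + poly r (length (enc i))) ^ nh"
    proof (rule power_mono)
      show "length (enc i) + length w + 2 \<le> 2 + length (enc i) + poly r (length (enc i))" using w(1) by linarith
    qed simp
    have "(card Q * (length (enc i) + length w + 2) ^ nh) ^ 2 \<le> (card Q * (2 + length (enc i) + poly r (length (enc i))) ^ nh) ^ 2"
      by (rule power_mono[OF mult_le_mono2[OF h]]) simp
    moreover have "poly b (length (enc i)) = 2 * poly r (length (enc i)) + 1 +
      (card Q * (2 + length (enc i) + poly r (length (enc i))) ^ nh) ^ 2"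
      by (simp add: b_def poly_power)
    ultimately have "length u \<le> poly b (length (enc i))" using u(1) w(1) by linarith
    thus "\<exists>u. length u \<le> poly b (length (enc i)) \<and> accepts M (enc i) u" using u(2) by blast
  next
    assume "\<exists>u. length u \<le> poly b (length (enc i)) \<and> accepts M (enc i) u"
    thus "P i" using accepts_imp_word sound[OF i] by blast
  qed
  thus ?thesis unfolding promise_NP_def using wf_M poly_time_M by blast
qed

section \<open>Predicates on head positions\<close>

definition valid_heads :: "bool list \<Rightarrow> heads \<Rightarrow> bool" where
  "valid_heads bs e \<longleftrightarrow> (\<forall>h. e h \<le> Suc (length bs))"

lemma symbol_eq_0_iff: "symbol bs p = 0 \<longleftrightarrow> p > length bs" by (auto simp: symbol_def)
lemma symbol_eq_3_iff: "symbol bs p = 3 \<longleftrightarrow> p = 0" by (auto simp: symbol_def)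

lemma exec_valid: "exec bs a e = Some e' \<Longrightarrow> valid_heads bs e \<Longrightarrow> valid_heads bs e'"
  by (cases a) (auto simp: valid_heads_def symbol_eq_0_iff le_diff_conv le_SucI split: if_splits)

lemma sem_valid: "(e, e') \<in> sem bs p \<Longrightarrow> valid_heads bs e \<Longrightarrow> valid_heads bs e'"
proof (induction p arbitrary: e e')
  case (Star p)
  have "(e, e') \<in> (sem bs p)\<^sup>*" using Star.prems by simp
  thus ?case using Star.prems(2) by (induction rule: rtrancl_induct) (auto dest: Star.IH)
qed (auto simp: exec_valid)

lemma valid_le: "valid_heads bs e \<Longrightarrow> e h \<le> Suc (length bs)" by (simp add: valid_heads_def)

text \<open>Heads below \<open>f\<close> hold the arguments and are returned unchanged, while those
  from \<open>f\<close> on are scratch and may end anywhere. Failure is the absence of a run, so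
  only the truth of \<open>P\<close> can be witnessed.\<close>

definition tests :: "nat \<Rightarrow> (bool list \<Rightarrow> heads \<Rightarrow> bool) \<Rightarrow> prog \<Rightarrow> bool" where
  "tests f P p \<longleftrightarrow> (\<forall>bs e. valid_heads bs e \<longrightarrow>
     (\<forall>e'. (e, e') \<in> sem bs p \<longrightarrow> P bs e \<and> (\<forall>i<f. e' i = e i)) \<and>
     (P bs e \<longrightarrow> (\<exists>e'. (e, e') \<in> sem bs p)))"

definition local_below :: "nat \<Rightarrow> (bool list \<Rightarrow> heads \<Rightarrow> bool) \<Rightarrow> bool" where
  "local_below f P \<longleftrightarrow> (\<forall>bs e e'. (\<forall>i<f. e i = e' i) \<longrightarrow> P bs e = P bs e')"

definition checkable :: "nat \<Rightarrow> (bool list \<Rightarrow> heads \<Rightarrow> bool) \<Rightarrow> bool" where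
  "checkable f P \<longleftrightarrow> local_below f P \<and> (\<exists>p. tests f P p)"

lemma checkableD: "checkable f P \<Longrightarrow> \<exists>p. tests f P p"
  by (simp add: checkable_def)

lemma testsI:
  assumes "\<And>bs e e'. valid_heads bs e \<Longrightarrow> (e, e') \<in> sem bs p \<Longrightarrow> P bs e"
    and "\<And>bs e e' i. valid_heads bs e \<Longrightarrow> (e, e') \<in> sem bs p \<Longrightarrow> i < f \<Longrightarrow> e' i = e i"
    and "\<And>bs e. valid_heads bs e \<Longrightarrow> P bs e \<Longrightarrow> \<exists>e'. (e, e') \<in> sem bs p"
  shows "tests f P p"
  unfolding tests_def
proof (intro allI impI conjI)
  fix bs e assume v: "valid_heads bs e"
  show "P bs e" if "(e, e') \<in> sem bs p" for e' using assms(1)[OF v that] .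
  show "e' i = e i" if "(e, e') \<in> sem bs p" "i < f" for e' i using assms(2)[OF v that] .
  show "\<exists>e'. (e, e') \<in> sem bs p" if "P bs e" using assms(3)[OF v that] .
qed

lemma tests_sound: "tests f P p \<Longrightarrow> valid_heads bs e \<Longrightarrow> (e, e') \<in> sem bs p \<Longrightarrow> P bs e"
  by (simp add: tests_def)
lemma tests_same: "tests f P p \<Longrightarrow> valid_heads bs e \<Longrightarrow> (e, e') \<in> sem bs p \<Longrightarrow> i < f \<Longrightarrow> e' i = e i"
  by (simp add: tests_def)
lemma tests_complete:
  assumes "tests f P p" "valid_heads bs e" "P bs e"
  obtains e' where "(e, e') \<in> sem bs p" "valid_heads bs e'" "\<And>i. i < f \<Longrightarrow> e' i = e i"
proof -
  have "\<exists>e'. (e, e') \<in> sem bs p" using assms unfolding tests_def by blast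
  then obtain e' where e': "(e, e') \<in> sem bs p" ..
  show ?thesis
  proof (rule that[OF e'])
    show "valid_heads bs e'" using sem_valid[OF e' assms(2)] .
    show "e' i = e i" if "i < f" for i using tests_same[OF assms(1,2) e' that] .
  qed
qed

lemma tests_ex:
  assumes "tests f P p" "valid_heads bs e" "P bs e"
  shows "\<exists>e'. (e, e') \<in> sem bs p \<and> valid_heads bs e' \<and> (\<forall>i<f. e' i = e i)"
  using assms by (rule tests_complete) blast

lemma localI: "(\<And>bs e e'. (\<And>i. i < f \<Longrightarrow> e i = e' i) \<Longrightarrow> P bs e = P bs e') \<Longrightarrow> local_below f P"
  unfolding local_below_def by (intro allI impI) blast

lemma localD:
  assumes "local_below f P" "\<And>i. i < f \<Longrightarrow> e i = e' i" shows "P bs e = P bs e'"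
proof -
  have "\<forall>i<f. e i = e' i" using assms(2) by blast
  thus ?thesis using assms(1) unfolding local_below_def by (elim allE[where x=bs] allE[where x=e] allE[where x=e'] impE)
qed

lemma checkable_symbol: "i < f \<Longrightarrow> checkable f (\<lambda>bs e. symbol bs (e i) = a)"
  unfolding checkable_def
proof (intro conjI exI)
  show "tests f (\<lambda>bs e. symbol bs (e i) = a) (Act (Read i a))"
    by (rule testsI) (auto split: if_splits)
  show "i < f \<Longrightarrow> local_below f (\<lambda>bs e. symbol bs (e i) = a)" by (rule localI) simp
qed

lemma checkable_True: "checkable f (\<lambda>bs e. True)"
  unfolding checkable_def
proof (intro conjI exI)
  show "tests f (\<lambda>bs e. True) (Act Skip)" by (rule testsI) auto
  show "local_below f (\<lambda>bs e. True)" by (rule localI) simp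
qed

lemma tests_conj:
  assumes "local_below f Q" "tests f P p" "tests f Q q"
  shows "tests f (\<lambda>bs e. P bs e \<and> Q bs e) (Seq p q)"
proof (rule testsI)
  fix bs e assume v: "valid_heads bs e"
  show "P bs e \<and> Q bs e" "\<And>i. i < f \<Longrightarrow> e' i = e i" if pq: "(e, e') \<in> sem bs (Seq p q)" for e'
  proof -
    obtain y where y: "(e, y) \<in> sem bs p" "(y, e') \<in> sem bs q" using pq by auto
    have vy: "valid_heads bs y" using sem_valid[OF y(1) v] .
    have s: "y i = e i" if "i < f" for i using tests_same[OF assms(2) v y(1) that] .
    show "P bs e \<and> Q bs e"
      using tests_sound[OF assms(2) v y(1)] tests_sound[OF assms(3) vy y(2)] localD[OF assms(1), of y e bs] s by simp
    show "e' i = e i" if "i < f" for i using tests_same[OF assms(3) vy y(2) that] s[OF that] by simp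
  qed
  show "\<exists>e'. (e, e') \<in> sem bs (Seq p q)" if PQ: "P bs e \<and> Q bs e"
  proof -
    obtain y where y: "(e, y) \<in> sem bs p" "valid_heads bs y" "\<And>i. i < f \<Longrightarrow> y i = e i"
      using tests_complete[OF assms(2) v] PQ by blast
    have "Q bs y" using localD[OF assms(1), of y e bs] y(3) PQ by simp
    from tests_complete[OF assms(3) y(2) this] obtain e' where "(y, e') \<in> sem bs q" by blast
    thus ?thesis using y(1) by auto
  qed
qed

lemma checkable_conj:
  assumes "checkable f P" "checkable f Q" shows "checkable f (\<lambda>bs e. P bs e \<and> Q bs e)"
proof -
  obtain p q where p: "local_below f P" "tests f P p" and q: "local_below f Q" "tests f Q q"
    using assms unfolding checkable_def by blast
  have "local_below f (\<lambda>bs e. P bs e \<and> Q bs e)"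
  proof (rule localI)
    fix bs :: "bool list" and e e' :: heads assume s: "\<And>i. i < f \<Longrightarrow> e i = e' i"
    show "(P bs e \<and> Q bs e) = (P bs e' \<and> Q bs e')" using localD[OF p(1) s] localD[OF q(1) s] by simp
  qed
  thus ?thesis unfolding checkable_def using tests_conj[OF q(1) p(2) q(2)] by blast
qed

lemma checkable_disj:
  assumes "checkable f P" "checkable f Q" shows "checkable f (\<lambda>bs e. P bs e \<or> Q bs e)"
proof -
  obtain p q where p: "local_below f P" "tests f P p" and q: "local_below f Q" "tests f Q q"
    using assms unfolding checkable_def by blast
  have "local_below f (\<lambda>bs e. P bs e \<or> Q bs e)"
  proof (rule localI)
    fix bs :: "bool list" and e e' :: heads assume s: "\<And>i. i < f \<Longrightarrow> e i = e' i"
    show "(P bs e \<or> Q bs e) = (P bs e' \<or> Q bs e')" using localD[OF p(1) s] localD[OF q(1) s] by simp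
  qed
  moreover have "tests f (\<lambda>bs e. P bs e \<or> Q bs e) (Alt p q)"
  proof (rule testsI)
    fix bs e assume v: "valid_heads bs e"
    show "P bs e \<or> Q bs e" if "(e, e') \<in> sem bs (Alt p q)" for e'
      using that tests_sound[OF p(2) v, of e'] tests_sound[OF q(2) v, of e'] by auto
    show "e' i = e i" if "(e, e') \<in> sem bs (Alt p q)" "i < f" for e' i
      using that tests_same[OF p(2) v, of e'] tests_same[OF q(2) v, of e'] by auto
    show "\<exists>e'. (e, e') \<in> sem bs (Alt p q)" if pq: "P bs e \<or> Q bs e"
      using pq
    proof
      assume "P bs e"
      from tests_complete[OF p(2) v this] obtain e' where "(e, e') \<in> sem bs p" by blast
      thus ?thesis by auto
    next
      assume "Q bs e"
      from tests_complete[OF q(2) v this] obtain e' where "(e, e') \<in> sem bs q" by blast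
      thus ?thesis by auto
    qed
  qed
  ultimately show ?thesis unfolding checkable_def by blast
qed

section \<open>Bounded quantification and arithmetic of positions\<close>

definition guess :: "nat \<Rightarrow> prog" where
  "guess h = Seq (Star (Act (GoL h))) (Star (Act (GoR h)))"

lemma sem_rewind: "(e, e') \<in> sem bs (Star (Act (GoL h))) \<longleftrightarrow> (\<exists>x\<le>e h. e' = e(h := x))"
proof
  assume "(e, e') \<in> sem bs (Star (Act (GoL h)))"
  hence "(e, e') \<in> (sem bs (Act (GoL h)))\<^sup>*" by simp
  thus "\<exists>x\<le>e h. e' = e(h := x)"
  proof (induction rule: rtrancl_induct)
    case base
    show ?case by (rule exI[of _ "e h"]) simp
  next
    case (step y z)
    then obtain x where x: "x \<le> e h" "y = e(h := x)" by blast
    have "z = y(h := x - 1)" using step.hyps(2) x by (auto split: if_splits)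
    thus ?case using x by (intro exI[of _ "x - 1"]) auto
  qed
next
  assume "\<exists>x\<le>e h. e' = e(h := x)"
  then obtain x where x: "x \<le> e h" "e' = e(h := x)" by blast
  have "(e, e(h := e h - k)) \<in> (sem bs (Act (GoL h)))\<^sup>*" if "k \<le> e h" for k
    using that
  proof (induction k)
    case 0
    show ?case by simp
  next
    case (Suc k)
    have "(e(h := e h - k), e(h := e h - Suc k)) \<in> sem bs (Act (GoL h))"
      using Suc.prems by (simp add: symbol_eq_3_iff)
    with Suc show ?case by (meson Suc_leD rtrancl.rtrancl_into_rtrancl)
  qed
  from this[of "e h - x"] show "(e, e') \<in> sem bs (Star (Act (GoL h)))" using x by simp
qed

lemma sem_forward:
  assumes "e h \<le> Suc (length bs)"
  shows "(e, e') \<in> sem bs (Star (Act (GoR h))) \<longleftrightarrow> (\<exists>x. e h \<le> x \<and> x \<le> Suc (length bs) \<and> e' = e(h := x))"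
proof
  assume "(e, e') \<in> sem bs (Star (Act (GoR h)))"
  hence "(e, e') \<in> (sem bs (Act (GoR h)))\<^sup>*" by simp
  thus "\<exists>x. e h \<le> x \<and> x \<le> Suc (length bs) \<and> e' = e(h := x)"
  proof (induction rule: rtrancl_induct)
    case base
    show ?case by (rule exI[of _ "e h"]) (use assms in simp)
  next
    case (step y z)
    then obtain x where x: "e h \<le> x" "y = e(h := x)" by blast
    have "z = y(h := x + 1)" "x \<le> length bs" using step.hyps(2) x by (auto simp: symbol_eq_0_iff split: if_splits)
    thus ?case using x by (intro exI[of _ "x + 1"]) auto
  qed
next
  assume "\<exists>x. e h \<le> x \<and> x \<le> Suc (length bs) \<and> e' = e(h := x)"
  then obtain x where x: "e h \<le> x" "x \<le> Suc (length bs)" "e' = e(h := x)" by blast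
  have "(e, e(h := e h + k)) \<in> (sem bs (Act (GoR h)))\<^sup>*" if "e h + k \<le> Suc (length bs)" for k
    using that
  proof (induction k)
    case 0
    show ?case by simp
  next
    case (Suc k)
    have "(e(h := e h + k), e(h := e h + Suc k)) \<in> sem bs (Act (GoR h))"
      using Suc.prems by (simp add: symbol_eq_0_iff)
    moreover have "(e, e(h := e h + k)) \<in> (sem bs (Act (GoR h)))\<^sup>*" by (rule Suc.IH) (use Suc.prems in simp)
    ultimately show ?case by (meson rtrancl.rtrancl_into_rtrancl)
  qed
  from this[of "x - e h"] show "(e, e') \<in> sem bs (Star (Act (GoR h)))" using x by simp
qed

lemma sem_guess:
  assumes "valid_heads bs e"
  shows "(e, e') \<in> sem bs (guess h) \<longleftrightarrow> (\<exists>x\<le>Suc (length bs). e' = e(h := x))"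
proof
  assume "(e, e') \<in> sem bs (guess h)"
  then obtain y where y: "(e, y) \<in> sem bs (Star (Act (GoL h)))" "(y, e') \<in> sem bs (Star (Act (GoR h)))"
    by (auto simp: guess_def)
  obtain x where x: "y = e(h := x)" using y(1) unfolding sem_rewind by blast
  have "y h \<le> Suc (length bs)" using sem_valid[OF y(1) assms] by (rule valid_le)
  thus "\<exists>x\<le>Suc (length bs). e' = e(h := x)" using y(2) sem_forward[of y h bs e'] x by auto
next
  assume "\<exists>x\<le>Suc (length bs). e' = e(h := x)"
  then obtain x where x: "x \<le> Suc (length bs)" "e' = e(h := x)" by blast
  have "(e, e(h := 0)) \<in> sem bs (Star (Act (GoL h)))" unfolding sem_rewind by (rule exI[of _ 0]) simp
  moreover have "(e(h := 0), e') \<in> sem bs (Star (Act (GoR h)))"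
    by (subst sem_forward) (use x in \<open>auto intro!: exI[of _ x]\<close>)
  ultimately show "(e, e') \<in> sem bs (guess h)" unfolding guess_def by (simp only: sem.simps) (rule relcompI)
qed

text \<open>Head \<open>f\<close> holds the guessed position and becomes an argument of the inner
  test, whose scratch heads begin one higher. The locality assumption keeps \<open>Q\<close>
  unaffected by the move of that head.\<close>

lemma checkable_ex:
  assumes Q: "checkable (Suc f) (\<lambda>bs e. Q bs e (e f))"
    and loc: "\<And>bs e e' x. (\<And>i. i < f \<Longrightarrow> e i = e' i) \<Longrightarrow> Q bs e x = Q bs e' x"
  shows "checkable f (\<lambda>bs e. \<exists>x\<le>Suc (length bs). Q bs e x)"
proof -
  obtain p where p: "tests (Suc f) (\<lambda>bs e. Q bs e (e f)) p" using checkableD[OF Q] by (rule exE)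
  have upd: "Q bs (e(f := y)) x = Q bs e x" for bs e x y by (rule loc) simp
  have "tests f (\<lambda>bs e. \<exists>x\<le>Suc (length bs). Q bs e x) (Seq (guess f) p)"
  proof (rule testsI)
    fix bs e assume v: "valid_heads bs e"
    show "\<exists>x\<le>Suc (length bs). Q bs e x" "\<And>i. i < f \<Longrightarrow> e' i = e i" if gp: "(e, e') \<in> sem bs (Seq (guess f) p)" for e'
    proof -
      obtain y where y: "(e, y) \<in> sem bs (guess f)" "(y, e') \<in> sem bs p" using gp by auto
      have vy: "valid_heads bs y" using sem_valid[OF y(1) v] .
      obtain x where x: "x \<le> Suc (length bs)" "y = e(f := x)" using y(1) sem_guess[OF v] by blast
      have "Q bs y (y f)" using tests_sound[OF p vy y(2)] .
      hence "Q bs e x" unfolding x(2) upd fun_upd_same .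
      thus "\<exists>x\<le>Suc (length bs). Q bs e x" using x(1) by blast
      show "e' i = e i" if "i < f" for i using tests_same[OF p vy y(2), of i] x that by simp
    qed
    show "\<exists>e'. (e, e') \<in> sem bs (Seq (guess f) p)" if ex: "\<exists>x\<le>Suc (length bs). Q bs e x"
    proof -
      obtain x where x: "x \<le> Suc (length bs)" "Q bs e x" using ex by blast
      have g: "(e, e(f := x)) \<in> sem bs (guess f)" using x sem_guess[OF v] by blast
      have "Q bs (e(f := x)) ((e(f := x)) f)" unfolding upd fun_upd_same using x(2) .
      from tests_ex[OF p, OF sem_valid[OF g v], OF this] obtain e' where "(e(f := x), e') \<in> sem bs p" by (elim exE conjE)
      hence "(e, e') \<in> sem bs (guess f) O sem bs p" using g by (rule_tac relcompI)
      thus ?thesis by auto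
    qed
  qed
  moreover have "local_below f (\<lambda>bs e. \<exists>x\<le>Suc (length bs). Q bs e x)"
  proof (rule localI)
    fix bs :: "bool list" and e e' :: heads assume "\<And>i. i < f \<Longrightarrow> e i = e' i"
    hence "Q bs e = Q bs e'" by (intro ext loc)
    thus "(\<exists>x\<le>Suc (length bs). Q bs e x) = (\<exists>x\<le>Suc (length bs). Q bs e' x)" by (simp only:)
  qed
  ultimately show ?thesis unfolding checkable_def by blast
qed

text \<open>The equality test moves \<open>i\<close> and \<open>j\<close> to the left marker in parallel, with \<open>s\<close> counting the moves, and back.\<close>

definition shift_left :: "nat \<Rightarrow> nat \<Rightarrow> nat \<Rightarrow> prog" where
  "shift_left i j s = Seq (Act (GoL i)) (Seq (Act (GoL j)) (Act (GoR s)))"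
definition shift_right :: "nat \<Rightarrow> nat \<Rightarrow> nat \<Rightarrow> prog" where
  "shift_right i j s = Seq (Act (GoR i)) (Seq (Act (GoR j)) (Act (GoL s)))"

definition equal_heads :: "nat \<Rightarrow> nat \<Rightarrow> nat \<Rightarrow> prog" where
  "equal_heads i j s = Seq (Star (Act (GoL s))) (Seq (Act (Read s 3)) (Seq (Star (shift_left i j s))
     (Seq (Act (Read i 3)) (Seq (Act (Read j 3)) (Seq (Star (shift_right i j s)) (Act (Read s 3)))))))"

context
  fixes i j s :: nat
  assumes d: "i \<noteq> j" "i \<noteq> s" "j \<noteq> s"
begin

lemma sem_shift_left:
  "(e, e') \<in> sem bs (shift_left i j s) \<longleftrightarrow> e i > 0 \<and> e j > 0 \<and> e s \<le> length bs \<and>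
     e' = e(i := e i - 1, j := e j - 1, s := e s + 1)"
  using d by (auto simp: shift_left_def relcomp_unfold symbol_eq_0_iff symbol_eq_3_iff)

lemma sem_shift_right:
  "(e, e') \<in> sem bs (shift_right i j s) \<longleftrightarrow> e i \<le> length bs \<and> e j \<le> length bs \<and> e s > 0 \<and>
     e' = e(i := e i + 1, j := e j + 1, s := e s - 1)"
  using d by (auto simp: shift_right_def relcomp_unfold symbol_eq_0_iff symbol_eq_3_iff)

lemma sem_shift_left_star:
  "(e, e') \<in> (sem bs (shift_left i j s))\<^sup>* \<Longrightarrow> \<exists>k \<le> e i. k \<le> e j \<and> e' = e(i := e i - k, j := e j - k, s := e s + k)"
proof (induction rule: rtrancl_induct)
  case base
  show ?case by (rule exI[of _ 0]) simp
next
  case (step y z)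
  then obtain k where k: "k \<le> e i" "k \<le> e j" "y = e(i := e i - k, j := e j - k, s := e s + k)" by blast
  have "y i > 0" "y j > 0" "z = y(i := y i - 1, j := y j - 1, s := y s + 1)"
    using step.hyps(2) by (simp_all add: sem_shift_left)
  thus ?case using k d by (intro exI[of _ "Suc k"]) (auto simp: fun_eq_iff)
qed

lemma sem_shift_right_star:
  "(e, e') \<in> (sem bs (shift_right i j s))\<^sup>* \<Longrightarrow> \<exists>k \<le> e s. e' = e(i := e i + k, j := e j + k, s := e s - k)"
proof (induction rule: rtrancl_induct)
  case base
  show ?case by (rule exI[of _ 0]) simp
next
  case (step y z)
  then obtain k where k: "k \<le> e s" "y = e(i := e i + k, j := e j + k, s := e s - k)" by blast
  have "y s > 0" "z = y(i := y i + 1, j := y j + 1, s := y s - 1)"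
    using step.hyps(2) by (simp_all add: sem_shift_right)
  thus ?case using k d by (intro exI[of _ "Suc k"]) (auto simp: fun_eq_iff)
qed

lemma shift_left_run:
  "k \<le> e i \<Longrightarrow> k \<le> e j \<Longrightarrow> e s + k \<le> Suc (length bs) \<Longrightarrow>
   (e, e(i := e i - k, j := e j - k, s := e s + k)) \<in> (sem bs (shift_left i j s))\<^sup>*"
proof (induction k)
  case (Suc k)
  have "(e(i := e i - k, j := e j - k, s := e s + k), e(i := e i - Suc k, j := e j - Suc k, s := e s + Suc k))
    \<in> sem bs (shift_left i j s)" using Suc.prems d by (auto simp: sem_shift_left fun_eq_iff)
  moreover have "(e, e(i := e i - k, j := e j - k, s := e s + k)) \<in> (sem bs (shift_left i j s))\<^sup>*"
    by (rule Suc.IH) (use Suc.prems in simp_all)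
  ultimately show ?case by (meson rtrancl.rtrancl_into_rtrancl)
qed simp

lemma shift_right_run:
  "e i + k \<le> Suc (length bs) \<Longrightarrow> e j + k \<le> Suc (length bs) \<Longrightarrow> k \<le> e s \<Longrightarrow>
   (e, e(i := e i + k, j := e j + k, s := e s - k)) \<in> (sem bs (shift_right i j s))\<^sup>*"
proof (induction k)
  case (Suc k)
  have "(e(i := e i + k, j := e j + k, s := e s - k), e(i := e i + Suc k, j := e j + Suc k, s := e s - Suc k))
    \<in> sem bs (shift_right i j s)" using Suc.prems d by (auto simp: sem_shift_right fun_eq_iff)
  moreover have "(e, e(i := e i + k, j := e j + k, s := e s - k)) \<in> (sem bs (shift_right i j s))\<^sup>*"
    by (rule Suc.IH) (use Suc.prems in simp_all)
  ultimately show ?case by (meson rtrancl.rtrancl_into_rtrancl)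
qed simp

text \<open>Both heads reach the left marker after the same number of joint moves, so they started
  at equal positions. Requiring \<open>s\<close> to be back at the marker forces exactly as many
  moves in return.\<close>

lemma equal_heads_sound:
  assumes "(e, e') \<in> sem bs (equal_heads i j s)" shows "e i = e j" "h \<noteq> s \<Longrightarrow> e' h = e h"
proof -
  obtain e1 e2 where 1: "(e, e1) \<in> sem bs (Star (Act (GoL s)))" "e1 s = 0"
    "(e1, e2) \<in> (sem bs (shift_left i j s))\<^sup>*" "e2 i = 0" "e2 j = 0"
    "(e2, e') \<in> (sem bs (shift_right i j s))\<^sup>*" "e' s = 0"
    using assms by (auto simp: equal_heads_def symbol_eq_3_iff simp del: exec.simps(3) split: if_splits)
  have e1: "e1 = e(s := 0)" using 1(1,2) unfolding sem_rewind by auto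
  obtain k where k: "k \<le> e1 i" "k \<le> e1 j" "e2 = e1(i := e1 i - k, j := e1 j - k, s := e1 s + k)"
    using sem_shift_left_star[OF 1(3)] by blast
  obtain l where l: "l \<le> e2 s" "e' = e2(i := e2 i + l, j := e2 j + l, s := e2 s - l)"
    using sem_shift_right_star[OF 1(6)] by blast
  have k': "k = e1 i" "k = e1 j" using k 1(4,5) d by auto
  thus "e i = e j" using e1 d by simp
  have "l = k" using l 1(2,7) k d by simp
  thus "h \<noteq> s \<Longrightarrow> e' h = e h" using l k k' e1 d by auto
qed

lemma equal_heads_complete:
  assumes "valid_heads bs e" "e i = e j" shows "\<exists>e'. (e, e') \<in> sem bs (equal_heads i j s)"
proof -
  let ?e1 = "e(s := 0)" and ?e2 = "e(i := 0, j := 0, s := e i)"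
  have b: "e i \<le> Suc (length bs)" using assms(1) by (rule valid_le)
  have "(e, ?e1) \<in> sem bs (Star (Act (GoL s)))" unfolding sem_rewind by (rule exI[of _ 0]) simp
  moreover have "(?e1, ?e2) \<in> sem bs (Star (shift_left i j s))"
    using shift_left_run[of "e i" ?e1 bs] assms(2) b d by (simp add: fun_upd_twist)
  moreover have "(?e2, e(s := 0)) \<in> sem bs (Star (shift_right i j s))"
  proof -
    have "?e2(i := ?e2 i + e i, j := ?e2 j + e i, s := ?e2 s - e i) = e(s := 0)" using assms(2) d by (auto simp: fun_eq_iff)
    thus ?thesis using shift_right_run[of ?e2 "e i" bs] b d by simp
  qed
  moreover have "(?e1, ?e1) \<in> sem bs (Act (Read s 3))" "(?e2, ?e2) \<in> sem bs (Act (Read i 3))" "(?e2, ?e2) \<in> sem bs (Act (Read j 3))"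
    using d by (simp_all add: symbol_eq_3_iff)
  ultimately have "(e, ?e1) \<in> sem bs (equal_heads i j s)"
    unfolding equal_heads_def sem.simps(2) by (intro relcompI)
  thus ?thesis by blast
qed

end

lemma checkable_eq: "i < f \<Longrightarrow> j < f \<Longrightarrow> checkable f (\<lambda>bs e. e i = e j)"
proof (cases "i = j")
  case True
  thus ?thesis using checkable_True by simp
next
  case False
  assume f: "i < f" "j < f"
  have "tests f (\<lambda>bs e. e i = e j) (equal_heads i j f)"
  proof (rule testsI)
    have d: "i \<noteq> j" "i \<noteq> f" "j \<noteq> f" using f False by auto
    fix bs :: "bool list" and e :: heads assume v: "valid_heads bs e"
    show "e i = e j" if "(e, e') \<in> sem bs (equal_heads i j f)" for e' using equal_heads_sound(1)[OF d that] .
    show "e' h = e h" if "(e, e') \<in> sem bs (equal_heads i j f)" "h < f" for e' h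
      using equal_heads_sound(2)[OF d that(1)] that(2) by simp
    show "\<exists>e'. (e, e') \<in> sem bs (equal_heads i j f)" if "e i = e j" using equal_heads_complete[OF d v that] .
  qed
  moreover have "local_below f (\<lambda>bs e. e i = e j)" by (rule localI) (use f in simp)
  ultimately show ?thesis unfolding checkable_def by blast
qed

text \<open>A scratch head is put on the position of \<open>i\<close>, moved once to the right and
  compared with \<open>j\<close>. The move fails only at the right end marker, where no successor
  position exists.\<close>

lemma checkable_Suc:
  assumes "i < f" "j < f" shows "checkable f (\<lambda>bs e. e j = Suc (e i))"
proof -
  obtain p where p: "tests (Suc f) (\<lambda>bs e. e f = e i) p" using checkable_eq[of f "Suc f" i] assms unfolding checkable_def by auto
  obtain q where q: "tests (Suc f) (\<lambda>bs e. e f = e j) q" using checkable_eq[of f "Suc f" j] assms unfolding checkable_def by auto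
  let ?r = "Seq (guess f) (Seq p (Seq (Act (GoR f)) q))"
  have "tests f (\<lambda>bs e. e j = Suc (e i)) ?r"
  proof (rule testsI)
    fix bs e assume v: "valid_heads bs e"
    show "e j = Suc (e i)" "\<And>h. h < f \<Longrightarrow> e' h = e h" if r: "(e, e') \<in> sem bs ?r" for e'
    proof -
      obtain e1 e2 e3 where 1: "(e, e1) \<in> sem bs (guess f)" "(e1, e2) \<in> sem bs p" "(e2, e3) \<in> sem bs (Act (GoR f))" "(e3, e') \<in> sem bs q"
        using r unfolding sem.simps(2) by blast
      have v1: "valid_heads bs e1" using sem_valid[OF 1(1) v] .
      have v2: "valid_heads bs e2" using sem_valid[OF 1(2) v1] .
      have v3: "valid_heads bs e3" using sem_valid[OF 1(3) v2] .
      obtain x where x: "e1 = e(f := x)" using 1(1) sem_guess[OF v] by blast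
      have "e1 f = e1 i" using tests_sound[OF p v1 1(2)] .
      moreover have "e3 f = e3 j" using tests_sound[OF q v3 1(4)] .
      moreover have s2: "e2 h = e1 h" if "h < Suc f" for h using tests_same[OF p v1 1(2) that] .
      moreover have e3: "e3 = e2(f := e2 f + 1)" using 1(3) by (auto split: if_splits)
      ultimately show "e j = Suc (e i)" using x assms by simp
      show "e' h = e h" if "h < f" for h using tests_same[OF q v3 1(4), of h] e3 s2[of h] x that by simp
    qed
    show "\<exists>e'. (e, e') \<in> sem bs ?r" if ji: "e j = Suc (e i)"
    proof -
      have b: "e i \<le> length bs" using valid_le[OF v, of j] ji by simp
      let ?e1 = "e(f := e i)"
      have g: "(e, ?e1) \<in> sem bs (guess f)" unfolding sem_guess[OF v] by (rule exI[of _ "e i"]) (use b in simp)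
      have v1: "valid_heads bs ?e1" using sem_valid[OF g v] .
      have "?e1 f = ?e1 i" by simp
      from tests_ex[OF p, OF v1, OF this] obtain e2 where e2: "(?e1, e2) \<in> sem bs p" "valid_heads bs e2" "\<And>i. i < Suc f \<Longrightarrow> e2 i = ?e1 i"
        by blast
      let ?e3 = "e2(f := e2 f + 1)"
      have s: "(e2, ?e3) \<in> sem bs (Act (GoR f))" using e2(3)[of f] b by (simp add: symbol_eq_0_iff)
      have "?e3 f = ?e3 j" using e2(3)[of f] e2(3)[of j] ji assms by simp
      from tests_ex[OF q, OF sem_valid[OF s e2(2)], OF this] obtain e' where "(?e3, e') \<in> sem bs q" by blast
      thus ?thesis unfolding sem.simps(2) using g e2(1) s by blast
    qed
  qed
  moreover have "local_below f (\<lambda>bs e. e j = Suc (e i))" by (rule localI) (use assms in simp)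
  ultimately show ?thesis unfolding checkable_def by blast
qed

section \<open>Lists of positions and transitive closure\<close>

primrec guesses :: "nat list \<Rightarrow> prog" where
  "guesses [] = Act Skip"
| "guesses (h # hs) = Seq (guess h) (guesses hs)"

lemma guesses_sound:
  "(e, e') \<in> sem bs (guesses hs) \<Longrightarrow> valid_heads bs e \<Longrightarrow> h \<notin> set hs \<Longrightarrow> e' h = e h"
proof (induction hs arbitrary: e)
  case (Cons k hs)
  then obtain y where y: "(e, y) \<in> sem bs (guess k)" "(y, e') \<in> sem bs (guesses hs)" by auto
  have "e' h = y h" using Cons.IH[OF y(2) sem_valid[OF y(1) Cons.prems(2)]] Cons.prems(3) by simp
  moreover obtain x where "y = e(k := x)" using y(1) unfolding sem_guess[OF Cons.prems(2)] by blast
  ultimately show ?case using Cons.prems(3) by simp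
qed simp

lemma guesses_complete:
  "valid_heads bs e \<Longrightarrow> distinct hs \<Longrightarrow> length xs = length hs \<Longrightarrow> set xs \<subseteq> {..Suc (length bs)} \<Longrightarrow>
   \<exists>e'. (e, e') \<in> sem bs (guesses hs) \<and> map e' hs = xs"
proof (induction hs arbitrary: e xs)
  case (Cons k hs)
  then obtain x ys where x: "xs = x # ys" by (cases xs) auto
  have g: "(e, e(k := x)) \<in> sem bs (guess k)"
    unfolding sem_guess[OF Cons.prems(1)] using Cons.prems(4) x by auto
  have v: "valid_heads bs (e(k := x))" using sem_valid[OF g Cons.prems(1)] .
  obtain e' where e': "(e(k := x), e') \<in> sem bs (guesses hs)" "map e' hs = ys"
  proof -
    have "distinct hs" "length ys = length hs" "set ys \<subseteq> {..Suc (length bs)}" using Cons.prems(2-4) x by auto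
    from Cons.IH[OF v this] show ?thesis using that by blast
  qed
  have "e' k = x" using guesses_sound[OF e'(1) v, of k] Cons.prems(2) by simp
  moreover have "(e, e') \<in> sem bs (guesses (k # hs))" unfolding guesses.simps sem.simps using g e'(1) by (rule relcompI)
  ultimately show ?case using e'(2) x by (intro exI[of _ e']) simp
qed simp

lemma checkable_eq_list:
  "length is = length js \<Longrightarrow> set is \<subseteq> {..<f} \<Longrightarrow> set js \<subseteq> {..<f} \<Longrightarrow> checkable f (\<lambda>bs e. map e is = map e js)"
proof (induction "is" js rule: list_induct2)
  case (Cons i "is" j js)
  have "checkable f (\<lambda>bs e. e i = e j \<and> map e is = map e js)"
    by (rule checkable_conj[OF checkable_eq Cons.IH]) (use Cons.prems in auto)
  thus ?case by (simp only: list.map list.inject)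
qed (simp add: checkable_True)

definition bounded_step :: "nat \<Rightarrow> bool list \<Rightarrow> (nat list \<Rightarrow> nat list \<Rightarrow> bool) \<Rightarrow> (nat list \<times> nat list) set" where
  "bounded_step m bs R = {(xs, ys). length ys = m \<and> set ys \<subseteq> {..Suc (length bs)} \<and> R xs ys}"

text \<open>The heads \<open>cur\<close> hold the current list. A round guesses its successor on
  \<open>nxt\<close>, tests the step, then guesses \<open>cur\<close> anew and compares, since
  guessing and comparing is how one head is set to the position of another. The arguments below
  \<open>f\<close> survive every round, so by locality all rounds test the same relation.\<close>

theorem checkable_rtrancl_list:
  fixes f m :: nat
  defines "cur \<equiv> [f..<f + m]" and "nxt \<equiv> [f + m..<f + 2 * m]"
  assumes R: "checkable (f + 2 * m) (\<lambda>bs e. R bs e (map e cur) (map e nxt))"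
    and loc: "\<And>bs e e' xs ys. (\<And>i. i < f \<Longrightarrow> e i = e' i) \<Longrightarrow> R bs e xs ys = R bs e' xs ys"
    and ij: "length is = m" "length js = m" "set is \<subseteq> {..<f}" "set js \<subseteq> {..<f}"
  shows "checkable f (\<lambda>bs e. (map e is, map e js) \<in> (bounded_step m bs (R bs e))\<^sup>*)"
proof -
  let ?F = "f + 2 * m"
  have cn: "length cur = m" "length nxt = m" "set cur \<subseteq> {..<?F}" "set nxt \<subseteq> {..<?F}" "distinct cur" "distinct nxt"
    by (auto simp: cur_def nxt_def)
  have disj: "set cur \<inter> set nxt = {}" "\<And>h. h < f \<Longrightarrow> h \<notin> set cur \<and> h \<notin> set nxt" by (auto simp: cur_def nxt_def)
  have ij': "set is \<subseteq> {..<?F}" "set js \<subseteq> {..<?F}" using ij by auto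
  obtain r where r: "tests ?F (\<lambda>bs e. R bs e (map e cur) (map e nxt)) r" using checkableD[OF R] by (rule exE)
  obtain c where c: "tests ?F (\<lambda>bs e. map e cur = map e nxt) c"
    using checkableD[OF checkable_eq_list[of cur nxt ?F]] cn ij ij' by auto
  obtain a where a: "tests ?F (\<lambda>bs e. map e cur = map e is) a"
    using checkableD[OF checkable_eq_list[of cur "is" ?F]] cn ij ij' by auto
  obtain b where b: "tests ?F (\<lambda>bs e. map e cur = map e js) b"
    using checkableD[OF checkable_eq_list[of cur js ?F]] cn ij ij' by auto
  define body where "body = Seq (guesses nxt) (Seq r (Seq (guesses cur) c))"
  define p where "p = Seq (guesses cur) (Seq a (Seq (Star body) b))"
  have bounded: "set (map e xs) \<subseteq> {..Suc (length bs)}" if "valid_heads bs e" for e bs xs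
    using that by (auto simp: valid_heads_def)
  have same_map: "map e hs = map e' hs" if "\<forall>h<?F. e h = e' h" "set hs \<subseteq> {..<?F}" for e e' :: heads and hs
  proof (rule map_cong[OF refl])
    fix h assume "h \<in> set hs"
    thus "e h = e' h" using that by blast
  qed
  have body_sound: "(\<forall>h<f. e' h = e h) \<and> (map e cur, map e' cur) \<in> bounded_step m bs (R bs e)"
    if v: "valid_heads bs e" and ee: "(e, e') \<in> sem bs body" for bs e e'
  proof -
    obtain e1 e2 e3 where 1: "(e, e1) \<in> sem bs (guesses nxt)" "(e1, e2) \<in> sem bs r" "(e2, e3) \<in> sem bs (guesses cur)" "(e3, e') \<in> sem bs c"
      using ee unfolding body_def sem.simps(2) by blast
    have v1: "valid_heads bs e1" using sem_valid[OF 1(1) v] .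
    have v2: "valid_heads bs e2" using sem_valid[OF 1(2) v1] .
    have v3: "valid_heads bs e3" using sem_valid[OF 1(3) v2] .
    have s1: "e1 h = e h" if "h \<notin> set nxt" for h using guesses_sound[OF 1(1) v that] .
    have s2: "e2 h = e1 h" if "h < ?F" for h using tests_same[OF r v1 1(2) that] .
    have s3: "e3 h = e2 h" if "h \<notin> set cur" for h using guesses_sound[OF 1(3) v2 that] .
    have s4: "e' h = e3 h" if "h < ?F" for h using tests_same[OF c v3 1(4) that] .
    have low: "e' h = e h" "e1 h = e h" if "h < f" for h
      using s1[of h] s2[of h] s3[of h] s4[of h] disj(2)[OF that] that by auto
    have step: "R bs e1 (map e1 cur) (map e1 nxt)" using tests_sound[OF r v1 1(2)] .
    have 2: "map e1 cur = map e cur" using s1 disj(1) by auto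
    have "map e1 nxt = map e3 nxt"
    proof (rule map_cong[OF refl])
      fix h assume "h \<in> set nxt"
      hence "h < ?F" "h \<notin> set cur" using disj(1) cn(4) by auto
      thus "e1 h = e3 h" using s2[of h] s3[of h] by simp
    qed
    also have "map e3 nxt = map e3 cur" using tests_sound[OF c v3 1(4)] by (rule sym)
    also have "map e3 cur = map e' cur" by (rule same_map[OF _ cn(3)]) (simp add: s4)
    finally have 3: "map e1 nxt = map e' cur" .
    have 4: "R bs e1 = R bs e" by (intro ext loc low(2))
    have "R bs e (map e cur) (map e' cur)" using step unfolding 2 3 4 .
    moreover have "set (map e' cur) \<subseteq> {..Suc (length bs)}" using sem_valid[OF 1(4) v3] by (rule bounded)
    ultimately have "(map e cur, map e' cur) \<in> bounded_step m bs (R bs e)"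
      unfolding bounded_step_def using cn(1) by simp
    thus ?thesis using low(1) by blast
  qed
  have body_complete: "\<exists>e'. (e, e') \<in> sem bs body \<and> valid_heads bs e' \<and> (\<forall>h<f. e' h = e h) \<and> map e' cur = ys"
    if v: "valid_heads bs e" and xy: "(map e cur, ys) \<in> bounded_step m bs (R bs e)" for bs e ys
  proof -
    have ys: "length ys = m" "set ys \<subseteq> {..Suc (length bs)}" "R bs e (map e cur) ys" using xy by (auto simp: bounded_step_def)
    obtain e1 where e1: "(e, e1) \<in> sem bs (guesses nxt)" "map e1 nxt = ys"
      using guesses_complete[OF v cn(6)] ys cn by metis
    have v1: "valid_heads bs e1" using sem_valid[OF e1(1) v] .
    have s1: "e1 h = e h" if "h \<notin> set nxt" for h using guesses_sound[OF e1(1) v that] .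
    have 1: "map e1 cur = map e cur" using s1 disj(1) by auto
    have 2: "R bs e1 = R bs e" by (intro ext loc s1) (use disj(2) in blast)
    have "R bs e1 (map e1 cur) (map e1 nxt)" unfolding 1 2 e1(2) using ys(3) .
    from tests_ex[OF r, OF v1, OF this] obtain e2 where e2: "(e1, e2) \<in> sem bs r" "valid_heads bs e2" "\<And>i. i < ?F \<Longrightarrow> e2 i = e1 i" by blast
    obtain e3 where e3: "(e2, e3) \<in> sem bs (guesses cur)" "map e3 cur = ys"
      using guesses_complete[OF e2(2) cn(5)] ys cn by metis
    have v3: "valid_heads bs e3" using sem_valid[OF e3(1) e2(2)] .
    have s3: "e3 h = e2 h" if "h \<notin> set cur" for h using guesses_sound[OF e3(1) e2(2) that] .
    have "map e3 nxt = map e1 nxt"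
    proof (rule map_cong[OF refl])
      fix h assume "h \<in> set nxt"
      hence "h < ?F" "h \<notin> set cur" using disj(1) cn(4) by auto
      thus "e3 h = e1 h" using e2(3)[of h] s3[of h] by simp
    qed
    hence "map e3 cur = map e3 nxt" unfolding e1(2) e3(2) by (rule sym)
    from tests_ex[OF c, OF v3, OF this] obtain e4 where e4: "(e3, e4) \<in> sem bs c" "valid_heads bs e4" "\<And>i. i < ?F \<Longrightarrow> e4 i = e3 i" by blast
    have "(e, e4) \<in> sem bs body" unfolding body_def sem.simps(2) using e1(1) e2(1) e3(1) e4(1) by blast
    moreover have "map e4 cur = map e3 cur" by (rule same_map[OF _ cn(3)]) (simp add: e4(3))
    hence "map e4 cur = ys" unfolding e3(2) .
    moreover have "e4 h = e h" if "h < f" for h using disj(2)[OF that] that s1[of h] e2(3)[of h] s3[of h] e4(3)[of h] by simp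
    ultimately show ?thesis using e4(2) by blast
  qed
  have star_sound: "(\<forall>h<f. e' h = e h) \<and> (map e cur, map e' cur) \<in> (bounded_step m bs (R bs e))\<^sup>* \<and> valid_heads bs e'"
    if v: "valid_heads bs e" and ee: "(e, e') \<in> (sem bs body)\<^sup>*" for bs e e'
    using ee
  proof (induction rule: rtrancl_induct)
    case base
    show ?case using v by simp
  next
    case (step y z)
    have R: "R bs y = R bs e" by (intro ext loc) (use step.IH in blast)
    have "(\<forall>h<f. z h = y h) \<and> (map y cur, map z cur) \<in> bounded_step m bs (R bs e)"
      using body_sound[OF _ step.hyps(2)] step.IH unfolding R by blast
    thus ?case using step.IH sem_valid[OF step.hyps(2)] by (metis rtrancl.rtrancl_into_rtrancl)
  qed
  have star_complete: "\<exists>e'. (e, e') \<in> (sem bs body)\<^sup>* \<and> valid_heads bs e' \<and> (\<forall>h<f. e' h = e h) \<and> map e' cur = ys"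
    if v: "valid_heads bs e" and xy: "(map e cur, ys) \<in> (bounded_step m bs (R bs e))\<^sup>*" for bs e ys
    using xy
  proof (induction rule: rtrancl_induct)
    case base
    show ?case using v by blast
  next
    case (step y z)
    obtain e1 where e1: "(e, e1) \<in> (sem bs body)\<^sup>*" "valid_heads bs e1" "\<forall>h<f. e1 h = e h" "map e1 cur = y" using step.IH by blast
    have R: "R bs e1 = R bs e" by (intro ext loc) (use e1(3) in blast)
    have "(map e1 cur, z) \<in> bounded_step m bs (R bs e1)" unfolding R e1(4) using step.hyps(2) .
    from body_complete[OF e1(2) this] obtain e' where e': "(e1, e') \<in> sem bs body" "valid_heads bs e'" "\<forall>h<f. e' h = e1 h" "map e' cur = z" by blast
    have "e' h = e h" if "h < f" for h using e'(3) e1(3) that by simp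
    thus ?case using rtrancl_into_rtrancl[OF e1(1) e'(1)] e'(2,4) by blast
  qed
  have "tests f (\<lambda>bs e. (map e is, map e js) \<in> (bounded_step m bs (R bs e))\<^sup>*) p"
  proof (rule testsI)
    fix bs e assume v: "valid_heads bs e"
    show "(map e is, map e js) \<in> (bounded_step m bs (R bs e))\<^sup>*" "\<And>h. h < f \<Longrightarrow> e' h = e h" if ee: "(e, e') \<in> sem bs p" for e'
    proof -
      obtain e1 e2 e3 where 1: "(e, e1) \<in> sem bs (guesses cur)" "(e1, e2) \<in> sem bs a" "(e2, e3) \<in> (sem bs body)\<^sup>*" "(e3, e') \<in> sem bs b"
        using ee unfolding p_def sem.simps(2,4) by blast
      have v1: "valid_heads bs e1" using sem_valid[OF 1(1) v] .
      have v2: "valid_heads bs e2" using sem_valid[OF 1(2) v1] .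
      note st = star_sound[OF v2 1(3)]
      have v3: "valid_heads bs e3" using st by blast
      have s1: "e1 h = e h" if "h < f" for h using guesses_sound[OF 1(1) v] disj(2)[OF that] by simp
      have s2: "e2 h = e1 h" if "h < ?F" for h using tests_same[OF a v1 1(2) that] .
      have s4: "e' h = e3 h" if "h < ?F" for h using tests_same[OF b v3 1(4) that] .
      have low: "e2 h = e h" "e3 h = e h" "e' h = e h" if "h < f" for h
        using that s1[of h] s2[of h] s4[of h] st by simp_all
      show "e' h = e h" if "h < f" for h using low(3)[OF that] .
      have "map e2 cur = map e1 cur" by (rule same_map[OF _ cn(3)]) (simp add: s2)
      also have "\<dots> = map e1 is" using tests_sound[OF a v1 1(2)] .
      also have "\<dots> = map e is" using s1 ij(3) by auto
      finally have i: "map e2 cur = map e is" .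
      have "map e3 cur = map e3 js" using tests_sound[OF b v3 1(4)] .
      also have "\<dots> = map e js" using low(2) ij(4) by auto
      finally have j: "map e3 cur = map e js" .
      have "R bs e2 = R bs e" by (intro ext loc low(1))
      thus "(map e is, map e js) \<in> (bounded_step m bs (R bs e))\<^sup>*" using st unfolding i j by simp
    qed
    show "\<exists>e'. (e, e') \<in> sem bs p" if S: "(map e is, map e js) \<in> (bounded_step m bs (R bs e))\<^sup>*"
    proof -
      obtain e1 where e1: "(e, e1) \<in> sem bs (guesses cur)" "map e1 cur = map e is"
        using guesses_complete[OF v cn(5), of "map e is"] bounded[OF v] ij(1) cn(1) by auto
      have v1: "valid_heads bs e1" using sem_valid[OF e1(1) v] .
      have s1: "e1 h = e h" if "h < f" for h using guesses_sound[OF e1(1) v] disj(2)[OF that] by simp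
      have "map e1 is = map e is" using s1 ij(3) by auto
      hence "map e1 cur = map e1 is" unfolding e1(2) by (rule sym)
      from tests_ex[OF a, OF v1, OF this] obtain e2 where e2: "(e1, e2) \<in> sem bs a" "valid_heads bs e2" "\<And>i. i < ?F \<Longrightarrow> e2 i = e1 i" by blast
      have s2: "e2 h = e h" if "h < f" for h using that s1 e2(3) by simp
      have "map e2 cur = map e1 cur" by (rule same_map[OF _ cn(3)]) (simp add: e2(3))
      hence 1: "map e2 cur = map e is" unfolding e1(2) .
      have 2: "R bs e2 = R bs e" by (intro ext loc s2)
      have "(map e2 cur, map e js) \<in> (bounded_step m bs (R bs e2))\<^sup>*" unfolding 1 2 using S .
      from star_complete[OF e2(2) this] obtain e3 where e3: "(e2, e3) \<in> (sem bs body)\<^sup>*" "valid_heads bs e3" "\<forall>h<f. e3 h = e2 h" "map e3 cur = map e js" by blast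
      have "map e3 js = map e js" using s2 e3(3) ij(4) by auto
      hence "map e3 cur = map e3 js" unfolding e3(4) by (rule sym)
      from tests_ex[OF b, OF e3(2), OF this] obtain e' where "(e3, e') \<in> sem bs b" by blast
      thus ?thesis unfolding p_def sem.simps(2,4) using e1(1) e2(1) e3(1) by blast
    qed
  qed
  moreover have "local_below f (\<lambda>bs e. (map e is, map e js) \<in> (bounded_step m bs (R bs e))\<^sup>*)"
  proof (rule localI)
    fix bs :: "bool list" and e e' :: heads assume s: "\<And>i. i < f \<Longrightarrow> e i = e' i"
    have "R bs e = R bs e'" by (intro ext loc s)
    moreover have "map e is = map e' is" "map e js = map e' js" using s ij(3,4) by auto
    ultimately show "((map e is, map e js) \<in> (bounded_step m bs (R bs e))\<^sup>*) = ((map e' is, map e' js) \<in> (bounded_step m bs (R bs e'))\<^sup>*)"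
      by (simp only:)
  qed
  ultimately show ?thesis unfolding checkable_def by blast
qed

lemma checkable_ex_list:
  assumes "checkable (f + m) (\<lambda>bs e. Q bs e (map e [f..<f + m]))"
    and "\<And>bs e e' xs. (\<And>i. i < f \<Longrightarrow> e i = e' i) \<Longrightarrow> Q bs e xs = Q bs e' xs"
  shows "checkable f (\<lambda>bs e. \<exists>xs. length xs = m \<and> set xs \<subseteq> {..Suc (length bs)} \<and> Q bs e xs)"
  using assms
proof (induction m arbitrary: f Q)
  case 0
  show ?case using 0(1) by simp
next
  case (Suc m)
  have eq: "(\<exists>xs. length xs = Suc m \<and> set xs \<subseteq> {..Suc (length bs)} \<and> Q bs e xs) \<longleftrightarrow>
    (\<exists>x\<le>Suc (length bs). \<exists>ys. length ys = m \<and> set ys \<subseteq> {..Suc (length bs)} \<and> Q bs e (x # ys))"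
    for bs :: "bool list" and e :: heads
  proof
    assume "\<exists>xs. length xs = Suc m \<and> set xs \<subseteq> {..Suc (length bs)} \<and> Q bs e xs"
    then obtain xs where xs: "length xs = Suc m" "set xs \<subseteq> {..Suc (length bs)}" "Q bs e xs" by blast
    obtain x ys where "xs = x # ys" using xs(1) by (cases xs) auto
    thus "\<exists>x\<le>Suc (length bs). \<exists>ys. length ys = m \<and> set ys \<subseteq> {..Suc (length bs)} \<and> Q bs e (x # ys)"
      using xs by (intro exI[of _ x] conjI exI[of _ ys]) auto
  next
    assume "\<exists>x\<le>Suc (length bs). \<exists>ys. length ys = m \<and> set ys \<subseteq> {..Suc (length bs)} \<and> Q bs e (x # ys)"
    then obtain x ys where "x \<le> Suc (length bs)" "length ys = m" "set ys \<subseteq> {..Suc (length bs)}" "Q bs e (x # ys)" by blast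
    thus "\<exists>xs. length xs = Suc m \<and> set xs \<subseteq> {..Suc (length bs)} \<and> Q bs e xs"
      by (intro exI[of _ "x # ys"] conjI) auto
  qed
  have c: "checkable (Suc f) (\<lambda>bs e. \<exists>ys. length ys = m \<and> set ys \<subseteq> {..Suc (length bs)} \<and> Q bs e (e f # ys))"
  proof (rule Suc.IH[where Q = "\<lambda>bs e ys. Q bs e (e f # ys)"])
    show "checkable (Suc f + m) (\<lambda>bs e. Q bs e (e f # map e [Suc f..<Suc f + m]))"
      using Suc.prems(1) by (simp add: upt_conv_Cons del: upt_Suc)
    show "Q bs e (e f # ys) = Q bs e' (e' f # ys)" if "\<And>i. i < Suc f \<Longrightarrow> e i = e' i" for bs :: "bool list" and e e' :: heads and ys
    proof -
      have "e f = e' f" by (rule that) simp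
      moreover have "Q bs e = Q bs e'" by (intro ext Suc.prems(2) that) simp
      ultimately show ?thesis by (simp only:)
    qed
  qed
  show ?case unfolding eq
  proof (rule checkable_ex[where Q = "\<lambda>bs e x. \<exists>ys. length ys = m \<and> set ys \<subseteq> {..Suc (length bs)} \<and> Q bs e (x # ys)"])
    show "checkable (Suc f) (\<lambda>bs e. \<exists>ys. length ys = m \<and> set ys \<subseteq> {..Suc (length bs)} \<and> Q bs e (e f # ys))" by (rule c)
  next
    fix bs :: "bool list" and e e' :: heads and x assume "\<And>i. i < f \<Longrightarrow> e i = e' i"
    hence "Q bs e = Q bs e'" by (intro ext Suc.prems(2))
    thus "(\<exists>ys. length ys = m \<and> set ys \<subseteq> {..Suc (length bs)} \<and> Q bs e (x # ys)) =
      (\<exists>ys. length ys = m \<and> set ys \<subseteq> {..Suc (length bs)} \<and> Q bs e' (x # ys))" by (simp only:)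
  qed
qed

text \<open>Reachability with one, two and four heads is what the checks need: scanning a list,
  comparing two numbers, and walking through four tuples in parallel. Positions reached on the way
  are bounded because they are guessed.\<close>

inductive reach1 :: "bool list \<Rightarrow> (nat \<Rightarrow> nat \<Rightarrow> bool) \<Rightarrow> (nat \<Rightarrow> bool) \<Rightarrow> nat \<Rightarrow> bool" for bs R G where
  goal1: "p \<le> Suc (length bs) \<Longrightarrow> G p \<Longrightarrow> reach1 bs R G p"
| step1: "q \<le> Suc (length bs) \<Longrightarrow> R p q \<Longrightarrow> reach1 bs R G q \<Longrightarrow> reach1 bs R G p"

inductive reach2 :: "bool list \<Rightarrow> (nat \<Rightarrow> nat \<Rightarrow> nat \<Rightarrow> nat \<Rightarrow> bool) \<Rightarrow> (nat \<Rightarrow> nat \<Rightarrow> bool) \<Rightarrow> nat \<Rightarrow> nat \<Rightarrow> bool" for bs R G where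
  goal2: "p \<le> Suc (length bs) \<Longrightarrow> p' \<le> Suc (length bs) \<Longrightarrow> G p p' \<Longrightarrow> reach2 bs R G p p'"
| step2: "q \<le> Suc (length bs) \<Longrightarrow> q' \<le> Suc (length bs) \<Longrightarrow> R p p' q q' \<Longrightarrow> reach2 bs R G q q' \<Longrightarrow> reach2 bs R G p p'"

inductive reach4 :: "bool list \<Rightarrow> (nat \<Rightarrow> nat \<Rightarrow> nat \<Rightarrow> nat \<Rightarrow> nat \<Rightarrow> nat \<Rightarrow> nat \<Rightarrow> nat \<Rightarrow> bool) \<Rightarrow>
    (nat \<Rightarrow> nat \<Rightarrow> nat \<Rightarrow> nat \<Rightarrow> bool) \<Rightarrow> nat \<Rightarrow> nat \<Rightarrow> nat \<Rightarrow> nat \<Rightarrow> bool" for bs R G where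
  goal4: "set [p1, p2, p3, p4] \<subseteq> {..Suc (length bs)} \<Longrightarrow> G p1 p2 p3 p4 \<Longrightarrow> reach4 bs R G p1 p2 p3 p4"
| step4: "set [q1, q2, q3, q4] \<subseteq> {..Suc (length bs)} \<Longrightarrow> R p1 p2 p3 p4 q1 q2 q3 q4 \<Longrightarrow> reach4 bs R G q1 q2 q3 q4 \<Longrightarrow>
    reach4 bs R G p1 p2 p3 p4"

definition reach_list :: "nat \<Rightarrow> bool list \<Rightarrow> (nat list \<Rightarrow> nat list \<Rightarrow> bool) \<Rightarrow> (nat list \<Rightarrow> bool) \<Rightarrow> nat list \<Rightarrow> bool" where
  "reach_list m bs R G xs \<longleftrightarrow>
     (\<exists>zs. length zs = m \<and> set zs \<subseteq> {..Suc (length bs)} \<and> G zs \<and> (xs, zs) \<in> (bounded_step m bs R)\<^sup>*)"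

lemma reach_listI:
  "length xs = m \<Longrightarrow> set xs \<subseteq> {..Suc (length bs)} \<Longrightarrow> G xs \<Longrightarrow> reach_list m bs R G xs"
  "length ys = m \<Longrightarrow> set ys \<subseteq> {..Suc (length bs)} \<Longrightarrow> R xs ys \<Longrightarrow> reach_list m bs R G ys \<Longrightarrow> reach_list m bs R G xs"
  unfolding reach_list_def
  by (intro exI[of _ xs] conjI rtrancl_refl; assumption)
    (elim exE conjE, rule exI, intro conjI, assumption, assumption, assumption, rule converse_rtrancl_into_rtrancl[of xs ys],
      simp_all add: bounded_step_def)

lemma reach_list_induct:
  assumes "reach_list m bs R G xs" "length xs = m"
    and "\<And>xs. length xs = m \<Longrightarrow> set xs \<subseteq> {..Suc (length bs)} \<Longrightarrow> G xs \<Longrightarrow> P xs"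
    and "\<And>xs ys. length xs = m \<Longrightarrow> length ys = m \<Longrightarrow> set ys \<subseteq> {..Suc (length bs)} \<Longrightarrow> R xs ys \<Longrightarrow> P ys \<Longrightarrow> P xs"
  shows "P xs"
proof -
  obtain zs where zs: "length zs = m" "set zs \<subseteq> {..Suc (length bs)}" "G zs" "(xs, zs) \<in> (bounded_step m bs R)\<^sup>*"
    using assms(1) unfolding reach_list_def by (elim exE conjE)
  have "length xs = m \<longrightarrow> P xs" using zs(4)
  proof (induction rule: converse_rtrancl_induct)
    case base
    show ?case using assms(3)[OF zs(1-3)] by simp
  next
    case (step y z)
    have z: "length z = m" "set z \<subseteq> {..Suc (length bs)}" "R y z" using step.hyps(1) by (simp_all add: bounded_step_def)
    show ?case using assms(4)[OF _ z] step.IH z(1) by simp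
  qed
  thus ?thesis using assms(2) by simp
qed

text \<open>The step relation is needed at all offsets \<open>g \<ge> f\<close>, because the guessed
  goal occupies \<open>m\<close> heads below those used for the steps.\<close>

lemma checkable_reach_list:
  assumes R: "\<And>g. f \<le> g \<Longrightarrow> checkable (g + 2 * m) (\<lambda>bs e. R bs e (map e [g..<g + m]) (map e [g + m..<g + 2 * m]))"
    and G: "checkable (f + m) (\<lambda>bs e. G bs e (map e [f..<f + m]))"
    and locR: "\<And>bs e e' xs ys. (\<And>i. i < f \<Longrightarrow> e i = e' i) \<Longrightarrow> R bs e xs ys = R bs e' xs ys"
    and locG: "\<And>bs e e' xs. (\<And>i. i < f \<Longrightarrow> e i = e' i) \<Longrightarrow> G bs e xs = G bs e' xs"
    and i: "length is = m" "set is \<subseteq> {..<f}"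
  shows "checkable f (\<lambda>bs e. reach_list m bs (R bs e) (G bs e) (map e is))"
  unfolding reach_list_def
proof (rule checkable_ex_list[where Q = "\<lambda>bs e zs. G bs e zs \<and> (map e is, zs) \<in> (bounded_step m bs (R bs e))\<^sup>*"])
  have "checkable (f + m) (\<lambda>bs e. (map e is, map e [f..<f + m]) \<in> (bounded_step m bs (R bs e))\<^sup>*)"
  proof (rule checkable_rtrancl_list)
    show "checkable (f + m + 2 * m) (\<lambda>bs e. R bs e (map e [f + m..<f + m + m]) (map e [f + m + m..<f + m + 2 * m]))"
      by (rule R) simp
    show "R bs e xs ys = R bs e' xs ys" if "\<And>i. i < f + m \<Longrightarrow> e i = e' i" for bs :: "bool list" and e e' :: heads and xs ys
      by (rule locR, rule that) simp
  qed (use i in auto)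
  with G show "checkable (f + m) (\<lambda>bs e. G bs e (map e [f..<f + m]) \<and>
      (map e is, map e [f..<f + m]) \<in> (bounded_step m bs (R bs e))\<^sup>*)" by (rule checkable_conj)
  show "(G bs e zs \<and> (map e is, zs) \<in> (bounded_step m bs (R bs e))\<^sup>*) =
      (G bs e' zs \<and> (map e' is, zs) \<in> (bounded_step m bs (R bs e'))\<^sup>*)" if s: "\<And>i. i < f \<Longrightarrow> e i = e' i" for bs :: "bool list" and e e' :: heads and zs
  proof -
    have "R bs e = R bs e'" by (intro ext locR s)
    moreover have "G bs e zs = G bs e' zs" by (intro locG s)
    moreover have "map e is = map e' is" using s i(2) by auto
    ultimately show ?thesis by (simp only:)
  qed
qed

lemma reach1_list: "reach1 bs R G p \<longleftrightarrow> reach_list 1 bs (\<lambda>xs ys. R (xs ! 0) (ys ! 0)) (\<lambda>xs. G (xs ! 0)) [p]"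
proof
  assume "reach1 bs R G p"
  thus "reach_list 1 bs (\<lambda>xs ys. R (xs ! 0) (ys ! 0)) (\<lambda>xs. G (xs ! 0)) [p]"
  proof induction
    case (goal1 p)
    thus ?case by (rule_tac reach_listI(1)) simp_all
  next
    case (step1 q p)
    thus ?case by (rule_tac reach_listI(2)[of "[q]"]) simp_all
  qed
next
  assume "reach_list 1 bs (\<lambda>xs ys. R (xs ! 0) (ys ! 0)) (\<lambda>xs. G (xs ! 0)) [p]"
  hence "reach1 bs R G ([p] ! 0)"
  proof (rule reach_list_induct[where xs = "[p]" and P = "\<lambda>xs. reach1 bs R G (xs ! 0)"])
    fix xs assume "length xs = 1" "set xs \<subseteq> {..Suc (length bs)}" "G (xs ! 0)"
    thus "reach1 bs R G (xs ! 0)" by (cases xs) (auto intro: goal1)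
  next
    fix xs ys assume a: "length ys = 1" "set ys \<subseteq> {..Suc (length bs)}" and b: "R (xs ! 0) (ys ! 0)" "reach1 bs R G (ys ! 0)"
    have "ys ! 0 \<le> Suc (length bs)" using a by (cases ys) auto
    thus "reach1 bs R G (xs ! 0)" using b by (rule step1)
  qed simp
  thus "reach1 bs R G p" by simp
qed

lemma reach2_list: "reach2 bs R G p q \<longleftrightarrow>
  reach_list 2 bs (\<lambda>xs ys. R (xs ! 0) (xs ! 1) (ys ! 0) (ys ! 1)) (\<lambda>xs. G (xs ! 0) (xs ! 1)) [p, q]"
proof
  assume "reach2 bs R G p q"
  thus "reach_list 2 bs (\<lambda>xs ys. R (xs ! 0) (xs ! 1) (ys ! 0) (ys ! 1)) (\<lambda>xs. G (xs ! 0) (xs ! 1)) [p, q]"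
  proof induction
    case (goal2 p p')
    thus ?case by (rule_tac reach_listI(1)) simp_all
  next
    case (step2 q q' p p')
    thus ?case by (rule_tac reach_listI(2)[of "[q, q']"]) simp_all
  qed
next
  assume "reach_list 2 bs (\<lambda>xs ys. R (xs ! 0) (xs ! 1) (ys ! 0) (ys ! 1)) (\<lambda>xs. G (xs ! 0) (xs ! 1)) [p, q]"
  hence "reach2 bs R G ([p, q] ! 0) ([p, q] ! 1)"
  proof (rule reach_list_induct[where xs = "[p, q]" and P = "\<lambda>xs. reach2 bs R G (xs ! 0) (xs ! 1)"])
    fix xs assume a: "length xs = 2" "set xs \<subseteq> {..Suc (length bs)}" "G (xs ! 0) (xs ! 1)"
    have "xs ! 0 \<in> set xs" "xs ! 1 \<in> set xs" using a(1) by simp_all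
    hence "xs ! 0 \<le> Suc (length bs)" "xs ! 1 \<le> Suc (length bs)" using a(2) by auto
    thus "reach2 bs R G (xs ! 0) (xs ! 1)" using a(3) by (rule goal2)
  next
    fix xs ys assume a: "length ys = 2" "set ys \<subseteq> {..Suc (length bs)}"
      and b: "R (xs ! 0) (xs ! 1) (ys ! 0) (ys ! 1)" "reach2 bs R G (ys ! 0) (ys ! 1)"
    have "ys ! 0 \<in> set ys" "ys ! 1 \<in> set ys" using a(1) by simp_all
    hence "ys ! 0 \<le> Suc (length bs)" "ys ! 1 \<le> Suc (length bs)" using a(2) by auto
    thus "reach2 bs R G (xs ! 0) (xs ! 1)" using b by (rule step2)
  qed simp
  thus "reach2 bs R G p q" by simp
qed

lemma nth_4: "length xs = 4 \<Longrightarrow> xs = [xs ! 0, xs ! 1, xs ! 2, xs ! 3]"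
  by (auto simp: numeral_eq_Suc length_Suc_conv)

lemma reach4_list: "reach4 bs R G p1 p2 p3 p4 \<longleftrightarrow>
  reach_list 4 bs (\<lambda>xs ys. R (xs ! 0) (xs ! 1) (xs ! 2) (xs ! 3) (ys ! 0) (ys ! 1) (ys ! 2) (ys ! 3))
    (\<lambda>xs. G (xs ! 0) (xs ! 1) (xs ! 2) (xs ! 3)) [p1, p2, p3, p4]" (is "_ \<longleftrightarrow> reach_list 4 bs ?R ?G _")
proof
  assume "reach4 bs R G p1 p2 p3 p4"
  thus "reach_list 4 bs ?R ?G [p1, p2, p3, p4]"
  proof induction
    case (goal4 p1 p2 p3 p4)
    thus ?case by (rule_tac reach_listI(1)) simp_all
  next
    case (step4 q1 q2 q3 q4 p1 p2 p3 p4)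
    thus ?case by (rule_tac reach_listI(2)[of "[q1, q2, q3, q4]"]) simp_all
  qed
next
  assume "reach_list 4 bs ?R ?G [p1, p2, p3, p4]"
  hence "reach4 bs R G ([p1, p2, p3, p4] ! 0) ([p1, p2, p3, p4] ! 1) ([p1, p2, p3, p4] ! 2) ([p1, p2, p3, p4] ! 3)"
  proof (rule reach_list_induct[where xs = "[p1, p2, p3, p4]" and P = "\<lambda>xs. reach4 bs R G (xs ! 0) (xs ! 1) (xs ! 2) (xs ! 3)"])
    fix xs assume a: "length xs = 4" "set xs \<subseteq> {..Suc (length bs)}" "?G xs"
    show "reach4 bs R G (xs ! 0) (xs ! 1) (xs ! 2) (xs ! 3)" using a(2) nth_4[OF a(1)] a(3) by (intro goal4) simp_all
  next
    fix xs ys assume a: "length ys = 4" "set ys \<subseteq> {..Suc (length bs)}"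
      and b: "?R xs ys" "reach4 bs R G (ys ! 0) (ys ! 1) (ys ! 2) (ys ! 3)"
    have "set [ys ! 0, ys ! 1, ys ! 2, ys ! 3] \<subseteq> {..Suc (length bs)}" using a(2) nth_4[OF a(1)] by simp
    thus "reach4 bs R G (xs ! 0) (xs ! 1) (xs ! 2) (xs ! 3)" using b by (rule step4)
  qed simp
  thus "reach4 bs R G p1 p2 p3 p4" by simp
qed

lemma checkable_reach1:
  assumes R: "\<And>g. f \<le> g \<Longrightarrow> checkable (Suc (Suc g)) (\<lambda>bs e. R bs e (e g) (e (Suc g)))"
    and G: "checkable (Suc f) (\<lambda>bs e. G bs e (e f))"
    and locR: "\<And>bs e e' p q. (\<And>i. i < f \<Longrightarrow> e i = e' i) \<Longrightarrow> R bs e p q = R bs e' p q"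
    and locG: "\<And>bs e e' p. (\<And>i. i < f \<Longrightarrow> e i = e' i) \<Longrightarrow> G bs e p = G bs e' p"
    and i: "i < f"
  shows "checkable f (\<lambda>bs e. reach1 bs (R bs e) (G bs e) (e i))"
proof -
  have "checkable f (\<lambda>bs e. reach_list 1 bs ((\<lambda>bs e xs ys. R bs e (xs ! 0) (ys ! 0)) bs e) ((\<lambda>bs e xs. G bs e (xs ! 0)) bs e) (map e [i]))"
  proof (rule checkable_reach_list)
    fix g assume "f \<le> g"
    thus "checkable (g + 2 * 1) (\<lambda>bs e. R bs e (map e [g..<g + 1] ! 0) (map e [g + 1..<g + 2 * 1] ! 0))"
      using R[of g] by simp
  next
    show "checkable (f + 1) (\<lambda>bs e. G bs e (map e [f..<f + 1] ! 0))" using G by simp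
  next
    show "R bs e (xs ! 0) (ys ! 0) = R bs e' (xs ! 0) (ys ! 0)" if "\<And>i. i < f \<Longrightarrow> e i = e' i" for bs :: "bool list" and e e' :: heads and xs ys
      by (rule locR, rule that)
    show "G bs e (xs ! 0) = G bs e' (xs ! 0)" if "\<And>i. i < f \<Longrightarrow> e i = e' i" for bs :: "bool list" and e e' :: heads and xs
      by (rule locG, rule that)
  qed (use i in simp_all)
  thus ?thesis unfolding reach1_list by simp
qed

lemma checkable_reach2:
  assumes R: "\<And>g. f \<le> g \<Longrightarrow> checkable (g + 4) (\<lambda>bs e. R bs (e g) (e (g + 1)) (e (g + 2)) (e (g + 3)))"
    and G: "checkable (f + 2) (\<lambda>bs e. G bs (e f) (e (f + 1)))"
    and i: "i < f" "j < f"
  shows "checkable f (\<lambda>bs e. reach2 bs (R bs) (G bs) (e i) (e j))"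
proof -
  have "checkable f (\<lambda>bs e. reach_list 2 bs ((\<lambda>bs e xs ys. R bs (xs ! 0) (xs ! 1) (ys ! 0) (ys ! 1)) bs e)
    ((\<lambda>bs e xs. G bs (xs ! 0) (xs ! 1)) bs e) (map e [i, j]))"
  proof (rule checkable_reach_list)
    fix g assume "f \<le> g"
    thus "checkable (g + 2 * 2) (\<lambda>bs e. R bs (map e [g..<g + 2] ! 0) (map e [g..<g + 2] ! 1)
        (map e [g + 2..<g + 2 * 2] ! 0) (map e [g + 2..<g + 2 * 2] ! 1))"
      using R[of g] by (simp add: eval_nat_numeral)
  next
    show "checkable (f + 2) (\<lambda>bs e. G bs (map e [f..<f + 2] ! 0) (map e [f..<f + 2] ! 1))" using G by simp
  qed (use i in simp_all)
  thus ?thesis unfolding reach2_list by simp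
qed

lemma checkable_reach4:
  assumes R: "\<And>g. f \<le> g \<Longrightarrow> checkable (g + 8) (\<lambda>bs e. R bs e (e g) (e (g + 1)) (e (g + 2)) (e (g + 3))
      (e (g + 4)) (e (g + 5)) (e (g + 6)) (e (g + 7)))"
    and G: "checkable (f + 4) (\<lambda>bs e. G bs (e f) (e (f + 1)) (e (f + 2)) (e (f + 3)))"
    and locR: "\<And>bs e e'. (\<And>i. i < f \<Longrightarrow> e i = e' i) \<Longrightarrow> R bs e = R bs e'"
    and i: "i1 < f" "i2 < f" "i3 < f" "i4 < f"
  shows "checkable f (\<lambda>bs e. reach4 bs (R bs e) (G bs) (e i1) (e i2) (e i3) (e i4))"
proof -
  have "checkable f (\<lambda>bs e. reach_list 4 bs
    ((\<lambda>bs e xs ys. R bs e (xs ! 0) (xs ! 1) (xs ! 2) (xs ! 3) (ys ! 0) (ys ! 1) (ys ! 2) (ys ! 3)) bs e)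
    ((\<lambda>bs e xs. G bs (xs ! 0) (xs ! 1) (xs ! 2) (xs ! 3)) bs e) (map e [i1, i2, i3, i4]))"
  proof (rule checkable_reach_list)
    fix g assume "f \<le> g"
    thus "checkable (g + 2 * 4) (\<lambda>bs e. R bs e (map e [g..<g + 4] ! 0) (map e [g..<g + 4] ! 1)
        (map e [g..<g + 4] ! 2) (map e [g..<g + 4] ! 3) (map e [g + 4..<g + 2 * 4] ! 0) (map e [g + 4..<g + 2 * 4] ! 1)
        (map e [g + 4..<g + 2 * 4] ! 2) (map e [g + 4..<g + 2 * 4] ! 3))"
      using R[of g] by (simp add: add.commute)
  next
    show "checkable (f + 4) (\<lambda>bs e. G bs (map e [f..<f + 4] ! 0) (map e [f..<f + 4] ! 1) (map e [f..<f + 4] ! 2) (map e [f..<f + 4] ! 3))"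
      using G by simp
  next
    show "R bs e (xs ! 0) (xs ! 1) (xs ! 2) (xs ! 3) (ys ! 0) (ys ! 1) (ys ! 2) (ys ! 3) =
      R bs e' (xs ! 0) (xs ! 1) (xs ! 2) (xs ! 3) (ys ! 0) (ys ! 1) (ys ! 2) (ys ! 3)"
      if "\<And>i. i < f \<Longrightarrow> e i = e' i" for bs :: "bool list" and e e' :: heads and xs ys
      using locR[of e e' bs, OF that] by (simp only:)
  qed (use i in simp_all)
  thus ?thesis unfolding reach4_list by simp
qed

section \<open>Parsing and comparing encoded data by reachability\<close>

definition enter :: "bool list \<Rightarrow> nat \<Rightarrow> nat \<Rightarrow> bool" where
  "enter bs p q \<longleftrightarrow> symbol bs p = 2 \<and> q = Suc p"

definition digit :: "bool list \<Rightarrow> nat \<Rightarrow> nat \<Rightarrow> nat \<Rightarrow> bool" where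
  "digit bs a p q \<longleftrightarrow> (\<exists>r\<le>Suc (length bs). enter bs p r \<and> symbol bs r = a \<and> q = Suc r)"

definition list_end :: "bool list \<Rightarrow> (nat \<Rightarrow> nat \<Rightarrow> bool) \<Rightarrow> nat \<Rightarrow> nat \<Rightarrow> bool" where
  "list_end bs E p q = reach1 bs (\<lambda>p r. \<exists>s\<le>Suc (length bs). enter bs p s \<and> E s r) (\<lambda>r. symbol bs r = 1 \<and> q = Suc r) p"

definition item :: "bool list \<Rightarrow> (nat \<Rightarrow> nat \<Rightarrow> bool) \<Rightarrow> nat \<Rightarrow> nat \<Rightarrow> bool" where
  "item bs E p q = reach1 bs (\<lambda>p r. \<exists>s\<le>Suc (length bs). enter bs p s \<and> E s r) (\<lambda>r. enter bs r q) p"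

text \<open>Universal quantification over a list as a single scan that succeeds only if it gets to
  the end; this replaces negation.\<close>

definition all_items :: "bool list \<Rightarrow> (nat \<Rightarrow> nat \<Rightarrow> bool) \<Rightarrow> (nat \<Rightarrow> bool) \<Rightarrow> nat \<Rightarrow> bool" where
  "all_items bs E \<Phi> p = reach1 bs (\<lambda>p r. \<exists>s\<le>Suc (length bs). enter bs p s \<and> \<Phi> s \<and> E s r) (\<lambda>r. symbol bs r = 1) p"

definition eq_num :: "bool list \<Rightarrow> nat \<Rightarrow> nat \<Rightarrow> bool" where
  "eq_num bs p q = reach2 bs (\<lambda>p q p' q'. digit bs 1 p p' \<and> digit bs 1 q q' \<or> digit bs 2 p p' \<and> digit bs 2 q q')
     (\<lambda>p q. symbol bs p = 1 \<and> symbol bs q = 1) p q"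

text \<open>Disequality is witnessed by a common prefix of digits followed by two different digits
  or by the end of only one number.\<close>

definition neq_num :: "bool list \<Rightarrow> nat \<Rightarrow> nat \<Rightarrow> bool" where
  "neq_num bs p q = reach2 bs (\<lambda>p q p' q'. digit bs 1 p p' \<and> digit bs 1 q q' \<or> digit bs 2 p p' \<and> digit bs 2 q q')
     (\<lambda>p q. symbol bs p = 1 \<and> symbol bs q = 2 \<or> symbol bs p = 2 \<and> symbol bs q = 1 \<or>
       (\<exists>p'\<le>Suc (length bs). \<exists>q'\<le>Suc (length bs). digit bs 1 p p' \<and> digit bs 2 q q' \<or> digit bs 2 p p' \<and> digit bs 1 q q')) p q"

definition checkable2 :: "(bool list \<Rightarrow> nat \<Rightarrow> nat \<Rightarrow> bool) \<Rightarrow> bool" where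
  "checkable2 E \<longleftrightarrow> (\<forall>f i j. i < f \<longrightarrow> j < f \<longrightarrow> checkable f (\<lambda>bs e. E bs (e i) (e j)))"

lemma checkable2D: "checkable2 E \<Longrightarrow> i < f \<Longrightarrow> j < f \<Longrightarrow> checkable f (\<lambda>bs e. E bs (e i) (e j))"
  by (simp add: checkable2_def)

lemma checkable_enter: "i < f \<Longrightarrow> j < f \<Longrightarrow> checkable f (\<lambda>bs e. enter bs (e i) (e j))"
  unfolding enter_def by (intro checkable_conj checkable_symbol checkable_Suc)

lemma checkable_digit: "i < f \<Longrightarrow> j < f \<Longrightarrow> checkable f (\<lambda>bs e. digit bs a (e i) (e j))"
  unfolding digit_def by (intro checkable_ex checkable_conj checkable_symbol checkable_Suc checkable_enter) simp_all

lemma checkable_list_end: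
  assumes "checkable2 E" shows "checkable2 (\<lambda>bs. list_end bs (E bs))"
  unfolding checkable2_def list_end_def
  by (intro allI impI checkable_reach1 checkable_ex checkable_conj checkable_symbol checkable_Suc checkable_enter checkable2D[OF assms]) simp_all

lemma checkable_item:
  assumes "checkable2 E" shows "checkable2 (\<lambda>bs. item bs (E bs))"
  unfolding checkable2_def item_def
  by (intro allI impI checkable_reach1 checkable_ex checkable_conj checkable_enter checkable2D[OF assms]) simp_all

lemma checkable_all_items:
  assumes E: "checkable2 E" and \<Phi>: "\<And>g. f \<le> g \<Longrightarrow> checkable (Suc g) (\<lambda>bs e. \<Phi> bs e (e g))"
    and loc: "\<And>bs e e' p. (\<And>i. i < f \<Longrightarrow> e i = e' i) \<Longrightarrow> \<Phi> bs e p = \<Phi> bs e' p" and i: "i < f"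
  shows "checkable f (\<lambda>bs e. all_items bs (E bs) (\<Phi> bs e) (e i))"
  unfolding all_items_def
proof (rule checkable_reach1)
  fix g assume g: "f \<le> g"
  have l: "\<Phi> bs e = \<Phi> bs e'" if "\<And>i. i < Suc (Suc g) \<Longrightarrow> e i = e' i" for bs :: "bool list" and e e' :: heads
    by (intro ext loc that) (use g in simp)
  show "checkable (Suc (Suc g)) (\<lambda>bs e. \<exists>s\<le>Suc (length bs). enter bs (e g) s \<and> \<Phi> bs e s \<and> E bs s (e (Suc g)))"
  proof (rule checkable_ex)
    show "checkable (Suc (Suc (Suc g))) (\<lambda>bs e. enter bs (e g) (e (Suc (Suc g))) \<and> \<Phi> bs e (e (Suc (Suc g))) \<and>
        E bs (e (Suc (Suc g))) (e (Suc g)))"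
      by (intro checkable_conj checkable_enter checkable2D[OF E] \<Phi>) (use g in simp_all)
    show "(enter bs (e g) s \<and> \<Phi> bs e s \<and> E bs s (e (Suc g))) = (enter bs (e' g) s \<and> \<Phi> bs e' s \<and> E bs s (e' (Suc g)))"
      if "\<And>i. i < Suc (Suc g) \<Longrightarrow> e i = e' i" for bs :: "bool list" and e e' :: heads and s
      using l[of e e' bs, OF that] that[of g] that[of "Suc g"] by simp
  qed
next
  show "(\<exists>s\<le>Suc (length bs). enter bs p s \<and> \<Phi> bs e s \<and> E bs s r) = (\<exists>s\<le>Suc (length bs). enter bs p s \<and> \<Phi> bs e' s \<and> E bs s r)"
    if "\<And>i. i < f \<Longrightarrow> e i = e' i" for bs :: "bool list" and e e' :: heads and p r
  proof -
    have "\<Phi> bs e = \<Phi> bs e'" by (intro ext loc that)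
    thus ?thesis by (simp only:)
  qed
qed (use i in \<open>simp_all add: checkable_symbol\<close>)

lemma checkable_eq_num: "i < f \<Longrightarrow> j < f \<Longrightarrow> checkable f (\<lambda>bs e. eq_num bs (e i) (e j))"
  unfolding eq_num_def
  by (intro checkable_reach2 checkable_conj checkable_disj checkable_symbol checkable_digit) simp_all

lemma checkable_neq_num: "i < f \<Longrightarrow> j < f \<Longrightarrow> checkable f (\<lambda>bs e. neq_num bs (e i) (e j))"
  unfolding neq_num_def
  by (intro checkable_reach2 checkable_ex checkable_conj checkable_disj checkable_symbol checkable_digit) simp_all

section \<open>Certificates\<close>

definition nat_end :: "bool list \<Rightarrow> nat \<Rightarrow> nat \<Rightarrow> bool" where
  "nat_end bs = list_end bs (\<lambda>p q. q = Suc p)"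

definition tuple_end :: "bool list \<Rightarrow> nat \<Rightarrow> nat \<Rightarrow> bool" where
  "tuple_end bs = list_end bs (nat_end bs)"

definition relation_end :: "bool list \<Rightarrow> nat \<Rightarrow> nat \<Rightarrow> bool" where
  "relation_end bs p q \<longleftrightarrow> (\<exists>r\<le>Suc (length bs). nat_end bs p r \<and> list_end bs (tuple_end bs) r q)"

definition entry_end :: "bool list \<Rightarrow> nat \<Rightarrow> nat \<Rightarrow> bool" where
  "entry_end bs p q \<longleftrightarrow> (\<exists>a\<le>Suc (length bs). nat_end bs p a \<and> (\<exists>b\<le>Suc (length bs). nat_end bs a b \<and>
     (\<exists>c\<le>Suc (length bs). nat_end bs b c \<and> nat_end bs c q)))"

definition table_end :: "bool list \<Rightarrow> nat \<Rightarrow> nat \<Rightarrow> bool" where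
  "table_end bs = list_end bs (entry_end bs)"

definition lookup :: "bool list \<Rightarrow> nat \<Rightarrow> nat \<Rightarrow> nat \<Rightarrow> nat \<Rightarrow> nat \<Rightarrow> bool" where
  "lookup bs \<beta> x y z v \<longleftrightarrow> (\<exists>p\<le>Suc (length bs). item bs (entry_end bs) \<beta> p \<and> eq_num bs x p \<and>
     (\<exists>q\<le>Suc (length bs). nat_end bs p q \<and> eq_num bs y q \<and>
     (\<exists>r\<le>Suc (length bs). nat_end bs q r \<and> eq_num bs z r \<and>
     (\<exists>s\<le>Suc (length bs). nat_end bs r s \<and> eq_num bs v s))))"

text \<open>The positive form of "equal arguments imply equal values" for two table entries.\<close>

definition compatible :: "bool list \<Rightarrow> nat \<Rightarrow> nat \<Rightarrow> bool" where
  "compatible bs p p' \<longleftrightarrow> neq_num bs p p' \<or>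
     (\<exists>q\<le>Suc (length bs). \<exists>q'\<le>Suc (length bs). nat_end bs p q \<and> nat_end bs p' q' \<and> (neq_num bs q q' \<or>
     (\<exists>r\<le>Suc (length bs). \<exists>r'\<le>Suc (length bs). nat_end bs q r \<and> nat_end bs q' r' \<and> (neq_num bs r r' \<or>
     (\<exists>s\<le>Suc (length bs). \<exists>s'\<le>Suc (length bs). nat_end bs r s \<and> nat_end bs r' s' \<and> eq_num bs s s')))))"

definition apply_step :: "bool list \<Rightarrow> nat \<Rightarrow> nat \<Rightarrow> nat \<Rightarrow> nat \<Rightarrow> nat \<Rightarrow> nat \<Rightarrow> nat \<Rightarrow> nat \<Rightarrow> nat \<Rightarrow> bool" where
  "apply_step bs \<beta> p1 p2 p3 p4 q1 q2 q3 q4 \<longleftrightarrow>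
     (\<exists>r1\<le>Suc (length bs). enter bs p1 r1 \<and> nat_end bs r1 q1 \<and>
     (\<exists>r2\<le>Suc (length bs). enter bs p2 r2 \<and> nat_end bs r2 q2 \<and>
     (\<exists>r3\<le>Suc (length bs). enter bs p3 r3 \<and> nat_end bs r3 q3 \<and>
     (\<exists>r4\<le>Suc (length bs). enter bs p4 r4 \<and> nat_end bs r4 q4 \<and> lookup bs \<beta> r1 r2 r3 r4))))"

definition apply_table :: "bool list \<Rightarrow> nat \<Rightarrow> nat \<Rightarrow> nat \<Rightarrow> nat \<Rightarrow> nat \<Rightarrow> bool" where
  "apply_table bs \<beta> = reach4 bs (apply_step bs \<beta>)
     (\<lambda>p1 p2 p3 p4. symbol bs p1 = 1 \<and> symbol bs p2 = 1 \<and> symbol bs p3 = 1 \<and> symbol bs p4 = 1)"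

definition total_table :: "bool list \<Rightarrow> nat \<Rightarrow> nat \<Rightarrow> bool" where
  "total_table bs u \<beta> \<longleftrightarrow> all_items bs (nat_end bs) (\<lambda>x. all_items bs (nat_end bs) (\<lambda>y. all_items bs (nat_end bs) (\<lambda>z.
     \<exists>v\<le>Suc (length bs). item bs (nat_end bs) u v \<and> lookup bs \<beta> x y z v) u) u) u"

definition functional_table :: "bool list \<Rightarrow> nat \<Rightarrow> bool" where
  "functional_table bs \<beta> \<longleftrightarrow> all_items bs (entry_end bs) (\<lambda>p. all_items bs (entry_end bs) (\<lambda>q. compatible bs p q) \<beta>) \<beta>"

definition idempotent_table :: "bool list \<Rightarrow> nat \<Rightarrow> nat \<Rightarrow> bool" where
  "idempotent_table bs u \<beta> \<longleftrightarrow> all_items bs (nat_end bs) (\<lambda>x. lookup bs \<beta> x x x x) u"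

definition absorbing_table :: "bool list \<Rightarrow> nat \<Rightarrow> nat \<Rightarrow> nat \<Rightarrow> bool" where
  "absorbing_table bs u b \<beta> \<longleftrightarrow> all_items bs (nat_end bs) (\<lambda>x. all_items bs (nat_end bs) (\<lambda>y. all_items bs (nat_end bs) (\<lambda>z.
     \<exists>v\<le>Suc (length bs). item bs (nat_end bs) b v \<and> lookup bs \<beta> x y z v) b) u) b"

definition preserving_table :: "bool list \<Rightarrow> nat \<Rightarrow> nat \<Rightarrow> bool" where
  "preserving_table bs l \<beta> \<longleftrightarrow> all_items bs (relation_end bs) (\<lambda>r. \<exists>t\<le>Suc (length bs). nat_end bs r t \<and>
     all_items bs (tuple_end bs) (\<lambda>x. all_items bs (tuple_end bs) (\<lambda>y. all_items bs (tuple_end bs) (\<lambda>z.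
       \<exists>v\<le>Suc (length bs). item bs (tuple_end bs) t v \<and> apply_table bs \<beta> x y z v) t) t) t) l"

definition good_table :: "bool list \<Rightarrow> nat \<Rightarrow> nat \<Rightarrow> nat \<Rightarrow> nat \<Rightarrow> bool" where
  "good_table bs u l b \<beta> \<longleftrightarrow> total_table bs u \<beta> \<and> functional_table bs \<beta> \<and>
     idempotent_table bs u \<beta> \<and> absorbing_table bs u b \<beta> \<and> preserving_table bs l \<beta>"

text \<open>The path runs through positions of list entries and not through values. A value listed
  several times has several positions, and the path must end at the given one.\<close>

definition linked_list :: "bool list \<Rightarrow> (nat \<Rightarrow> nat \<Rightarrow> bool) \<Rightarrow> (nat \<Rightarrow> nat \<Rightarrow> nat \<Rightarrow> nat \<Rightarrow> nat \<Rightarrow> bool) \<Rightarrow> nat \<Rightarrow> nat \<Rightarrow> bool" where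
  "linked_list bs E A l w \<longleftrightarrow> all_items bs E (\<lambda>x. all_items bs E (\<lambda>y. reach1 bs
     (\<lambda>p q. item bs E l q \<and> (\<exists>\<beta>\<le>Suc (length bs). item bs (table_end bs) w \<beta> \<and> A \<beta> x x y p \<and> A \<beta> x y y q))
     (\<lambda>q. q = y) x) l) l"

text \<open>The positions \<open>u\<close>, \<open>l\<close>, \<open>b\<close> and \<open>w\<close> are those of the universe, the relations, the subset and the list of
  the tables of operations.\<close>

definition certified :: "bool list \<Rightarrow> bool" where
  "certified bs \<longleftrightarrow> (\<exists>z\<le>Suc (length bs). symbol bs z = 3 \<and> (\<exists>u\<le>Suc (length bs). u = Suc z \<and>
     (\<exists>l\<le>Suc (length bs). tuple_end bs u l \<and> (\<exists>b\<le>Suc (length bs). list_end bs (relation_end bs) l b \<and>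
     (\<exists>w\<le>Suc (length bs). tuple_end bs b w \<and> all_items bs (table_end bs) (\<lambda>\<beta>. good_table bs u l b \<beta>) w \<and>
        linked_list bs (nat_end bs) (lookup bs) u w \<and>
        all_items bs (relation_end bs) (\<lambda>r. \<exists>t\<le>Suc (length bs). nat_end bs r t \<and>
          linked_list bs (tuple_end bs) (apply_table bs) t w) l)))))"

lemma checkable2_nat_end: "checkable2 nat_end"
proof -
  have "checkable2 (\<lambda>bs p q. q = Suc p)" by (simp add: checkable2_def checkable_Suc)
  from checkable_list_end[OF this] show ?thesis by (simp add: nat_end_def[abs_def])
qed

lemma checkable2_tuple_end: "checkable2 tuple_end"
  using checkable_list_end[OF checkable2_nat_end] by (simp add: tuple_end_def[abs_def])

lemmas checkable_nat_end = checkable2D[OF checkable2_nat_end]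
lemmas checkable_tuple_end = checkable2D[OF checkable2_tuple_end]
lemmas checkable_tuples_end = checkable2D[OF checkable_list_end[OF checkable2_tuple_end]]

lemma checkable2_relation_end: "checkable2 relation_end"
  unfolding checkable2_def relation_end_def
  by (intro allI impI checkable_ex checkable_conj checkable_nat_end checkable_tuples_end) simp_all

lemma checkable2_entry_end: "checkable2 entry_end"
  unfolding checkable2_def entry_end_def
  by (intro allI impI checkable_ex checkable_conj checkable_nat_end) simp_all

lemma checkable2_table_end: "checkable2 table_end"
  using checkable_list_end[OF checkable2_entry_end] by (simp add: table_end_def[abs_def])

lemma checkable_item_at:
  "checkable2 E \<Longrightarrow> i < f \<Longrightarrow> j < f \<Longrightarrow> checkable f (\<lambda>bs e. item bs (E bs) (e i) (e j))"
  by (rule checkable2D[OF checkable_item])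

lemma checkable_lookup:
  "i < f \<Longrightarrow> i1 < f \<Longrightarrow> i2 < f \<Longrightarrow> i3 < f \<Longrightarrow> i4 < f \<Longrightarrow> checkable f (\<lambda>bs e. lookup bs (e i) (e i1) (e i2) (e i3) (e i4))"
  unfolding lookup_def
  by (intro checkable_ex checkable_conj checkable_nat_end checkable_item_at checkable2_entry_end checkable_eq_num) simp_all

lemma checkable_compatible: "i < f \<Longrightarrow> j < f \<Longrightarrow> checkable f (\<lambda>bs e. compatible bs (e i) (e j))"
  unfolding compatible_def
  by (intro checkable_ex checkable_conj checkable_disj checkable_nat_end checkable_eq_num checkable_neq_num) simp_all

lemma checkable_apply_step:
  "i < f \<Longrightarrow> i1 < f \<Longrightarrow> i2 < f \<Longrightarrow> i3 < f \<Longrightarrow> i4 < f \<Longrightarrow> j1 < f \<Longrightarrow> j2 < f \<Longrightarrow> j3 < f \<Longrightarrow> j4 < f \<Longrightarrow>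
   checkable f (\<lambda>bs e. apply_step bs (e i) (e i1) (e i2) (e i3) (e i4) (e j1) (e j2) (e j3) (e j4))"
  unfolding apply_step_def
  by (intro checkable_ex checkable_conj checkable_nat_end checkable_enter checkable_lookup) simp_all

lemma checkable_apply_table:
  "i < f \<Longrightarrow> i1 < f \<Longrightarrow> i2 < f \<Longrightarrow> i3 < f \<Longrightarrow> i4 < f \<Longrightarrow>
   checkable f (\<lambda>bs e. apply_table bs (e i) (e i1) (e i2) (e i3) (e i4))"
  unfolding apply_table_def
  by (intro checkable_reach4 checkable_conj checkable_symbol checkable_apply_step) simp_all

lemma checkable_total_table: "i < f \<Longrightarrow> j < f \<Longrightarrow> checkable f (\<lambda>bs e. total_table bs (e i) (e j))"
  unfolding total_table_def
  by (intro checkable_all_items checkable_ex checkable_conj checkable2_nat_end checkable_item_at checkable_lookup) simp_all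

lemma checkable_functional_table: "j < f \<Longrightarrow> checkable f (\<lambda>bs e. functional_table bs (e j))"
  unfolding functional_table_def
  by (intro checkable_all_items checkable2_entry_end checkable_compatible) simp_all

lemma checkable_idempotent_table: "i < f \<Longrightarrow> j < f \<Longrightarrow> checkable f (\<lambda>bs e. idempotent_table bs (e i) (e j))"
  unfolding idempotent_table_def
  by (intro checkable_all_items checkable2_nat_end checkable_lookup) simp_all

lemma checkable_absorbing_table: "h < f \<Longrightarrow> i < f \<Longrightarrow> j < f \<Longrightarrow> checkable f (\<lambda>bs e. absorbing_table bs (e h) (e i) (e j))"
  unfolding absorbing_table_def
  by (intro checkable_all_items checkable_ex checkable_conj checkable2_nat_end checkable_item_at checkable_lookup) simp_all

lemma checkable_preserving_table: "i < f \<Longrightarrow> j < f \<Longrightarrow> checkable f (\<lambda>bs e. preserving_table bs (e i) (e j))"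
  unfolding preserving_table_def
  by (intro checkable_all_items checkable_ex checkable_conj checkable2_relation_end checkable2_tuple_end checkable_nat_end
      checkable_item_at checkable_apply_table) simp_all

lemma checkable_good_table:
  "g < f \<Longrightarrow> h < f \<Longrightarrow> i < f \<Longrightarrow> j < f \<Longrightarrow> checkable f (\<lambda>bs e. good_table bs (e g) (e h) (e i) (e j))"
  unfolding good_table_def
  by (intro checkable_conj checkable_total_table checkable_functional_table checkable_idempotent_table
      checkable_absorbing_table checkable_preserving_table)

lemma checkable_linked_lookup:
  "i < f \<Longrightarrow> j < f \<Longrightarrow> checkable f (\<lambda>bs e. linked_list bs (nat_end bs) (lookup bs) (e i) (e j))"
  unfolding linked_list_def
  by (intro checkable_all_items checkable_reach1 checkable_ex checkable_conj checkable2_nat_end checkable2_table_end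
      checkable_item_at checkable_lookup checkable_eq) simp_all

lemma checkable_linked_apply:
  "i < f \<Longrightarrow> j < f \<Longrightarrow> checkable f (\<lambda>bs e. linked_list bs (tuple_end bs) (apply_table bs) (e i) (e j))"
  unfolding linked_list_def
  by (intro checkable_all_items checkable_reach1 checkable_ex checkable_conj checkable2_tuple_end checkable2_table_end
      checkable_item_at checkable_apply_table checkable_eq) simp_all

theorem certified_program: "\<exists>p. \<forall>bs. accepts_word p bs \<longleftrightarrow> certified bs"
proof -
  have "checkable 0 (\<lambda>bs e. certified bs)"
    unfolding certified_def
    by (intro checkable_ex checkable_conj checkable_symbol checkable_Suc checkable_tuple_end checkable_all_items
        checkable2_relation_end checkable2D[OF checkable_list_end[OF checkable2_relation_end]] checkable2_table_end
        checkable_good_table checkable_linked_lookup checkable_linked_apply checkable_nat_end) simp_all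
  then obtain p where p: "tests 0 (\<lambda>bs e. certified bs) p" unfolding checkable_def by (elim conjE exE)
  have v: "valid_heads bs (final_heads bs)" for bs by (simp add: valid_heads_def final_heads_def)
  have "accepts_word p bs \<longleftrightarrow> certified bs" for bs
    unfolding accepts_word_def using tests_sound[OF p v] tests_ex[OF p, OF v] by blast
  thus ?thesis by blast
qed

lemma symbol_bound: "symbol bs p = 1 \<Longrightarrow> 0 < p \<and> p \<le> length bs" "symbol bs p = 2 \<Longrightarrow> 0 < p \<and> p \<le> length bs"
  "symbol bs p = Suc 0 \<Longrightarrow> 0 < p \<and> p \<le> length bs"
  by (auto simp: symbol_def split: if_splits)

section \<open>Head positions and the words that are encoded there\<close>

text \<open>Positions count from the left marker, so the first letter is at 1, and \<open>q\<close>
  is the position just after the occurrence. This makes occurrences of concatenations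
  compose.\<close>

primrec occurs :: "bool list \<Rightarrow> nat \<Rightarrow> bool list \<Rightarrow> nat \<Rightarrow> bool" where
  "occurs bs p [] q \<longleftrightarrow> p = q"
| "occurs bs p (b # s) q \<longleftrightarrow> symbol bs p = (if b then 2 else 1) \<and> occurs bs (Suc p) s q"

lemma occurs_append: "occurs bs p (s @ t) q \<longleftrightarrow> (\<exists>m. occurs bs p s m \<and> occurs bs m t q)"
  by (induction s arbitrary: p) auto

lemma occurs_end: "occurs bs p s q \<Longrightarrow> q = p + length s"
proof (induction s arbitrary: p)
  case (Cons b s)
  from Cons.prems have "occurs bs (Suc p) s q" by simp
  from Cons.IH[OF this] show ?case by simp
qed simp

lemma occurs_start: "occurs bs p s q \<Longrightarrow> s \<noteq> [] \<Longrightarrow> p \<le> length bs"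
  by (cases s) (auto dest: symbol_bound split: if_splits)

lemma occurs_bound: "occurs bs p s q \<Longrightarrow> s \<noteq> [] \<Longrightarrow> q \<le> Suc (length bs)"
proof (induction s arbitrary: p)
  case (Cons b s)
  thus ?case by (cases s) (auto dest: symbol_bound split: if_splits)
qed simp

lemma occurs_whole: "occurs (u @ s @ v) (Suc (length u)) s (Suc (length u + length s))"
proof (induction s arbitrary: u)
  case (Cons b s)
  have "occurs ((u @ [b]) @ s @ v) (Suc (length (u @ [b]))) s (Suc (length (u @ [b]) + length s))" by (rule Cons.IH)
  thus ?case by (simp add: symbol_def nth_append)
qed simp

lemma list_end_unfold: "list_end bs E p q \<longleftrightarrow>
  symbol bs p = 1 \<and> q = Suc p \<or> symbol bs p = 2 \<and> (\<exists>r\<le>Suc (length bs). E (Suc p) r \<and> list_end bs E r q)"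
  unfolding list_end_def by (subst reach1.simps) (auto simp: enter_def dest: symbol_bound)

lemma item_unfold: "item bs E p q \<longleftrightarrow>
  symbol bs p = 2 \<and> (q = Suc p \<or> (\<exists>r\<le>Suc (length bs). E (Suc p) r \<and> item bs E r q))"
  unfolding item_def by (subst reach1.simps) (auto simp: enter_def dest: symbol_bound)

lemma all_items_unfold: "all_items bs E \<Phi> p \<longleftrightarrow>
  symbol bs p = 1 \<or> symbol bs p = 2 \<and> \<Phi> (Suc p) \<and> (\<exists>r\<le>Suc (length bs). E (Suc p) r \<and> all_items bs E \<Phi> r)"
  unfolding all_items_def by (subst reach1.simps) (auto simp: enter_def dest: symbol_bound)

lemma digit_iff: "a = 1 \<or> a = 2 \<Longrightarrow> digit bs a p q \<longleftrightarrow> symbol bs p = 2 \<and> symbol bs (Suc p) = a \<and> q = Suc (Suc p)"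
  by (auto simp: digit_def enter_def dest: symbol_bound)

lemma eq_num_unfold: "eq_num bs p q \<longleftrightarrow> symbol bs p = 1 \<and> symbol bs q = 1 \<or>
  symbol bs p = 2 \<and> symbol bs q = 2 \<and> (symbol bs (Suc p) = 1 \<and> symbol bs (Suc q) = 1 \<or> symbol bs (Suc p) = 2 \<and> symbol bs (Suc q) = 2) \<and>
  eq_num bs (Suc (Suc p)) (Suc (Suc q))"
  unfolding eq_num_def by (subst reach2.simps) (auto simp: digit_iff dest: symbol_bound)

lemma neq_num_unfold: "neq_num bs p q \<longleftrightarrow> symbol bs p = 1 \<and> symbol bs q = 2 \<or> symbol bs p = 2 \<and> symbol bs q = 1 \<or>
  symbol bs p = 2 \<and> symbol bs q = 2 \<and> (symbol bs (Suc p) = 1 \<and> symbol bs (Suc q) = 2 \<or> symbol bs (Suc p) = 2 \<and> symbol bs (Suc q) = 1 \<or>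
    (symbol bs (Suc p) = 1 \<and> symbol bs (Suc q) = 1 \<or> symbol bs (Suc p) = 2 \<and> symbol bs (Suc q) = 2) \<and>
    neq_num bs (Suc (Suc p)) (Suc (Suc q)))"
  unfolding neq_num_def by (subst reach2.simps) (auto simp: digit_iff dest: symbol_bound)

lemma enc_list_simps [simp]: "enc_list e [] = [False]" "enc_list e (x # xs) = True # e x @ enc_list e xs"
  by (simp_all add: enc_list_def)

lemma enc_list_nonempty [simp]: "enc_list e xs \<noteq> []" by (simp add: enc_list_def)
lemma enc_nat_nonempty [simp]: "enc_nat n \<noteq> []" by (simp add: enc_nat_def)

text \<open>Wherever a code word really occurs, the nondeterministic parser \<open>E\<close> has
  exactly one outcome, the end of that word.\<close>

definition ends :: "bool list \<Rightarrow> (nat \<Rightarrow> nat \<Rightarrow> bool) \<Rightarrow> ('a \<Rightarrow> bool list) \<Rightarrow> bool" where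
  "ends bs E en \<longleftrightarrow> (\<forall>p a q. occurs bs p (en a) q \<longrightarrow> (\<forall>q'. E p q' \<longleftrightarrow> q' = q))"

lemma endsD: "ends bs E en \<Longrightarrow> occurs bs p (en a) q \<Longrightarrow> E p q' \<longleftrightarrow> q' = q"
  unfolding ends_def by metis

lemma ends_list:
  assumes E: "ends bs E en" shows "ends bs (list_end bs E) (enc_list en)"
  unfolding ends_def
proof (intro allI impI)
  fix p xs q q' assume "occurs bs p (enc_list en xs) q"
  thus "list_end bs E p q' \<longleftrightarrow> q' = q"
  proof (induction xs arbitrary: p)
    case Nil
    thus ?case by (subst list_end_unfold) auto
  next
    case (Cons x xs)
    then obtain m where m: "symbol bs p = 2" "occurs bs (Suc p) (en x) m" "occurs bs m (enc_list en xs) q"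
      by (auto simp: occurs_append)
    have "m \<le> length bs" using occurs_start[OF m(3)] by simp
    thus ?case using m(1) endsD[OF E m(2)] Cons.IH[OF m(3)] by (subst list_end_unfold) auto
  qed
qed

lemma ends_seq:
  assumes "ends bs E en" "ends bs E' en'" "\<And>b. en' b \<noteq> []"
  shows "ends bs (\<lambda>p q. \<exists>r\<le>Suc (length bs). E p r \<and> E' r q) (\<lambda>(a, b). en a @ en' b)"
  unfolding ends_def
proof (intro allI impI)
  fix p ab q q' assume "occurs bs p (case ab of (a, b) \<Rightarrow> en a @ en' b) q"
  then obtain a b m where m: "occurs bs p (en a) m" "occurs bs m (en' b) q" by (cases ab) (auto simp: occurs_append)
  have "m \<le> length bs" using occurs_start[OF m(2) assms(3)] .
  thus "(\<exists>r\<le>Suc (length bs). E p r \<and> E' r q') \<longleftrightarrow> q' = q" using endsD[OF assms(1) m(1)] endsD[OF assms(2) m(2)] by auto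
qed

lemma item_bound: "item bs E p q \<Longrightarrow> q \<le> Suc (length bs)"
  unfolding item_def by (induction rule: reach1.induct) (auto simp: enter_def dest: symbol_bound)

lemma item_occurs:
  assumes E: "ends bs E en"
  shows "occurs bs p (enc_list en xs) q \<Longrightarrow> item bs E p r \<Longrightarrow> \<exists>a\<in>set xs. \<exists>s. occurs bs r (en a) s"
proof (induction xs arbitrary: p)
  case Nil
  thus ?case by (subst (asm) item_unfold) auto
next
  case (Cons x xs)
  then obtain m where m: "symbol bs p = 2" "occurs bs (Suc p) (en x) m" "occurs bs m (enc_list en xs) q"
    by (auto simp: occurs_append)
  have "r = Suc p \<or> item bs E m r" using Cons.prems(2) endsD[OF E m(2)] by (subst (asm) item_unfold) auto
  thus ?case using m(2) Cons.IH[OF m(3)] by auto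
qed

lemma occurs_item:
  assumes E: "ends bs E en"
  shows "occurs bs p (enc_list en xs) q \<Longrightarrow> a \<in> set xs \<Longrightarrow> \<exists>r s. item bs E p r \<and> occurs bs r (en a) s"
proof (induction xs arbitrary: p)
  case (Cons x xs)
  obtain m where m: "symbol bs p = 2" "occurs bs (Suc p) (en x) m" "occurs bs m (enc_list en xs) q"
    using Cons.prems(1) by (auto simp: occurs_append)
  show ?case
  proof (cases "a = x")
    case True
    have "item bs E p (Suc p)" using m(1) by (subst item_unfold) simp
    thus ?thesis using m(2) True by blast
  next
    case False
    then obtain r s where r: "item bs E m r" "occurs bs r (en a) s" using Cons.IH[OF m(3)] Cons.prems(2) by auto
    have "m \<le> length bs" using occurs_start[OF m(3)] by simp
    hence "item bs E p r" using m(1) r(1) endsD[OF E m(2)] by (subst item_unfold) auto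
    thus ?thesis using r(2) by blast
  qed
qed simp

lemma all_items_item_iff:
  assumes E: "ends bs E en"
  shows "occurs bs p (enc_list en xs) q \<Longrightarrow> all_items bs E \<Phi> p \<longleftrightarrow> (\<forall>r. item bs E p r \<longrightarrow> \<Phi> r)"
proof (induction xs arbitrary: p)
  case Nil
  thus ?case by (subst all_items_unfold, subst item_unfold) auto
next
  case (Cons x xs)
  then obtain m where m: "symbol bs p = 2" "occurs bs (Suc p) (en x) m" "occurs bs m (enc_list en xs) q"
    by (auto simp: occurs_append)
  have b: "m \<le> length bs" using occurs_start[OF m(3)] by simp
  have "all_items bs E \<Phi> p \<longleftrightarrow> \<Phi> (Suc p) \<and> all_items bs E \<Phi> m"
    using m(1) b endsD[OF E m(2)] by (subst all_items_unfold) auto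
  moreover have "item bs E p r \<longleftrightarrow> r = Suc p \<or> item bs E m r" for r
    using m(1) b endsD[OF E m(2)] by (subst item_unfold) auto
  ultimately show ?case using Cons.IH[OF m(3)] by auto
qed

lemma all_items_iff:
  assumes "ends bs E en" "occurs bs p (enc_list en xs) q"
    and "\<And>r a s. a \<in> set xs \<Longrightarrow> occurs bs r (en a) s \<Longrightarrow> item bs E p r \<Longrightarrow> \<Phi> r \<longleftrightarrow> P a"
  shows "all_items bs E \<Phi> p \<longleftrightarrow> (\<forall>a\<in>set xs. P a)"
  unfolding all_items_item_iff[OF assms(1,2)]
proof (intro iffI ballI allI impI)
  fix a assume a: "\<forall>r. item bs E p r \<longrightarrow> \<Phi> r" "a \<in> set xs"
  obtain r s where r: "item bs E p r" "occurs bs r (en a) s" using occurs_item[OF assms(1,2) a(2)] by blast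
  have "\<Phi> r" using a(1) r(1) by blast
  thus "P a" using assms(3)[OF a(2) r(2,1)] by (rule iffD1[rotated])
next
  fix r assume a: "\<forall>a\<in>set xs. P a" "item bs E p r"
  obtain a s where r: "a \<in> set xs" "occurs bs r (en a) s" using item_occurs[OF assms(1,2) a(2)] by blast
  have "P a" using a(1) r(1) by blast
  thus "\<Phi> r" using assms(3)[OF r a(2)] by (rule iffD2[rotated])
qed

lemma ex_item_iff:
  assumes "ends bs E en" "occurs bs p (enc_list en xs) q"
    and "\<And>r a s. a \<in> set xs \<Longrightarrow> occurs bs r (en a) s \<Longrightarrow> item bs E p r \<Longrightarrow> \<Phi> r \<longleftrightarrow> P a"
  shows "(\<exists>r\<le>Suc (length bs). item bs E p r \<and> \<Phi> r) \<longleftrightarrow> (\<exists>a\<in>set xs. P a)"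
proof
  assume "\<exists>r\<le>Suc (length bs). item bs E p r \<and> \<Phi> r"
  then obtain r where r: "item bs E p r" "\<Phi> r" by blast
  obtain a s where a: "a \<in> set xs" "occurs bs r (en a) s" using item_occurs[OF assms(1,2) r(1)] by blast
  have "P a" using r(2) assms(3)[OF a r(1)] by (rule iffD1[rotated])
  thus "\<exists>a\<in>set xs. P a" using a(1) by (rule bexI)
next
  assume "\<exists>a\<in>set xs. P a"
  then obtain a where a: "a \<in> set xs" "P a" by (elim bexE)
  obtain r s where r: "item bs E p r" "occurs bs r (en a) s" using occurs_item[OF assms(1,2) a(1)] by blast
  have "\<Phi> r" using a(2) assms(3)[OF a(1) r(2,1)] by (rule iffD2[rotated])
  thus "\<exists>r\<le>Suc (length bs). item bs E p r \<and> \<Phi> r" using r(1) item_bound[OF r(1)] by (intro exI[of _ r] conjI)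
qed

text \<open>Inside the certificate it is not known that code words occur, so \<open>ends\<close>
  does not apply; uniqueness of the outcome of a parse holds on every word.\<close>

definition single_valued2 :: "(nat \<Rightarrow> nat \<Rightarrow> bool) \<Rightarrow> bool" where
  "single_valued2 E \<longleftrightarrow> (\<forall>p q q'. E p q \<longrightarrow> E p q' \<longrightarrow> q = q')"

lemma single_valued2D: "single_valued2 E \<Longrightarrow> E p q \<Longrightarrow> E p q' \<Longrightarrow> q = q'"
  unfolding single_valued2_def by metis

lemma list_end_single_valued:
  assumes E: "single_valued2 E" shows "single_valued2 (list_end bs E)"
  unfolding single_valued2_def
proof (intro allI impI)
  fix p q q' assume "list_end bs E p q" "list_end bs E p q'"
  thus "q = q'" unfolding list_end_def[of bs E p q]
  proof (induction rule: reach1.induct)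
    case (goal1 p)
    have "q' = Suc p" using goal1.prems goal1.hyps(2) list_end_unfold[of bs E p q'] by simp
    thus ?case using goal1.hyps(2) by simp
  next
    case (step1 r p)
    hence r: "symbol bs p = 2" "E (Suc p) r" unfolding enter_def by blast+
    obtain r' where r': "E (Suc p) r'" "list_end bs E r' q'" using step1.prems r(1) list_end_unfold[of bs E p q'] by auto
    have "list_end bs E r q'" using r'(2) unfolding single_valued2D[OF E r(2) r'(1)] .
    thus ?case by (rule step1.IH)
  qed
qed

text \<open>With a unique parse, an item reached by another run is one of those inspected by the
  scan, even in a list that encodes nothing.\<close>

lemma all_items_item:
  assumes E: "single_valued2 E" and "all_items bs E \<Phi> p" "item bs E p r" shows "\<Phi> r"
  using assms(2,3) unfolding all_items_def
proof (induction rule: reach1.induct)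
  case (goal1 p)
  thus ?case using item_unfold[of bs E p r] by simp
next
  case (step1 q p)
  hence q: "symbol bs p = 2" "\<Phi> (Suc p)" "E (Suc p) q" unfolding enter_def by blast+
  from step1.prems item_unfold[of bs E p r] consider "r = Suc p" | q' where "E (Suc p) q'" "item bs E q' r" by blast
  thus ?case
  proof cases
    case 1
    thus ?thesis using q(2) by (simp only:)
  next
    case 2
    have "item bs E q r" using 2(2) unfolding single_valued2D[OF E q(3) 2(1)] .
    thus ?thesis by (rule step1.IH)
  qed
qed

lemma bin_inject: "bin a = bin b \<Longrightarrow> a = b"
proof (induction a arbitrary: b rule: less_induct)
  case (less a)
  show ?case
  proof (cases "a = 0 \<or> b = 0")
    case True
    thus ?thesis using less.prems by (subst (asm) bin.simps, subst (asm) (2) bin.simps) (auto split: if_splits)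
  next
    case False
    hence h: "odd a = odd b" "bin (a div 2) = bin (b div 2)"
      using less.prems bin.simps[of a] bin.simps[of b] by auto
    have "a div 2 = b div 2" using less.IH[OF _ h(2)] False by simp
    thus ?thesis using h(1) by presburger
  qed
qed

abbreviation enc_digits :: "bool list \<Rightarrow> bool list" where "enc_digits \<equiv> enc_list (\<lambda>b. [b])"

text \<open>Only one side is known to be a digit string. The comparison then forces the same string
  at the other side, which is how numbers in an untrusted table are recognised.\<close>

lemma eq_num_digits: "occurs bs p (enc_digits ds) p' \<Longrightarrow> eq_num bs p q \<longleftrightarrow> (\<exists>q'. occurs bs q (enc_digits ds) q')"
proof (induction ds arbitrary: p q)
  case Nil
  thus ?case by (subst eq_num_unfold) auto
next
  case (Cons b ds)
  hence p: "symbol bs p = 2" "symbol bs (Suc p) = (if b then 2 else 1)" "occurs bs (Suc (Suc p)) (enc_digits ds) p'" by auto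
  show ?case using p(1,2) Cons.IH[OF p(3)] by (subst eq_num_unfold) auto
qed

lemma neq_num_digits:
  "occurs bs p (enc_digits ds) p' \<Longrightarrow> occurs bs q (enc_digits ds') q' \<Longrightarrow> neq_num bs p q \<longleftrightarrow> ds \<noteq> ds'"
proof (induction ds arbitrary: p q ds')
  case Nil
  thus ?case by (subst neq_num_unfold) (cases ds', auto)
next
  case (Cons b ds)
  hence p: "symbol bs p = 2" "symbol bs (Suc p) = (if b then 2 else 1)" "occurs bs (Suc (Suc p)) (enc_digits ds) p'" by auto
  show ?case
  proof (cases ds')
    case Nil
    thus ?thesis using p Cons.prems(2) by (subst neq_num_unfold) auto
  next
    case (Cons c es)
    hence q: "symbol bs q = 2" "symbol bs (Suc q) = (if c then 2 else 1)" "occurs bs (Suc (Suc q)) (enc_digits es) q'"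
      using Cons.prems(2) by auto
    show ?thesis using p(1,2) q(1,2) Cons.IH[OF p(3) q(3)] Cons by (subst neq_num_unfold) auto
  qed
qed

definition num :: "bool list \<Rightarrow> nat \<Rightarrow> nat \<Rightarrow> bool" where "num bs p a \<longleftrightarrow> (\<exists>q. occurs bs p (enc_nat a) q)"

lemma eq_num_iff: "num bs p a \<Longrightarrow> eq_num bs p q \<longleftrightarrow> num bs q a"
  unfolding num_def enc_nat_def using eq_num_digits by blast

lemma neq_num_iff: "num bs p a \<Longrightarrow> num bs q b \<Longrightarrow> neq_num bs p q \<longleftrightarrow> a \<noteq> b"
  unfolding num_def enc_nat_def using neq_num_digits bin_inject by blast

lemma num_unique: "num bs p a \<Longrightarrow> num bs p b \<Longrightarrow> a = b"
proof -
  assume a: "num bs p a" "num bs p b"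
  have "neq_num bs p p \<longleftrightarrow> a \<noteq> b" "neq_num bs p p \<longleftrightarrow> a \<noteq> a" using neq_num_iff a by blast+
  thus "a = b" by blast
qed

lemma numI: "occurs bs p (enc_nat a) q \<Longrightarrow> num bs p a" by (auto simp: num_def)

lemma ends_nat_end: "ends bs (nat_end bs) enc_nat"
proof -
  have "ends bs (\<lambda>p q. q = Suc p) (\<lambda>b. [b])" by (auto simp: ends_def)
  from ends_list[OF this] show ?thesis unfolding ends_def nat_end_def enc_nat_def by blast
qed

lemma ends_tuple_end: "ends bs (tuple_end bs) (enc_list enc_nat)"
  unfolding tuple_end_def by (rule ends_list[OF ends_nat_end])

definition enc_relation :: "nat \<times> nat list list \<Rightarrow> bool list" where
  "enc_relation = (\<lambda>(r, ts). enc_nat r @ enc_list (enc_list enc_nat) ts)"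

definition enc_entry :: "nat \<times> nat \<times> nat \<times> nat \<Rightarrow> bool list" where
  "enc_entry = (\<lambda>(a, b, c, d). enc_nat a @ enc_nat b @ enc_nat c @ enc_nat d)"

lemma ends_relation_end: "ends bs (relation_end bs) enc_relation"
proof -
  have "ends bs (\<lambda>p q. \<exists>r\<le>Suc (length bs). nat_end bs p r \<and> list_end bs (tuple_end bs) r q) enc_relation"
    unfolding enc_relation_def by (rule ends_seq[OF ends_nat_end ends_list[OF ends_tuple_end]]) simp
  thus ?thesis by (simp add: ends_def relation_end_def)
qed

lemma ends_entry_end: "ends bs (entry_end bs) enc_entry"
proof -
  have 1: "ends bs (\<lambda>p q. \<exists>r\<le>Suc (length bs). nat_end bs p r \<and> nat_end bs r q) (\<lambda>(a, b). enc_nat a @ enc_nat b)"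
    by (rule ends_seq[OF ends_nat_end ends_nat_end]) simp
  note 2 = ends_seq[OF ends_nat_end 1]
  have 3: "ends bs (\<lambda>p q. \<exists>r\<le>Suc (length bs). nat_end bs p r \<and> (\<exists>s\<le>Suc (length bs). nat_end bs r s \<and> nat_end bs s q))
    (\<lambda>(a, y). enc_nat a @ (case y of (b, c) \<Rightarrow> enc_nat b @ enc_nat c))"
    by (rule 2) (simp split: prod.split)
  note 4 = ends_seq[OF ends_nat_end 3]
  have "ends bs (entry_end bs) (\<lambda>(a, y). enc_nat a @ (case y of (b, y) \<Rightarrow> enc_nat b @ (case y of (c, d) \<Rightarrow> enc_nat c @ enc_nat d)))"
    unfolding entry_end_def[abs_def] by (rule 4) (simp split: prod.split)
  moreover have "(\<lambda>(a, y). enc_nat a @ (case y of (b, y) \<Rightarrow> enc_nat b @ (case y of (c, d) \<Rightarrow> enc_nat c @ enc_nat d))) = enc_entry"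
    by (auto simp: enc_entry_def fun_eq_iff)
  ultimately show ?thesis by simp
qed

lemma ends_table_end: "ends bs (table_end bs) (enc_list enc_entry)"
  unfolding table_end_def by (rule ends_list[OF ends_entry_end])

lemma single_valued2_nat_end: "single_valued2 (nat_end bs)"
  unfolding nat_end_def by (rule list_end_single_valued) (simp add: single_valued2_def)

lemma single_valued2_entry_end: "single_valued2 (entry_end bs)"
  unfolding single_valued2_def
proof (intro allI impI)
  fix p q q' assume "entry_end bs p q" "entry_end bs p q'"
  then obtain a b c a' b' c' where h: "nat_end bs p a" "nat_end bs a b" "nat_end bs b c" "nat_end bs c q"
    "nat_end bs p a'" "nat_end bs a' b'" "nat_end bs b' c'" "nat_end bs c' q'"
    unfolding entry_end_def by (elim exE conjE)
  note s = single_valued2D[OF single_valued2_nat_end]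
  have a: "a' = a" using s[OF h(5,1)] .
  have b: "b' = b" using s[OF h(6)[unfolded a] h(2)] .
  have c: "c' = c" using s[OF h(7)[unfolded b] h(3)] .
  show "q = q'" using s[OF h(4) h(8)[unfolded c]] .
qed

lemma single_valued2_table_end: "single_valued2 (table_end bs)"
  unfolding table_end_def by (rule list_end_single_valued[OF single_valued2_entry_end])

definition decodable :: "bool list \<Rightarrow> ('a \<Rightarrow> bool list) \<Rightarrow> bool" where
  "decodable bs en \<longleftrightarrow> (\<forall>p a q a' q'. occurs bs p (en a) q \<longrightarrow> occurs bs p (en a') q' \<longrightarrow> a = a')"

lemma decodableD: "decodable bs en \<Longrightarrow> occurs bs p (en a) q \<Longrightarrow> occurs bs p (en a') q' \<Longrightarrow> a = a'"
  unfolding decodable_def by metis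

lemma decodable_nat: "decodable bs enc_nat"
  unfolding decodable_def using num_unique numI by metis

lemma decodable_list:
  assumes "decodable bs en" shows "decodable bs (enc_list en)"
  unfolding decodable_def
proof (intro allI impI)
  fix p xs q xs' q' assume "occurs bs p (enc_list en xs) q" "occurs bs p (enc_list en xs') q'"
  thus "xs = xs'"
  proof (induction xs arbitrary: p xs')
    case Nil
    thus ?case by (cases xs') auto
  next
    case (Cons x xs)
    then obtain y ys where y: "xs' = y # ys" by (cases xs') auto
    obtain m m' where m: "occurs bs (Suc p) (en x) m" "occurs bs m (enc_list en xs) q"
      "occurs bs (Suc p) (en y) m'" "occurs bs m' (enc_list en ys) q'"
      using Cons.prems y by (auto simp: occurs_append)
    have x: "x = y" using decodableD[OF assms m(1,3)] .
    have "m = m'" using occurs_end[OF m(1)] occurs_end[OF m(3)] x by simp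
    thus ?case using Cons.IH[OF m(2)] m(4) x y by simp
  qed
qed

definition entry :: "bool list \<Rightarrow> nat \<Rightarrow> nat \<Rightarrow> nat \<Rightarrow> nat \<Rightarrow> nat \<Rightarrow> bool" where
  "entry bs \<beta> a b c d \<longleftrightarrow> (\<exists>p q. item bs (entry_end bs) \<beta> p \<and> occurs bs p (enc_entry (a, b, c, d)) q)"

lemma occurs_entry: "occurs bs p (enc_entry (a, b, c, d)) q \<longleftrightarrow> (\<exists>p1 p2 p3. occurs bs p (enc_nat a) p1 \<and>
  occurs bs p1 (enc_nat b) p2 \<and> occurs bs p2 (enc_nat c) p3 \<and> occurs bs p3 (enc_nat d) q)"
  by (auto simp: enc_entry_def occurs_append)

lemma decodable_entry: "decodable bs enc_entry"
  unfolding decodable_def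
proof (intro allI impI)
  fix p x q y q' assume o: "occurs bs p (enc_entry x) q" "occurs bs p (enc_entry y) q'"
  obtain a b c d where x: "x = (a, b, c, d)" by (cases x)
  obtain a' b' c' d' where y: "y = (a', b', c', d')" by (cases y)
  obtain p1 p2 p3 where p: "occurs bs p (enc_nat a) p1" "occurs bs p1 (enc_nat b) p2" "occurs bs p2 (enc_nat c) p3" "occurs bs p3 (enc_nat d) q"
    using o(1) unfolding x occurs_entry by (elim exE conjE)
  obtain q1 q2 q3 where r: "occurs bs p (enc_nat a') q1" "occurs bs q1 (enc_nat b') q2" "occurs bs q2 (enc_nat c') q3" "occurs bs q3 (enc_nat d') q'"
    using o(2) unfolding y occurs_entry by (elim exE conjE)
  note dec = decodableD[OF decodable_nat]
  have a: "a = a'" using dec[OF p(1) r(1)] .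
  have 1: "q1 = p1" using occurs_end[OF p(1)] occurs_end[OF r(1)] a by simp
  have b: "b = b'" using dec[OF p(2) r(2)[unfolded 1]] .
  have 2: "q2 = p2" using occurs_end[OF p(2)] occurs_end[OF r(2)] b 1 by simp
  have c: "c = c'" using dec[OF p(3) r(3)[unfolded 2]] .
  have 3: "q3 = p3" using occurs_end[OF p(3)] occurs_end[OF r(3)] c 2 by simp
  have "d = d'" using dec[OF p(4) r(4)[unfolded 3]] .
  thus "x = y" using a b c x y by simp
qed

lemma nat_end_iff: "occurs bs p (enc_nat a) q \<Longrightarrow> nat_end bs p q' \<longleftrightarrow> q' = q"
  by (rule endsD[OF ends_nat_end])

lemma num_nat_end: "num bs p a \<Longrightarrow> nat_end bs p q \<Longrightarrow> occurs bs p (enc_nat a) q"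
  unfolding num_def by (elim exE) (simp add: nat_end_iff)

lemma lookup_iff:
  assumes "num bs x a" "num bs y b" "num bs z c" "num bs v d"
  shows "lookup bs \<beta> x y z v \<longleftrightarrow> entry bs \<beta> a b c d"
proof
  assume "lookup bs \<beta> x y z v"
  then obtain p q r s where p: "item bs (entry_end bs) \<beta> p" "eq_num bs x p" "nat_end bs p q" "eq_num bs y q" "nat_end bs q r"
    "eq_num bs z r" "nat_end bs r s" "eq_num bs v s" unfolding lookup_def by (elim exE conjE)
  have n: "num bs p a" "num bs q b" "num bs r c" "num bs s d"
    using p eq_num_iff[OF assms(1)] eq_num_iff[OF assms(2)] eq_num_iff[OF assms(3)] eq_num_iff[OF assms(4)] by blast+
  obtain e where "occurs bs s (enc_nat d) e" using n(4) unfolding num_def by blast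
  thus "entry bs \<beta> a b c d" unfolding entry_def occurs_entry
    using p(1) num_nat_end[OF n(1) p(3)] num_nat_end[OF n(2) p(5)] num_nat_end[OF n(3) p(7)] by blast
next
  assume "entry bs \<beta> a b c d"
  then obtain p p1 p2 p3 q where p: "item bs (entry_end bs) \<beta> p" "occurs bs p (enc_nat a) p1" "occurs bs p1 (enc_nat b) p2"
    "occurs bs p2 (enc_nat c) p3" "occurs bs p3 (enc_nat d) q" unfolding entry_def occurs_entry by (elim exE conjE)
  have e: "eq_num bs x p" "eq_num bs y p1" "eq_num bs z p2" "eq_num bs v p3"
    using eq_num_iff[OF assms(1)] eq_num_iff[OF assms(2)] eq_num_iff[OF assms(3)] eq_num_iff[OF assms(4)] numI p(2-5) by blast+
  have n: "nat_end bs p p1" "nat_end bs p1 p2" "nat_end bs p2 p3"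
    using nat_end_iff[OF p(2)] nat_end_iff[OF p(3)] nat_end_iff[OF p(4)] by blast+
  have le: "p \<le> Suc (length bs)" "p1 \<le> Suc (length bs)" "p2 \<le> Suc (length bs)" "p3 \<le> Suc (length bs)"
    using item_bound[OF p(1)] occurs_bound[OF p(2)] occurs_bound[OF p(3)] occurs_bound[OF p(4)] by simp_all
  show "lookup bs \<beta> x y z v" unfolding lookup_def
    by (rule exI[of _ p], intro conjI le p(1) e(1), rule exI[of _ p1], intro conjI le n(1) e(2),
        rule exI[of _ p2], intro conjI le n(2) e(3), rule exI[of _ p3], intro conjI le n(3) e(4))
qed

lemma compatible_iff:
  assumes "occurs bs p (enc_entry (a, b, c, d)) e" "occurs bs p' (enc_entry (a', b', c', d')) e'"
  shows "compatible bs p p' \<longleftrightarrow> a \<noteq> a' \<or> b \<noteq> b' \<or> c \<noteq> c' \<or> d = d'"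
proof -
  obtain p1 p2 p3 where p: "occurs bs p (enc_nat a) p1" "occurs bs p1 (enc_nat b) p2" "occurs bs p2 (enc_nat c) p3" "occurs bs p3 (enc_nat d) e"
    using assms(1) unfolding occurs_entry by (elim exE conjE)
  obtain q1 q2 q3 where q: "occurs bs p' (enc_nat a') q1" "occurs bs q1 (enc_nat b') q2" "occurs bs q2 (enc_nat c') q3" "occurs bs q3 (enc_nat d') e'"
    using assms(2) unfolding occurs_entry by (elim exE conjE)
  have le: "p1 \<le> Suc (length bs)" "p2 \<le> Suc (length bs)" "p3 \<le> Suc (length bs)" "q1 \<le> Suc (length bs)" "q2 \<le> Suc (length bs)" "q3 \<le> Suc (length bs)"
    using occurs_bound[OF p(1)] occurs_bound[OF p(2)] occurs_bound[OF p(3)] occurs_bound[OF q(1)] occurs_bound[OF q(2)] occurs_bound[OF q(3)] by simp_all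
  have n: "nat_end bs p r \<longleftrightarrow> r = p1" "nat_end bs p1 r \<longleftrightarrow> r = p2" "nat_end bs p2 r \<longleftrightarrow> r = p3"
    "nat_end bs p' r \<longleftrightarrow> r = q1" "nat_end bs q1 r \<longleftrightarrow> r = q2" "nat_end bs q2 r \<longleftrightarrow> r = q3" for r
    by (rule nat_end_iff, rule p q)+
  have m: "neq_num bs p p' \<longleftrightarrow> a \<noteq> a'" "neq_num bs p1 q1 \<longleftrightarrow> b \<noteq> b'" "neq_num bs p2 q2 \<longleftrightarrow> c \<noteq> c'"
    by (rule neq_num_iff; rule numI, rule p q)+
  have "eq_num bs p3 q3 \<longleftrightarrow> num bs q3 d" by (rule eq_num_iff, rule numI, rule p)
  hence k: "eq_num bs p3 q3 \<longleftrightarrow> d = d'" using num_unique[of bs q3] numI[OF q(4)] by blast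
  show ?thesis unfolding compatible_def n m k using le by (auto simp: k m n)
qed

definition represents :: "bool list \<Rightarrow> nat \<Rightarrow> nat set \<Rightarrow> (nat list \<Rightarrow> nat) \<Rightarrow> bool" where
  "represents bs \<beta> U d \<longleftrightarrow> (\<forall>a\<in>U. \<forall>b\<in>U. \<forall>c\<in>U. \<forall>v. entry bs \<beta> a b c v \<longleftrightarrow> v = d [a, b, c])"

lemma functional_table_entry:
  assumes "functional_table bs \<beta>" "entry bs \<beta> a b c d" "entry bs \<beta> a b c d'" shows "d = d'"
proof -
  obtain p q where p: "item bs (entry_end bs) \<beta> p" "occurs bs p (enc_entry (a, b, c, d)) q" using assms(2) unfolding entry_def by (elim exE conjE)
  obtain p' q' where p': "item bs (entry_end bs) \<beta> p'" "occurs bs p' (enc_entry (a, b, c, d')) q'" using assms(3) unfolding entry_def by (elim exE conjE)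
  have "all_items bs (entry_end bs) (\<lambda>q. compatible bs p q) \<beta>"
    using all_items_item[OF single_valued2_entry_end assms(1)[unfolded functional_table_def] p(1)] .
  from all_items_item[OF single_valued2_entry_end this p'(1)] show ?thesis using compatible_iff[OF p(2) p'(2)] by simp
qed

definition coords :: "(nat \<Rightarrow> nat \<Rightarrow> nat \<Rightarrow> nat \<Rightarrow> bool) \<Rightarrow> nat list \<Rightarrow> nat list \<Rightarrow> nat list \<Rightarrow> nat list \<Rightarrow> bool" where
  "coords E xs ys zs vs \<longleftrightarrow> length ys = length xs \<and> length zs = length xs \<and> length vs = length xs \<and>
     (\<forall>i<length xs. E (xs ! i) (ys ! i) (zs ! i) (vs ! i))"

lemma coords_Cons: "coords E (x # xs) (y # ys) (z # zs) (v # vs) \<longleftrightarrow> E x y z v \<and> coords E xs ys zs vs"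
  by (auto simp: coords_def All_less_Suc2)

lemma apply_table_unfold: "apply_table bs \<beta> p1 p2 p3 p4 \<longleftrightarrow>
  symbol bs p1 = 1 \<and> symbol bs p2 = 1 \<and> symbol bs p3 = 1 \<and> symbol bs p4 = 1 \<or>
  (\<exists>q1 q2 q3 q4. set [q1, q2, q3, q4] \<subseteq> {..Suc (length bs)} \<and> apply_step bs \<beta> p1 p2 p3 p4 q1 q2 q3 q4 \<and> apply_table bs \<beta> q1 q2 q3 q4)"
proof -
  have "symbol bs p = 1 \<Longrightarrow> p \<le> Suc (length bs)" for p using symbol_bound(1)[of bs p] by simp
  thus ?thesis unfolding apply_table_def by (subst reach4.simps) auto
qed

lemma apply_step_symbols:
  "apply_step bs \<beta> p1 p2 p3 p4 q1 q2 q3 q4 \<Longrightarrow> symbol bs p1 = 2 \<and> symbol bs p2 = 2 \<and> symbol bs p3 = 2 \<and> symbol bs p4 = 2"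
  unfolding apply_step_def enter_def by blast

lemma list_symbol: "occurs bs p (enc_list en xs) q \<Longrightarrow> symbol bs p = (if xs = [] then 1 else 2)"
  by (cases xs) auto

lemma apply_table_iff:
  assumes "occurs bs p1 (enc_list enc_nat xs) e1" "occurs bs p2 (enc_list enc_nat ys) e2"
    "occurs bs p3 (enc_list enc_nat zs) e3" "occurs bs p4 (enc_list enc_nat vs) e4"
  shows "apply_table bs \<beta> p1 p2 p3 p4 \<longleftrightarrow> coords (entry bs \<beta>) xs ys zs vs"
  using assms
proof (induction xs arbitrary: ys zs vs p1 p2 p3 p4)
  case Nil
  note s = list_symbol[OF Nil(1)] list_symbol[OF Nil(2)] list_symbol[OF Nil(3)] list_symbol[OF Nil(4)]
  have "\<not> apply_step bs \<beta> p1 p2 p3 p4 q1 q2 q3 q4" for q1 q2 q3 q4 using apply_step_symbols[of bs \<beta> p1] s(1) by fastforce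
  thus ?case using s by (subst apply_table_unfold) (auto simp: coords_def split: if_splits)
next
  case (Cons x xs)
  note s = list_symbol[OF Cons.prems(1)] list_symbol[OF Cons.prems(2)] list_symbol[OF Cons.prems(3)] list_symbol[OF Cons.prems(4)]
  show ?case
  proof (cases "ys = [] \<or> zs = [] \<or> vs = []")
    case True
    hence "\<not> apply_step bs \<beta> p1 p2 p3 p4 q1 q2 q3 q4" for q1 q2 q3 q4
      using apply_step_symbols[of bs \<beta> p1 p2 p3 p4 q1 q2 q3 q4] s by (auto split: if_splits)
    moreover have "\<not> coords (entry bs \<beta>) (x # xs) ys zs vs" using True by (auto simp: coords_def)
    ultimately show ?thesis using s(1) by (subst apply_table_unfold) simp
  next
    case False
    then obtain y ys' z zs' v vs' where e: "ys = y # ys'" "zs = z # zs'" "vs = v # vs'"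
      by (cases ys; cases zs; cases vs) auto
    obtain m1 where m1: "symbol bs p1 = 2" "occurs bs (Suc p1) (enc_nat x) m1" "occurs bs m1 (enc_list enc_nat xs) e1"
      using Cons.prems(1) by (auto simp: occurs_append)
    obtain m2 where m2: "symbol bs p2 = 2" "occurs bs (Suc p2) (enc_nat y) m2" "occurs bs m2 (enc_list enc_nat ys') e2"
      using Cons.prems(2) e by (auto simp: occurs_append)
    obtain m3 where m3: "symbol bs p3 = 2" "occurs bs (Suc p3) (enc_nat z) m3" "occurs bs m3 (enc_list enc_nat zs') e3"
      using Cons.prems(3) e by (auto simp: occurs_append)
    obtain m4 where m4: "symbol bs p4 = 2" "occurs bs (Suc p4) (enc_nat v) m4" "occurs bs m4 (enc_list enc_nat vs') e4"
      using Cons.prems(4) e by (auto simp: occurs_append)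
    have le: "set [m1, m2, m3, m4] \<subseteq> {..Suc (length bs)}"
      using occurs_bound[OF m1(2)] occurs_bound[OF m2(2)] occurs_bound[OF m3(2)] occurs_bound[OF m4(2)] by simp
    have "apply_step bs \<beta> p1 p2 p3 p4 q1 q2 q3 q4 \<longleftrightarrow> q1 = m1 \<and> q2 = m2 \<and> q3 = m3 \<and> q4 = m4 \<and>
        lookup bs \<beta> (Suc p1) (Suc p2) (Suc p3) (Suc p4)" for q1 q2 q3 q4
      unfolding apply_step_def enter_def
      using nat_end_iff[OF m1(2)] nat_end_iff[OF m2(2)] nat_end_iff[OF m3(2)] nat_end_iff[OF m4(2)] m1(1) m2(1) m3(1) m4(1)
        symbol_bound(2)[OF m1(1)] symbol_bound(2)[OF m2(1)] symbol_bound(2)[OF m3(1)] symbol_bound(2)[OF m4(1)] by auto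
    moreover have "lookup bs \<beta> (Suc p1) (Suc p2) (Suc p3) (Suc p4) \<longleftrightarrow> entry bs \<beta> x y z v"
      by (rule lookup_iff; rule numI, rule m1 m2 m3 m4)
    moreover have "apply_table bs \<beta> m1 m2 m3 m4 \<longleftrightarrow> coords (entry bs \<beta>) xs ys' zs' vs'"
      by (rule Cons.IH[OF m1(3) m2(3) m3(3) m4(3)])
    ultimately show ?thesis using le m1(1) unfolding e coords_Cons by (subst apply_table_unfold) auto
  qed
qed

lemma represents_coords:
  assumes "represents bs \<beta> U d" "set xs \<subseteq> U" "set ys \<subseteq> U" "set zs \<subseteq> U" "length ys = length xs" "length zs = length xs"
  shows "coords (entry bs \<beta>) xs ys zs vs \<longleftrightarrow> vs = lift3 d xs ys zs"
proof -
  have "entry bs \<beta> (xs ! i) (ys ! i) (zs ! i) v \<longleftrightarrow> v = d [xs ! i, ys ! i, zs ! i]" if "i < length xs" for i v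
  proof -
    have "xs ! i \<in> U" "ys ! i \<in> U" "zs ! i \<in> U" using assms that by (auto simp: subset_iff)
    thus ?thesis using assms(1) unfolding represents_def by blast
  qed
  thus ?thesis using assms(5,6) unfolding coords_def by (auto intro!: nth_equalityI)
qed

lemma args_3: "args A 3 = {[a, b, c] | a b c. a \<in> A \<and> b \<in> A \<and> c \<in> A}"
  by (auto simp: args_def numeral_eq_Suc length_Suc_conv)

lemma jonsson_ops_iff:
  assumes fin: "finite_structure (input_structure x)"
  shows "d \<in> jonsson_ops (input_structure x) B \<longleftrightarrow>
    (\<forall>a\<in>set (in_universe x). \<forall>b\<in>set (in_universe x). \<forall>c\<in>set (in_universe x). d [a, b, c] \<in> set (in_universe x)) \<and>
    (\<forall>a\<in>set (in_universe x). d [a, a, a] = a) \<and> (\<forall>a\<in>B. \<forall>b\<in>set (in_universe x). \<forall>c\<in>B. d [a, b, c] \<in> B) \<and>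
    (\<forall>(r, ts)\<in>set (in_relations x). \<forall>X\<in>set ts. \<forall>Y\<in>set ts. \<forall>Z\<in>set ts. lift3 d X Y Z \<in> set ts)"
proof -
  have dom: "domain (input_structure x) = set (in_universe x)" by (simp add: input_structure_def)
  have pres: "preserves 3 d r (set ts) \<longleftrightarrow> (\<forall>X\<in>set ts. \<forall>Y\<in>set ts. \<forall>Z\<in>set ts. lift3 d X Y Z \<in> set ts)"
    if "(r, ts) \<in> set (in_relations x)" for r ts
  proof -
    have "set ts \<subseteq> args (set (in_universe x)) r"
      using fin that unfolding finite_structure_def input_structure_def by fastforce
    hence len: "X \<in> set ts \<Longrightarrow> length X = r" for X by (auto simp: args_def)
    have "preserves 3 d r (set ts) \<longleftrightarrow> (\<forall>Xs\<in>args (set ts) 3. columnwise r d Xs \<in> set ts)"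
      unfolding preserves_columnwise args_def by blast
    also have "\<dots> \<longleftrightarrow> (\<forall>X\<in>set ts. \<forall>Y\<in>set ts. \<forall>Z\<in>set ts. columnwise r d [X, Y, Z] \<in> set ts)"
      unfolding args_3 by blast
    also have "\<dots> \<longleftrightarrow> (\<forall>X\<in>set ts. \<forall>Y\<in>set ts. \<forall>Z\<in>set ts. lift3 d X Y Z \<in> set ts)"
      using len by (auto simp: lift3_def)
    finally show ?thesis .
  qed
  have "(\<forall>(r, R)\<in>set (relations (input_structure x)). preserves 3 d r R) \<longleftrightarrow> (\<forall>(r, ts)\<in>set (in_relations x). preserves 3 d r (set ts))"
    by (force simp: input_structure_def)
  also have "\<dots> \<longleftrightarrow> (\<forall>(r, ts)\<in>set (in_relations x). \<forall>X\<in>set ts. \<forall>Y\<in>set ts. \<forall>Z\<in>set ts. lift3 d X Y Z \<in> set ts)"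
    using pres by blast
  finally have rel: "(\<forall>(r, R)\<in>set (relations (input_structure x)). preserves 3 d r R) \<longleftrightarrow>
    (\<forall>(r, ts)\<in>set (in_relations x). \<forall>X\<in>set ts. \<forall>Y\<in>set ts. \<forall>Z\<in>set ts. lift3 d X Y Z \<in> set ts)" .
  have un: "(\<forall>xs\<in>args (set (in_universe x)) 3. d xs \<in> set (in_universe x)) \<longleftrightarrow>
    (\<forall>a\<in>set (in_universe x). \<forall>b\<in>set (in_universe x). \<forall>c\<in>set (in_universe x). d [a, b, c] \<in> set (in_universe x))"
    unfolding args_3 by blast
  have rep: "replicate 3 a = [a, a, a]" for a :: nat by (simp add: numeral_3_eq_3)
  show ?thesis unfolding jonsson_ops_def idempotent_pol_def polymorphism_def mem_Collect_eq rel dom un rep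
    by (simp only: zero_less_numeral simp_thms conj_ac)
qed

definition table :: "nat list \<Rightarrow> (nat list \<Rightarrow> nat) \<Rightarrow> (nat \<times> nat \<times> nat \<times> nat) list" where
  "table us d = concat (map (\<lambda>a. concat (map (\<lambda>b. map (\<lambda>c. (a, b, c, d [a, b, c])) us) us)) us)"

lemma set_table: "(a, b, c, v) \<in> set (table us d) \<longleftrightarrow> a \<in> set us \<and> b \<in> set us \<and> c \<in> set us \<and> v = d [a, b, c]"
  by (auto simp: table_def)

lemma table_entry:
  assumes o: "occurs bs \<beta> (enc_list enc_entry tb) e"
  shows "entry bs \<beta> a b c v \<longleftrightarrow> (a, b, c, v) \<in> set tb"
proof
  assume "entry bs \<beta> a b c v"
  then obtain p q where p: "item bs (entry_end bs) \<beta> p" "occurs bs p (enc_entry (a, b, c, v)) q" unfolding entry_def by (elim exE conjE)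
  obtain y s where y: "y \<in> set tb" "occurs bs p (enc_entry y) s" using item_occurs[OF ends_entry_end o p(1)] by blast
  have "(a, b, c, v) = y" using decodableD[OF decodable_entry p(2) y(2)] .
  thus "(a, b, c, v) \<in> set tb" using y(1) by simp
next
  assume "(a, b, c, v) \<in> set tb"
  from occurs_item[OF ends_entry_end o this] show "entry bs \<beta> a b c v" unfolding entry_def .
qed

lemma table_represents:
  assumes "occurs bs \<beta> (enc_list enc_entry (table us d)) e" shows "represents bs \<beta> (set us) d"
  unfolding represents_def table_entry[OF assms] set_table by blast

lemma table_functional:
  assumes o: "occurs bs \<beta> (enc_list enc_entry (table us d)) e" shows "functional_table bs \<beta>"
  unfolding functional_table_def all_items_item_iff[OF ends_entry_end o]
proof (intro allI impI)
  fix p q assume pq: "item bs (entry_end bs) \<beta> p" "item bs (entry_end bs) \<beta> q"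
  obtain y s where y: "y \<in> set (table us d)" "occurs bs p (enc_entry y) s" using item_occurs[OF ends_entry_end o pq(1)] by blast
  obtain z t where z: "z \<in> set (table us d)" "occurs bs q (enc_entry z) t" using item_occurs[OF ends_entry_end o pq(2)] by blast
  obtain a b c v where 1: "y = (a, b, c, v)" by (cases y)
  obtain a' b' c' v' where 2: "z = (a', b', c', v')" by (cases z)
  show "compatible bs p q" using compatible_iff[OF y(2)[unfolded 1] z(2)[unfolded 2]] y(1) z(1) unfolding 1 2 set_table by auto
qed

lemma lift3_singleton: "lift3 d [a] [b] [c] = [d [a, b, c]]"
  by (simp add: lift3_def columnwise_def)

section \<open>Correctness of the checks on a presented input\<close>

text \<open>A well-formed input is assumed up to position \<open>pw\<close>; the certificate that
  starts there is arbitrary.\<close>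

locale presented =
  fixes bs :: "bool list" and pu pl pb pw :: nat and x :: input
  assumes pu: "occurs bs pu (enc_list enc_nat (in_universe x)) pl"
    and pl: "occurs bs pl (enc_list enc_relation (in_relations x)) pb"
    and pb: "occurs bs pb (enc_list enc_nat (in_subset x)) pw"
    and fin: "finite_structure (input_structure x)"
    and sub: "set (in_subset x) \<subseteq> set (in_universe x)"
begin

abbreviation U :: "nat set" where "U \<equiv> set (in_universe x)"
abbreviation B :: "nat set" where "B \<equiv> set (in_subset x)"
abbreviation J :: "(nat list \<Rightarrow> nat) set" where "J \<equiv> jonsson_ops (input_structure x) B"

lemma relation_args: "(r, ts) \<in> set (in_relations x) \<Longrightarrow> X \<in> set ts \<Longrightarrow> length X = r \<and> set X \<subseteq> U"
  using fin unfolding finite_structure_def input_structure_def args_def by fastforce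

lemma represents_lookup:
  assumes "represents bs \<beta> U d" "a \<in> U" "b \<in> U" "c \<in> U" "num bs X a" "num bs Y b" "num bs Z c" "num bs V v"
  shows "lookup bs \<beta> X Y Z V \<longleftrightarrow> v = d [a, b, c]"
  unfolding lookup_iff[OF assms(5-8)] using assms(1-4) unfolding represents_def by blast

lemma represents_apply:
  assumes "represents bs \<beta> U d" "(r, ts) \<in> set (in_relations x)" "X \<in> set ts" "Y \<in> set ts" "Z \<in> set ts"
    "occurs bs p1 (enc_list enc_nat X) e1" "occurs bs p2 (enc_list enc_nat Y) e2"
    "occurs bs p3 (enc_list enc_nat Z) e3" "occurs bs p4 (enc_list enc_nat V) e4"
  shows "apply_table bs \<beta> p1 p2 p3 p4 \<longleftrightarrow> V = lift3 d X Y Z"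
proof -
  note r = relation_args[OF assms(2)]
  have "set X \<subseteq> U" "set Y \<subseteq> U" "set Z \<subseteq> U" "length Y = length X" "length Z = length X"
    using r[OF assms(3)] r[OF assms(4)] r[OF assms(5)] by simp_all
  from represents_coords[OF assms(1) this] show ?thesis unfolding apply_table_iff[OF assms(6-9)] .
qed

lemma total_iff: "total_table bs pu \<beta> \<longleftrightarrow> (\<forall>a\<in>U. \<forall>b\<in>U. \<forall>c\<in>U. \<exists>v\<in>U. entry bs \<beta> a b c v)"
  unfolding total_table_def
  by (rule all_items_iff[OF ends_nat_end pu], rule all_items_iff[OF ends_nat_end pu], rule all_items_iff[OF ends_nat_end pu],
      rule ex_item_iff[OF ends_nat_end pu], (rule lookup_iff; (rule numI, assumption)))

lemma idempotent_iff:
  assumes "represents bs \<beta> U d" shows "idempotent_table bs pu \<beta> \<longleftrightarrow> (\<forall>a\<in>U. a = d [a, a, a])"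
  unfolding idempotent_table_def
  by (rule all_items_iff[OF ends_nat_end pu], (rule represents_lookup[OF assms]; (assumption | rule numI, assumption)))

lemma absorbing_iff:
  assumes "represents bs \<beta> U d"
  shows "absorbing_table bs pu pb \<beta> \<longleftrightarrow> (\<forall>a\<in>B. \<forall>b\<in>U. \<forall>c\<in>B. \<exists>v\<in>B. v = d [a, b, c])"
  unfolding absorbing_table_def
  by (rule all_items_iff[OF ends_nat_end pb], rule all_items_iff[OF ends_nat_end pu], rule all_items_iff[OF ends_nat_end pb],
      rule ex_item_iff[OF ends_nat_end pb],
      (rule represents_lookup[OF assms]; (assumption | rule subsetD[OF sub], assumption | rule numI, assumption)))

lemma relations_iff:
  assumes "\<And>r ts t s. (r, ts) \<in> set (in_relations x) \<Longrightarrow> occurs bs t (enc_list (enc_list enc_nat) ts) s \<Longrightarrow> \<Phi> t \<longleftrightarrow> P ts"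
  shows "all_items bs (relation_end bs) (\<lambda>r. \<exists>t\<le>Suc (length bs). nat_end bs r t \<and> \<Phi> t) pl \<longleftrightarrow>
    (\<forall>(r, ts)\<in>set (in_relations x). P ts)"
proof (rule all_items_iff[OF ends_relation_end pl])
  fix p rt s assume rt: "rt \<in> set (in_relations x)" "occurs bs p (enc_relation rt) s"
  obtain r ts where e: "rt = (r, ts)" by (cases rt)
  obtain t where t: "occurs bs p (enc_nat r) t" "occurs bs t (enc_list (enc_list enc_nat) ts) s"
    using rt(2) unfolding e by (auto simp: enc_relation_def occurs_append)
  have "t \<le> Suc (length bs)" using occurs_bound[OF t(1)] by simp
  hence "(\<exists>t\<le>Suc (length bs). nat_end bs p t \<and> \<Phi> t) \<longleftrightarrow> \<Phi> t" unfolding nat_end_iff[OF t(1)] by blast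
  also have "\<dots> \<longleftrightarrow> P ts" by (rule assms[OF rt(1)[unfolded e] t(2)])
  finally show "(\<exists>t\<le>Suc (length bs). nat_end bs p t \<and> \<Phi> t) \<longleftrightarrow> (case rt of (r, ts) \<Rightarrow> P ts)" unfolding e by simp
qed

lemma relationsD:
  assumes a: "all_items bs (relation_end bs) (\<lambda>r. \<exists>t\<le>Suc (length bs). nat_end bs r t \<and> \<Phi> t) pl"
    and r: "(r, ts) \<in> set (in_relations x)"
  shows "\<exists>t s. occurs bs t (enc_list (enc_list enc_nat) ts) s \<and> \<Phi> t"
proof -
  obtain p s where p: "item bs (relation_end bs) pl p" "occurs bs p (enc_relation (r, ts)) s"
    using occurs_item[OF ends_relation_end pl r] by blast
  obtain t where t: "occurs bs p (enc_nat r) t" "occurs bs t (enc_list (enc_list enc_nat) ts) s"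
    using p(2) by (auto simp: enc_relation_def occurs_append)
  have "\<exists>t\<le>Suc (length bs). nat_end bs p t \<and> \<Phi> t" using a p(1) unfolding all_items_item_iff[OF ends_relation_end pl] by blast
  hence "\<Phi> t" unfolding nat_end_iff[OF t(1)] by blast
  thus ?thesis using t(2) by blast
qed

lemma preserving_iff:
  assumes "represents bs \<beta> U d"
  shows "preserving_table bs pl \<beta> \<longleftrightarrow>
    (\<forall>(r, ts)\<in>set (in_relations x). \<forall>X\<in>set ts. \<forall>Y\<in>set ts. \<forall>Z\<in>set ts. \<exists>V\<in>set ts. V = lift3 d X Y Z)"
  unfolding preserving_table_def
proof (rule relations_iff)
  fix r ts t s assume r: "(r, ts) \<in> set (in_relations x)" and t: "occurs bs t (enc_list (enc_list enc_nat) ts) s"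
  show "all_items bs (tuple_end bs) (\<lambda>x. all_items bs (tuple_end bs) (\<lambda>y. all_items bs (tuple_end bs) (\<lambda>z.
       \<exists>v\<le>Suc (length bs). item bs (tuple_end bs) t v \<and> apply_table bs \<beta> x y z v) t) t) t \<longleftrightarrow>
    (\<forall>X\<in>set ts. \<forall>Y\<in>set ts. \<forall>Z\<in>set ts. \<exists>V\<in>set ts. V = lift3 d X Y Z)"
    by (rule all_items_iff[OF ends_tuple_end t], rule all_items_iff[OF ends_tuple_end t], rule all_items_iff[OF ends_tuple_end t],
      rule ex_item_iff[OF ends_tuple_end t], (rule represents_apply[OF assms r]; assumption))
qed

lemma good_iff:
  assumes "represents bs \<beta> U d"
  shows "good_table bs pu pl pb \<beta> \<longleftrightarrow> functional_table bs \<beta> \<and> d \<in> J"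
proof -
  have "total_table bs pu \<beta> \<longleftrightarrow> (\<forall>a\<in>U. \<forall>b\<in>U. \<forall>c\<in>U. d [a, b, c] \<in> U)"
    unfolding total_iff
  proof (intro ball_cong refl)
    fix a b c assume "a \<in> U" "b \<in> U" "c \<in> U"
    hence "entry bs \<beta> a b c v \<longleftrightarrow> v = d [a, b, c]" for v using assms unfolding represents_def by blast
    thus "(\<exists>v\<in>U. entry bs \<beta> a b c v) \<longleftrightarrow> d [a, b, c] \<in> U" by simp
  qed
  moreover have "idempotent_table bs pu \<beta> \<longleftrightarrow> (\<forall>a\<in>U. d [a, a, a] = a)" unfolding idempotent_iff[OF assms] by auto
  moreover have "absorbing_table bs pu pb \<beta> \<longleftrightarrow> (\<forall>a\<in>B. \<forall>b\<in>U. \<forall>c\<in>B. d [a, b, c] \<in> B)" unfolding absorbing_iff[OF assms] by simp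
  moreover have "preserving_table bs pl \<beta> \<longleftrightarrow>
    (\<forall>(r, ts)\<in>set (in_relations x). \<forall>X\<in>set ts. \<forall>Y\<in>set ts. \<forall>Z\<in>set ts. lift3 d X Y Z \<in> set ts)"
    unfolding preserving_iff[OF assms] by simp
  ultimately show ?thesis unfolding good_table_def jonsson_ops_iff[OF fin] by argo
qed

text \<open>Totality and functionality make the entries the graph of an operation, whatever the
  certificate looks like otherwise; the remaining checks then speak about that operation.\<close>

lemma good_represents:
  assumes g: "good_table bs pu pl pb \<beta>" shows "\<exists>d\<in>J. represents bs \<beta> U d"
proof -
  define d where "d = (\<lambda>xs. THE v. entry bs \<beta> (xs ! 0) (xs ! 1) (xs ! 2) v)"
  have tot: "\<forall>a\<in>U. \<forall>b\<in>U. \<forall>c\<in>U. \<exists>v\<in>U. entry bs \<beta> a b c v" and func: "functional_table bs \<beta>"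
    using g unfolding good_table_def total_iff by blast+
  have "represents bs \<beta> U d"
    unfolding represents_def
  proof (intro ballI allI)
    fix a b c v assume abc: "a \<in> U" "b \<in> U" "c \<in> U"
    obtain v0 where v0: "entry bs \<beta> a b c v0" using tot abc by blast
    have u: "entry bs \<beta> a b c v' \<longleftrightarrow> v' = v0" for v' using functional_table_entry[OF func _ v0] v0 by blast
    have "entry bs \<beta> a b c = (\<lambda>v. v = v0)" by (intro ext u)
    hence "d [a, b, c] = v0" unfolding d_def by simp
    thus "entry bs \<beta> a b c v \<longleftrightarrow> v = d [a, b, c]" using u by simp
  qed
  thus ?thesis using g good_iff by blast
qed

text \<open>The parameters \<open>tup\<close>, \<open>en\<close> and \<open>A\<close> allow one
  proof for the universe, with elements as one-element tuples, and for the relations.\<close>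

lemma linked_sound:
  fixes tup :: "'c \<Rightarrow> nat list"
  assumes E: "ends bs E en" and dec: "decodable bs en" and p: "occurs bs p (enc_list en xs) q"
    and A: "\<And>\<beta> d X px x' Y py y' Z pz z' V pv v'. represents bs \<beta> U d \<Longrightarrow> X \<in> set xs \<Longrightarrow> Y \<in> set xs \<Longrightarrow> Z \<in> set xs \<Longrightarrow>
      occurs bs px (en X) x' \<Longrightarrow> occurs bs py (en Y) y' \<Longrightarrow> occurs bs pz (en Z) z' \<Longrightarrow> occurs bs pv (en V) v' \<Longrightarrow>
      A \<beta> px py pz pv \<longleftrightarrow> tup V = lift3 d (tup X) (tup Y) (tup Z)"
    and tables: "\<And>\<beta>. item bs (table_end bs) pw \<beta> \<Longrightarrow> \<exists>d\<in>J. represents bs \<beta> U d"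
    and L: "linked_list bs E A p pw" and X: "X \<in> set xs" and Y: "Y \<in> set xs"
  shows "(tup X, tup Y) \<in> {(lift3 d (tup X) (tup X) (tup Y), lift3 d (tup X) (tup Y) (tup Y)) | d. d \<in> J}\<^sup>*" (is "_ \<in> ?R\<^sup>*")
proof -
  obtain px sx where px: "item bs E p px" "occurs bs px (en X) sx" using occurs_item[OF E p X] by blast
  obtain py sy where py: "item bs E p py" "occurs bs py (en Y) sy" using occurs_item[OF E p Y] by blast
  have "reach1 bs (\<lambda>p' q. item bs E p q \<and> (\<exists>\<beta>\<le>Suc (length bs). item bs (table_end bs) pw \<beta> \<and> A \<beta> px px py p' \<and> A \<beta> px py py q))
     (\<lambda>q. q = py) px"
    using L px(1) py(1) unfolding linked_list_def all_items_item_iff[OF E p] by blast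
  hence "\<forall>V s. occurs bs px (en V) s \<longrightarrow> (tup V, tup Y) \<in> ?R\<^sup>*"
  proof (induction rule: reach1.induct)
    case (goal1 r)
    show ?case
    proof (intro allI impI)
      fix V s assume v: "occurs bs r (en V) s"
      have "V = Y" using decodableD[OF dec v[unfolded goal1.hyps(2)] py(2)] .
      thus "(tup V, tup Y) \<in> ?R\<^sup>*" by simp
    qed
  next
    case (step1 r' r)
    show ?case
    proof (intro allI impI)
      fix V s assume v: "occurs bs r (en V) s"
      obtain \<beta> where b: "item bs E p r'" "item bs (table_end bs) pw \<beta>" "A \<beta> px px py r" "A \<beta> px py py r'" using step1.hyps(2) by blast
      obtain d where d: "d \<in> J" "represents bs \<beta> U d" using tables[OF b(2)] by blast
      obtain W s' where w: "W \<in> set xs" "occurs bs r' (en W) s'" using item_occurs[OF E p b(1)] by blast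
      have "tup V = lift3 d (tup X) (tup X) (tup Y)" using A[OF d(2) X X Y px(2) px(2) py(2) v] b(3) by simp
      moreover have "tup W = lift3 d (tup X) (tup Y) (tup Y)" using A[OF d(2) X Y Y px(2) py(2) py(2) w(2)] b(4) by simp
      ultimately have "(tup V, tup W) \<in> ?R" using d(1) by blast
      moreover have "(tup W, tup Y) \<in> ?R\<^sup>*" using step1.IH w(2) by blast
      ultimately show "(tup V, tup Y) \<in> ?R\<^sup>*" by (rule converse_rtrancl_into_rtrancl)
    qed
  qed
  thus ?thesis using px(2) by blast
qed

lemma linked_complete:
  fixes tup :: "'c \<Rightarrow> nat list"
  assumes E: "ends bs E en" and p: "occurs bs p (enc_list en xs) q"
    and A: "\<And>\<beta> d X px x' Y py y' Z pz z' V pv v'. represents bs \<beta> U d \<Longrightarrow> X \<in> set xs \<Longrightarrow> Y \<in> set xs \<Longrightarrow> Z \<in> set xs \<Longrightarrow>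
      occurs bs px (en X) x' \<Longrightarrow> occurs bs py (en Y) y' \<Longrightarrow> occurs bs pz (en Z) z' \<Longrightarrow> occurs bs pv (en V) v' \<Longrightarrow>
      A \<beta> px py pz pv \<longleftrightarrow> tup V = lift3 d (tup X) (tup Y) (tup Z)"
    and closed: "\<And>d X Y Z. d \<in> J \<Longrightarrow> X \<in> set xs \<Longrightarrow> Y \<in> set xs \<Longrightarrow> Z \<in> set xs \<Longrightarrow> lift3 d (tup X) (tup Y) (tup Z) \<in> tup ` set xs"
    and len: "\<And>X Y. X \<in> set xs \<Longrightarrow> Y \<in> set xs \<Longrightarrow> length (tup X) = length (tup Y)"
    and proj: "(\<lambda>xs. xs ! 2) \<in> J"
    and tables: "\<And>X Y V W d. X \<in> set xs \<Longrightarrow> Y \<in> set xs \<Longrightarrow> V \<in> set xs \<Longrightarrow> W \<in> set xs \<Longrightarrow> d \<in> J \<Longrightarrow>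
      tup V = lift3 d (tup X) (tup X) (tup Y) \<Longrightarrow> tup W = lift3 d (tup X) (tup Y) (tup Y) \<Longrightarrow>
      \<exists>\<beta> d'. item bs (table_end bs) pw \<beta> \<and> represents bs \<beta> U d' \<and>
        tup V = lift3 d' (tup X) (tup X) (tup Y) \<and> tup W = lift3 d' (tup X) (tup Y) (tup Y)"
    and paths: "\<And>X Y. X \<in> set xs \<Longrightarrow> Y \<in> set xs \<Longrightarrow>
      (tup X, tup Y) \<in> {(lift3 d (tup X) (tup X) (tup Y), lift3 d (tup X) (tup Y) (tup Y)) | d. d \<in> J}\<^sup>*"
  shows "linked_list bs E A p pw"
  unfolding linked_list_def all_items_item_iff[OF E p]
proof (intro allI impI)
  fix px py assume pxy: "item bs E p px" "item bs E p py"
  obtain X sx where X: "X \<in> set xs" "occurs bs px (en X) sx" using item_occurs[OF E p pxy(1)] by blast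
  obtain Y sy where Y: "Y \<in> set xs" "occurs bs py (en Y) sy" using item_occurs[OF E p pxy(2)] by blast
  let ?S = "\<lambda>p' q. item bs E p q \<and> (\<exists>\<beta>\<le>Suc (length bs). item bs (table_end bs) pw \<beta> \<and> A \<beta> px px py p' \<and> A \<beta> px py py q)"
  have edge: "?S r r'"
    if v: "V \<in> set xs" "occurs bs r (en V) s" and w: "W \<in> set xs" "occurs bs r' (en W) s'" "item bs E p r'" and d: "d \<in> J"
      "tup V = lift3 d (tup X) (tup X) (tup Y)" "tup W = lift3 d (tup X) (tup Y) (tup Y)" for V r s W r' s' d
  proof -
    obtain \<beta> d' where b: "item bs (table_end bs) pw \<beta>" "represents bs \<beta> U d'"
      "tup V = lift3 d' (tup X) (tup X) (tup Y)" "tup W = lift3 d' (tup X) (tup Y) (tup Y)"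
      using tables[OF X(1) Y(1) v(1) w(1) d] by blast
    have "A \<beta> px px py r" using A[OF b(2) X(1) X(1) Y(1) X(2) X(2) Y(2) v(2)] b(3) by simp
    moreover have "A \<beta> px py py r'" using A[OF b(2) X(1) Y(1) Y(1) X(2) Y(2) Y(2) w(2)] b(4) by simp
    ultimately show ?thesis using w(3) b(1) item_bound[OF b(1)] by blast
  qed
  have "\<forall>V r s. V \<in> set xs \<longrightarrow> tup V = t \<longrightarrow> occurs bs r (en V) s \<longrightarrow> reach1 bs ?S (\<lambda>q. q = py) r"
    if "(t, tup Y) \<in> {(lift3 d (tup X) (tup X) (tup Y), lift3 d (tup X) (tup Y) (tup Y)) | d. d \<in> J}\<^sup>*" for t
    using that
  proof (induction rule: converse_rtrancl_induct)
    case base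
    show ?case
    proof (intro allI impI)
      fix V r s assume v: "V \<in> set xs" "tup V = tup Y" "occurs bs r (en V) s"
      have l: "length (tup X) = length (tup Y)" using len[OF X(1) Y(1)] .
      \<comment> \<open>The third projection yields an edge from the value \<open>tup Y\<close> to
        itself. It moves from any position holding this value to \<open>py\<close>, which matters
        when the list has repetitions.\<close>
      have "tup V = lift3 (\<lambda>xs. xs ! 2) (tup X) (tup X) (tup Y)" "tup Y = lift3 (\<lambda>xs. xs ! 2) (tup X) (tup Y) (tup Y)"
        using l v(2) by (auto intro!: nth_equalityI)
      from edge[OF v(1,3) Y(1,2) pxy(2) proj this] have S: "?S r py" .
      have g: "reach1 bs ?S (\<lambda>q. q = py) py" by (rule goal1[OF item_bound[OF pxy(2)]], rule refl)
      show "reach1 bs ?S (\<lambda>q. q = py) r" by (rule step1[OF item_bound[OF pxy(2)]], rule S, rule g)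
    qed
  next
    case (step t t')
    obtain d where d: "d \<in> J" "t = lift3 d (tup X) (tup X) (tup Y)" "t' = lift3 d (tup X) (tup Y) (tup Y)" using step.hyps(1) by blast
    obtain W where W: "W \<in> set xs" "tup W = t'" using closed[OF d(1) X(1) Y(1) Y(1)] d(3) by auto
    obtain r' s' where r': "item bs E p r'" "occurs bs r' (en W) s'" using occurs_item[OF E p W(1)] by blast
    have IH: "reach1 bs ?S (\<lambda>q. q = py) r'" using step.IH W r'(2) by blast
    show ?case
    proof (intro allI impI)
      fix V r s assume v: "V \<in> set xs" "tup V = t" "occurs bs r (en V) s"
      have S: "?S r r'"
      proof (rule edge[OF v(1,3) W(1) r'(2,1) d(1)])
        show "tup V = lift3 d (tup X) (tup X) (tup Y)" unfolding v(2) by (rule d(2))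
        show "tup W = lift3 d (tup X) (tup Y) (tup Y)" unfolding W(2) by (rule d(3))
      qed
      show "reach1 bs ?S (\<lambda>q. q = py) r" by (rule step1[OF item_bound[OF r'(1)]], rule S, rule IH)
    qed
  qed
  thus "reach1 bs ?S (\<lambda>q. q = py) px" using paths[OF X(1) Y(1)] X by blast
qed

definition body :: bool where
  "body \<longleftrightarrow> all_items bs (table_end bs) (\<lambda>\<beta>. good_table bs pu pl pb \<beta>) pw \<and>
     linked_list bs (nat_end bs) (lookup bs) pu pw \<and>
     all_items bs (relation_end bs) (\<lambda>r. \<exists>t\<le>Suc (length bs). nat_end bs r t \<and>
       linked_list bs (tuple_end bs) (apply_table bs) t pw) pl"

lemma all_relations_cases:
  assumes "(r, R) \<in> set (all_relations (input_structure x))"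
  obtains "R = (\<lambda>a. [a]) ` U" | ts where "(r, ts) \<in> set (in_relations x)" "R = set ts"
  using assms by (auto simp: unary_def input_structure_def)

lemma lookup_singleton:
  assumes "represents bs \<beta> U d" "a \<in> U" "b \<in> U" "c \<in> U" "occurs bs X (enc_nat a) X'" "occurs bs Y (enc_nat b) Y'"
    "occurs bs Z (enc_nat c) Z'" "occurs bs V (enc_nat v) V'"
  shows "lookup bs \<beta> X Y Z V \<longleftrightarrow> [v] = lift3 d [a] [b] [c]"
  unfolding lift3_singleton using represents_lookup[OF assms(1-4) assms(5-8)[THEN numI]] by simp

lemma body_sound:
  assumes body shows "locally_absorbing (input_structure x) B"
  unfolding locally_absorbing_def
proof (intro ballI, clarify)
  fix r R X Y assume R: "(r, R) \<in> set (all_relations (input_structure x))" and XY: "X \<in> R" "Y \<in> R"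
  have tables: "\<exists>d\<in>J. represents bs \<beta> U d" if "item bs (table_end bs) pw \<beta>" for \<beta>
  proof -
    have "all_items bs (table_end bs) (\<lambda>\<beta>. good_table bs pu pl pb \<beta>) pw" using assms unfolding body_def by blast
    from all_items_item[OF single_valued2_table_end this that] show ?thesis by (rule good_represents)
  qed
  show "(X, Y) \<in> {(lift3 d X X Y, lift3 d X Y Y) |d. d \<in> J}\<^sup>*"
    using R
  proof (cases rule: all_relations_cases)
    case 1
    then obtain a b where ab: "X = [a]" "Y = [b]" "a \<in> U" "b \<in> U" using XY by blast
    have "linked_list bs (nat_end bs) (lookup bs) pu pw" using assms unfolding body_def by blast
    note L = this
    show ?thesis unfolding ab(1,2)
    proof (rule linked_sound[OF ends_nat_end decodable_nat pu, where tup = "\<lambda>a. [a]" and A = "lookup bs" and X = a and Y = b])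
      show "lookup bs \<beta> px py pz pv \<longleftrightarrow> [V] = lift3 d [X] [Y] [Z]"
        if "represents bs \<beta> U d" "X \<in> U" "Y \<in> U" "Z \<in> U" "occurs bs px (enc_nat X) x'" "occurs bs py (enc_nat Y) y'"
          "occurs bs pz (enc_nat Z) z'" "occurs bs pv (enc_nat V) v'" for \<beta> d X px x' Y py y' Z pz z' V pv v'
        using that by (rule lookup_singleton)
      show "\<exists>d\<in>J. represents bs \<beta> U d" if "item bs (table_end bs) pw \<beta>" for \<beta> using that by (rule tables)
      show "linked_list bs (nat_end bs) (lookup bs) pu pw" by (rule L)
      show "a \<in> U" "b \<in> U" by (rule ab)+
    qed
  next
    case (2 ts)
    have c: "all_items bs (relation_end bs) (\<lambda>r. \<exists>t\<le>Suc (length bs). nat_end bs r t \<and>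
       linked_list bs (tuple_end bs) (apply_table bs) t pw) pl" using assms unfolding body_def by blast
    obtain t s where t: "occurs bs t (enc_list (enc_list enc_nat) ts) s" "linked_list bs (tuple_end bs) (apply_table bs) t pw"
      using relationsD[OF c 2(1)] by blast
    show ?thesis
    proof (rule linked_sound[OF ends_tuple_end decodable_list[OF decodable_nat] t(1), where tup = "\<lambda>X. X" and A = "apply_table bs" and X = X and Y = Y])
      show "apply_table bs \<beta> px py pz pv \<longleftrightarrow> V = lift3 d X Y Z"
        if "represents bs \<beta> U d" "X \<in> set ts" "Y \<in> set ts" "Z \<in> set ts" "occurs bs px (enc_list enc_nat X) x'"
          "occurs bs py (enc_list enc_nat Y) y'" "occurs bs pz (enc_list enc_nat Z) z'" "occurs bs pv (enc_list enc_nat V) v'"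
        for \<beta> d X px x' Y py y' Z pz z' V pv v'
        by (rule represents_apply[OF that(1) 2(1) that(2-8)])
      show "\<exists>d\<in>J. represents bs \<beta> U d" if "item bs (table_end bs) pw \<beta>" for \<beta> using that by (rule tables)
      show "linked_list bs (tuple_end bs) (apply_table bs) t pw" by (rule t(2))
      show "X \<in> set ts" "Y \<in> set ts" using XY 2(2) by simp_all
    qed
  qed
qed

lemma projection_J: "(\<lambda>xs. xs ! 2) \<in> J"
proof -
  have "lift3 (\<lambda>xs. xs ! 2) X Y Z = Z" if "length X = length Z" for X Y Z :: "nat list"
    using that by (auto intro!: nth_equalityI)
  thus ?thesis unfolding jonsson_ops_iff[OF fin] using relation_args by fastforce
qed

lemma body_complete:
  assumes loc: "locally_absorbing (input_structure x) B" and ds: "set ds \<subseteq> J"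
    and cover: "\<And>r R X Y V W d. (r, R) \<in> set (all_relations (input_structure x)) \<Longrightarrow> X \<in> R \<Longrightarrow> Y \<in> R \<Longrightarrow> V \<in> R \<Longrightarrow> W \<in> R \<Longrightarrow>
      d \<in> J \<Longrightarrow> V = lift3 d X X Y \<Longrightarrow> W = lift3 d X Y Y \<Longrightarrow> \<exists>d\<in>set ds. V = lift3 d X X Y \<and> W = lift3 d X Y Y"
    and pw: "occurs bs pw (enc_list (enc_list enc_entry) (map (table (in_universe x)) ds)) e"
  shows body
proof -
  have good: "all_items bs (table_end bs) (\<lambda>\<beta>. good_table bs pu pl pb \<beta>) pw"
    unfolding all_items_item_iff[OF ends_table_end pw]
  proof (intro allI impI)
    fix \<beta> assume "item bs (table_end bs) pw \<beta>"
    from item_occurs[OF ends_table_end pw this] obtain tb s where tb: "tb \<in> set (map (table (in_universe x)) ds)"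
      "occurs bs \<beta> (enc_list enc_entry tb) s" by (elim bexE exE)
    obtain d where d: "d \<in> set ds" "occurs bs \<beta> (enc_list enc_entry (table (in_universe x) d)) s" using tb by auto
    show "good_table bs pu pl pb \<beta>" unfolding good_iff[OF table_represents[OF d(2)]] using table_functional[OF d(2)] ds d(1) by blast
  qed
  have tab: "\<exists>\<beta>. item bs (table_end bs) pw \<beta> \<and> represents bs \<beta> U d" if "d \<in> set ds" for d
  proof -
    have "table (in_universe x) d \<in> set (map (table (in_universe x)) ds)" using that by simp
    from occurs_item[OF ends_table_end pw this] show ?thesis using table_represents by blast
  qed
  have tables: "\<exists>\<beta> d'. item bs (table_end bs) pw \<beta> \<and> represents bs \<beta> U d' \<and> V = lift3 d' X X Y \<and> W = lift3 d' X Y Y"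
    if R: "(r, R) \<in> set (all_relations (input_structure x))" and m: "X \<in> R" "Y \<in> R" "V \<in> R" "W \<in> R" "d \<in> J"
      "V = lift3 d X X Y" "W = lift3 d X Y Y" for r R X Y V W d
  proof -
    obtain d' where d': "d' \<in> set ds" "V = lift3 d' X X Y" "W = lift3 d' X Y Y" using cover[OF R m] by (elim bexE conjE)
    thus ?thesis using tab[OF d'(1)] by blast
  qed
  have paths: "(X, Y) \<in> {(lift3 d X X Y, lift3 d X Y Y) |d. d \<in> J}\<^sup>*"
    if "(r, R) \<in> set (all_relations (input_structure x))" "X \<in> R" "Y \<in> R" for r R X Y
    using loc that unfolding locally_absorbing_def by blast
  have un: "(1, (\<lambda>a. [a]) ` U) \<in> set (all_relations (input_structure x))" by (simp add: unary_def input_structure_def)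
  have l1: "linked_list bs (nat_end bs) (lookup bs) pu pw"
  proof (rule linked_complete[OF ends_nat_end pu, where tup = "\<lambda>a. [a]"])
    show "lookup bs \<beta> px py pz pv \<longleftrightarrow> [V] = lift3 d [X] [Y] [Z]"
      if "represents bs \<beta> U d" "X \<in> U" "Y \<in> U" "Z \<in> U" "occurs bs px (enc_nat X) x'" "occurs bs py (enc_nat Y) y'"
        "occurs bs pz (enc_nat Z) z'" "occurs bs pv (enc_nat V) v'" for \<beta> d X px x' Y py y' Z pz z' V pv v'
      using that by (rule lookup_singleton)
    show "lift3 d [X] [Y] [Z] \<in> (\<lambda>a. [a]) ` U" if "d \<in> J" "X \<in> U" "Y \<in> U" "Z \<in> U" for d X Y Z
      using that unfolding lift3_singleton jonsson_ops_iff[OF fin] by blast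
    show "(\<lambda>xs. xs ! 2) \<in> J" by (rule projection_J)
    show "\<exists>\<beta> d'. item bs (table_end bs) pw \<beta> \<and> represents bs \<beta> U d' \<and> [V] = lift3 d' [X] [X] [Y] \<and> [W] = lift3 d' [X] [Y] [Y]"
      if "X \<in> U" "Y \<in> U" "V \<in> U" "W \<in> U" "d \<in> J" "[V] = lift3 d [X] [X] [Y]" "[W] = lift3 d [X] [Y] [Y]" for X Y V W d
      using tables[OF un _ _ _ _ that(5-7)] that(1-4) by blast
    show "([X], [Y]) \<in> {(lift3 d [X] [X] [Y], lift3 d [X] [Y] [Y]) |d. d \<in> J}\<^sup>*" if "X \<in> U" "Y \<in> U" for X Y
      using paths[OF un] that by blast
  qed simp
  have l2: "linked_list bs (tuple_end bs) (apply_table bs) t pw"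
    if r: "(r, ts) \<in> set (in_relations x)" and t: "occurs bs t (enc_list (enc_list enc_nat) ts) s" for r ts t s
  proof -
    have rel: "(r, set ts) \<in> set (all_relations (input_structure x))" using r by (force simp: input_structure_def)
    show ?thesis
    proof (rule linked_complete[OF ends_tuple_end t, where tup = "\<lambda>X. X"])
      show "apply_table bs \<beta> px py pz pv \<longleftrightarrow> V = lift3 d X Y Z"
        if "represents bs \<beta> U d" "X \<in> set ts" "Y \<in> set ts" "Z \<in> set ts" "occurs bs px (enc_list enc_nat X) x'"
          "occurs bs py (enc_list enc_nat Y) y'" "occurs bs pz (enc_list enc_nat Z) z'" "occurs bs pv (enc_list enc_nat V) v'"
        for \<beta> d X px x' Y py y' Z pz z' V pv v'
        by (rule represents_apply[OF that(1) r that(2-8)])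
      show "lift3 d X Y Z \<in> (\<lambda>X. X) ` set ts" if "d \<in> J" "X \<in> set ts" "Y \<in> set ts" "Z \<in> set ts" for d X Y Z
        using that r unfolding jonsson_ops_iff[OF fin] by auto
      show "length X = length Y" if "X \<in> set ts" "Y \<in> set ts" for X Y using relation_args[OF r] that by simp
      show "(\<lambda>xs. xs ! 2) \<in> J" by (rule projection_J)
      show "\<exists>\<beta> d'. item bs (table_end bs) pw \<beta> \<and> represents bs \<beta> U d' \<and> V = lift3 d' X X Y \<and> W = lift3 d' X Y Y"
        if "X \<in> set ts" "Y \<in> set ts" "V \<in> set ts" "W \<in> set ts" "d \<in> J" "V = lift3 d X X Y" "W = lift3 d X Y Y" for X Y V W d
        using that by (rule tables[OF rel])
      show "(X, Y) \<in> {(lift3 d X X Y, lift3 d X Y Y) |d. d \<in> J}\<^sup>*" if "X \<in> set ts" "Y \<in> set ts" for X Y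
        using that by (rule paths[OF rel])
    qed
  qed
  have "all_items bs (relation_end bs) (\<lambda>r. \<exists>t\<le>Suc (length bs). nat_end bs r t \<and>
       linked_list bs (tuple_end bs) (apply_table bs) t pw) pl"
    by (subst relations_iff[where P = "\<lambda>_. True"]) (simp_all add: l2)
  thus ?thesis unfolding body_def using good l1 by blast
qed

lemma certified_iff:
  assumes "pu = 1" shows "certified bs \<longleftrightarrow> body"
proof -
  have le: "1 \<le> Suc (length bs)" "pl \<le> Suc (length bs)" "pb \<le> Suc (length bs)" "pw \<le> Suc (length bs)"
    using occurs_bound[OF pu] occurs_bound[OF pl] occurs_bound[OF pb] by simp_all
  have e: "tuple_end bs pu q \<longleftrightarrow> q = pl" "list_end bs (relation_end bs) pl q \<longleftrightarrow> q = pb" "tuple_end bs pb q \<longleftrightarrow> q = pw" for q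
    using endsD[OF ends_tuple_end pu] endsD[OF ends_list[OF ends_relation_end] pl] endsD[OF ends_tuple_end pb] by blast+
  \<comment> \<open>The left marker occurs only at position 0, so its successor names the constant
    position 1, where the input starts.\<close>
  have u: "(\<exists>z\<le>Suc (length bs). z = 0 \<and> (\<exists>u\<le>Suc (length bs). u = Suc z \<and> P u)) \<longleftrightarrow> P pu" for P
    using le(1) assms by auto
  have o: "(\<exists>q\<le>Suc (length bs). q = pl \<and> P q) \<longleftrightarrow> P pl" "(\<exists>q\<le>Suc (length bs). q = pb \<and> P q) \<longleftrightarrow> P pb"
    "(\<exists>q\<le>Suc (length bs). q = pw \<and> P q) \<longleftrightarrow> P pw" for P using le(2-4) by blast+
  show ?thesis unfolding certified_def symbol_eq_3_iff u e(1) o(1) e(2) o(2) e(3) o(3) body_def by (rule refl)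
qed

end

section \<open>Construction and length of the certificate\<close>

lemma set_concat_mapI: "y \<in> set ys \<Longrightarrow> z \<in> set (f y) \<Longrightarrow> z \<in> set (concat (map f ys))"
  by auto

lemma length_concat_map_le: "(\<And>y. y \<in> set ys \<Longrightarrow> length (f y) \<le> k) \<Longrightarrow> length (concat (map f ys)) \<le> length ys * k"
proof (induction ys)
  case (Cons y ys)
  have "length (f y) \<le> k" "length (concat (map f ys)) \<le> length ys * k" using Cons by simp_all
  thus ?case by simp
qed simp

lemma length_enc_list_le: "(\<And>y. y \<in> set ys \<Longrightarrow> length (e y) \<le> k) \<Longrightarrow> length (enc_list e ys) \<le> 1 + length ys * (1 + k)"
proof (induction ys)
  case (Cons y ys)
  have "length (e y) \<le> k" "length (enc_list e ys) \<le> 1 + length ys * (1 + k)" using Cons by simp_all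
  thus ?case by simp
qed simp

lemma length_le_enc_list: "length ys \<le> length (enc_list e ys)"
  by (induction ys) simp_all

lemma item_le_enc_list: "y \<in> set ys \<Longrightarrow> length (e y) \<le> length (enc_list e ys)"
  by (induction ys) auto

text \<open>A witness for the possible edge from \<open>V\<close> to \<open>W\<close> in the graph
  of the pair \<open>X\<close>, \<open>Y\<close>. The default is a projection, which is always a
  valid operation, so every table in the list passes the checks even where there is no edge.\<close>

definition pick :: "input \<Rightarrow> nat list \<Rightarrow> nat list \<Rightarrow> nat list \<Rightarrow> nat list \<Rightarrow> nat list \<Rightarrow> nat" where
  "pick x X Y V W =
    (if \<exists>d. d \<in> jonsson_ops (input_structure x) (set (in_subset x)) \<and> V = lift3 d X X Y \<and> W = lift3 d X Y Y
     then SOME d. d \<in> jonsson_ops (input_structure x) (set (in_subset x)) \<and> V = lift3 d X X Y \<and> W = lift3 d X Y Y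
     else (\<lambda>xs. xs ! 2))"

text \<open>Listing one operation for each quadruple of tuples covers every edge of every graph
  without computing the paths; this accounts for the fourth power in the length.\<close>

definition certificate_ops :: "input \<Rightarrow> (nat list \<Rightarrow> nat) list" where
  "certificate_ops x = concat (map (\<lambda>ts. concat (map (\<lambda>X. concat (map (\<lambda>Y. concat (map (\<lambda>V. map (\<lambda>W. pick x X Y V W) ts) ts)) ts)) ts))
     (map (\<lambda>a. [a]) (in_universe x) # map snd (in_relations x)))"

lemma enc_input_relation: "enc_input x = enc_list enc_nat (in_universe x) @ enc_list enc_relation (in_relations x) @ enc_list enc_nat (in_subset x)"
  by (simp add: enc_input_def enc_relation_def)

lemma presented_input:
  assumes "x \<in> promised"
  shows "\<exists>pl pb pw. presented (enc_input x @ w) 1 pl pb pw x \<and> occurs (enc_input x @ w) pw w (Suc (length (enc_input x @ w)))"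
proof -
  let ?bs = "enc_input x @ w"
  have "occurs ?bs 1 ?bs (Suc (length ?bs))" using occurs_whole[of "[]" ?bs "[]"] by simp
  hence "occurs ?bs 1 (enc_list enc_nat (in_universe x) @ enc_list enc_relation (in_relations x) @ enc_list enc_nat (in_subset x) @ w) (Suc (length ?bs))"
    by (simp add: enc_input_relation)
  then obtain pl pb pw where o: "occurs ?bs 1 (enc_list enc_nat (in_universe x)) pl" "occurs ?bs pl (enc_list enc_relation (in_relations x)) pb"
    "occurs ?bs pb (enc_list enc_nat (in_subset x)) pw" "occurs ?bs pw w (Suc (length ?bs))"
    unfolding occurs_append by (elim exE conjE)
  have f: "finite_structure (input_structure x)" "set (in_subset x) \<subseteq> set (in_universe x)"
    using assms by (simp_all add: promised_def subuniverse_def Pol_def input_structure_def)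
  have "presented ?bs 1 pl pb pw x" using o(1-3) f by (rule presented.intro)
  thus ?thesis using o(4) by blast
qed

lemma certified_sound:
  assumes "x \<in> promised" "certified (enc_input x @ w)"
  shows "locally_absorbing (input_structure x) (set (in_subset x))"
proof -
  obtain pl pb pw where p: "presented (enc_input x @ w) 1 pl pb pw x" using presented_input[OF assms(1)] by blast
  interpret presented "enc_input x @ w" 1 pl pb pw x by (rule p)
  show ?thesis using body_sound certified_iff[OF refl] assms(2) by blast
qed

text \<open>With \<open>n\<close> the length of the input: \<open>1 + n\<close> bounds the number of
  lists, the universe included, and each contributes up to \<open>n ^ 4\<close> tables. A table has
  up to \<open>n ^ 3\<close> entries of four numbers with at most \<open>n\<close> bits each. The
  ones are the bits that announce items and end lists.\<close>

definition certificate_length :: "nat poly" where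
  "certificate_length = 1 + (1 + [:0, 1:]) * ([:0, 1:] * ([:0, 1:] * ([:0, 1:] * [:0, 1:]))) *
     (1 + (1 + [:0, 1:] * ([:0, 1:] * [:0, 1:]) * (1 + 4 * [:0, 1:])))"

lemma poly_certificate_length:
  "poly certificate_length n = 1 + (1 + n) * (n * (n * (n * n))) * (1 + (1 + n * (n * n) * (1 + 4 * n)))"
  by (simp add: certificate_length_def algebra_simps)

lemma length_certificate_ops: "length (certificate_ops x) \<le>
  (1 + length (enc_input x)) * (length (enc_input x) * (length (enc_input x) * (length (enc_input x) * length (enc_input x))))"
proof -
  let ?n = "length (enc_input x)"
  have ts: "length ts \<le> ?n" if ts_in: "ts \<in> set (map (\<lambda>a. [a]) (in_universe x) # map snd (in_relations x))" for ts
  proof (cases "ts = map (\<lambda>a. [a]) (in_universe x)")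
    case True
    thus ?thesis using length_le_enc_list[of "in_universe x" enc_nat] by (simp add: enc_input_relation)
  next
    case False
    then obtain r where r: "(r, ts) \<in> set (in_relations x)" using ts_in by auto
    have "length ts \<le> length (enc_relation (r, ts))" using length_le_enc_list[of ts "enc_list enc_nat"] by (simp add: enc_relation_def)
    also have "\<dots> \<le> length (enc_list enc_relation (in_relations x))" by (rule item_le_enc_list[OF r])
    finally show ?thesis by (simp add: enc_input_relation)
  qed
  have "length (in_relations x) \<le> ?n" using length_le_enc_list[of "in_relations x" enc_relation] by (simp add: enc_input_relation)
  hence l: "length (map (\<lambda>a. [a]) (in_universe x) # map snd (in_relations x)) \<le> 1 + ?n" by simp
  have "length (certificate_ops x) \<le> length (map (\<lambda>a. [a]) (in_universe x) # map snd (in_relations x)) * (?n * (?n * (?n * ?n)))"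
    unfolding certificate_ops_def
  proof (rule length_concat_map_le)
    fix ts assume t: "ts \<in> set (map (\<lambda>a. [a]) (in_universe x) # map snd (in_relations x))"
    have "length (concat (map (\<lambda>X. concat (map (\<lambda>Y. concat (map (\<lambda>V. map (\<lambda>W. pick x X Y V W) ts) ts)) ts)) ts)) \<le>
        length ts * (length ts * (length ts * length ts))"
      by (rule length_concat_map_le, rule length_concat_map_le, rule length_concat_map_le) simp
    also have "\<dots> \<le> ?n * (?n * (?n * ?n))" using ts[OF t] by (intro mult_le_mono)
    finally show "length (concat (map (\<lambda>X. concat (map (\<lambda>Y. concat (map (\<lambda>V. map (\<lambda>W. pick x X Y V W) ts) ts)) ts)) ts)) \<le> ?n * (?n * (?n * ?n))" .
  qed
  also have "\<dots> \<le> (1 + ?n) * (?n * (?n * (?n * ?n)))" using l by (rule mult_le_mono1)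
  finally show ?thesis .
qed

lemma length_enc_table:
  assumes "\<And>a b c. a \<in> set (in_universe x) \<Longrightarrow> b \<in> set (in_universe x) \<Longrightarrow> c \<in> set (in_universe x) \<Longrightarrow> d [a, b, c] \<in> set (in_universe x)"
  shows "length (enc_list enc_entry (table (in_universe x) d)) \<le>
    1 + length (enc_input x) * (length (enc_input x) * length (enc_input x)) * (1 + 4 * length (enc_input x))"
proof -
  let ?n = "length (enc_input x)" and ?us = "in_universe x"
  have a: "length (enc_nat a) \<le> ?n" if "a \<in> set ?us" for a
    using item_le_enc_list[OF that, of enc_nat] by (simp add: enc_input_relation)
  have u: "length ?us \<le> ?n" using length_le_enc_list[of ?us enc_nat] by (simp add: enc_input_relation)
  have e: "length (enc_entry y) \<le> 4 * ?n" if y_in: "y \<in> set (table ?us d)" for y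
  proof -
    obtain a' b c v where y: "y = (a', b, c, v)" by (cases y)
    have m: "a' \<in> set ?us" "b \<in> set ?us" "c \<in> set ?us" "v = d [a', b, c]" using y_in unfolding y set_table by blast+
    have "v \<in> set ?us" using assms[OF m(1-3)] m(4) by simp
    from a[OF m(1)] a[OF m(2)] a[OF m(3)] a[OF this] show ?thesis unfolding y by (simp add: enc_entry_def)
  qed
  have "length (table ?us d) \<le> length ?us * (length ?us * length ?us)"
    unfolding table_def by (rule length_concat_map_le, rule length_concat_map_le) simp
  also have "\<dots> \<le> ?n * (?n * ?n)" using u by (intro mult_le_mono)
  finally have l: "length (table ?us d) \<le> ?n * (?n * ?n)" .
  have "length (enc_list enc_entry (table ?us d)) \<le> 1 + length (table ?us d) * (1 + 4 * ?n)" using e by (rule length_enc_list_le)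
  also have "\<dots> \<le> 1 + ?n * (?n * ?n) * (1 + 4 * ?n)" by (rule add_left_mono, rule mult_le_mono1[OF l])
  finally show ?thesis .
qed

lemma certified_complete:
  assumes x: "x \<in> promised" and loc: "locally_absorbing (input_structure x) (set (in_subset x))"
  shows "\<exists>w. length w \<le> poly certificate_length (length (enc_input x)) \<and> certified (enc_input x @ w)"
proof -
  define ds where "ds = certificate_ops x"
  define w where "w = enc_list (enc_list enc_entry) (map (table (in_universe x)) ds)"
  let ?n = "length (enc_input x)"
  obtain pl pb pw where p: "presented (enc_input x @ w) 1 pl pb pw x" and o: "occurs (enc_input x @ w) pw w (Suc (length (enc_input x @ w)))"
    using presented_input[OF x] by blast
  interpret presented "enc_input x @ w" 1 pl pb pw x by (rule p)
  have pick: "pick x X Y V W \<in> J \<and> V = lift3 (pick x X Y V W) X X Y \<and> W = lift3 (pick x X Y V W) X Y Y"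
    if "d \<in> J" "V = lift3 d X X Y" "W = lift3 d X Y Y" for d X Y V W
  proof -
    have ex: "\<exists>d. d \<in> J \<and> V = lift3 d X X Y \<and> W = lift3 d X Y Y" using that by blast
    hence "pick x X Y V W = (SOME d. d \<in> J \<and> V = lift3 d X X Y \<and> W = lift3 d X Y Y)" unfolding pick_def by (rule if_P)
    thus ?thesis using someI_ex[OF ex] by simp
  qed
  have pickJ: "pick x X Y V W \<in> J" for X Y V W
  proof (cases "\<exists>d. d \<in> J \<and> V = lift3 d X X Y \<and> W = lift3 d X Y Y")
    case True
    thus ?thesis using pick by blast
  next
    case False
    hence "pick x X Y V W = (\<lambda>xs. xs ! 2)" unfolding pick_def by (rule if_not_P)
    thus ?thesis using projection_J by simp
  qed
  have ds: "set ds \<subseteq> J" unfolding ds_def certificate_ops_def using pickJ by auto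
  have cover: "\<exists>d\<in>set ds. V = lift3 d X X Y \<and> W = lift3 d X Y Y"
    if R: "(r, R) \<in> set (all_relations (input_structure x))" and m: "X \<in> R" "Y \<in> R" "V \<in> R" "W \<in> R"
      and d: "d \<in> J" "V = lift3 d X X Y" "W = lift3 d X Y Y" for r R X Y V W d
  proof -
    obtain ts where ts: "R = set ts" "ts \<in> set (map (\<lambda>a. [a]) (in_universe x) # map snd (in_relations x))"
      using R
    proof (cases rule: all_relations_cases)
      case 1
      show ?thesis by (rule that[of "map (\<lambda>a. [a]) (in_universe x)"]) (use 1 in simp_all)
    next
      case (2 ts)
      show ?thesis by (rule that[of ts]) (use 2 in force)+
    qed
    have m': "X \<in> set ts" "Y \<in> set ts" "V \<in> set ts" "W \<in> set ts" using m ts(1) by simp_all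
    have "pick x X Y V W \<in> set ds" unfolding ds_def certificate_ops_def
      by (rule set_concat_mapI[OF ts(2)], rule set_concat_mapI[OF m'(1)], rule set_concat_mapI[OF m'(2)],
          rule set_concat_mapI[OF m'(3)]) (use m'(4) in simp)
    thus ?thesis using pick[OF d] by blast
  qed
  have "occurs (enc_input x @ w) pw (enc_list (enc_list enc_entry) (map (table (in_universe x)) ds)) (Suc (length (enc_input x @ w)))"
    using o unfolding w_def .
  hence body by (rule body_complete[OF loc ds, rotated]) (rule cover; assumption)
  hence c: "certified (enc_input x @ w)" using certified_iff[OF refl] by blast
  have "length w \<le> 1 + length (map (table (in_universe x)) ds) * (1 + (1 + ?n * (?n * ?n) * (1 + 4 * ?n)))"
    unfolding w_def
  proof (rule length_enc_list_le)
    fix tb assume "tb \<in> set (map (table (in_universe x)) ds)"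
    then obtain d where d: "d \<in> J" "tb = table (in_universe x) d" using ds by auto
    show "length (enc_list enc_entry tb) \<le> 1 + ?n * (?n * ?n) * (1 + 4 * ?n)"
      unfolding d(2) by (rule length_enc_table) (use d(1) in \<open>simp add: jonsson_ops_iff[OF fin]\<close>)
  qed
  also have "\<dots> \<le> 1 + (1 + ?n) * (?n * (?n * (?n * ?n))) * (1 + (1 + ?n * (?n * ?n) * (1 + 4 * ?n)))"
    unfolding length_map ds_def by (rule add_left_mono, rule mult_le_mono1[OF length_certificate_ops])
  finally have "length w \<le> poly certificate_length ?n" unfolding poly_certificate_length .
  thus ?thesis using c by blast
qed

theorem theorem1p2:
  shows "promise_NP enc_input promised
           (\<lambda>x. absorbing (Pol (input_structure x)) (set (in_subset x))) \<and>
         promise_NP enc_input promised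
           (\<lambda>x. jonsson_absorbing (Pol (input_structure x)) (set (in_subset x)))"
proof -
  obtain p where p: "\<And>bs. accepts_word p bs \<longleftrightarrow> certified bs" using certified_program by blast
  have np: "promise_NP enc_input promised P"
    if iff: "\<And>x. x \<in> promised \<Longrightarrow> P x \<longleftrightarrow> locally_absorbing (input_structure x) (set (in_subset x))" for P
  proof (rule promise_NP_prog[where p = p and r = certificate_length])
    show "P x" if "x \<in> promised" "accepts_word p (enc_input x @ w)" for x w
      using certified_sound[OF that(1)] that(2) unfolding p iff[OF that(1)] by blast
    show "\<exists>w. length w \<le> poly certificate_length (length (enc_input x)) \<and> accepts_word p (enc_input x @ w)"
      if "x \<in> promised" "P x" for x
      using certified_complete[OF that(1)] that(2) unfolding p iff[OF that(1)] by blast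
  qed
  have eq: "absorbing (Pol (input_structure x)) (set (in_subset x)) \<longleftrightarrow> locally_absorbing (input_structure x) (set (in_subset x))"
    "jonsson_absorbing (Pol (input_structure x)) (set (in_subset x)) \<longleftrightarrow> locally_absorbing (input_structure x) (set (in_subset x))"
    if "x \<in> promised" for x
  proof -
    have "finite_structure (input_structure x)" "subuniverse (Pol (input_structure x)) (set (in_subset x))"
      using that by (simp_all add: promised_def)
    thus "absorbing (Pol (input_structure x)) (set (in_subset x)) \<longleftrightarrow> locally_absorbing (input_structure x) (set (in_subset x))"
      "jonsson_absorbing (Pol (input_structure x)) (set (in_subset x)) \<longleftrightarrow> locally_absorbing (input_structure x) (set (in_subset x))"
      using absorbing_imp_jonsson jonsson_imp_locally_absorbing locally_absorbing_imp_absorbing by blast+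
  qed
  show ?thesis by (intro conjI np eq)
qed

end
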